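(* Let $\mathfrak P$ be a nonempty set of probability measures on a measurable space $(\Omega,\mathcal F)$. Then the following are equivalent: (1) $\mathfrak P$ is of class (S) and $L^\infty_{\mathbf c}$ is Dedekind complete. (2) $L^\infty_{\mathbf c}$ is the dual space of $sca_{\mathbf c}$. (3) $L^\infty_{\mathbf c}$ is the dual space of a normed vector lattice. (4) $L^\infty_{\mathbf c}$ is the dual space of a Banach lattice. (5) $L^\infty_{\mathbf c}$ is perfect, i.e. $((L^\infty_{\mathbf c})^\sim_n)^\sim_n=L^\infty_{\mathbf c}$ via the canonical embedding $X\mapsto\ell_X$, $\ell_X(\phi)=\phi(X)$ for $\phi\in(L^\infty_{\mathbf c})^\sim_n$. (6) $L^\infty_{\mathbf c}$ carries a locally convex-solid order-continuous Hausdorff topology and is Dedekind complete.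
   Context: $\Delta(\mathcal F)$ is the set of probability measures on $(\Omega,\mathcal F)$; $ca$ is the space of finite countably additive signed measures on $\mathcal F$, with total variation $|\mu|$ and total variation norm $TV$. Put $\mathbf c(A)=\sup_{\mathbb P\in\mathfrak P}\mathbb P(A)$. A property holds $\mathfrak P$-quasi surely (q.s.) if it holds outside an event $A$ with $\mathbf c(A)=0$. $L^0_{\mathbf c}$ is the vector lattice of classes, up to $\mathfrak P$-q.s. equality, of real-valued random variables, with order $X\preceq Y$ iff $f\le g$ $\mathfrak P$-q.s. for representatives. $L^\infty_{\mathbf c}=\{X\in L^0_{\mathbf c}\mid\exists m>0:\ |X|\preceq m\mathbf 1_\Omega\}$ is a Banach lattice with norm $\|X\|=\inf\{m>0\mid|X|\preceq m\mathbf 1_\Omega\}$. For sets $\mathfrak S,\mathfrak T$ of (signed) measures, $\mathfrak S\ll\mathfrak T$ means that every $N\in\mathcal F$ with $\sup_{\nu\in\mathfrak T}|\nu|(N)=0$ satisfies $\sup_{\mu\in\mathfrak S}|\mu|(N)=0$; $\mathfrak S\approx\mathfrak T$ means both $\ll$ relations hold. $ca_{\mathbf c}=\{\mu\in ca\mid\{\mu\}\ll\mathfrak P\}$. A measure $\mu$ is supported if there is $S(\mu)\in\mathcal F$ with $\mu(S(\mu)^c)=0$ such that every $N\in\mathcal F$ with $\mu(N\cap S(\mu))=0$ satisfies $\mathbf c(N\cap S(\mu))=0$. A signed $\mu\in ca_{\mathbf c}$ is supported if $|\mu|$ is; $sca_{\mathbf c}$ is the set of supported $\mu\in ca_{\mathbf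 c}$, a normed vector lattice with the setwise order and norm $TV$. $\mathfrak P$ is of class (S) if there is $\mathfrak Q\subset\Delta(\mathcal F)$ with $\mathfrak Q\approx\mathfrak P$ and $\mathfrak Q\subset sca_{\mathbf c}$. A vector lattice is Dedekind complete if every nonempty subset with an upper bound has a supremum. "Dual space" means norm dual: in (2) the identification is $X\mapsto(\mu\mapsto\int X\,d\mu)$; in (3) and (4) $(L^\infty_{\mathbf c},\preceq,\|\cdot\|)$ is identified as a Banach lattice (isometrically and order-isomorphically) with the norm dual. For a vector lattice $\mathcal X$, $\mathcal X^\sim_n$ is the vector lattice of order bounded linear functionals $\phi:\mathcal X\to\mathbb R$ that are order continuous ($x_\alpha\to x$ in order implies $\phi(x_\alpha)\to\phi(x)$). A net $(x_\alpha)_{\alpha\in I}$ order converges to $x$ if there is a decreasing net $(y_\alpha)_{\alpha\in I}$ with infimum $0$ and $|x_\alpha-x|\preceq y_\alpha$ for all $\alpha$. A topology is locally convex-solid if it is generated by a family of lattice seminorms $p$ ($|x|\preceq|y|$ implies $p(x)\le p(y)$); it is order continuous if order convergence of a net to $0$ implies its topological convergence to $0$. *)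

theory Defs
  imports "HOL-Probability.Probability"
begin

section \<open>Vector lattices on carrier sets\<close>

text \<open>
  The spaces below depend on the measurable space and on the set of priors, hence are not types.
  A vector lattice is therefore a record of operations on a carrier set.
\<close>

record 'x vlat =
  vcar :: "'x set"
  vadd :: "'x \<Rightarrow> 'x \<Rightarrow> 'x"
  vscale :: "real \<Rightarrow> 'x \<Rightarrow> 'x"
  vzero :: "'x"
  vle :: "'x \<Rightarrow> 'x \<Rightarrow> bool"

record 'x nvlat = "'x vlat" +
  vnorm :: "'x \<Rightarrow> real"

definition vdiff :: "('x, 'm) vlat_scheme \<Rightarrow> 'x \<Rightarrow> 'x \<Rightarrow> 'x" where
  "vdiff V x y = vadd V x (vscale V (- 1) y)"

definition is_sup :: "('x, 'm) vlat_scheme \<Rightarrow> 'x set \<Rightarrow> 'x \<Rightarrow> bool" where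
  "is_sup V A s \<longleftrightarrow> s \<in> vcar V \<and> (\<forall>a\<in>A. vle V a s) \<and>
     (\<forall>u\<in>vcar V. (\<forall>a\<in>A. vle V a u) \<longrightarrow> vle V s u)"

definition is_inf :: "('x, 'm) vlat_scheme \<Rightarrow> 'x set \<Rightarrow> 'x \<Rightarrow> bool" where
  "is_inf V A s \<longleftrightarrow> s \<in> vcar V \<and> (\<forall>a\<in>A. vle V s a) \<and>
     (\<forall>u\<in>vcar V. (\<forall>a\<in>A. vle V u a) \<longrightarrow> vle V u s)"

definition vabs :: "('x, 'm) vlat_scheme \<Rightarrow> 'x \<Rightarrow> 'x" where
  "vabs V x = (THE s. is_sup V {x, vscale V (- 1) x} s)"

locale vector_lattice =
  fixes V :: "('x, 'm) vlat_scheme"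
  assumes zero_closed: "vzero V \<in> vcar V"
    and add_closed: "x \<in> vcar V \<Longrightarrow> y \<in> vcar V \<Longrightarrow> vadd V x y \<in> vcar V"
    and scale_closed: "x \<in> vcar V \<Longrightarrow> vscale V a x \<in> vcar V"
    and add_assoc: "x \<in> vcar V \<Longrightarrow> y \<in> vcar V \<Longrightarrow> z \<in> vcar V \<Longrightarrow>
      vadd V (vadd V x y) z = vadd V x (vadd V y z)"
    and add_commute: "x \<in> vcar V \<Longrightarrow> y \<in> vcar V \<Longrightarrow> vadd V x y = vadd V y x"
    and add_zero: "x \<in> vcar V \<Longrightarrow> vadd V x (vzero V) = x"
    and add_inverse: "x \<in> vcar V \<Longrightarrow> vadd V x (vscale V (- 1) x) = vzero V"
    and scale_add_right: "x \<in> vcar V \<Longrightarrow> y \<in> vcar V \<Longrightarrow>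
      vscale V a (vadd V x y) = vadd V (vscale V a x) (vscale V a y)"
    and scale_add_left: "x \<in> vcar V \<Longrightarrow>
      vscale V (a + b) x = vadd V (vscale V a x) (vscale V b x)"
    and scale_scale: "x \<in> vcar V \<Longrightarrow> vscale V a (vscale V b x) = vscale V (a * b) x"
    and scale_one: "x \<in> vcar V \<Longrightarrow> vscale V 1 x = x"
    and le_refl: "x \<in> vcar V \<Longrightarrow> vle V x x"
    and le_trans: "x \<in> vcar V \<Longrightarrow> y \<in> vcar V \<Longrightarrow> z \<in> vcar V \<Longrightarrow>
      vle V x y \<Longrightarrow> vle V y z \<Longrightarrow> vle V x z"
    and le_antisym: "x \<in> vcar V \<Longrightarrow> y \<in> vcar V \<Longrightarrow> vle V x y \<Longrightarrow> vle V y x \<Longrightarrow> x = y"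
    and add_mono: "x \<in> vcar V \<Longrightarrow> y \<in> vcar V \<Longrightarrow> z \<in> vcar V \<Longrightarrow>
      vle V x y \<Longrightarrow> vle V (vadd V x z) (vadd V y z)"
    and scale_mono: "x \<in> vcar V \<Longrightarrow> y \<in> vcar V \<Longrightarrow> 0 \<le> a \<Longrightarrow>
      vle V x y \<Longrightarrow> vle V (vscale V a x) (vscale V a y)"
    and sup_exists: "x \<in> vcar V \<Longrightarrow> y \<in> vcar V \<Longrightarrow> \<exists>s. is_sup V {x, y} s"
    and inf_exists: "x \<in> vcar V \<Longrightarrow> y \<in> vcar V \<Longrightarrow> \<exists>s. is_inf V {x, y} s"

locale normed_vector_lattice = vector_lattice N for N :: "('x, 'm) nvlat_scheme" +
  assumes norm_eq_zero: "x \<in> vcar N \<Longrightarrow> vnorm N x = 0 \<longleftrightarrow> x = vzero N"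
    and norm_triangle: "x \<in> vcar N \<Longrightarrow> y \<in> vcar N \<Longrightarrow>
      vnorm N (vadd N x y) \<le> vnorm N x + vnorm N y"
    and norm_scale: "x \<in> vcar N \<Longrightarrow> vnorm N (vscale N a x) = \<bar>a\<bar> * vnorm N x"
    and norm_lattice: "x \<in> vcar N \<Longrightarrow> y \<in> vcar N \<Longrightarrow> vle N (vabs N x) (vabs N y) \<Longrightarrow>
      vnorm N x \<le> vnorm N y"

text \<open>
  The distance is set to 0 outside the carrier because the library's metric spaces require it to
  be nonnegative and symmetric on the whole type.
\<close>

definition vdist :: "('x, 'm) nvlat_scheme \<Rightarrow> 'x \<Rightarrow> 'x \<Rightarrow> real" where
  "vdist N x y = (if x \<in> vcar N \<and> y \<in> vcar N then vnorm N (vdiff N x y) else 0)"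

definition banach_lattice :: "('x, 'm) nvlat_scheme \<Rightarrow> bool" where
  "banach_lattice N \<longleftrightarrow> normed_vector_lattice N \<and> Metric_space.mcomplete (vcar N) (vdist N)"

definition dedekind_complete :: "('x, 'm) vlat_scheme \<Rightarrow> bool" where
  "dedekind_complete V \<longleftrightarrow>
     (\<forall>A. A \<subseteq> vcar V \<longrightarrow> A \<noteq> {} \<longrightarrow> (\<exists>u\<in>vcar V. \<forall>a\<in>A. vle V a u) \<longrightarrow> (\<exists>s. is_sup V A s))"

definition lattice_iso ::
  "('x, 'm) vlat_scheme \<Rightarrow> ('y, 'n) vlat_scheme \<Rightarrow> ('x \<Rightarrow> 'y) \<Rightarrow> bool" where
  "lattice_iso V W T \<longleftrightarrow> bij_betw T (vcar V) (vcar W) \<and>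
     (\<forall>x\<in>vcar V. \<forall>y\<in>vcar V. T (vadd V x y) = vadd W (T x) (T y)) \<and>
     (\<forall>a. \<forall>x\<in>vcar V. T (vscale V a x) = vscale W a (T x)) \<and>
     (\<forall>x\<in>vcar V. \<forall>y\<in>vcar V. vle V x y \<longleftrightarrow> vle W (T x) (T y))"

definition isometric_lattice_iso ::
  "('x, 'm) nvlat_scheme \<Rightarrow> ('y, 'n) nvlat_scheme \<Rightarrow> ('x \<Rightarrow> 'y) \<Rightarrow> bool" where
  "isometric_lattice_iso V W T \<longleftrightarrow>
     lattice_iso V W T \<and> (\<forall>x\<in>vcar V. vnorm W (T x) = vnorm V x)"


section \<open>Order convergence\<close>

definition directed :: "'i set \<Rightarrow> ('i \<times> 'i) set \<Rightarrow> bool" where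
  "directed I r \<longleftrightarrow> I \<noteq> {} \<and> preorder_on I r \<and>
     (\<forall>i\<in>I. \<forall>j\<in>I. \<exists>k\<in>I. (i, k) \<in> r \<and> (j, k) \<in> r)"

definition net_filter :: "'i set \<Rightarrow> ('i \<times> 'i) set \<Rightarrow> 'i filter" where
  "net_filter I r = (INF i\<in>I. principal {j \<in> I. (i, j) \<in> r})"

definition order_converges ::
  "('x, 'm) vlat_scheme \<Rightarrow> 'i set \<Rightarrow> ('i \<times> 'i) set \<Rightarrow> ('i \<Rightarrow> 'x) \<Rightarrow> 'x \<Rightarrow> bool" where
  "order_converges V I r x x0 \<longleftrightarrow>
     directed I r \<and> x \<in> I \<rightarrow> vcar V \<and> x0 \<in> vcar V \<and>
     (\<exists>y \<in> I \<rightarrow> vcar V.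
        (\<forall>i\<in>I. \<forall>j\<in>I. (i, j) \<in> r \<longrightarrow> vle V (y j) (y i)) \<and>
        is_inf V (y ` I) (vzero V) \<and>
        (\<forall>i\<in>I. vle V (vabs V (vdiff V (x i) x0)) (y i)))"

text \<open>
  Order continuity quantifies over nets, but a definition cannot quantify over the type of their
  indices. Nets indexed by pairs of lattice elements suffice: see
  \<open>order_continuous_any_index\<close> and \<open>order_continuous_topology_any_index\<close> below.
\<close>

definition order_continuous :: "('x, 'm) vlat_scheme \<Rightarrow> ('x \<Rightarrow> real) \<Rightarrow> bool" where
  "order_continuous V \<phi> \<longleftrightarrow>
     (\<forall>(I :: ('x \<times> 'x) set) r x x0. order_converges V I r x x0 \<longrightarrow>
        ((\<lambda>i. \<phi> (x i)) \<longlongrightarrow> \<phi> x0) (net_filter I r))"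

definition order_continuous_topology :: "('x, 'm) vlat_scheme \<Rightarrow> 'x topology \<Rightarrow> bool" where
  "order_continuous_topology V \<T> \<longleftrightarrow>
     (\<forall>(I :: ('x \<times> 'x) set) r x. order_converges V I r x (vzero V) \<longrightarrow>
        limitin \<T> x (vzero V) (net_filter I r))"

definition lattice_seminorm :: "('x, 'm) vlat_scheme \<Rightarrow> ('x \<Rightarrow> real) \<Rightarrow> bool" where
  "lattice_seminorm V p \<longleftrightarrow>
     (\<forall>x\<in>vcar V. 0 \<le> p x) \<and>
     (\<forall>x\<in>vcar V. \<forall>y\<in>vcar V. p (vadd V x y) \<le> p x + p y) \<and>
     (\<forall>a. \<forall>x\<in>vcar V. p (vscale V a x) = \<bar>a\<bar> * p x) \<and>
     (\<forall>x\<in>vcar V. \<forall>y\<in>vcar V. vle V (vabs V x) (vabs V y) \<longrightarrow> p x \<le> p y)"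

text \<open>The carrier is added to the subbasis to cover the empty family of seminorms.\<close>

definition seminorm_topology :: "('x, 'm) vlat_scheme \<Rightarrow> ('x \<Rightarrow> real) set \<Rightarrow> 'x topology" where
  "seminorm_topology V \<S> = topology_generated_by
     (insert (vcar V)
       {B. \<exists>p\<in>\<S>. \<exists>x\<in>vcar V. \<exists>e>0. B = {y \<in> vcar V. p (vdiff V y x) < e}})"

definition locally_convex_solid :: "('x, 'm) vlat_scheme \<Rightarrow> 'x topology \<Rightarrow> bool" where
  "locally_convex_solid V \<T> \<longleftrightarrow>
     (\<exists>\<S>. (\<forall>p\<in>\<S>. lattice_seminorm V p) \<and> \<T> = seminorm_topology V \<S>)"


section \<open>Dual spaces\<close>

text \<open>
  Functionals on a carrier are represented by functions that are undefined outside it, so that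
  functionals agreeing on the carrier are equal.
\<close>

definition linear_functional :: "('x, 'm) vlat_scheme \<Rightarrow> ('x \<Rightarrow> real) \<Rightarrow> bool" where
  "linear_functional V \<phi> \<longleftrightarrow> \<phi> \<in> extensional (vcar V) \<and>
     (\<forall>x\<in>vcar V. \<forall>y\<in>vcar V. \<phi> (vadd V x y) = \<phi> x + \<phi> y) \<and>
     (\<forall>a. \<forall>x\<in>vcar V. \<phi> (vscale V a x) = a * \<phi> x)"

definition norm_dual :: "('x, 'm) nvlat_scheme \<Rightarrow> ('x \<Rightarrow> real) nvlat" where
  "norm_dual N = \<lparr>
     vcar = {\<phi>. linear_functional N \<phi> \<and> (\<exists>C. \<forall>x\<in>vcar N. \<bar>\<phi> x\<bar> \<le> C * vnorm N x)},
     vadd = (\<lambda>\<phi> \<psi>. \<lambda>x\<in>vcar N. \<phi> x + \<psi> x),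
     vscale = (\<lambda>a \<phi>. \<lambda>x\<in>vcar N. a * \<phi> x),
     vzero = (\<lambda>x\<in>vcar N. 0),
     vle = (\<lambda>\<phi> \<psi>. \<forall>x\<in>vcar N. vle N (vzero N) x \<longrightarrow> \<phi> x \<le> \<psi> x),
     vnorm = (\<lambda>\<phi>. SUP x\<in>{x \<in> vcar N. vnorm N x \<le> 1}. \<bar>\<phi> x\<bar>)\<rparr>"

text \<open>
  Statements about the existence of a normed vector lattice \<open>N\<close> with norm dual \<open>L\<^sup>\<infinity>\<close> take \<open>N\<close> on
  the type \<open>'a set \<Rightarrow> real\<close>. This loses no generality: if \<open>T\<close> identifies \<open>L\<^sup>\<infinity>\<close> with the dual of \<open>N\<close>,
  then \<open>x \<mapsto> (A \<mapsto> T 1\<^sub>A x)\<close> is injective on \<open>N\<close>, because the dual separates points and simple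
  functions are dense in \<open>L\<^sup>\<infinity>\<close>. The last conjunct of the theorem treats lattices on any type.
\<close>

definition order_bounded :: "('x, 'm) vlat_scheme \<Rightarrow> ('x \<Rightarrow> real) \<Rightarrow> bool" where
  "order_bounded V \<phi> \<longleftrightarrow>
     (\<forall>a\<in>vcar V. \<forall>b\<in>vcar V. bounded (\<phi> ` {x \<in> vcar V. vle V a x \<and> vle V x b}))"

definition order_continuous_dual :: "('x, 'm) vlat_scheme \<Rightarrow> ('x \<Rightarrow> real) vlat" where
  "order_continuous_dual V = \<lparr>
     vcar = {\<phi>. linear_functional V \<phi> \<and> order_bounded V \<phi> \<and> order_continuous V \<phi>},
     vadd = (\<lambda>\<phi> \<psi>. \<lambda>x\<in>vcar V. \<phi> x + \<psi> x),
     vscale = (\<lambda>a \<phi>. \<lambda>x\<in>vcar V. a * \<phi> x),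
     vzero = (\<lambda>x\<in>vcar V. 0),
     vle = (\<lambda>\<phi> \<psi>. \<forall>x\<in>vcar V. vle V (vzero V) x \<longrightarrow> \<phi> x \<le> \<psi> x)\<rparr>"

definition perfect :: "('x, 'm) vlat_scheme \<Rightarrow> bool" where
  "perfect V \<longleftrightarrow> lattice_iso V (order_continuous_dual (order_continuous_dual V))
     (\<lambda>x. \<lambda>\<phi>\<in>vcar (order_continuous_dual V). \<phi> x)"


section \<open>Signed measures\<close>

text \<open>
  Throughout, only the underlying set and the sigma-algebra of \<open>M\<close> matter. A signed measure is a
  real set function that vanishes outside the sigma-algebra, as \<^const>\<open>measure\<close> does.
\<close>

definition Delta :: "'a measure \<Rightarrow> 'a measure set" where
  "Delta M = {Q. prob_space Q \<and> sets Q = sets M}"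

definition ca :: "'a measure \<Rightarrow> ('a set \<Rightarrow> real) set" where
  "ca M = {\<mu>. (\<forall>A. A \<notin> sets M \<longrightarrow> \<mu> A = 0) \<and> \<mu> {} = 0 \<and>
     (\<forall>A :: nat \<Rightarrow> 'a set. range A \<subseteq> sets M \<longrightarrow> disjoint_family A \<longrightarrow>
        (\<lambda>n. \<mu> (A n)) sums \<mu> (\<Union>n. A n))}"

definition tv :: "'a measure \<Rightarrow> ('a set \<Rightarrow> real) \<Rightarrow> 'a set \<Rightarrow> real" where
  "tv M \<mu> A = (if A \<in> sets M
     then SUP \<D>\<in>{\<D>. finite \<D> \<and> \<D> \<subseteq> sets M \<and> disjoint \<D> \<and> \<Union>\<D> = A}. \<Sum>D\<in>\<D>. \<bar>\<mu> D\<bar>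
     else 0)"

definition pos_part_measure :: "'a measure \<Rightarrow> ('a set \<Rightarrow> real) \<Rightarrow> 'a measure" where
  "pos_part_measure M \<mu> =
     measure_of (space M) (sets M) (\<lambda>A. ennreal ((tv M \<mu> A + \<mu> A) / 2))"

definition neg_part_measure :: "'a measure \<Rightarrow> ('a set \<Rightarrow> real) \<Rightarrow> 'a measure" where
  "neg_part_measure M \<mu> =
     measure_of (space M) (sets M) (\<lambda>A. ennreal ((tv M \<mu> A - \<mu> A) / 2))"

definition signed_integral :: "'a measure \<Rightarrow> ('a set \<Rightarrow> real) \<Rightarrow> ('a \<Rightarrow> real) \<Rightarrow> real" where
  "signed_integral M \<mu> f =
     (\<integral>\<omega>. f \<omega> \<partial>pos_part_measure M \<mu>) - (\<integral>\<omega>. f \<omega> \<partial>neg_part_measure M \<mu>)"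

text \<open>The suprema are taken in \<^typ>\<open>ennreal\<close>, so that the supremum of the empty set is 0.\<close>

definition dominated ::
  "'a measure \<Rightarrow> ('a set \<Rightarrow> real) set \<Rightarrow> ('a set \<Rightarrow> real) set \<Rightarrow> bool" where
  "dominated M \<SS> \<TT> \<longleftrightarrow>
     (\<forall>N\<in>sets M. (SUP \<nu>\<in>\<TT>. ennreal (tv M \<nu> N)) = 0 \<longrightarrow> (SUP \<mu>\<in>\<SS>. ennreal (tv M \<mu> N)) = 0)"

definition upper_prob :: "'a measure set \<Rightarrow> 'a set \<Rightarrow> ennreal" where
  "upper_prob \<PP> A = (SUP P\<in>\<PP>. emeasure P A)"

definition ca_c :: "'a measure \<Rightarrow> 'a measure set \<Rightarrow> ('a set \<Rightarrow> real) set" where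
  "ca_c M \<PP> = {\<mu> \<in> ca M. dominated M {\<mu>} (measure ` \<PP>)}"

definition supported :: "'a measure \<Rightarrow> 'a measure set \<Rightarrow> ('a set \<Rightarrow> real) \<Rightarrow> bool" where
  "supported M \<PP> \<mu> \<longleftrightarrow> (\<exists>S\<in>sets M. \<mu> (space M - S) = 0 \<and>
     (\<forall>N\<in>sets M. \<mu> (N \<inter> S) = 0 \<longrightarrow> upper_prob \<PP> (N \<inter> S) = 0))"

definition sca_c :: "'a measure \<Rightarrow> 'a measure set \<Rightarrow> ('a set \<Rightarrow> real) nvlat" where
  "sca_c M \<PP> = \<lparr>
     vcar = {\<mu> \<in> ca_c M \<PP>. supported M \<PP> (tv M \<mu>)},
     vadd = (\<lambda>\<mu> \<nu> A. \<mu> A + \<nu> A),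
     vscale = (\<lambda>a \<mu> A. a * \<mu> A),
     vzero = (\<lambda>A. 0),
     vle = (\<lambda>\<mu> \<nu>. \<forall>A\<in>sets M. \<mu> A \<le> \<nu> A),
     vnorm = (\<lambda>\<mu>. tv M \<mu> (space M))\<rparr>"

definition class_S :: "'a measure \<Rightarrow> 'a measure set \<Rightarrow> bool" where
  "class_S M \<PP> \<longleftrightarrow> (\<exists>\<QQ>. \<QQ> \<subseteq> Delta M \<and>
     dominated M (measure ` \<QQ>) (measure ` \<PP>) \<and> dominated M (measure ` \<PP>) (measure ` \<QQ>) \<and>
     measure ` \<QQ> \<subseteq> vcar (sca_c M \<PP>))"


section \<open>The spaces of random variables\<close>

definition quasi_surely :: "'a measure \<Rightarrow> 'a measure set \<Rightarrow> ('a \<Rightarrow> bool) \<Rightarrow> bool" where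
  "quasi_surely M \<PP> p \<longleftrightarrow> (\<exists>A\<in>sets M. upper_prob \<PP> A = 0 \<and> (\<forall>\<omega>\<in>space M - A. p \<omega>))"

definition qs_eq :: "'a measure \<Rightarrow> 'a measure set \<Rightarrow> (('a \<Rightarrow> real) \<times> ('a \<Rightarrow> real)) set" where
  "qs_eq M \<PP> = {(f, g). f \<in> borel_measurable M \<and> g \<in> borel_measurable M \<and>
     quasi_surely M \<PP> (\<lambda>\<omega>. f \<omega> = g \<omega>)}"

definition qs_class :: "'a measure \<Rightarrow> 'a measure set \<Rightarrow> ('a \<Rightarrow> real) \<Rightarrow> ('a \<Rightarrow> real) set" where
  "qs_class M \<PP> f = qs_eq M \<PP> `` {f}"

definition representative :: "('a \<Rightarrow> real) set \<Rightarrow> 'a \<Rightarrow> real" where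
  "representative X = (SOME f. f \<in> X)"

definition L0_c :: "'a measure \<Rightarrow> 'a measure set \<Rightarrow> ('a \<Rightarrow> real) set vlat" where
  "L0_c M \<PP> = \<lparr>
     vcar = borel_measurable M // qs_eq M \<PP>,
     vadd = (\<lambda>X Y. qs_class M \<PP> (\<lambda>\<omega>. representative X \<omega> + representative Y \<omega>)),
     vscale = (\<lambda>a X. qs_class M \<PP> (\<lambda>\<omega>. a * representative X \<omega>)),
     vzero = qs_class M \<PP> (\<lambda>\<omega>. 0),
     vle = (\<lambda>X Y. \<exists>f\<in>X. \<exists>g\<in>Y. quasi_surely M \<PP> (\<lambda>\<omega>. f \<omega> \<le> g \<omega>))\<rparr>"

definition ess_bounded_by ::
  "'a measure \<Rightarrow> 'a measure set \<Rightarrow> ('a \<Rightarrow> real) set \<Rightarrow> real \<Rightarrow> bool" where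
  "ess_bounded_by M \<PP> X m \<longleftrightarrow> vle (L0_c M \<PP>) (vabs (L0_c M \<PP>) X)
     (vscale (L0_c M \<PP>) m (qs_class M \<PP> (indicator (space M))))"

definition Linf_c :: "'a measure \<Rightarrow> 'a measure set \<Rightarrow> ('a \<Rightarrow> real) set nvlat" where
  "Linf_c M \<PP> = \<lparr>
     vcar = {X \<in> vcar (L0_c M \<PP>). \<exists>m>0. ess_bounded_by M \<PP> X m},
     vadd = vadd (L0_c M \<PP>),
     vscale = vscale (L0_c M \<PP>),
     vzero = vzero (L0_c M \<PP>),
     vle = vle (L0_c M \<PP>),
     vnorm = (\<lambda>X. Inf {m. m > 0 \<and> ess_bounded_by M \<PP> X m})\<rparr>"

text \<open>
  The integral does not depend on the representative, since every \<open>\<mu>\<close> in \<^const>\<open>sca_c\<close> vanishes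
  on the sets of upper probability 0.
\<close>

definition integral_functional ::
  "'a measure \<Rightarrow> 'a measure set \<Rightarrow> ('a \<Rightarrow> real) set \<Rightarrow> ('a set \<Rightarrow> real) \<Rightarrow> real" where
  "integral_functional M \<PP> X =
     (\<lambda>\<mu>\<in>vcar (sca_c M \<PP>). signed_integral M \<mu> (representative X))"


section \<open>Nets with arbitrary index types\<close>

lemma eventually_net_filter:
  assumes "directed I r"
  shows "eventually Q (net_filter I r) \<longleftrightarrow> (\<exists>i\<in>I. \<forall>j\<in>I. (i, j) \<in> r \<longrightarrow> Q j)"
proof -
  have "eventually Q (net_filter I r) \<longleftrightarrow>
      (\<exists>i\<in>I. eventually Q (principal {j \<in> I. (i, j) \<in> r}))"
    unfolding net_filter_def
  proof (rule eventually_INF_base)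
    show "I \<noteq> {}" using assms by (simp add: directed_def)
    fix a b assume "a \<in> I" "b \<in> I"
    then obtain k where k: "k \<in> I" "(a, k) \<in> r" "(b, k) \<in> r"
      using assms by (auto simp: directed_def)
    have "trans r" using assms by (simp add: directed_def preorder_on_def)
    with k have "{j \<in> I. (k, j) \<in> r} \<subseteq> {j \<in> I. (a, j) \<in> r} \<inter> {j \<in> I. (b, j) \<in> r}"
      by (auto dest: transD)
    with k show "\<exists>x\<in>I. principal {j \<in> I. (x, j) \<in> r} \<le>
        inf (principal {j \<in> I. (a, j) \<in> r}) (principal {j \<in> I. (b, j) \<in> r})"
      by (auto intro!: bexI[of _ k])
  qed
  then show ?thesis by (auto simp: eventually_principal)
qed

lemma order_converges_reindex:
  fixes V :: "('x, 'm) vlat_scheme"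
  assumes "vector_lattice V" and conv: "order_converges V I r x x0"
    and nev: "\<not> eventually (\<lambda>i. Q (x i)) (net_filter I r)"
  obtains J :: "('x \<times> 'x) set" and s z
  where "order_converges V J s z x0" "\<not> eventually (\<lambda>j. Q (z j)) (net_filter J s)"
proof -
  interpret vector_lattice V by fact
  from conv obtain y where dir: "directed I r" and x: "x \<in> I \<rightarrow> vcar V" and x0: "x0 \<in> vcar V"
    and y: "y \<in> I \<rightarrow> vcar V" and dec: "\<And>i j. i \<in> I \<Longrightarrow> j \<in> I \<Longrightarrow> (i, j) \<in> r \<Longrightarrow> vle V (y j) (y i)"
    and inf0: "is_inf V (y ` I) (vzero V)"
    and dom: "\<And>i. i \<in> I \<Longrightarrow> vle V (vabs V (vdiff V (x i) x0)) (y i)"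
    unfolding order_converges_def by blast
  define K where "K = {i \<in> I. \<not> Q (x i)}"
  define J where "J = (\<lambda>i. (x i, y i)) ` K"
  define s where "s = {(p, q). p \<in> J \<and> q \<in> J \<and> vle V (snd q) (snd p)}"
  have cofinal: "\<exists>j\<in>K. (i, j) \<in> r" if "i \<in> I" for i
    using nev that unfolding eventually_net_filter[OF dir] K_def by blast
  have J_car: "snd p \<in> vcar V" if "p \<in> J" for p
    using that y by (auto simp: J_def K_def)
  have "I \<noteq> {}" using dir by (simp add: directed_def)
  then have "J \<noteq> {}" using cofinal by (auto simp: J_def)
  moreover have "preorder_on J s"
    unfolding preorder_on_def
  proof (intro conjI)
    show "s \<subseteq> J \<times> J" by (auto simp: s_def)
    show "refl_on J s" using le_refl J_car by (auto simp: refl_on_def s_def)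
    show "trans s"
    proof (rule transI)
      fix p q t assume "(p, q) \<in> s" "(q, t) \<in> s"
      then have "p \<in> J" "q \<in> J" "t \<in> J" "vle V (snd q) (snd p)" "vle V (snd t) (snd q)"
        unfolding s_def by blast+
      then have "vle V (snd t) (snd p)" using le_trans[of "snd t" "snd q" "snd p"] J_car by blast
      then show "(p, t) \<in> s" using \<open>p \<in> J\<close> \<open>t \<in> J\<close> by (simp add: s_def)
    qed
  qed
  moreover have "\<exists>q\<in>J. (p1, q) \<in> s \<and> (p2, q) \<in> s" if "p1 \<in> J" "p2 \<in> J" for p1 p2
  proof -
    from that obtain i j where ij: "i \<in> K" "j \<in> K" "p1 = (x i, y i)" "p2 = (x j, y j)"
      by (auto simp: J_def)
    then have "i \<in> I" "j \<in> I" by (auto simp: K_def)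
    then obtain k where k: "k \<in> I" "(i, k) \<in> r" "(j, k) \<in> r"
      using dir by (auto simp: directed_def)
    obtain l where l: "l \<in> K" "(k, l) \<in> r" using cofinal k by blast
    have "trans r" using dir by (simp add: directed_def preorder_on_def)
    then have "(i, l) \<in> r" "(j, l) \<in> r" using k l by (auto dest: transD)
    then have "vle V (y l) (y i)" "vle V (y l) (y j)"
      using dec \<open>i \<in> I\<close> \<open>j \<in> I\<close> l by (auto simp: K_def)
    then show ?thesis
      using that l ij by (intro bexI[of _ "(x l, y l)"]) (auto simp: s_def J_def)
  qed
  ultimately have dirJ: "directed J s" by (simp add: directed_def)
  have "is_inf V (snd ` J) (vzero V)"
    unfolding is_inf_def
  proof (intro conjI ballI impI)
    show "vzero V \<in> vcar V" by (rule zero_closed)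
    show "vle V (vzero V) a" if "a \<in> snd ` J" for a
      using that inf0 by (auto simp: J_def K_def is_inf_def)
    fix u assume u: "u \<in> vcar V" "\<forall>a\<in>snd ` J. vle V u a"
    have "vle V u (y i)" if "i \<in> I" for i
    proof -
      obtain j where j: "j \<in> K" "(i, j) \<in> r" using cofinal \<open>i \<in> I\<close> by blast
      then have "vle V u (y j)" using u by (auto simp: J_def)
      moreover have "vle V (y j) (y i)" using dec j \<open>i \<in> I\<close> by (auto simp: K_def)
      ultimately show ?thesis
        using le_trans[of u "y j" "y i"] u y j \<open>i \<in> I\<close> by (auto simp: K_def)
    qed
    then show "vle V u (vzero V)" using inf0 u by (auto simp: is_inf_def)
  qed
  moreover have "fst \<in> J \<rightarrow> vcar V" using x by (auto simp: J_def K_def)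
  moreover have "\<forall>p\<in>J. vle V (vabs V (vdiff V (fst p) x0)) (snd p)"
    using dom by (auto simp: J_def K_def)
  ultimately have "order_converges V J s fst x0"
    unfolding order_converges_def using dirJ x0 J_car
    by (intro conjI bexI[of _ snd]) (auto simp: s_def)
  moreover have "\<not> eventually (\<lambda>j. Q (fst j)) (net_filter J s)"
    unfolding eventually_net_filter[OF dirJ]
  proof
    assume "\<exists>i\<in>J. \<forall>j\<in>J. (i, j) \<in> s \<longrightarrow> Q (fst j)"
    then obtain i where i: "i \<in> J" "\<And>j. j \<in> J \<Longrightarrow> (i, j) \<in> s \<Longrightarrow> Q (fst j)" by blast
    then have "(i, i) \<in> s" using le_refl J_car by (auto simp: s_def)
    with i have "Q (fst i)" by blast
    then show False using i(1) by (auto simp: J_def K_def)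
  qed
  ultimately show ?thesis by (rule that)
qed

lemma order_continuous_any_index:
  assumes "vector_lattice V" "order_continuous V \<phi>" "order_converges V I r x x0"
  shows "((\<lambda>i. \<phi> (x i)) \<longlongrightarrow> \<phi> x0) (net_filter I r)"
proof (rule topological_tendstoI, rule ccontr)
  fix S :: "real set"
  assume S: "open S" "\<phi> x0 \<in> S" and nev: "\<not> eventually (\<lambda>i. \<phi> (x i) \<in> S) (net_filter I r)"
  from order_converges_reindex[OF assms(1,3), of "\<lambda>z. \<phi> z \<in> S"] nev
  obtain J :: "('a \<times> 'a) set" and s z where J: "order_converges V J s z x0"
    "\<not> eventually (\<lambda>j. \<phi> (z j) \<in> S) (net_filter J s)" by blast
  then have "((\<lambda>j. \<phi> (z j)) \<longlongrightarrow> \<phi> x0) (net_filter J s)"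
    using assms(2) by (simp add: order_continuous_def)
  with S J show False by (auto dest: topological_tendstoD)
qed

lemma order_continuous_topology_any_index:
  assumes "vector_lattice V" "order_continuous_topology V \<T>" "order_converges V I r x (vzero V)"
    and "vzero V \<in> topspace \<T>"
  shows "limitin \<T> x (vzero V) (net_filter I r)"
proof (rule ccontr)
  assume "\<not> limitin \<T> x (vzero V) (net_filter I r)"
  then obtain S where S: "openin \<T> S" "vzero V \<in> S"
    and nev: "\<not> eventually (\<lambda>i. x i \<in> S) (net_filter I r)"
    using assms(4) by (auto simp: limitin_def)
  from order_converges_reindex[OF assms(1,3), of "\<lambda>z. z \<in> S"] nev
  obtain J :: "('a \<times> 'a) set" and s z where J: "order_converges V J s z (vzero V)"
    "\<not> eventually (\<lambda>j. z j \<in> S) (net_filter J s)" by blast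
  then have "limitin \<T> z (vzero V) (net_filter J s)"
    using assms(2) by (simp add: order_continuous_topology_def)
  with S J show False by (auto simp: limitin_def)
qed

end

theory Submission
  imports Defs
begin

text \<open>
  A positive order continuous functional on \<open>L\<^sup>\<infinity>\<close> restricts to a countably additive measure on
  indicators. If \<open>L\<^sup>\<infinity>\<close> is Dedekind complete, the null sets of this measure have a supremum, and the
  complement of this supremum is a support. So class (S) holds as soon as order continuous functionals
  separate indicators from 0. Such functionals are the evaluations at points of a predual, the
  elements of the order continuous dual of a perfect lattice, and, for an order continuous lattice
  seminorm \<open>p\<close>, the functionals that the Hahn-Banach theorem provides below \<open>x \<mapsto> p (x\<^sup>+)\<close>.

  Conversely, a norm bounded functional on \<open>sca\<^sub>c\<close> has a density with respect to each positive
  supported \<open>\<mu>\<close>; these densities agree quasi surely on common supports, and Dedekind completeness glues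
  them to one element of \<open>L\<^sup>\<infinity>\<close>. By class (S), \<open>sca\<^sub>c\<close> detects the order and the norm of \<open>L\<^sup>\<infinity>\<close>. Since
  \<open>sca\<^sub>c\<close> is a Banach lattice, order bounded functionals on it are norm bounded, and it is isomorphic
  to the order continuous dual of \<open>L\<^sup>\<infinity>\<close>; hence \<open>L\<^sup>\<infinity>\<close> is perfect. The seminorms \<open>X \<mapsto> \<integral>|X| d\<mu>\<close> generate
  an order continuous topology.
\<close>

text \<open>No single measure need dominate the priors, so there is no global Radon-Nikodym theorem,
  and only countably many quasi sure statements can be combined at once. Supports are the remedy. A
  positive supported measure vanishes on negligible sets, and its null sets inside its support are
  negligible; there almost sure and quasi sure statements coincide. Hence every passage from
  integrals to the order of \<open>Linf\<close> is made on one support at a time, and uncountable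
  families meet only through a supremum in \<open>Linf\<close>. Supported measures form a large
  enough space because being supported passes to absolutely continuous measures and to countable
  sums: negligible sets are closed under countable unions. Lattice structure and norm completeness
  of \<open>sca_c\<close> both come from this. Signs are treated by Hahn sets, for signed measures
  as well as for order continuous functionals. Integral identities are checked on indicators only,
  since sup-norm bounded functionals are determined there.\<close>

section \<open>Vector lattices\<close>

text \<open>
  The axioms of \<^locale>\<open>vector_lattice\<close> without suprema and infima of pairs, which all follow from
  the existence of positive parts.
\<close>

locale ordered_vector_space =
  fixes V :: "('x, 'm) vlat_scheme"
  assumes zero_closed: "vzero V \<in> vcar V"
    and add_closed: "x \<in> vcar V \<Longrightarrow> y \<in> vcar V \<Longrightarrow> vadd V x y \<in> vcar V"
    and scale_closed: "x \<in> vcar V \<Longrightarrow> vscale V a x \<in> vcar V"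
    and add_assoc: "x \<in> vcar V \<Longrightarrow> y \<in> vcar V \<Longrightarrow> z \<in> vcar V \<Longrightarrow>
      vadd V (vadd V x y) z = vadd V x (vadd V y z)"
    and add_commute: "x \<in> vcar V \<Longrightarrow> y \<in> vcar V \<Longrightarrow> vadd V x y = vadd V y x"
    and add_zero: "x \<in> vcar V \<Longrightarrow> vadd V x (vzero V) = x"
    and add_inverse: "x \<in> vcar V \<Longrightarrow> vadd V x (vscale V (- 1) x) = vzero V"
    and scale_add_right: "x \<in> vcar V \<Longrightarrow> y \<in> vcar V \<Longrightarrow>
      vscale V a (vadd V x y) = vadd V (vscale V a x) (vscale V a y)"
    and scale_add_left: "x \<in> vcar V \<Longrightarrow>
      vscale V (a + b) x = vadd V (vscale V a x) (vscale V b x)"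
    and scale_scale: "x \<in> vcar V \<Longrightarrow> vscale V a (vscale V b x) = vscale V (a * b) x"
    and scale_one: "x \<in> vcar V \<Longrightarrow> vscale V 1 x = x"
    and le_refl: "x \<in> vcar V \<Longrightarrow> vle V x x"
    and le_trans: "x \<in> vcar V \<Longrightarrow> y \<in> vcar V \<Longrightarrow> z \<in> vcar V \<Longrightarrow>
      vle V x y \<Longrightarrow> vle V y z \<Longrightarrow> vle V x z"
    and le_antisym: "x \<in> vcar V \<Longrightarrow> y \<in> vcar V \<Longrightarrow> vle V x y \<Longrightarrow> vle V y x \<Longrightarrow> x = y"
    and add_mono: "x \<in> vcar V \<Longrightarrow> y \<in> vcar V \<Longrightarrow> z \<in> vcar V \<Longrightarrow>
      vle V x y \<Longrightarrow> vle V (vadd V x z) (vadd V y z)"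
    and scale_mono: "x \<in> vcar V \<Longrightarrow> y \<in> vcar V \<Longrightarrow> 0 \<le> a \<Longrightarrow>
      vle V x y \<Longrightarrow> vle V (vscale V a x) (vscale V a y)"

sublocale vector_lattice \<subseteq> ordered_vector_space V
  by unfold_locales
    (fact zero_closed add_closed scale_closed add_assoc add_commute add_zero add_inverse
      scale_add_right scale_add_left scale_scale scale_one le_refl le_trans le_antisym
      add_mono scale_mono)+

context ordered_vector_space
begin

abbreviation nonneg :: "'x set" where
  "nonneg \<equiv> {x \<in> vcar V. vle V (vzero V) x}"

lemma zero_add: "x \<in> vcar V \<Longrightarrow> vadd V (vzero V) x = x"
  using add_zero add_commute zero_closed by metis

lemma scale_zero_left: "x \<in> vcar V \<Longrightarrow> vscale V 0 x = vzero V"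
  using scale_add_left[of x 1 "- 1"] scale_one[of x] add_inverse[of x] by simp

lemma scale_zero_right: "vscale V a (vzero V) = vzero V"
  using scale_scale[OF zero_closed, of a 0] scale_zero_left[OF zero_closed] by simp

lemma diff_closed: "x \<in> vcar V \<Longrightarrow> y \<in> vcar V \<Longrightarrow> vdiff V x y \<in> vcar V"
  unfolding vdiff_def by (intro add_closed scale_closed)

lemma minus_minus: "x \<in> vcar V \<Longrightarrow> vscale V (- 1) (vscale V (- 1) x) = x"
  using scale_scale[of x "- 1" "- 1"] scale_one by simp

lemma diff_add_cancel: "x \<in> vcar V \<Longrightarrow> y \<in> vcar V \<Longrightarrow> vadd V (vdiff V x y) y = x"
  unfolding vdiff_def
  by (metis add_assoc add_commute add_inverse add_zero scale_closed)

lemma add_diff_cancel: "x \<in> vcar V \<Longrightarrow> y \<in> vcar V \<Longrightarrow> vdiff V (vadd V x y) y = x"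
  unfolding vdiff_def
  by (metis add_assoc add_inverse add_zero scale_closed)

lemma diff_zero: "x \<in> vcar V \<Longrightarrow> vdiff V x (vzero V) = x"
  unfolding vdiff_def by (simp add: scale_zero_right add_zero)

lemma zero_diff: "x \<in> vcar V \<Longrightarrow> vdiff V (vzero V) x = vscale V (- 1) x"
  unfolding vdiff_def by (simp add: zero_add scale_closed)

lemma diff_self: "x \<in> vcar V \<Longrightarrow> vdiff V x x = vzero V"
  unfolding vdiff_def by (simp add: add_inverse)

lemma minus_diff: "x \<in> vcar V \<Longrightarrow> y \<in> vcar V \<Longrightarrow> vscale V (- 1) (vdiff V x y) = vdiff V y x"
  unfolding vdiff_def using scale_add_right[of x "vscale V (- 1) y" "- 1"]
  by (simp add: scale_closed minus_minus add_commute)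

lemma diff_eq_zero: "x \<in> vcar V \<Longrightarrow> y \<in> vcar V \<Longrightarrow> vdiff V x y = vzero V \<longleftrightarrow> x = y"
  by (metis diff_add_cancel diff_self zero_add)

lemma diff_add_diff: "x \<in> vcar V \<Longrightarrow> y \<in> vcar V \<Longrightarrow> z \<in> vcar V \<Longrightarrow>
  vadd V (vdiff V x y) (vdiff V y z) = vdiff V x z"
proof -
  assume c: "x \<in> vcar V" "y \<in> vcar V" "z \<in> vcar V"
  then have "vadd V (vdiff V x y) (vdiff V y z) =
      vadd V (vadd V (vdiff V x y) y) (vscale V (- 1) z)"
    using add_assoc[of "vdiff V x y" y "vscale V (- 1) z"]
    by (simp add: diff_closed scale_closed vdiff_def[of V y z])
  also have "\<dots> = vdiff V x z"
    using c by (simp add: diff_add_cancel vdiff_def[of V x z])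
  finally show ?thesis .
qed

lemma add_mono2:
  assumes "x \<in> vcar V" "y \<in> vcar V" "z \<in> vcar V" "w \<in> vcar V" "vle V x y" "vle V z w"
  shows "vle V (vadd V x z) (vadd V y w)"
proof (rule le_trans)
  show "vle V (vadd V x z) (vadd V y z)" using assms by (intro add_mono)
  show "vle V (vadd V y z) (vadd V y w)"
    using add_mono[of z w y] assms by (simp add: add_commute)
qed (use assms in \<open>auto intro: add_closed\<close>)

lemma le_iff_diff_nonneg:
  assumes "x \<in> vcar V" "y \<in> vcar V"
  shows "vle V x y \<longleftrightarrow> vle V (vzero V) (vdiff V y x)"
proof
  assume "vle V x y"
  then have "vle V (vadd V x (vscale V (- 1) x)) (vadd V y (vscale V (- 1) x))"
    using assms by (intro add_mono scale_closed)
  then show "vle V (vzero V) (vdiff V y x)"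
    using assms by (simp add: add_inverse vdiff_def)
next
  assume "vle V (vzero V) (vdiff V y x)"
  then have "vle V (vadd V (vzero V) x) (vadd V (vdiff V y x) x)"
    using assms by (intro add_mono zero_closed diff_closed)
  then show "vle V x y" using assms by (simp add: zero_add diff_add_cancel)
qed

lemma le_minus:
  assumes "x \<in> vcar V" "y \<in> vcar V" "vle V x y"
  shows "vle V (vscale V (- 1) y) (vscale V (- 1) x)"
proof -
  have "vdiff V (vscale V (- 1) x) (vscale V (- 1) y) = vdiff V y x"
    using assms by (simp add: vdiff_def minus_minus add_commute scale_closed)
  then show ?thesis using assms le_iff_diff_nonneg by (metis scale_closed)
qed

lemma le_minus_swap:
  assumes "x \<in> vcar V" "y \<in> vcar V" "vle V (vscale V (- 1) x) y"
  shows "vle V (vscale V (- 1) y) x"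
  using le_minus[of "vscale V (- 1) x" y] assms by (simp add: scale_closed minus_minus)

lemma is_sup_closed: "is_sup V A s \<Longrightarrow> s \<in> vcar V"
  and is_sup_ge: "is_sup V A s \<Longrightarrow> a \<in> A \<Longrightarrow> vle V a s"
  and is_sup_least: "is_sup V A s \<Longrightarrow> u \<in> vcar V \<Longrightarrow> (\<And>a. a \<in> A \<Longrightarrow> vle V a u) \<Longrightarrow> vle V s u"
  by (auto simp: is_sup_def)

lemma is_sup_unique: "is_sup V A s \<Longrightarrow> is_sup V A t \<Longrightarrow> s = t"
  unfolding is_sup_def by (intro le_antisym) auto

lemma is_sup_translate:
  assumes s: "is_sup V A s" and A: "A \<subseteq> vcar V" and z: "z \<in> vcar V"
  shows "is_sup V ((\<lambda>a. vadd V a z) ` A) (vadd V s z)"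
  unfolding is_sup_def
proof (intro conjI ballI impI)
  have sc: "s \<in> vcar V" using s by (simp add: is_sup_def)
  then show "vadd V s z \<in> vcar V" using z by (simp add: add_closed)
  show "vle V a (vadd V s z)" if "a \<in> (\<lambda>a. vadd V a z) ` A" for a
    using that A sc z by (auto intro!: add_mono is_sup_ge[OF s])
  fix u assume u: "u \<in> vcar V" "\<forall>a\<in>(\<lambda>a. vadd V a z) ` A. vle V a u"
  have "vle V a (vdiff V u z)" if "a \<in> A" for a
  proof -
    have "a \<in> vcar V" using that A by auto
    then have "vle V (vdiff V (vadd V a z) z) (vdiff V u z)"
      unfolding vdiff_def[of V "vadd V a z"] vdiff_def[of V u]
      using u z that by (intro add_mono) (auto intro: add_closed scale_closed)
    then show ?thesis using \<open>a \<in> vcar V\<close> z by (simp add: add_diff_cancel)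
  qed
  then have "vle V s (vdiff V u z)" by (rule is_sup_least[OF s diff_closed[OF u(1) z]])
  then have "vle V (vadd V s z) (vadd V (vdiff V u z) z)"
    using sc u z by (intro add_mono diff_closed)
  then show "vle V (vadd V s z) u" using u z by (simp add: diff_add_cancel)
qed

lemma is_inf_minus:
  assumes s: "is_sup V ((\<lambda>a. vscale V (- 1) a) ` A) s" and A: "A \<subseteq> vcar V"
  shows "is_inf V A (vscale V (- 1) s)"
  unfolding is_inf_def
proof (intro conjI ballI impI)
  have sc: "s \<in> vcar V" using s by (simp add: is_sup_def)
  then show "vscale V (- 1) s \<in> vcar V" by (rule scale_closed)
  show "vle V (vscale V (- 1) s) a" if "a \<in> A" for a
    by (rule le_minus_swap) (use that A sc in \<open>auto intro: is_sup_ge[OF s]\<close>)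
  fix u assume u: "u \<in> vcar V" "\<forall>a\<in>A. vle V u a"
  then have "vle V s (vscale V (- 1) u)"
    using A u by (intro is_sup_least[OF s] scale_closed) (auto intro!: le_minus)
  then have "vle V (vscale V (- 1) (vscale V (- 1) u)) (vscale V (- 1) s)"
    using sc u by (intro le_minus scale_closed)
  then show "vle V u (vscale V (- 1) s)" using u by (simp add: minus_minus)
qed

text \<open>The supremum of \<open>x\<close> and \<open>y\<close> is the positive part of
  \<open>x - y\<close> translated by \<open>y\<close>, and infima are negatives of suprema. For
  \<open>sca_c\<close>, \<open>Linf\<close> and the order continuous dual of \<open>Linf\<close> it
  then remains only to find positive parts.\<close>

lemma vector_lattice_if_pos_part:
  assumes pos: "\<And>x. x \<in> vcar V \<Longrightarrow> \<exists>s. is_sup V {x, vzero V} s"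
  shows "vector_lattice V"
proof -
  have sup: "\<exists>s. is_sup V {x, y} s" if xy: "x \<in> vcar V" "y \<in> vcar V" for x y
  proof -
    obtain s where "is_sup V {vdiff V x y, vzero V} s" using pos[OF diff_closed[OF xy]] by blast
    then have "is_sup V ((\<lambda>a. vadd V a y) ` {vdiff V x y, vzero V}) (vadd V s y)"
      using xy by (intro is_sup_translate) (auto simp: diff_closed zero_closed)
    then show ?thesis using xy by (auto simp: diff_add_cancel zero_add)
  qed
  have inf: "\<exists>s. is_inf V {x, y} s" if xy: "x \<in> vcar V" "y \<in> vcar V" for x y
  proof -
    obtain s where "is_sup V {vscale V (- 1) x, vscale V (- 1) y} s"
      using sup[OF xy[THEN scale_closed]] by blast
    then have "is_inf V {x, y} (vscale V (- 1) s)"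
      using xy by (intro is_inf_minus) auto
    then show ?thesis by blast
  qed
  show ?thesis
    by unfold_locales
      (fact zero_closed add_closed scale_closed add_assoc add_commute add_zero add_inverse
        scale_add_right scale_add_left scale_scale scale_one le_refl le_trans le_antisym
        add_mono scale_mono sup inf)+
qed

lemma linear_functional_add:
  "linear_functional V \<phi> \<Longrightarrow> x \<in> vcar V \<Longrightarrow> y \<in> vcar V \<Longrightarrow> \<phi> (vadd V x y) = \<phi> x + \<phi> y"
  by (simp add: linear_functional_def)

lemma linear_functional_scale:
  "linear_functional V \<phi> \<Longrightarrow> x \<in> vcar V \<Longrightarrow> \<phi> (vscale V a x) = a * \<phi> x"
  by (simp add: linear_functional_def)

lemma linear_functional_diff:
  "linear_functional V \<phi> \<Longrightarrow> x \<in> vcar V \<Longrightarrow> y \<in> vcar V \<Longrightarrow> \<phi> (vdiff V x y) = \<phi> x - \<phi> y"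
  by (simp add: vdiff_def linear_functional_add linear_functional_scale scale_closed)

lemma linear_functional_zero: "linear_functional V \<phi> \<Longrightarrow> \<phi> (vzero V) = 0"
  using linear_functional_diff[of \<phi> "vzero V" "vzero V"] diff_self[OF zero_closed] zero_closed
  by simp

lemma linear_functional_ext:
  "linear_functional V \<phi> \<Longrightarrow> linear_functional V \<psi> \<Longrightarrow>
    (\<And>x. x \<in> vcar V \<Longrightarrow> \<phi> x = \<psi> x) \<Longrightarrow> \<phi> = \<psi>"
  unfolding linear_functional_def by (auto intro: extensionalityI)

lemma linear_functional_combine:
  "linear_functional V \<phi> \<Longrightarrow> linear_functional V \<psi> \<Longrightarrow>
    linear_functional V (\<lambda>x\<in>vcar V. a * \<phi> x + b * \<psi> x)"
  unfolding linear_functional_def by (auto simp: add_closed scale_closed algebra_simps)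

definition positive_functional :: "('x \<Rightarrow> real) \<Rightarrow> bool" where
  "positive_functional \<phi> \<longleftrightarrow> linear_functional V \<phi> \<and> (\<forall>x\<in>nonneg. 0 \<le> \<phi> x)"

lemma positive_functional_mono:
  assumes "positive_functional \<phi>" "x \<in> vcar V" "y \<in> vcar V" "vle V x y"
  shows "\<phi> x \<le> \<phi> y"
proof -
  have "vdiff V y x \<in> nonneg" using assms by (simp add: diff_closed le_iff_diff_nonneg)
  then have "0 \<le> \<phi> (vdiff V y x)" using assms(1) unfolding positive_functional_def by blast
  then show ?thesis
    using assms by (simp add: linear_functional_diff positive_functional_def)
qed

lemma positive_functional_order_bounded:
  assumes "positive_functional \<phi>"
  shows "order_bounded V \<phi>"
  unfolding order_bounded_def
proof (intro ballI)
  fix a b assume ab: "a \<in> vcar V" "b \<in> vcar V"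
  show "bounded (\<phi> ` {x \<in> vcar V. vle V a x \<and> vle V x b})"
    by (rule bounded_subset[of "{\<phi> a..\<phi> b}"])
      (use ab assms in \<open>auto intro: positive_functional_mono\<close>)
qed

end


section \<open>Directed nets\<close>

lemma net_filter_not_bot: "directed I r \<Longrightarrow> net_filter I r \<noteq> bot"
  unfolding trivial_limit_def
  by (subst eventually_net_filter) (auto simp: directed_def preorder_on_def refl_on_def)

lemma eventually_net_filterI:
  "directed I r \<Longrightarrow> i \<in> I \<Longrightarrow> (\<And>j. j \<in> I \<Longrightarrow> (i, j) \<in> r \<Longrightarrow> Q j) \<Longrightarrow> eventually Q (net_filter I r)"
  by (auto simp: eventually_net_filter)

lemma monotone_net_tendsto:
  fixes g :: "'i \<Rightarrow> real"
  assumes dir: "directed I r" and mono: "\<And>i j. i \<in> I \<Longrightarrow> j \<in> I \<Longrightarrow> (i, j) \<in> r \<Longrightarrow> g i \<le> g j"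
    and bdd: "\<And>i. i \<in> I \<Longrightarrow> g i \<le> B"
  shows "(g \<longlongrightarrow> (SUP i\<in>I. g i)) (net_filter I r)"
proof (rule tendstoI)
  fix e :: real assume "0 < e"
  have ne: "I \<noteq> {}" using dir by (simp add: directed_def)
  have bd: "bdd_above (g ` I)" using bdd by (intro bdd_aboveI2)
  have "\<exists>i\<in>I. (SUP i\<in>I. g i) - e < g i"
    using less_cSUP_iff[OF ne bd, of "(SUP i\<in>I. g i) - e"] \<open>0 < e\<close> by simp
  then obtain i where i: "i \<in> I" "(SUP i\<in>I. g i) - e < g i" by blast
  show "\<forall>\<^sub>F j in net_filter I r. dist (g j) (SUP i\<in>I. g i) < e"
  proof (rule eventually_net_filterI[OF dir i(1)])
    fix j assume j: "j \<in> I" "(i, j) \<in> r"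
    have "g i \<le> g j" using mono i j by blast
    moreover have "g j \<le> (SUP i\<in>I. g i)" using bd j by (rule_tac cSUP_upper)
    ultimately show "dist (g j) (SUP i\<in>I. g i) < e" using i by (simp add: dist_real_def)
  qed
qed

lemma net_tendsto_mono_le:
  fixes g :: "'i \<Rightarrow> real"
  assumes dir: "directed I r" and mono: "\<And>i j. i \<in> I \<Longrightarrow> j \<in> I \<Longrightarrow> (i, j) \<in> r \<Longrightarrow> g i \<le> g j"
    and lim: "(g \<longlongrightarrow> l) (net_filter I r)" and i: "i \<in> I"
  shows "g i \<le> l"
proof (rule tendsto_lowerbound[OF lim _ net_filter_not_bot[OF dir]])
  show "\<forall>\<^sub>F j in net_filter I r. g i \<le> g j"
    by (rule eventually_net_filterI[OF dir i]) (auto intro: mono i)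
qed

definition up_directed :: "('x, 'm) vlat_scheme \<Rightarrow> 'x set \<Rightarrow> bool" where
  "up_directed V D \<longleftrightarrow> D \<noteq> {} \<and> D \<subseteq> vcar V \<and> (\<forall>x\<in>D. \<forall>y\<in>D. \<exists>z\<in>D. vle V x z \<and> vle V y z)"

text \<open>Lets an upward directed set be a net indexed by its own elements, so that suprema of
  sets can be handled as limits of nets.\<close>

definition up_rel :: "('x, 'm) vlat_scheme \<Rightarrow> 'x set \<Rightarrow> ('x \<times> 'x) set" where
  "up_rel V D = {(x, y). x \<in> D \<and> y \<in> D \<and> vle V x y}"

lemma (in ordered_vector_space) directed_up_rel:
  assumes "up_directed V D"
  shows "directed D (up_rel V D)"
proof -
  have D: "D \<subseteq> vcar V" using assms by (simp add: up_directed_def)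
  have "trans (up_rel V D)"
    by (rule transI) (use D le_trans in \<open>auto simp: up_rel_def, blast\<close>)
  moreover have "refl_on D (up_rel V D)" using D by (auto simp: refl_on_def up_rel_def le_refl)
  moreover have "up_rel V D \<subseteq> D \<times> D" by (auto simp: up_rel_def)
  ultimately have "preorder_on D (up_rel V D)" by (simp add: preorder_on_def)
  moreover have "\<exists>k\<in>D. (i, k) \<in> up_rel V D \<and> (j, k) \<in> up_rel V D" if "i \<in> D" "j \<in> D" for i j
    using assms that unfolding up_directed_def up_rel_def by blast
  ultimately show ?thesis using assms by (simp add: directed_def up_directed_def)
qed

context vector_lattice
begin

lemma vabs_is_sup: "x \<in> vcar V \<Longrightarrow> is_sup V {x, vscale V (- 1) x} (vabs V x)"
  unfolding vabs_def
  by (rule theI') (metis sup_exists scale_closed is_sup_unique)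

lemma vabs_eqI: "is_sup V {x, vscale V (- 1) x} s \<Longrightarrow> vabs V x = s"
  unfolding vabs_def by (rule the_equality) (auto intro: is_sup_unique)

lemma vabs_closed: "x \<in> vcar V \<Longrightarrow> vabs V x \<in> vcar V"
  and vabs_ge: "x \<in> vcar V \<Longrightarrow> vle V x (vabs V x)"
  and vabs_ge_minus: "x \<in> vcar V \<Longrightarrow> vle V (vscale V (- 1) x) (vabs V x)"
  using vabs_is_sup by (auto simp: is_sup_def)

text \<open>Both \<open>x\<close> and \<open>- x\<close> lie below the absolute value, so their sum
  0 lies below twice the absolute value.\<close>

lemma vabs_nonneg:
  assumes x: "x \<in> vcar V"
  shows "vle V (vzero V) (vabs V x)"
proof -
  have "vle V (vadd V x (vscale V (- 1) x)) (vadd V (vabs V x) (vabs V x))"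
    using x by (intro add_mono2 vabs_ge vabs_ge_minus vabs_closed scale_closed)
  then have "vle V (vzero V) (vscale V 2 (vabs V x))"
    using x scale_add_left[of "vabs V x" 1 1] by (simp add: add_inverse scale_one vabs_closed)
  then have "vle V (vscale V (1/2) (vzero V)) (vscale V (1/2) (vscale V 2 (vabs V x)))"
    using x by (intro scale_mono zero_closed scale_closed vabs_closed) auto
  then show ?thesis using x by (simp add: scale_scale scale_zero_right vabs_closed scale_one)
qed

lemma vabs_of_nonneg:
  assumes "x \<in> vcar V" "vle V (vzero V) x"
  shows "vabs V x = x"
proof (rule vabs_eqI)
  have "vle V (vscale V (- 1) x) (vscale V (- 1) (vzero V))"
    using assms by (intro le_minus zero_closed)
  then have "vle V (vscale V (- 1) x) x"
    using assms le_trans[of "vscale V (- 1) x" "vzero V" x]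
    by (simp add: scale_zero_right scale_closed zero_closed)
  then show "is_sup V {x, vscale V (- 1) x} x" using assms by (auto simp: is_sup_def le_refl)
qed

lemma nonneg_decompose:
  assumes x: "x \<in> vcar V"
  obtains u v where "u \<in> nonneg" "v \<in> nonneg" "x = vdiff V u v"
proof -
  obtain u where u: "is_sup V {x, vzero V} u" using sup_exists x zero_closed by blast
  then have uc: "u \<in> vcar V" "vle V (vzero V) u" "vle V x u" by (auto simp: is_sup_def)
  have "vdiff V u x \<in> nonneg" using uc x by (simp add: diff_closed le_iff_diff_nonneg)
  moreover have "x = vdiff V u (vdiff V u x)"
    using uc x by (metis add_commute diff_add_cancel add_diff_cancel diff_closed)
  ultimately show ?thesis using uc that by blast
qed

lemma linear_functional_eq_if_eq_on_nonneg:
  assumes lin: "linear_functional V \<phi>" "linear_functional V \<psi>"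
    and eq: "\<And>x. x \<in> nonneg \<Longrightarrow> \<phi> x = \<psi> x"
  shows "\<phi> = \<psi>"
proof (rule linear_functional_ext[OF lin])
  fix x assume "x \<in> vcar V"
  then obtain u v where "u \<in> nonneg" "v \<in> nonneg" "x = vdiff V u v" by (rule nonneg_decompose)
  then show "\<phi> x = \<psi> x" using eq[of u] eq[of v] lin by (simp add: linear_functional_diff)
qed

lemma positive_functional_abs_le:
  assumes "positive_functional \<phi>" "x \<in> vcar V"
  shows "\<bar>\<phi> x\<bar> \<le> \<phi> (vabs V x)"
  using positive_functional_mono[OF assms(1) assms(2) vabs_closed vabs_ge]
    positive_functional_mono[OF assms(1) scale_closed[OF assms(2)] vabs_closed vabs_ge_minus] assms
  by (auto simp: positive_functional_def linear_functional_scale)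

lemma order_converges_decreasing:
  assumes "directed I r" "y \<in> I \<rightarrow> vcar V"
    "\<And>i j. i \<in> I \<Longrightarrow> j \<in> I \<Longrightarrow> (i, j) \<in> r \<Longrightarrow> vle V (y j) (y i)"
    "is_inf V (y ` I) (vzero V)"
  shows "order_converges V I r y (vzero V)"
  unfolding order_converges_def
proof (intro conjI bexI[of _ y] ballI impI)
  fix i assume "i \<in> I"
  then have "y i \<in> vcar V" "vle V (vzero V) (y i)" using assms by (auto simp: is_inf_def)
  then show "vle V (vabs V (vdiff V (y i) (vzero V))) (y i)"
    by (simp add: diff_zero vabs_of_nonneg le_refl)
qed (use assms zero_closed in auto)

text \<open>For positive \<open>\<phi>\<close>, \<open>|\<phi> z| \<le> \<phi> |z|\<close> transfers
  the estimate to the dominating decreasing net, and monotonicity turns one index with a small value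
  into a small tail. So only nets decreasing to 0 have to be tested, and only one index has to be
  found.\<close>

lemma order_continuousI:
  assumes pos: "positive_functional \<phi>"
    and dec: "\<And>(I :: ('x \<times> 'x) set) r y e. directed I r \<Longrightarrow> y \<in> I \<rightarrow> vcar V \<Longrightarrow>
      (\<And>i j. i \<in> I \<Longrightarrow> j \<in> I \<Longrightarrow> (i, j) \<in> r \<Longrightarrow> vle V (y j) (y i)) \<Longrightarrow>
      is_inf V (y ` I) (vzero V) \<Longrightarrow> 0 < e \<Longrightarrow> \<exists>i\<in>I. \<phi> (y i) < e"
  shows "order_continuous V \<phi>"
  unfolding order_continuous_def
proof (intro allI impI)
  fix I :: "('x \<times> 'x) set" and r x x0 assume "order_converges V I r x x0"
  then obtain y where dir: "directed I r" and x: "x \<in> I \<rightarrow> vcar V" and x0: "x0 \<in> vcar V"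
    and y: "y \<in> I \<rightarrow> vcar V" and mono: "\<And>i j. i \<in> I \<Longrightarrow> j \<in> I \<Longrightarrow> (i, j) \<in> r \<Longrightarrow> vle V (y j) (y i)"
    and inf0: "is_inf V (y ` I) (vzero V)"
    and dom: "\<And>i. i \<in> I \<Longrightarrow> vle V (vabs V (vdiff V (x i) x0)) (y i)"
    unfolding order_converges_def by blast
  show "((\<lambda>i. \<phi> (x i)) \<longlongrightarrow> \<phi> x0) (net_filter I r)"
  proof (rule tendstoI)
    fix e :: real assume "0 < e"
    then obtain i where i: "i \<in> I" "\<phi> (y i) < e" using dec[OF dir y mono inf0] by blast
    show "\<forall>\<^sub>F i in net_filter I r. dist (\<phi> (x i)) (\<phi> x0) < e"
    proof (rule eventually_net_filterI[OF dir i(1)])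
      fix j assume j: "j \<in> I" "(i, j) \<in> r"
      then have c: "x j \<in> vcar V" "y j \<in> vcar V" "y i \<in> vcar V" using x y i by auto
      have "\<bar>\<phi> (vdiff V (x j) x0)\<bar> \<le> \<phi> (vabs V (vdiff V (x j) x0))"
        using pos c x0 by (intro positive_functional_abs_le diff_closed)
      also have "\<dots> \<le> \<phi> (y j)"
        using pos c x0 dom j by (intro positive_functional_mono vabs_closed diff_closed)
      also have "\<dots> \<le> \<phi> (y i)"
        using pos c mono i j by (intro positive_functional_mono)
      finally show "dist (\<phi> (x j)) (\<phi> x0) < e"
        using i pos c x0 by (simp add: dist_real_def linear_functional_diff positive_functional_def)
    qed
  qed
qed

text \<open>The index type is arbitrary here, which \<open>order_continuous_any_index\<close>
  permits; this covers sets indexed by themselves through \<open>up_rel\<close>.\<close>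

lemma order_continuous_eventually:
  assumes "order_continuous V \<phi>" "linear_functional V \<phi>" "directed I r" "y \<in> I \<rightarrow> vcar V"
    "\<And>i j. i \<in> I \<Longrightarrow> j \<in> I \<Longrightarrow> (i, j) \<in> r \<Longrightarrow> vle V (y j) (y i)"
    "is_inf V (y ` I) (vzero V)" "0 < e"
  shows "\<exists>i\<in>I. \<forall>j\<in>I. (i, j) \<in> r \<longrightarrow> \<bar>\<phi> (y j)\<bar> < e"
proof -
  have "order_converges V I r y (vzero V)" by (rule order_converges_decreasing) (use assms in auto)
  then have "((\<lambda>i. \<phi> (y i)) \<longlongrightarrow> \<phi> (vzero V)) (net_filter I r)"
    using vector_lattice_axioms assms(1) by (rule_tac order_continuous_any_index)
  then have "\<forall>\<^sub>F i in net_filter I r. \<bar>\<phi> (y i)\<bar> < e"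
    using tendstoD[OF _ assms(7), of "\<lambda>i. \<phi> (y i)" "\<phi> (vzero V)"] assms(2)
    by (simp add: linear_functional_zero dist_real_def)
  then show ?thesis unfolding eventually_net_filter[OF assms(3)] by blast
qed

lemma order_continuousD:
  assumes "order_continuous V \<phi>" "linear_functional V \<phi>" "directed I r" "y \<in> I \<rightarrow> vcar V"
    "\<And>i j. i \<in> I \<Longrightarrow> j \<in> I \<Longrightarrow> (i, j) \<in> r \<Longrightarrow> vle V (y j) (y i)"
    "is_inf V (y ` I) (vzero V)" "0 < e"
  shows "\<exists>i\<in>I. \<bar>\<phi> (y i)\<bar> < e"
proof -
  have "(i, i) \<in> r" if "i \<in> I" for i
    using assms(3) that by (auto simp: directed_def preorder_on_def refl_on_def)
  then show ?thesis using order_continuous_eventually[OF assms] by blast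
qed

text \<open>On a net decreasing to 0 the values of \<open>F\<close> are squeezed between 0 and those
  of \<open>G\<close>. This is how pointwise limits of functionals are recognised as order
  continuous.\<close>

lemma order_continuous_dominated:
  assumes G: "positive_functional G" "order_continuous V G" and F: "positive_functional F"
    and le: "\<And>x. x \<in> nonneg \<Longrightarrow> F x \<le> G x"
  shows "order_continuous V F"
proof (rule order_continuousI[OF F])
  fix I :: "('x \<times> 'x) set" and r y and e :: real
  assume *: "directed I r" "y \<in> I \<rightarrow> vcar V"
    "\<And>i j. i \<in> I \<Longrightarrow> j \<in> I \<Longrightarrow> (i, j) \<in> r \<Longrightarrow> vle V (y j) (y i)"
    "is_inf V (y ` I) (vzero V)" "0 < e"
  have "\<exists>i\<in>I. \<bar>G (y i)\<bar> < e"
    by (rule order_continuousD[OF G(2) _ *]) (use G in \<open>simp_all add: positive_functional_def\<close>)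
  then obtain i where i: "i \<in> I" "\<bar>G (y i)\<bar> < e" by blast
  then have "y i \<in> nonneg" using * by (auto simp: is_inf_def)
  then have "F (y i) \<le> G (y i)" by (rule le)
  then show "\<exists>i\<in>I. F (y i) < e" using i by (intro bexI[of _ i]) auto
qed

lemma order_continuous_combine:
  assumes "order_continuous V F" "order_continuous V G"
  shows "order_continuous V (\<lambda>x\<in>vcar V. a * F x + b * G x)"
  unfolding order_continuous_def
proof (intro allI impI)
  fix I :: "('x \<times> 'x) set" and r x x0 assume conv: "order_converges V I r x x0"
  then have dir: "directed I r" and x: "x \<in> I \<rightarrow> vcar V" and x0: "x0 \<in> vcar V"
    by (auto simp: order_converges_def)
  have "((\<lambda>i. a * F (x i) + b * G (x i)) \<longlongrightarrow> a * F x0 + b * G x0) (net_filter I r)"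
    using assms conv by (intro tendsto_intros) (auto simp: order_continuous_def)
  moreover have "\<forall>\<^sub>F i in net_filter I r. a * F (x i) + b * G (x i) =
      (\<lambda>x\<in>vcar V. a * F x + b * G x) (x i)"
    using dir x by (auto simp: eventually_net_filter directed_def)
  ultimately show "((\<lambda>i. (\<lambda>x\<in>vcar V. a * F x + b * G x) (x i)) \<longlongrightarrow>
      (\<lambda>x\<in>vcar V. a * F x + b * G x) x0) (net_filter I r)"
    using Lim_transform_eventually x0 by simp
qed

lemma order_bounded_combine:
  assumes "order_bounded V F" "order_bounded V G"
  shows "order_bounded V (\<lambda>x\<in>vcar V. a * F x + b * G x)"
  unfolding order_bounded_def
proof (intro ballI)
  fix u v assume "u \<in> vcar V" "v \<in> vcar V"
  then obtain B C where BC: "\<And>x. x \<in> vcar V \<Longrightarrow> vle V u x \<Longrightarrow> vle V x v \<Longrightarrow> \<bar>F x\<bar> \<le> B"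
    "\<And>x. x \<in> vcar V \<Longrightarrow> vle V u x \<Longrightarrow> vle V x v \<Longrightarrow> \<bar>G x\<bar> \<le> C"
    using assms unfolding order_bounded_def bounded_iff by (simp add: Ball_def image_iff) metis
  show "bounded ((\<lambda>x\<in>vcar V. a * F x + b * G x) ` {x \<in> vcar V. vle V u x \<and> vle V x v})"
    unfolding bounded_iff
  proof (intro exI[of _ "\<bar>a\<bar> * B + \<bar>b\<bar> * C"] ballI)
    fix z assume "z \<in> (\<lambda>x\<in>vcar V. a * F x + b * G x) ` {x \<in> vcar V. vle V u x \<and> vle V x v}"
    then obtain x where x: "x \<in> vcar V" "vle V u x" "vle V x v" "z = a * F x + b * G x" by auto
    have "\<bar>a * F x\<bar> \<le> \<bar>a\<bar> * B" "\<bar>b * G x\<bar> \<le> \<bar>b\<bar> * C"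
      using BC x by (auto simp: abs_mult intro!: mult_left_mono)
    then show "norm z \<le> \<bar>a\<bar> * B + \<bar>b\<bar> * C" using x by simp
  qed
qed

lemma order_continuous_dual_car:
  "\<phi> \<in> vcar (order_continuous_dual V) \<longleftrightarrow>
     linear_functional V \<phi> \<and> order_bounded V \<phi> \<and> order_continuous V \<phi>"
  by (simp add: order_continuous_dual_def)

lemma order_continuous_dual_vadd: "vadd (order_continuous_dual V) \<phi> \<psi> = (\<lambda>x\<in>vcar V. \<phi> x + \<psi> x)"
  and order_continuous_dual_vscale: "vscale (order_continuous_dual V) a \<phi> = (\<lambda>x\<in>vcar V. a * \<phi> x)"
  and order_continuous_dual_vzero: "vzero (order_continuous_dual V) = (\<lambda>x\<in>vcar V. 0)"
  and order_continuous_dual_vle: "vle (order_continuous_dual V) \<phi> \<psi> \<longleftrightarrow> (\<forall>x\<in>nonneg. \<phi> x \<le> \<psi> x)"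
  by (auto simp: order_continuous_dual_def)

lemma order_continuous_dual_combine:
  "\<phi> \<in> vcar (order_continuous_dual V) \<Longrightarrow> \<psi> \<in> vcar (order_continuous_dual V) \<Longrightarrow>
    (\<lambda>x\<in>vcar V. a * \<phi> x + b * \<psi> x) \<in> vcar (order_continuous_dual V)"
  by (simp add: order_continuous_dual_car linear_functional_combine order_bounded_combine
      order_continuous_combine)

lemma order_continuous_dual_dominated:
  assumes "positive_functional G" "G \<in> vcar (order_continuous_dual V)" "positive_functional F"
    and "\<And>x. x \<in> nonneg \<Longrightarrow> F x \<le> G x"
  shows "F \<in> vcar (order_continuous_dual V)"
  using assms positive_functional_order_bounded[of F] order_continuous_dominated[of G F]
  by (auto simp: order_continuous_dual_car positive_functional_def)

text \<open>Positive parts are left open at this level of generality. For \<open>Linf\<close> a Hahn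
  decomposition supplies them in \<open>W_pos_part\<close>, in place of the Riesz-Kantorovich
  formula.\<close>

lemma ordered_vector_space_order_continuous_dual:
  "ordered_vector_space (order_continuous_dual V)" (is "ordered_vector_space ?W")
proof -
  have ext: "\<phi> = \<psi>" if "\<phi> \<in> vcar ?W" "\<psi> \<in> vcar ?W" "\<And>x. x \<in> vcar V \<Longrightarrow> \<phi> x = \<psi> x" for \<phi> \<psi>
    using that by (intro linear_functional_ext) (simp_all add: order_continuous_dual_car)
  have pos0: "positive_functional (\<lambda>x\<in>vcar V. 0)"
    by (auto simp: positive_functional_def linear_functional_def add_closed scale_closed)
  have add: "vadd ?W \<phi> \<psi> \<in> vcar ?W" if "\<phi> \<in> vcar ?W" "\<psi> \<in> vcar ?W" for \<phi> \<psi>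
    using order_continuous_dual_combine[OF that, of 1 1] by (simp add: order_continuous_dual_def)
  have scale: "vscale ?W a \<phi> \<in> vcar ?W" if "\<phi> \<in> vcar ?W" for \<phi> a
    using order_continuous_dual_combine[OF that that, of a 0]
    by (simp add: order_continuous_dual_def)
  have "order_continuous V (\<lambda>x\<in>vcar V. 0)"
    by (rule order_continuousI[OF pos0]) (auto simp: directed_def)
  then have zero: "vzero ?W \<in> vcar ?W"
    using pos0 positive_functional_order_bounded[OF pos0]
    by (simp add: order_continuous_dual_def positive_functional_def)
  note ops = order_continuous_dual_vadd order_continuous_dual_vscale order_continuous_dual_vzero
    order_continuous_dual_vle
  show ?thesis
  proof
    fix x y assume xy: "x \<in> vcar ?W" "y \<in> vcar ?W" and le: "vle ?W x y" "vle ?W y x"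
    show "x = y"
    proof (rule linear_functional_eq_if_eq_on_nonneg)
      fix z assume "z \<in> nonneg"
      then show "x z = y z" using le by (auto simp: ops intro!: antisym)
    qed (use xy in \<open>auto simp: order_continuous_dual_car\<close>)
  next
    fix x y z assume "x \<in> vcar ?W" "y \<in> vcar ?W" "z \<in> vcar ?W" "vle ?W x y" "vle ?W y z"
    then show "vle ?W x z" by (force simp: ops)
  next
    fix x y z assume "x \<in> vcar ?W" "y \<in> vcar ?W" "z \<in> vcar ?W" "vle ?W x y"
    then show "vle ?W (vadd ?W x z) (vadd ?W y z)" by (simp add: ops)
  next
    fix x y and a :: real assume "x \<in> vcar ?W" "y \<in> vcar ?W" "0 \<le> a" "vle ?W x y"
    then show "vle ?W (vscale ?W a x) (vscale ?W a y)"
      by (simp add: ops mult_left_mono)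
  next
    fix x y assume xy: "x \<in> vcar ?W" "y \<in> vcar ?W"
    show "vadd ?W x y \<in> vcar ?W" using xy by (rule add)
    show "vscale ?W a x \<in> vcar ?W" for a using xy by (intro scale)
    show "vadd ?W x y = vadd ?W y x"
      by (rule ext[OF add[OF xy] add[OF xy(2,1)]]) (simp add: ops)
    show "vadd ?W x (vzero ?W) = x"
      by (rule ext[OF add[OF xy(1) zero] xy(1)]) (simp add: ops)
    show "vadd ?W x (vscale ?W (- 1) x) = vzero ?W"
      by (rule ext[OF add[OF xy(1) scale[OF xy(1)]] zero]) (simp add: ops)
    show "vscale ?W a (vadd ?W x y) = vadd ?W (vscale ?W a x) (vscale ?W a y)" for a
      by (rule ext[OF scale[OF add[OF xy]] add[OF xy[THEN scale]]]) (simp add: ops algebra_simps)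
    show "vscale ?W (a + b) x = vadd ?W (vscale ?W a x) (vscale ?W b x)" for a b
      by (rule ext[OF scale[OF xy(1)] add[OF scale[OF xy(1)] scale[OF xy(1)]]])
        (simp add: ops algebra_simps)
    show "vscale ?W a (vscale ?W b x) = vscale ?W (a * b) x" for a b
      by (rule ext[OF scale[OF scale[OF xy(1)]] scale[OF xy(1)]]) (simp add: ops algebra_simps)
    show "vscale ?W 1 x = x"
      by (rule ext[OF scale[OF xy(1)] xy(1)]) (simp add: ops)
    show "vle ?W x x" by (simp add: ops)
  next
    fix x y z assume xyz: "x \<in> vcar ?W" "y \<in> vcar ?W" "z \<in> vcar ?W"
    show "vadd ?W (vadd ?W x y) z = vadd ?W x (vadd ?W y z)"
      by (rule ext[OF add[OF add[OF xyz(1,2)] xyz(3)] add[OF xyz(1) add[OF xyz(2,3)]]])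
        (simp add: ops)
  qed (rule zero)
qed

end

section \<open>Directed suprema and pointwise limits of functionals\<close>

context vector_lattice
begin

text \<open>On positive elements the values form a bounded monotone net. Every element is a
  difference of two positive ones, so the values converge everywhere, and linearity passes to the
  limit.\<close>

lemma monotone_functional_limit:
  fixes G :: "'i \<Rightarrow> 'x \<Rightarrow> real"
  assumes dir: "directed I r" and lin: "\<And>i. i \<in> I \<Longrightarrow> linear_functional V (G i)"
    and mono: "\<And>i j x. i \<in> I \<Longrightarrow> j \<in> I \<Longrightarrow> (i, j) \<in> r \<Longrightarrow> x \<in> nonneg \<Longrightarrow> G i x \<le> G j x"
    and bdd: "\<And>x. x \<in> nonneg \<Longrightarrow> \<exists>B. \<forall>i\<in>I. G i x \<le> B"
  obtains F where "linear_functional V F"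
    "\<And>x. x \<in> vcar V \<Longrightarrow> ((\<lambda>i. G i x) \<longlongrightarrow> F x) (net_filter I r)"
proof -
  let ?N = "net_filter I r"
  have nb: "?N \<noteq> bot" using dir by (rule net_filter_not_bot)
  have ev: "\<forall>\<^sub>F i in ?N. i \<in> I"
    using dir by (auto simp: eventually_net_filter directed_def)
  have conv_nonneg: "\<exists>l. ((\<lambda>i. G i x) \<longlongrightarrow> l) ?N" if x: "x \<in> nonneg" for x
  proof -
    obtain B where "\<forall>i\<in>I. G i x \<le> B" using bdd[OF x] by blast
    then show ?thesis
      using monotone_net_tendsto[OF dir, of "\<lambda>i. G i x" B] mono x by blast
  qed
  have conv: "\<exists>l. ((\<lambda>i. G i x) \<longlongrightarrow> l) ?N" if "x \<in> vcar V" for x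
  proof -
    obtain u v where uv: "u \<in> nonneg" "v \<in> nonneg" "x = vdiff V u v"
      using nonneg_decompose \<open>x \<in> vcar V\<close> by blast
    obtain k l where "((\<lambda>i. G i u) \<longlongrightarrow> k) ?N" "((\<lambda>i. G i v) \<longlongrightarrow> l) ?N"
      using conv_nonneg uv by blast
    then have "((\<lambda>i. G i u - G i v) \<longlongrightarrow> k - l) ?N" by (rule tendsto_diff)
    moreover have "\<forall>\<^sub>F i in ?N. G i u - G i v = G i x"
      using ev by eventually_elim (use lin uv in \<open>simp add: linear_functional_diff\<close>)
    ultimately have "((\<lambda>i. G i x) \<longlongrightarrow> k - l) ?N" by (rule Lim_transform_eventually)
    then show ?thesis by blast
  qed
  define F where "F = (\<lambda>x\<in>vcar V. Lim ?N (\<lambda>i. G i x))"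
  have F: "((\<lambda>i. G i x) \<longlongrightarrow> F x) ?N" if "x \<in> vcar V" for x
    using conv[OF that] tendsto_Lim[OF nb] that by (force simp: F_def)
  have "linear_functional V F"
    unfolding linear_functional_def
  proof (intro conjI ballI allI)
    show "F \<in> extensional (vcar V)" by (simp add: F_def)
    fix x y assume xy: "x \<in> vcar V" "y \<in> vcar V"
    have "((\<lambda>i. G i x + G i y) \<longlongrightarrow> F x + F y) ?N" using F xy by (intro tendsto_add)
    moreover have "\<forall>\<^sub>F i in ?N. G i x + G i y = G i (vadd V x y)"
      using ev by eventually_elim (use lin xy in \<open>simp add: linear_functional_add\<close>)
    ultimately have "((\<lambda>i. G i (vadd V x y)) \<longlongrightarrow> F x + F y) ?N"
      by (rule Lim_transform_eventually)
    then show "F (vadd V x y) = F x + F y"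
      using F[OF add_closed[OF xy]] tendsto_unique[OF nb] by blast
  next
    fix a x assume x: "x \<in> vcar V"
    have "((\<lambda>i. a * G i x) \<longlongrightarrow> a * F x) ?N" using F x by (intro tendsto_mult tendsto_const)
    moreover have "\<forall>\<^sub>F i in ?N. a * G i x = G i (vscale V a x)"
      using ev by eventually_elim (use lin x in \<open>simp add: linear_functional_scale\<close>)
    ultimately have "((\<lambda>i. G i (vscale V a x)) \<longlongrightarrow> a * F x) ?N"
      by (rule Lim_transform_eventually)
    then show "F (vscale V a x) = a * F x"
      using F[OF scale_closed[OF x]] tendsto_unique[OF nb] by blast
  qed
  then show ?thesis using F that by blast
qed

text \<open>Turns increase to \<open>s\<close> into decrease to 0, the form in which order
  continuity is tested. If \<open>u\<close> lies below every \<open>s - d\<close>, then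
  \<open>s - u\<close> is an upper bound of \<open>D\<close>, so \<open>s \<le> s - u\<close> and
  hence \<open>u \<le> 0\<close>.\<close>

lemma up_directed_diff:
  assumes D: "up_directed V D" and s: "is_sup V D s"
  shows "vdiff V s \<in> D \<rightarrow> vcar V"
    and "(x, y) \<in> up_rel V D \<Longrightarrow> vle V (vdiff V s y) (vdiff V s x)"
    and "is_inf V (vdiff V s ` D) (vzero V)"
proof -
  have Dc: "D \<subseteq> vcar V" using D by (simp add: up_directed_def)
  have sc: "s \<in> vcar V" using s by (rule is_sup_closed)
  show "vdiff V s \<in> D \<rightarrow> vcar V" using Dc sc by (auto intro: diff_closed)
  show "vle V (vdiff V s y) (vdiff V s x)" if "(x, y) \<in> up_rel V D" for x y
  proof -
    have xy: "x \<in> vcar V" "y \<in> vcar V" "vle V x y" using that Dc by (auto simp: up_rel_def)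
    show ?thesis
      unfolding vdiff_def using xy sc
      by (intro add_mono2 le_minus le_refl scale_closed)
  qed
  show "is_inf V (vdiff V s ` D) (vzero V)"
    unfolding is_inf_def
  proof (intro conjI ballI impI)
    show "vzero V \<in> vcar V" by (rule zero_closed)
    show "vle V (vzero V) a" if a: "a \<in> vdiff V s ` D" for a
    proof -
      obtain d where d: "d \<in> D" "a = vdiff V s d" using a by blast
      have "vle V d s" using is_sup_ge[OF s d(1)] .
      then show ?thesis using d Dc sc le_iff_diff_nonneg by blast
    qed
    fix u assume u: "u \<in> vcar V" "\<forall>a\<in>vdiff V s ` D. vle V u a"
    have "vle V s (vdiff V s u)"
    proof (rule is_sup_least[OF s diff_closed[OF sc u(1)]])
      fix d assume "d \<in> D"
      then have d: "d \<in> vcar V" "vle V u (vdiff V s d)" using u Dc by auto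
      then have "vle V (vadd V u d) (vadd V (vdiff V s d) d)"
        using u sc by (intro add_mono diff_closed)
      then have "vle V (vadd V u d) s" using d sc by (simp add: diff_add_cancel)
      then have "vle V (vadd V (vadd V u d) (vscale V (- 1) u)) (vadd V s (vscale V (- 1) u))"
        using u d sc by (intro add_mono add_closed scale_closed)
      then show "vle V d (vdiff V s u)"
        using u d add_diff_cancel[of d u] by (simp add: vdiff_def add_commute)
    qed
    then have "vle V (vadd V s (vscale V (- 1) (vdiff V s u)))
        (vadd V (vdiff V s u) (vscale V (- 1) (vdiff V s u)))"
      using sc u by (intro add_mono diff_closed scale_closed)
    moreover have "vadd V s (vscale V (- 1) (vdiff V s u)) = u"
      using sc u by (simp add: minus_diff) (metis add_commute diff_add_cancel diff_closed)
    ultimately show "vle V u (vzero V)" using sc u by (simp add: add_inverse diff_closed)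
  qed
qed

lemma order_continuous_up_directed:
  assumes "order_continuous V \<phi>" "linear_functional V \<phi>" and D: "up_directed V D"
    and s: "is_sup V D s" and "0 < e"
  shows "\<exists>d\<in>D. \<forall>d'\<in>D. vle V d d' \<longrightarrow> \<bar>\<phi> s - \<phi> d'\<bar> < e"
proof -
  have "\<exists>d\<in>D. \<forall>d'\<in>D. (d, d') \<in> up_rel V D \<longrightarrow> \<bar>\<phi> (vdiff V s d')\<bar> < e"
    using up_directed_diff[OF D s] assms(1,2,5)
    by (intro order_continuous_eventually[OF _ _ directed_up_rel[OF D]]) auto
  moreover have "\<phi> (vdiff V s d) = \<phi> s - \<phi> d" if "d \<in> D" for d
    using assms(2) is_sup_closed[OF s] D that
    by (intro linear_functional_diff) (auto simp: up_directed_def)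
  ultimately show ?thesis by (auto simp: up_rel_def)
qed

lemma finite_sup_exists:
  assumes "finite F" "F \<noteq> {}" "F \<subseteq> vcar V"
  shows "\<exists>s. is_sup V F s"
  using assms
proof (induction F rule: finite_ne_induct)
  case (singleton x)
  then show ?case by (auto simp: is_sup_def intro!: exI[of _ x] le_refl)
next
  case (insert x F)
  then obtain s where s: "is_sup V F s" by auto
  have x: "x \<in> vcar V" using insert by simp
  obtain t where t: "is_sup V {x, s} t" using sup_exists[OF x is_sup_closed[OF s]] by blast
  have "is_sup V (insert x F) t"
    unfolding is_sup_def
  proof (intro conjI ballI impI)
    show "t \<in> vcar V" using t by (rule is_sup_closed)
    show "vle V a t" if "a \<in> insert x F" for a
    proof (cases "a = x")
      case False
      then have a: "a \<in> F" using that by simp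
      show ?thesis
        by (rule le_trans[OF _ _ _ is_sup_ge[OF s a] is_sup_ge[OF t]])
          (use a insert.prems s t in \<open>auto intro: is_sup_closed\<close>)
    qed (use is_sup_ge[OF t] in simp)
    fix u assume u: "u \<in> vcar V" "\<forall>a\<in>insert x F. vle V a u"
    have "vle V s u" by (rule is_sup_least[OF s u(1)]) (use u in simp)
    then show "vle V t u" by (rule_tac is_sup_least[OF t u(1)]) (use u(2) in blast)
  qed
  then show ?case by blast
qed

text \<open>The suprema of finite subsets of a set form an upward directed set with the same upper
  bounds, so only directed sets need suprema.\<close>

lemma dedekind_completeI:
  assumes sup: "\<And>D u. up_directed V D \<Longrightarrow> u \<in> vcar V \<Longrightarrow> (\<And>d. d \<in> D \<Longrightarrow> vle V d u) \<Longrightarrow>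
    \<exists>s. is_sup V D s"
  shows "dedekind_complete V"
  unfolding dedekind_complete_def
proof (intro allI impI)
  fix A assume A: "A \<subseteq> vcar V" "A \<noteq> {}" and "\<exists>u\<in>vcar V. \<forall>a\<in>A. vle V a u"
  then obtain u where u: "u \<in> vcar V" "\<And>a. a \<in> A \<Longrightarrow> vle V a u" by blast
  define D where "D = {s. \<exists>F. F \<subseteq> A \<and> finite F \<and> F \<noteq> {} \<and> is_sup V F s}"
  have AD: "a \<in> D" if "a \<in> A" for a
  proof -
    have "is_sup V {a} a" using that A by (auto simp: is_sup_def intro: le_refl)
    then show ?thesis unfolding D_def using that by (intro CollectI exI[of _ "{a}"]) simp
  qed
  have Dc: "D \<subseteq> vcar V" by (auto simp: D_def is_sup_def)
  have "\<exists>z\<in>D. vle V x z \<and> vle V y z" if xy: "x \<in> D" "y \<in> D" for x y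
  proof -
    obtain F G where F: "F \<subseteq> A" "finite F" "F \<noteq> {}" "is_sup V F x"
      and G: "G \<subseteq> A" "finite G" "G \<noteq> {}" "is_sup V G y"
      using xy unfolding D_def by blast
    have "F \<union> G \<subseteq> vcar V" "finite (F \<union> G)" "F \<union> G \<noteq> {}" using F G A by auto
    then obtain z where z: "is_sup V (F \<union> G) z" using finite_sup_exists by blast
    have "z \<in> D" unfolding D_def using z F G by (intro CollectI exI[of _ "F \<union> G"]) auto
    moreover have "vle V x z"
      by (rule is_sup_least[OF F(4) is_sup_closed[OF z] is_sup_ge[OF z]]) simp
    moreover have "vle V y z"
      by (rule is_sup_least[OF G(4) is_sup_closed[OF z] is_sup_ge[OF z]]) simp
    ultimately show ?thesis by blast
  qed
  then have "up_directed V D" using A AD Dc unfolding up_directed_def by blast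
  moreover have "vle V d u" if d: "d \<in> D" for d
  proof -
    obtain F where F: "F \<subseteq> A" "is_sup V F d" using d unfolding D_def by blast
    show ?thesis by (rule is_sup_least[OF F(2) u(1)]) (use u(2) F(1) in blast)
  qed
  ultimately obtain s where s: "is_sup V D s" using sup u by blast
  have "is_sup V A s"
    unfolding is_sup_def
  proof (intro conjI ballI impI)
    show "s \<in> vcar V" using s by (rule is_sup_closed)
    show "vle V a s" if "a \<in> A" for a by (rule is_sup_ge[OF s AD[OF that]])
    fix v assume v: "v \<in> vcar V" "\<forall>a\<in>A. vle V a v"
    show "vle V s v"
    proof (rule is_sup_least[OF s v(1)])
      fix d assume "d \<in> D"
      then obtain F where F: "F \<subseteq> A" "is_sup V F d" unfolding D_def by blast
      show "vle V d v" by (rule is_sup_least[OF F(2) v(1)]) (use v(2) F(1) in blast)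
    qed
  qed
  then show "\<exists>s. is_sup V A s" by blast
qed

text \<open>Common core of two implications: \<open>Y\<close> is represented by functionals on
  \<open>V\<close>, once with \<open>V\<close> a predual and once with \<open>V\<close> the order
  continuous dual. A bounded directed set has a pointwise limit \<open>F\<close>, which lies above
  its members and below all its upper bounds. As soon as \<open>F\<close> is itself represented,
  which is the premise \<open>lim\<close>, its representative is the supremum.\<close>

lemma functional_representation_sup:
  fixes Y :: "('y, 'n) vlat_scheme"
  assumes Y: "ordered_vector_space Y"
    and lin: "\<And>X. X \<in> vcar Y \<Longrightarrow> linear_functional V (T X)"
    and le: "\<And>X Z. X \<in> vcar Y \<Longrightarrow> Z \<in> vcar Y \<Longrightarrow> vle Y X Z \<longleftrightarrow> (\<forall>x\<in>nonneg. T X x \<le> T Z x)"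
    and D: "up_directed Y D" and U: "U \<in> vcar Y" "\<And>d. d \<in> D \<Longrightarrow> vle Y d U"
    and lim: "\<And>F. linear_functional V F \<Longrightarrow>
      (\<And>x. x \<in> vcar V \<Longrightarrow> ((\<lambda>d. T d x) \<longlongrightarrow> F x) (net_filter D (up_rel Y D))) \<Longrightarrow>
      (\<And>d x. d \<in> D \<Longrightarrow> x \<in> nonneg \<Longrightarrow> T d x \<le> F x) \<Longrightarrow>
      (\<And>u x. u \<in> vcar Y \<Longrightarrow> (\<And>d. d \<in> D \<Longrightarrow> vle Y d u) \<Longrightarrow> x \<in> nonneg \<Longrightarrow> F x \<le> T u x) \<Longrightarrow>
      \<exists>s\<in>vcar Y. T s = F"
  obtains s where "is_sup Y D s"
    "\<And>x. x \<in> vcar V \<Longrightarrow> ((\<lambda>d. T d x) \<longlongrightarrow> T s x) (net_filter D (up_rel Y D))"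
proof -
  interpret Y: ordered_vector_space Y by fact
  let ?r = "up_rel Y D"
  have dir: "directed D ?r" using D by (rule Y.directed_up_rel)
  have Dc: "D \<subseteq> vcar Y" using D by (simp add: up_directed_def)
  have mono: "T d x \<le> T e x" if "(d, e) \<in> ?r" "x \<in> nonneg" for d e x
    using that le[of d e] Dc by (auto simp: up_rel_def)
  have bdd: "T d x \<le> T u x" if "d \<in> D" "x \<in> nonneg" "u \<in> vcar Y" "vle Y d u" for d u x
    using that le[of d u] Dc by auto
  have "\<exists>B. \<forall>i\<in>D. T i x \<le> B" if "x \<in> nonneg" for x
    using bdd[OF _ that U(1) U(2)] by (intro exI[of _ "T U x"]) blast
  then obtain F where F: "linear_functional V F"
      "\<And>x. x \<in> vcar V \<Longrightarrow> ((\<lambda>d. T d x) \<longlongrightarrow> F x) (net_filter D ?r)"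
    using monotone_functional_limit[OF dir, of T] lin Dc mono by blast
  have ge: "T d x \<le> F x" if "d \<in> D" "x \<in> nonneg" for d x
    using net_tendsto_mono_le[OF dir _ F(2), of x d] mono that by auto
  have least: "F x \<le> T u x"
    if u: "u \<in> vcar Y" "\<And>d. d \<in> D \<Longrightarrow> vle Y d u" and x: "x \<in> nonneg" for u x
  proof (rule tendsto_upperbound[OF F(2) _ net_filter_not_bot[OF dir]])
    show "\<forall>\<^sub>F d in net_filter D ?r. T d x \<le> T u x"
      using bdd[OF _ x u(1) u(2)] dir by (auto simp: eventually_net_filter directed_def)
  qed (use x in simp)
  obtain s where s: "s \<in> vcar Y" "T s = F" using lim[OF F ge least] by blast
  have "is_sup Y D s"
    unfolding is_sup_def
  proof (intro conjI ballI impI)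
    show "vle Y d s" if "d \<in> D" for d using that ge s Dc le[of d s] by auto
    show "vle Y s u" if "u \<in> vcar Y" "\<forall>d\<in>D. vle Y d u" for u
      using least[of u] that s le[of s u] by auto
  qed (rule s)
  then show ?thesis using that F s by auto
qed

text \<open>The point is order continuity of evaluation at a positive \<open>x\<close>. A net of
  functionals decreasing to 0 has a pointwise limit that is positive and dominated by each member.
  By domination it is order continuous, so it is a lower bound inside the dual and must be 0; in
  particular the values at \<open>x\<close> tend to 0.\<close>

lemma evaluation_in_bidual:
  assumes W: "vector_lattice (order_continuous_dual V)" and x: "x \<in> vcar V"
  shows "(\<lambda>\<phi>\<in>vcar (order_continuous_dual V). \<phi> x)
    \<in> vcar (order_continuous_dual (order_continuous_dual V))"
proof -
  let ?W = "order_continuous_dual V"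
  let ?ev = "\<lambda>x. \<lambda>\<phi>\<in>vcar ?W. \<phi> x"
  interpret W: vector_lattice ?W by fact
  have lin: "linear_functional ?W (?ev x)" if "x \<in> vcar V" for x
    using that W.add_closed W.scale_closed
    by (auto simp: linear_functional_def order_continuous_dual_vadd order_continuous_dual_vscale)
  have nonneg: "?ev x \<in> vcar (order_continuous_dual ?W)" if x: "x \<in> nonneg" for x
  proof -
    have pos: "W.positive_functional (?ev x)"
      unfolding W.positive_functional_def
    proof (intro conjI ballI)
      show "linear_functional ?W (?ev x)" using x lin by simp
      fix \<phi> assume "\<phi> \<in> W.nonneg"
      then show "0 \<le> ?ev x \<phi>"
        using x by (auto simp: order_continuous_dual_vzero order_continuous_dual_vle)
    qed
    have "order_continuous ?W (?ev x)"
    proof (rule W.order_continuousI[OF pos])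
      fix I :: "(('x \<Rightarrow> real) \<times> ('x \<Rightarrow> real)) set" and r y and e :: real
      assume dir: "directed I r" and y: "y \<in> I \<rightarrow> vcar ?W"
        and dec: "\<And>i j. i \<in> I \<Longrightarrow> j \<in> I \<Longrightarrow> (i, j) \<in> r \<Longrightarrow> vle ?W (y j) (y i)"
        and inf: "is_inf ?W (y ` I) (vzero ?W)" and e: "0 < e"
      \<comment> \<open>The negatives increase, as \<open>monotone_functional_limit\<close>
        requires. The vanishing second summand only fits the shape of
        \<open>linear_functional_combine\<close>; \<open>?H\<close> below undoes the sign.\<close>
      let ?G = "\<lambda>i. \<lambda>z\<in>vcar V. (- 1) * y i z + 0 * y i z"
      have ylin: "linear_functional V (y i)" if "i \<in> I" for i
        using y that by (auto simp: order_continuous_dual_car)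
      have ypos: "0 \<le> y i z" if "i \<in> I" "z \<in> nonneg" for i z
        using inf that
        by (auto simp: is_inf_def order_continuous_dual_vzero order_continuous_dual_vle)
      have ydec: "y j z \<le> y i z" if "i \<in> I" "j \<in> I" "(i, j) \<in> r" "z \<in> nonneg" for i j z
        using dec[OF that(1-3)] that(4) by (simp add: order_continuous_dual_vle)
      have "linear_functional V (?G i)" if "i \<in> I" for i
        using ylin[OF that] ylin[OF that] by (rule linear_functional_combine)
      moreover have "?G i z \<le> ?G j z" if "i \<in> I" "j \<in> I" "(i, j) \<in> r" "z \<in> nonneg" for i j z
        using ydec[OF that] that(4) by simp
      moreover have "\<exists>B. \<forall>i\<in>I. ?G i z \<le> B" if "z \<in> nonneg" for z
        using ypos that by (intro exI[of _ 0]) auto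
      ultimately obtain F where F: "linear_functional V F"
        "\<And>z. z \<in> vcar V \<Longrightarrow> ((\<lambda>i. ?G i z) \<longlongrightarrow> F z) (net_filter I r)"
        by (rule monotone_functional_limit[OF dir, of ?G]) blast+
      let ?H = "\<lambda>z\<in>vcar V. (- 1) * F z + 0 * F z"
      have H_le: "?H z \<le> y i z" if "i \<in> I" "z \<in> nonneg" for i z
        using net_tendsto_mono_le[OF dir _ F(2), of z i] ydec that by auto
      have H_ge: "0 \<le> ?H z" if z: "z \<in> nonneg" for z
      proof -
        have "F z \<le> 0"
        proof (rule tendsto_upperbound[OF F(2) _ net_filter_not_bot[OF dir]])
          show "\<forall>\<^sub>F i in net_filter I r. ?G i z \<le> 0"
            using ypos z dir by (auto simp: eventually_net_filter directed_def)
        qed (use z in simp)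
        then show ?thesis using z by simp
      qed
      have Hpos: "positive_functional ?H"
        unfolding positive_functional_def
        using linear_functional_combine[OF F(1) F(1), of "- 1" 0] H_ge by blast
      obtain i where i: "i \<in> I" using dir by (auto simp: directed_def)
      have "positive_functional (y i)"
        using ylin[OF i] ypos[OF i] unfolding positive_functional_def by blast
      \<comment> \<open>A single member of the net suffices as dominating functional.\<close>
      then have HW: "?H \<in> vcar ?W"
        using y i Hpos H_le[OF i] by (intro order_continuous_dual_dominated[of "y i" ?H]) auto
      have "vle ?W ?H (y i)" if "i \<in> I" for i
        using H_le[OF that] by (auto simp: order_continuous_dual_vle)
      then have "vle ?W ?H (vzero ?W)"
        using inf HW unfolding is_inf_def by blast
      then have "?H x \<le> 0"
        using x by (auto simp: order_continuous_dual_vle order_continuous_dual_vzero)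
      then have "0 \<le> F x" using x by simp
      moreover have "\<forall>\<^sub>F i in net_filter I r. F x - e < ?G i x"
        using order_tendstoD(1)[OF F(2), of x "F x - e"] x e by simp
      then obtain i where "i \<in> I" "F x - e < ?G i x"
        using dir by (force simp: eventually_net_filter directed_def preorder_on_def refl_on_def)
      ultimately show "\<exists>i\<in>I. ?ev x (y i) < e"
        using x y by (intro bexI[of _ i]) auto
    qed
    then show ?thesis
      using lin x W.positive_functional_order_bounded[OF pos]
      by (simp add: W.order_continuous_dual_car)
  qed
  obtain u v where uv: "u \<in> nonneg" "v \<in> nonneg" "x = vdiff V u v"
    using nonneg_decompose x by blast
  have "(\<lambda>\<phi>\<in>vcar ?W. 1 * ?ev u \<phi> + (- 1) * ?ev v \<phi>) \<in> vcar (order_continuous_dual ?W)"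
    using nonneg uv by (intro W.order_continuous_dual_combine)
  moreover have "(\<lambda>\<phi>\<in>vcar ?W. 1 * ?ev u \<phi> + (- 1) * ?ev v \<phi>) = ?ev x"
    using uv by (auto simp: order_continuous_dual_car linear_functional_diff intro!: restrict_ext)
  ultimately show ?thesis by simp
qed

end


section \<open>The Hahn-Banach theorem\<close>

context ordered_vector_space
begin

text \<open>Extensionality makes pointwise comparison on the carrier antisymmetric, as the
  application of Zorn's lemma requires.\<close>

definition sublinear :: "('x \<Rightarrow> real) \<Rightarrow> bool" where
  "sublinear q \<longleftrightarrow> q \<in> extensional (vcar V) \<and>
     (\<forall>x\<in>vcar V. \<forall>y\<in>vcar V. q (vadd V x y) \<le> q x + q y) \<and>
     (\<forall>a\<ge>0. \<forall>x\<in>vcar V. q (vscale V a x) = a * q x)"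

lemma sublinear_add: "sublinear q \<Longrightarrow> x \<in> vcar V \<Longrightarrow> y \<in> vcar V \<Longrightarrow> q (vadd V x y) \<le> q x + q y"
  and sublinear_scale: "sublinear q \<Longrightarrow> x \<in> vcar V \<Longrightarrow> 0 \<le> a \<Longrightarrow> q (vscale V a x) = a * q x"
  by (auto simp: sublinear_def)

lemma sublinear_zero: "sublinear q \<Longrightarrow> q (vzero V) = 0"
  using sublinear_scale[of q "vzero V" 0] zero_closed scale_zero_right by simp

lemma sublinear_minus: "sublinear q \<Longrightarrow> x \<in> vcar V \<Longrightarrow> - q (vscale V (- 1) x) \<le> q x"
  using sublinear_add[of q x "vscale V (- 1) x"] sublinear_zero[of q]
  by (simp add: add_inverse scale_closed)

text \<open>Lowering \<open>q\<close> along the ray through \<open>a\<close> makes it additive in the direction of \<open>a\<close>.\<close>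

lemma sublinear_lower:
  assumes q: "sublinear q" and a: "a \<in> vcar V"
  obtains g where "sublinear g" "\<And>x. x \<in> vcar V \<Longrightarrow> g x \<le> q x" "g (vscale V (- 1) a) \<le> - q a"
proof -
  define h where "h t x = q (vadd V x (vscale V t a)) - t * q a" for t x
  define g where "g = (\<lambda>x\<in>vcar V. INF t\<in>{0..}. h t x)"
  \<comment> \<open>The infimum is finite because
    \<open>t * q a = q (t a) \<le> q (x + t a) + q (- x)\<close>.\<close>
  have h_ge: "- q (vscale V (- 1) x) \<le> h t x" if "x \<in> vcar V" "0 \<le> t" for x t
  proof -
    have c: "vscale V t a \<in> vcar V" "vscale V (- 1) x \<in> vcar V" using that a
      by (auto intro: scale_closed)
    have "vadd V (vadd V x (vscale V t a)) (vscale V (- 1) x) = vscale V t a"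
      using that c add_diff_cancel[of "vscale V t a" x] by (simp add: vdiff_def add_commute)
    then have "q (vscale V t a) \<le> q (vadd V x (vscale V t a)) + q (vscale V (- 1) x)"
      using sublinear_add[OF q, of "vadd V x (vscale V t a)" "vscale V (- 1) x"] that c
      by (simp add: add_closed)
    then show ?thesis using q a that by (simp add: h_def sublinear_scale)
  qed
  have bdd: "bdd_below ((\<lambda>t. h t x) ` {0..})" if "x \<in> vcar V" for x
    using h_ge that by (intro bdd_belowI2) auto
  have g_le: "g x \<le> h t x" if "x \<in> vcar V" "0 \<le> t" for x t
    using that cINF_lower[OF bdd, of x t] by (simp add: g_def)
  have g_ge: "c \<le> g x" if "x \<in> vcar V" "\<And>t. 0 \<le> t \<Longrightarrow> c \<le> h t x" for x c
    using that by (simp add: g_def) (intro cINF_greatest, auto)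
  have scale: "g (vscale V c x) \<le> c * g x" if c: "0 < c" and x: "x \<in> vcar V" for c x
  proof -
    have "g (vscale V c x) / c \<le> h t x" if t: "0 \<le> t" for t
    proof -
      \<comment> \<open>Scaling \<open>x\<close> by \<open>c\<close> amounts to running along the
        ray \<open>c\<close> times as fast. This gives one inequality for every
        \<open>c > 0\<close>; the other one follows by applying it to \<open>1 / c\<close>.\<close>
      have "h (c * t) (vscale V c x) = c * h t x"
        using q x a c t
        by (simp add: h_def scale_add_right[symmetric] scale_scale[symmetric] scale_closed
            sublinear_scale add_closed algebra_simps)
      moreover have "g (vscale V c x) \<le> h (c * t) (vscale V c x)"
        using x c t by (intro g_le scale_closed) simp_all
      ultimately show ?thesis using c by (simp add: field_simps)
    qed
    then have "g (vscale V c x) / c \<le> g x" by (rule g_ge[OF x])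
    then show ?thesis using c by (simp add: field_simps)
  qed
  have g0: "g (vzero V) = 0"
  proof (rule antisym)
    show "g (vzero V) \<le> 0"
      using g_le[OF zero_closed, of 0] q a
      by (simp add: h_def scale_zero_left add_zero zero_closed sublinear_zero)
    show "0 \<le> g (vzero V)"
      using h_ge[OF zero_closed] q
        by (intro g_ge zero_closed) (simp add: scale_zero_right sublinear_zero)
  qed
  have "sublinear g"
    unfolding sublinear_def
  proof (intro conjI ballI allI impI)
    show "g \<in> extensional (vcar V)" by (simp add: g_def)
    fix x y assume xy: "x \<in> vcar V" "y \<in> vcar V"
    have *: "g (vadd V x y) - h t y \<le> h s x" if st: "0 \<le> s" "0 \<le> t" for s t
    proof -
      have c: "vscale V s a \<in> vcar V" "vscale V t a \<in> vcar V" using a by (auto intro: scale_closed)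
      have "vadd V (vadd V x y) (vscale V (s + t) a) =
          vadd V (vadd V x (vscale V s a)) (vadd V y (vscale V t a))"
        using xy c a by (simp add: scale_add_left) (metis add_assoc add_closed add_commute)
      then have "h (s + t) (vadd V x y) \<le> h s x + h t y"
        using sublinear_add[OF q, of "vadd V x (vscale V s a)" "vadd V y (vscale V t a)"] xy c
        by (simp add: h_def add_closed algebra_simps)
      moreover have "g (vadd V x y) \<le> h (s + t) (vadd V x y)"
        using xy st by (intro g_le add_closed) simp_all
      ultimately show ?thesis by simp
    qed
    have "g (vadd V x y) - g x \<le> h t y" if "0 \<le> t" for t
      using g_ge[OF xy(1), of "g (vadd V x y) - h t y"] *[OF _ that] by force
    then have "g (vadd V x y) - g x \<le> g y" by (rule g_ge[OF xy(2)])
    then show "g (vadd V x y) \<le> g x + g y" by simp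
  next
    fix c :: real and x assume c: "0 \<le> c" and x: "x \<in> vcar V"
    show "g (vscale V c x) = c * g x"
    proof (cases "c = 0")
      case True
      then show ?thesis using x g0 by (simp add: scale_zero_left)
    next
      case False
      then have "0 < c" using c by simp
      moreover have "g (vscale V (1 / c) (vscale V c x)) \<le> 1 / c * g (vscale V c x)"
        using x \<open>0 < c\<close> by (intro scale scale_closed) simp_all
      ultimately have "c * g x \<le> g (vscale V c x)"
        using x by (simp add: scale_scale scale_one field_simps)
      then show ?thesis using scale[OF \<open>0 < c\<close> x] by simp
    qed
  qed
  moreover have "g x \<le> q x" if "x \<in> vcar V" for x
    using g_le[OF that, of 0] that a by (simp add: h_def scale_zero_left add_zero)
  moreover have "g (vscale V (- 1) a) \<le> - q a"
    using g_le[of "vscale V (- 1) a" 1] a q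
    by (simp add: h_def scale_closed scale_one add_commute[of "vscale V (- 1) a"] add_inverse
        sublinear_zero)
  ultimately show ?thesis using that by blast
qed

text \<open>Zorn's lemma: a chain of sublinear functionals below \<open>q\<close> has a pointwise
  infimum, finite because every member is at least \<open>- q (- x)\<close> at
  \<open>x\<close>.\<close>

lemma minimal_sublinear_exists:
  assumes q: "sublinear q"
  obtains m where "sublinear m" "\<And>x. x \<in> vcar V \<Longrightarrow> m x \<le> q x"
    "\<And>g. sublinear g \<Longrightarrow> (\<And>x. x \<in> vcar V \<Longrightarrow> g x \<le> m x) \<Longrightarrow> g = m"
proof -
  define A where "A = {g. sublinear g \<and> (\<forall>x\<in>vcar V. g x \<le> q x)}"
  \<comment> \<open>The order is reversed, so that a maximal element in the sense of Zorn is a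
    minimal functional.\<close>
  define P where "P g h \<longleftrightarrow> (\<forall>x\<in>vcar V. h x \<le> (g x :: real))" for g h :: "'x \<Rightarrow> real"
  have antisym: "g = h" if "g \<in> A" "h \<in> A" "P g h" "P h g" for g h
  proof (rule extensionalityI)
    show "g \<in> extensional (vcar V)" "h \<in> extensional (vcar V)"
      using that by (auto simp: A_def sublinear_def)
    show "g x = h x" if "x \<in> vcar V" for x
      using \<open>P g h\<close> \<open>P h g\<close> that by (auto simp: P_def intro!: antisym)
  qed
  have po: "partial_order_on A (relation_of P A)"
  proof (rule partial_order_on_relation_ofI)
    show "P a a" for a by (simp add: P_def)
    show "P a c" if "P a b" "P b c" for a b c
      using that by (auto simp: P_def intro: order_trans)
    show "a = b" if "a \<in> A" "b \<in> A" "P a b" "P b a" for a b using that by (rule antisym)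
  qed
  have "\<exists>m\<in>A. \<forall>g\<in>A. P m g \<longrightarrow> g = m"
  proof (rule predicate_Zorn[OF po])
    fix C assume C: "C \<in> Chains (relation_of P A)"
    then have CA: "C \<subseteq> A" by (auto simp: Chains_def relation_of_def)
    have chain: "P g h \<or> P h g" if "g \<in> C" "h \<in> C" for g h
      using C that by (auto simp: Chains_def relation_of_def)
    show "\<exists>u\<in>A. \<forall>g\<in>C. P g u"
    proof (cases "C = {}")
      case True
      then show ?thesis using q by (auto simp: A_def)
    next
      case False
      define u where "u = (\<lambda>x\<in>vcar V. INF g\<in>C. g x)"
      have C_ge: "- q (vscale V (- 1) x) \<le> g x" if "g \<in> C" "x \<in> vcar V" for g x
      proof -
        have "- g (vscale V (- 1) x) \<le> g x" "g (vscale V (- 1) x) \<le> q (vscale V (- 1) x)"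
          using that CA sublinear_minus scale_closed by (auto simp: A_def)
        then show ?thesis by simp
      qed
      have u_le: "u x \<le> g x" if "g \<in> C" "x \<in> vcar V" for g x
        using that C_ge by (auto simp: u_def intro!: cINF_lower bdd_belowI2)
      have u_ge: "c \<le> u x" if "x \<in> vcar V" "\<And>g. g \<in> C \<Longrightarrow> c \<le> g x" for c x
        using that False by (auto simp: u_def intro!: cINF_greatest)
      have "sublinear u"
        unfolding sublinear_def
      proof (intro conjI ballI allI impI)
        show "u \<in> extensional (vcar V)" by (simp add: u_def)
        fix x y assume xy: "x \<in> vcar V" "y \<in> vcar V"
        \<comment> \<open>Subadditivity of the infimum needs one functional that is small at both
          \<open>x\<close> and \<open>y\<close>; of two members of a chain the smaller one
          is.\<close>
        have *: "u (vadd V x y) - h y \<le> g x" if gh: "g \<in> C" "h \<in> C" for g h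
        proof -
          obtain k where k: "k \<in> C" "k x \<le> g x" "k y \<le> h y"
            using chain[OF gh] gh xy by (auto simp: P_def)
          have "u (vadd V x y) \<le> k (vadd V x y)" using k xy by (intro u_le add_closed)
          also have "\<dots> \<le> k x + k y" using k xy CA by (intro sublinear_add) (auto simp: A_def)
          finally show ?thesis using k by simp
        qed
        have "u (vadd V x y) - u x \<le> h y" if "h \<in> C" for h
          using u_ge[OF xy(1), of "u (vadd V x y) - h y"] *[OF _ that] by force
        then have "u (vadd V x y) - u x \<le> u y" by (rule u_ge[OF xy(2)])
        then show "u (vadd V x y) \<le> u x + u y" by simp
      next
        fix c :: real and x assume c: "0 \<le> c" and x: "x \<in> vcar V"
        have g_scale: "g (vscale V c x) = c * g x" if "g \<in> C" for g
          using that CA c x by (intro sublinear_scale) (auto simp: A_def)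
        show "u (vscale V c x) = c * u x"
        proof (cases "c = 0")
          case True
          then have "(\<lambda>g. g (vscale V c x)) ` C = {0}" using g_scale False by force
          then show ?thesis using x True by (simp add: u_def scale_closed)
        next
          case nz: False
          then have "0 < c" using c by simp
          have "u (vscale V c x) / c \<le> u x"
          proof (rule u_ge[OF x])
            fix g assume "g \<in> C"
            then show "u (vscale V c x) / c \<le> g x"
              using u_le[of g "vscale V c x"] g_scale x \<open>0 < c\<close>
              by (simp add: scale_closed field_simps)
          qed
          moreover have "c * u x \<le> u (vscale V c x)"
            using u_le[OF _ x] x c
            by (intro u_ge scale_closed) (simp_all add: g_scale mult_left_mono)
          ultimately show ?thesis using \<open>0 < c\<close> by (simp add: field_simps)
        qed
      qed
      moreover have "u x \<le> q x" if "x \<in> vcar V" for x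
      proof -
        obtain g where "g \<in> C" using False by blast
        then show ?thesis using u_le[of g x] that CA by (force simp: A_def)
      qed
      ultimately have "u \<in> A" by (simp add: A_def)
      then show ?thesis using u_le by (auto simp: P_def)
    qed
  qed
  then obtain m where m: "m \<in> A" "\<And>g. g \<in> A \<Longrightarrow> P m g \<Longrightarrow> g = m" by blast
  show ?thesis
  proof (rule that[of m])
    fix g assume "sublinear g" and le: "\<And>x. x \<in> vcar V \<Longrightarrow> g x \<le> m x"
    then show "g = m" using m by (intro m(2)) (auto simp: A_def P_def intro: order_trans)
  qed (use m in \<open>auto simp: A_def\<close>)
qed

text \<open>A minimal sublinear functional \<open>m\<close> is linear: lowering it along any
  \<open>x\<close> changes nothing, so \<open>m (- x) \<le> - m x\<close>, and an odd sublinear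
  functional is linear. Lowering \<open>q\<close> along \<open>a\<close> beforehand forces
  \<open>m (- a) \<le> - q a\<close>, which gives equality at \<open>a\<close>.\<close>

theorem hahn_banach:
  assumes q: "sublinear q" and a: "a \<in> vcar V"
  obtains \<phi> where "linear_functional V \<phi>" "\<And>x. x \<in> vcar V \<Longrightarrow> \<phi> x \<le> q x" "\<phi> a = q a"
proof -
  obtain g where g: "sublinear g" "\<And>x. x \<in> vcar V \<Longrightarrow> g x \<le> q x" "g (vscale V (- 1) a) \<le> - q a"
    using sublinear_lower[OF q a] by blast
  obtain m where m: "sublinear m" "\<And>x. x \<in> vcar V \<Longrightarrow> m x \<le> g x"
    and min: "\<And>h. sublinear h \<Longrightarrow> (\<And>x. x \<in> vcar V \<Longrightarrow> h x \<le> m x) \<Longrightarrow> h = m"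
    using minimal_sublinear_exists[OF g(1)] by blast
  have odd: "m (vscale V (- 1) x) = - m x" if x: "x \<in> vcar V" for x
  proof -
    obtain h where h: "sublinear h" "\<And>y. y \<in> vcar V \<Longrightarrow> h y \<le> m y" "h (vscale V (- 1) x) \<le> - m x"
      using sublinear_lower[OF m(1) x] by blast
    then have "m (vscale V (- 1) x) \<le> - m x" using min by metis
    then show ?thesis using sublinear_minus[OF m(1) x] by simp
  qed
  have "linear_functional V m"
    unfolding linear_functional_def
  proof (intro conjI ballI allI)
    show "m \<in> extensional (vcar V)" using m by (simp add: sublinear_def)
    fix x y assume xy: "x \<in> vcar V" "y \<in> vcar V"
    have "m x \<le> m (vadd V x y) + m (vscale V (- 1) y)"
      using sublinear_add[OF m(1), of "vadd V x y" "vscale V (- 1) y"] xy add_diff_cancel[of x y]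
      by (simp add: add_closed scale_closed vdiff_def)
    then show "m (vadd V x y) = m x + m y"
      using sublinear_add[OF m(1) xy] odd xy by simp
  next
    fix c :: real and x assume x: "x \<in> vcar V"
    show "m (vscale V c x) = c * m x"
    proof (cases "0 \<le> c")
      case False
      then have "m (vscale V (- c) (vscale V (- 1) x)) = - c * m (vscale V (- 1) x)"
        using x m by (intro sublinear_scale scale_closed) simp_all
      then show ?thesis using x odd by (simp add: scale_scale)
    qed (use x m in \<open>simp add: sublinear_scale\<close>)
  qed
  moreover have le: "m x \<le> q x" if "x \<in> vcar V" for x using m(2) g(2) that order_trans by blast
  moreover have "m a = q a"
    using m(2)[of "vscale V (- 1) a"] g(3) odd[OF a] le[OF a] a by (simp add: scale_closed)
  ultimately show ?thesis using that by blast
qed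

end

section \<open>Signed measures\<close>

lemma ca_outside: "\<mu> \<in> ca M \<Longrightarrow> A \<notin> sets M \<Longrightarrow> \<mu> A = 0"
  and ca_empty: "\<mu> \<in> ca M \<Longrightarrow> \<mu> {} = 0"
  and ca_sums: "\<mu> \<in> ca M \<Longrightarrow> range F \<subseteq> sets M \<Longrightarrow> disjoint_family F \<Longrightarrow>
    (\<lambda>n. \<mu> (F n)) sums \<mu> (\<Union>n. F n)" for F :: "nat \<Rightarrow> 'a set"
  by (auto simp: ca_def)

lemma ca_eqI: "\<mu> \<in> ca M \<Longrightarrow> \<nu> \<in> ca M \<Longrightarrow> (\<And>A. A \<in> sets M \<Longrightarrow> \<mu> A = \<nu> A) \<Longrightarrow> \<mu> = \<nu>"
  by (rule ext) (metis ca_outside)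

lemma ca_Un:
  assumes \<mu>: "\<mu> \<in> ca M" and AB: "A \<in> sets M" "B \<in> sets M" "A \<inter> B = {}"
  shows "\<mu> (A \<union> B) = \<mu> A + \<mu> B"
proof -
  have "(\<lambda>n. \<mu> (binaryset A B n)) sums \<mu> (\<Union>n. binaryset A B n)"
    using AB by (intro ca_sums[OF \<mu>]) (auto simp: range_binaryset_eq disjoint_family_on_def
      binaryset_def)
  moreover have "(\<lambda>n. \<mu> (binaryset A B n)) sums (\<mu> A + \<mu> B)"
    by (rule binaryset_sums) (rule ca_empty[OF \<mu>])
  ultimately show ?thesis by (simp add: UN_binaryset_eq sums_unique2)
qed

lemma ca_split:
  assumes "\<mu> \<in> ca M" "A \<in> sets M" "B \<in> sets M"
  shows "\<mu> A = \<mu> (A \<inter> B) + \<mu> (A - B)"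
  using ca_Un[of \<mu> M "A \<inter> B" "A - B"] assms by (simp add: Int_Diff_disjoint Int_Diff_Un)

lemma ca_diff:
  assumes "\<mu> \<in> ca M" "A \<in> sets M" "B \<in> sets M" "B \<subseteq> A"
  shows "\<mu> (A - B) = \<mu> A - \<mu> B"
  using ca_split[OF assms(1-3)] assms(4) by (simp add: Int_absorb1)

lemma ca_incseq:
  assumes \<mu>: "\<mu> \<in> ca M" and A: "range A \<subseteq> sets M" "incseq A"
  shows "(\<lambda>n. \<mu> (A n)) \<longlonglongrightarrow> \<mu> (\<Union>n. A n)"
proof -
  have "(\<lambda>n. \<mu> (disjointed A n)) sums \<mu> (\<Union>n. disjointed A n)"
    using A sets.range_disjointed_sets[of A M]
      by (intro ca_sums[OF \<mu>] disjoint_family_disjointed) auto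
  moreover have "(\<Sum>i\<le>n. \<mu> (disjointed A i)) = \<mu> (A n)" for n
  proof (induction n)
    case (Suc n)
    have "\<mu> (disjointed A (Suc n)) = \<mu> (A (Suc n)) - \<mu> (A n)"
      using A by (simp add: disjointed_mono, intro ca_diff[OF \<mu>]) (auto simp: incseq_SucD)
    then show ?case using Suc by simp
  qed (simp add: disjointed_def)
  ultimately show ?thesis by (simp add: sums_def_le UN_disjointed_eq)
qed

lemma ca_decseq:
  assumes \<mu>: "\<mu> \<in> ca M" and A: "range A \<subseteq> sets M" "decseq A"
  shows "(\<lambda>n. \<mu> (A n)) \<longlonglongrightarrow> \<mu> (\<Inter>n. A n)"
proof -
  have sub: "A n \<subseteq> A 0" for n using A by (auto simp: decseq_def)
  have "(\<lambda>n. \<mu> (A 0 - A n)) \<longlonglongrightarrow> \<mu> (\<Union>n. A 0 - A n)"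
    using A by (intro ca_incseq[OF \<mu>]) (auto simp: decseq_def incseq_def)
  moreover have "(\<Union>n. A 0 - A n) = A 0 - (\<Inter>n. A n)" by auto
  moreover have "\<mu> (A 0 - A n) = \<mu> (A 0) - \<mu> (A n)" for n
    using A sub by (intro ca_diff[OF \<mu>]) auto
  moreover have "\<mu> (A 0 - (\<Inter>n. A n)) = \<mu> (A 0) - \<mu> (\<Inter>n. A n)"
    using A by (intro ca_diff[OF \<mu>]) auto
  ultimately have "(\<lambda>n. \<mu> (A 0) - \<mu> (A n)) \<longlonglongrightarrow> \<mu> (A 0) - \<mu> (\<Inter>n. A n)" by simp
  from tendsto_diff[OF tendsto_const[of "\<mu> (A 0)"] this] show ?thesis by simp
qed

lemma caI_incseq:
  assumes out: "\<And>A. A \<notin> sets M \<Longrightarrow> \<mu> A = 0"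
    and add: "\<And>A B. A \<in> sets M \<Longrightarrow> B \<in> sets M \<Longrightarrow> A \<inter> B = {} \<Longrightarrow> \<mu> (A \<union> B) = \<mu> A + \<mu> B"
    and inc: "\<And>A. range A \<subseteq> sets M \<Longrightarrow> incseq A \<Longrightarrow> (\<lambda>n :: nat. \<mu> (A n)) \<longlonglongrightarrow> \<mu> (\<Union>n. A n)"
  shows "\<mu> \<in> ca M"
  unfolding ca_def
proof (intro CollectI conjI allI impI)
  show empty: "\<mu> {} = 0" using add[of "{}" "{}"] by simp
  fix A :: "nat \<Rightarrow> 'a set" assume A: "range A \<subseteq> sets M" "disjoint_family A"
  have "(\<Sum>i<n. \<mu> (A i)) = \<mu> (\<Union>i<n. A i)" for n
  proof (induction n)
    case (Suc n)
    have "\<mu> ((\<Union>i<n. A i) \<union> A n) = \<mu> (\<Union>i<n. A i) + \<mu> (A n)"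
    proof (rule add)
      have "A i \<inter> A n = {}" if "i < n" for i using A(2) that by (simp add: disjoint_family_on_def)
      then show "(\<Union>i<n. A i) \<inter> A n = {}" by blast
    qed (use A in auto)
    then show ?case using Suc by (simp add: lessThan_Suc Un_commute)
  qed (simp add: empty)
  moreover have "(\<lambda>n. \<mu> (\<Union>i<n. A i)) \<longlonglongrightarrow> \<mu> (\<Union>n. \<Union>i<n. A i)"
    using A by (intro inc incseq_SucI) (auto simp: less_Suc_eq)
  moreover have "(\<Union>n. \<Union>i<n. A i) = (\<Union>n. A n)" by auto
  ultimately show "(\<lambda>n. \<mu> (A n)) sums \<mu> (\<Union>n. A n)" by (simp add: sums_def)
qed (use out in auto)

text \<open>If the sets \<open>A n\<close> increase to \<open>U\<close>, the defect
  \<open>\<mu> (U - A n)\<close> is bounded by \<open>\<nu> (U - A n)\<close>, which tends to 0. So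
  finite additivity is all that remains to be checked for set functions built from functionals or
  integrals.\<close>

lemma ca_dominatedI:
  assumes out: "\<And>A. A \<notin> sets M \<Longrightarrow> \<mu> A = 0"
    and add: "\<And>A B. A \<in> sets M \<Longrightarrow> B \<in> sets M \<Longrightarrow> A \<inter> B = {} \<Longrightarrow> \<mu> (A \<union> B) = \<mu> A + \<mu> B"
    and \<nu>: "\<nu> \<in> ca M" and le: "\<And>A. A \<in> sets M \<Longrightarrow> \<bar>\<mu> A\<bar> \<le> \<nu> A"
  shows "\<mu> \<in> ca M"
proof (rule caI_incseq[OF out add])
  fix A :: "nat \<Rightarrow> 'a set" assume A: "range A \<subseteq> sets M" "incseq A"
  let ?U = "\<Union>n. A n"
  have "(\<lambda>n. \<nu> ?U - \<nu> (A n)) \<longlonglongrightarrow> \<nu> ?U - \<nu> ?U"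
    using ca_incseq[OF \<nu> A] by (intro tendsto_intros)
  then have lim: "(\<lambda>n. \<nu> ?U - \<nu> (A n)) \<longlonglongrightarrow> 0" by simp
  have "norm (\<mu> (A n) - \<mu> ?U) \<le> \<nu> ?U - \<nu> (A n)" for n
  proof -
    have "\<mu> (A n \<union> (?U - A n)) = \<mu> (A n) + \<mu> (?U - A n)"
      by (rule add) (use A in auto)
    moreover have "A n \<union> (?U - A n) = ?U" by blast
    ultimately have "\<mu> ?U = \<mu> (A n) + \<mu> (?U - A n)" by simp
    moreover have "\<nu> (?U - A n) = \<nu> ?U - \<nu> (A n)" using A by (intro ca_diff[OF \<nu>]) auto
    moreover have "\<bar>\<mu> (?U - A n)\<bar> \<le> \<nu> (?U - A n)" using A by (intro le) auto
    ultimately show ?thesis by simp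
  qed
  then have "(\<lambda>n. \<mu> (A n) - \<mu> ?U) \<longlonglongrightarrow> 0"
    by (intro Lim_null_comparison[OF _ lim]) simp
  then show "(\<lambda>n. \<mu> (A n)) \<longlonglongrightarrow> \<mu> ?U" by (rule Lim_null[THEN iffD2])
qed

lemma ca_zero: "(\<lambda>A. 0) \<in> ca M"
  by (simp add: ca_def)

lemma ca_add: "\<mu> \<in> ca M \<Longrightarrow> \<nu> \<in> ca M \<Longrightarrow> (\<lambda>A. \<mu> A + \<nu> A) \<in> ca M"
  by (auto simp: ca_def intro!: sums_add)

lemma ca_scale: "\<mu> \<in> ca M \<Longrightarrow> (\<lambda>A. a * \<mu> A) \<in> ca M"
  by (auto simp: ca_def intro!: sums_mult)

lemma ca_subtract: "\<mu> \<in> ca M \<Longrightarrow> \<nu> \<in> ca M \<Longrightarrow> (\<lambda>A. \<mu> A - \<nu> A) \<in> ca M"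
  by (auto simp: ca_def intro!: sums_diff)

definition restr :: "'a measure \<Rightarrow> ('a set \<Rightarrow> real) \<Rightarrow> 'a set \<Rightarrow> 'a set \<Rightarrow> real" where
  "restr M \<mu> B = (\<lambda>A. if A \<in> sets M then \<mu> (A \<inter> B) else 0)"

lemma restr_apply: "A \<in> sets M \<Longrightarrow> restr M \<mu> B A = \<mu> (A \<inter> B)"
  by (simp add: restr_def)

lemma ca_restr:
  assumes \<mu>: "\<mu> \<in> ca M" and B: "B \<in> sets M"
  shows "restr M \<mu> B \<in> ca M"
  unfolding ca_def
proof (intro CollectI conjI allI impI)
  fix A :: "nat \<Rightarrow> 'a set" assume A: "range A \<subseteq> sets M" "disjoint_family A"
  have "(\<lambda>n. \<mu> (A n \<inter> B)) sums \<mu> (\<Union>n. A n \<inter> B)"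
    using A B by (intro ca_sums[OF \<mu>]) (auto simp: disjoint_family_on_def)
  moreover have "A n \<in> sets M" for n using A by auto
  ultimately show "(\<lambda>n. restr M \<mu> B (A n)) sums restr M \<mu> B (\<Union>n. A n)"
    by (simp add: restr_def sets.countable_UN Int_UN_distrib2)
qed (use ca_empty[OF \<mu>] in \<open>auto simp: restr_def\<close>)

lemma ca_measure:
  assumes "finite_measure N" "sets N = sets M"
  shows "measure N \<in> ca M"
proof -
  interpret finite_measure N by fact
  show ?thesis
    unfolding ca_def
    using assms(2) by (auto simp: measure_notin_sets intro!: finite_measure_UNION)
qed


section \<open>Hahn decomposition and total variation\<close>

text \<open>Otherwise a piece of mass below \<open>- e\<close> could be removed again and again.
  Every removal raises the mass by at least \<open>e\<close>, yet the masses of the decreasing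
  remainders converge.\<close>

lemma ca_almost_positive_subset:
  assumes \<mu>: "\<mu> \<in> ca M" and A: "A \<in> sets M" and e: "0 < e"
  shows "\<exists>B\<in>sets M. B \<subseteq> A \<and> \<mu> A \<le> \<mu> B \<and> (\<forall>C\<in>sets M. C \<subseteq> B \<longrightarrow> - e \<le> \<mu> C)"
proof (rule ccontr)
  assume no: "\<not> ?thesis"
  have "\<exists>C. C \<in> sets M \<and> C \<subseteq> B \<and> \<mu> C < - e" if "B \<in> sets M" "B \<subseteq> A" "\<mu> A \<le> \<mu> B" for B
    using no that by (meson not_le)
  then obtain c where c: "\<And>B. B \<in> sets M \<Longrightarrow> B \<subseteq> A \<Longrightarrow> \<mu> A \<le> \<mu> B \<Longrightarrow>
      c B \<in> sets M \<and> c B \<subseteq> B \<and> \<mu> (c B) < - e" by metis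
  define D where "D = rec_nat A (\<lambda>n B. B - c B)"
  have D: "D 0 = A" "D (Suc n) = D n - c (D n)" for n by (simp_all add: D_def)
  have P: "D n \<in> sets M \<and> D n \<subseteq> A \<and> \<mu> A + n * e \<le> \<mu> (D n)" for n
  proof (induction n)
    case (Suc n)
    moreover have "0 \<le> n * e" using e by simp
    ultimately have "\<mu> A \<le> \<mu> (D n)" by linarith
    then have cD: "c (D n) \<in> sets M" "c (D n) \<subseteq> D n" "\<mu> (c (D n)) < - e"
      using c[of "D n"] Suc by auto
    then have "\<mu> (D (Suc n)) = \<mu> (D n) - \<mu> (c (D n))"
      using Suc unfolding D by (intro ca_diff[OF \<mu>]) auto
    then show ?case using Suc cD by (auto simp: D algebra_simps)
  qed (simp add: D A)
  have "decseq D" by (rule decseq_SucI) (auto simp: D)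
  then have "(\<lambda>n. \<mu> (D n)) \<longlonglongrightarrow> \<mu> (\<Inter>n. D n)" using P by (intro ca_decseq[OF \<mu>]) auto
  then have "Bseq (\<lambda>n. \<mu> (D n))" by (intro convergent_imp_Bseq convergentI)
  then obtain K where K: "\<And>n. \<bar>\<mu> (D n)\<bar> \<le> K" by (auto simp: Bseq_def)
  obtain n :: nat where "(K - \<mu> A) / e < n" using reals_Archimedean2 by blast
  then have "K < \<mu> A + n * e" using e by (simp add: field_simps)
  then show False using P[of n] K[of n] by linarith
qed

definition positive_set :: "'a measure \<Rightarrow> ('a set \<Rightarrow> real) \<Rightarrow> 'a set \<Rightarrow> bool" where
  "positive_set M \<mu> P \<longleftrightarrow> P \<in> sets M \<and> (\<forall>C\<in>sets M. C \<subseteq> P \<longrightarrow> 0 \<le> \<mu> C)"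

text \<open>Iterates the previous lemma with tolerances \<open>1 / (n + 1)\<close> and intersects;
  the mass does not drop in the limit by continuity from above.\<close>

lemma ca_positive_subset:
  assumes \<mu>: "\<mu> \<in> ca M" and A: "A \<in> sets M"
  shows "\<exists>P. positive_set M \<mu> P \<and> P \<subseteq> A \<and> \<mu> A \<le> \<mu> P"
proof -
  have "\<forall>B\<in>sets M. \<forall>n. \<exists>C\<in>sets M. C \<subseteq> B \<and> \<mu> B \<le> \<mu> C \<and>
      (\<forall>E\<in>sets M. E \<subseteq> C \<longrightarrow> - (1 / real (Suc n)) \<le> \<mu> E)"
    using ca_almost_positive_subset[OF \<mu>] by simp
  then obtain c where c: "\<And>B n. B \<in> sets M \<Longrightarrow> c B n \<in> sets M \<and> c B n \<subseteq> B \<and> \<mu> B \<le> \<mu> (c B n) \<and>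
      (\<forall>E\<in>sets M. E \<subseteq> c B n \<longrightarrow> - (1 / real (Suc n)) \<le> \<mu> E)" by metis
  define D where "D = rec_nat A (\<lambda>n B. c B n)"
  have D: "D 0 = A" "D (Suc n) = c (D n) n" for n by (simp_all add: D_def)
  have P: "D n \<in> sets M \<and> D n \<subseteq> A \<and> \<mu> A \<le> \<mu> (D n)" for n
  proof (induction n)
    case (Suc n)
    then show ?case using c[of "D n" n] by (auto simp: D)
  qed (simp add: D A)
  have "decseq D" by (rule decseq_SucI) (use c P D in auto)
  then have "(\<lambda>n. \<mu> (D n)) \<longlonglongrightarrow> \<mu> (\<Inter>n. D n)" using P by (intro ca_decseq[OF \<mu>]) auto
  then have "\<mu> A \<le> \<mu> (\<Inter>n. D n)"
    by (rule tendsto_lowerbound) (use P in \<open>auto intro: always_eventually\<close>)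
  moreover have "positive_set M \<mu> (\<Inter>n. D n)"
    unfolding positive_set_def
  proof (intro conjI ballI impI)
    show "(\<Inter>n. D n) \<in> sets M" using P by (intro sets.countable_INT) auto
    fix C assume C: "C \<in> sets M" "C \<subseteq> (\<Inter>n. D n)"
    have "- (1 / real (Suc n)) \<le> \<mu> C" for n
    proof -
      have "C \<subseteq> c (D n) n" using C D(2)[of n] by blast
      then show ?thesis using c[of "D n" n] P C by blast
    qed
    moreover have "(\<lambda>n. - (1 / real (Suc n))) \<longlonglongrightarrow> - 0"
      by (intro tendsto_minus LIMSEQ_Suc[OF lim_1_over_n])
    ultimately show "0 \<le> \<mu> C" using LIMSEQ_le_const2[of _ "- 0" "\<mu> C"] by auto
  qed
  moreover have "(\<Inter>n. D n) \<subseteq> A" using D(1) by auto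
  ultimately show ?thesis by blast
qed

lemma positive_set_UN:
  fixes P :: "nat \<Rightarrow> 'a set"
  assumes \<mu>: "\<mu> \<in> ca M" and P: "\<And>n. positive_set M \<mu> (P n)"
  shows "positive_set M \<mu> (\<Union>n. P n)"
  unfolding positive_set_def
proof (intro conjI ballI impI)
  have Ps: "range P \<subseteq> sets M" using P by (auto simp: positive_set_def)
  then show "(\<Union>n. P n) \<in> sets M" by auto
  fix C assume C: "C \<in> sets M" "C \<subseteq> (\<Union>n. P n)"
  have d: "disjointed P n \<in> sets M" for n using sets.range_disjointed_sets[OF Ps] by auto
  have "(\<lambda>n. \<mu> (C \<inter> disjointed P n)) sums \<mu> (\<Union>n. C \<inter> disjointed P n)"
  proof (rule ca_sums[OF \<mu>])
    show "disjoint_family (\<lambda>n. C \<inter> disjointed P n)"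
      using disjoint_family_disjointed[of P] by (auto simp: disjoint_family_on_def)
  qed (use d C in auto)
  moreover have "(\<Union>n. C \<inter> disjointed P n) = C" using C UN_disjointed_eq[of P] by auto
  moreover have "0 \<le> \<mu> (C \<inter> disjointed P n)" for n
    using P[of n] d[of n] C disjointed_subset[of P n] unfolding positive_set_def
    by (meson inf.coboundedI2 sets.Int)
  ultimately show "0 \<le> \<mu> C" using sums_le[OF _ sums_zero] by metis
qed

lemma positive_set_mono:
  assumes "\<mu> \<in> ca M" "positive_set M \<mu> P" "A \<in> sets M" "A \<subseteq> P"
  shows "\<mu> A \<le> \<mu> P"
proof -
  have "\<mu> (P - A) = \<mu> P - \<mu> A" using assms by (intro ca_diff) (auto simp: positive_set_def)
  moreover have "0 \<le> \<mu> (P - A)" using assms by (auto simp: positive_set_def)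
  ultimately show ?thesis by simp
qed

definition hahn_set :: "'a measure \<Rightarrow> ('a set \<Rightarrow> real) \<Rightarrow> 'a set \<Rightarrow> bool" where
  "hahn_set M \<mu> H \<longleftrightarrow> H \<in> sets M \<and> (\<forall>A\<in>sets M. 0 \<le> \<mu> (A \<inter> H) \<and> \<mu> (A - H) \<le> 0)"

lemma hahn_setD:
  assumes "hahn_set M \<mu> H"
  shows "H \<in> sets M" "A \<in> sets M \<Longrightarrow> 0 \<le> \<mu> (A \<inter> H)" "A \<in> sets M \<Longrightarrow> \<mu> (A - H) \<le> 0"
  using assms by (auto simp: hahn_set_def)

text \<open>The supremum of \<open>\<mu>\<close> over positive sets is attained by a countable union
  \<open>H\<close>. If some \<open>A - H\<close> had positive mass, it would contain a positive set
  of positive mass, and adjoining this set to \<open>H\<close> would exceed the supremum.\<close>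

lemma ca_Hahn_decomposition:
  assumes \<mu>: "\<mu> \<in> ca M"
  shows "\<exists>H. hahn_set M \<mu> H"
proof -
  let ?P = "{P. positive_set M \<mu> P}"
  \<comment> \<open>Positive sets of masses exceeding every \<open>n\<close> would have a union,
    again a positive set, of infinite mass.\<close>
  have bdd: "bdd_above (\<mu> ` ?P)"
  proof (rule ccontr)
    assume "\<not> ?thesis"
    then have "\<exists>P. positive_set M \<mu> P \<and> real n < \<mu> P" for n
      unfolding bdd_above_def by (force simp: not_le)
    then obtain P where P: "\<And>n. positive_set M \<mu> (P n)" "\<And>n. real n < \<mu> (P n)" by metis
    have "real n < \<mu> (\<Union>n. P n)" for n
    proof -
      have "\<mu> (P n) \<le> \<mu> (\<Union>n. P n)"
        using P by (intro positive_set_mono[OF \<mu>] positive_set_UN[OF \<mu>]) (auto simp: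
          positive_set_def)
      then show ?thesis using P(2)[of n] by linarith
    qed
    then show False using reals_Archimedean2 less_asym by blast
  qed
  have ne: "?P \<noteq> {}" using ca_positive_subset[OF \<mu>, of "{}"] by auto
  define s where "s = (SUP P\<in>?P. \<mu> P)"
  have "\<exists>P. positive_set M \<mu> P \<and> s - 1 / real (Suc n) < \<mu> P" for n
    using less_cSUP_iff[OF ne bdd, of "s - 1 / real (Suc n)"] by (auto simp: s_def)
  then obtain P where P: "\<And>n. positive_set M \<mu> (P n)" "\<And>n. s - 1 / real (Suc n) < \<mu> (P n)" by metis
  define H where "H = (\<Union>n. P n)"
  have H: "positive_set M \<mu> H" unfolding H_def using P by (intro positive_set_UN[OF \<mu>])
  have "s - 1 / real (Suc n) \<le> \<mu> H" for n
  proof -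
    have "\<mu> (P n) \<le> \<mu> H"
      using P(1)[of n] by (intro positive_set_mono[OF \<mu> H]) (auto simp: positive_set_def H_def)
    then show ?thesis using P(2)[of n] by linarith
  qed
  moreover have "(\<lambda>n. s - 1 / real (Suc n)) \<longlonglongrightarrow> s - 0"
    by (intro tendsto_diff tendsto_const LIMSEQ_Suc[OF lim_1_over_n])
  ultimately have s_le: "s \<le> \<mu> H" using LIMSEQ_le_const2[of _ "s - 0" "\<mu> H"] by auto
  have "\<mu> (A - H) \<le> 0" if A: "A \<in> sets M" for A
  proof (rule ccontr)
    assume pos: "\<not> ?thesis"
    have HM: "H \<in> sets M" using H by (simp add: positive_set_def)
    obtain Q where Q: "positive_set M \<mu> Q" "Q \<subseteq> A - H" "\<mu> (A - H) \<le> \<mu> Q"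
      using ca_positive_subset[OF \<mu> sets.Diff[OF A HM]] by blast
    have "positive_set M \<mu> (\<Union>n. binaryset H Q n)"
      using H Q by (intro positive_set_UN[OF \<mu>]) (auto simp: binaryset_def positive_set_def
        ca_empty[OF \<mu>])
    then have "positive_set M \<mu> (H \<union> Q)" by (simp add: UN_binaryset_eq)
    then have "\<mu> (H \<union> Q) \<le> s" unfolding s_def using bdd by (intro cSUP_upper) auto
    moreover have "\<mu> (H \<union> Q) = \<mu> H + \<mu> Q"
      using H Q by (intro ca_Un[OF \<mu>]) (auto simp: positive_set_def)
    ultimately show False using s_le pos Q(3) by linarith
  qed
  moreover have "0 \<le> \<mu> (A \<inter> H)" if "A \<in> sets M" for A
    using H that by (auto simp: positive_set_def)
  ultimately show ?thesis using H by (auto simp: positive_set_def hahn_set_def)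
qed

lemma ca_Union_finite:
  assumes \<mu>: "\<mu> \<in> ca M" and D: "finite \<D>" "\<D> \<subseteq> sets M" "disjoint \<D>"
  shows "(\<Sum>D\<in>\<D>. \<mu> D) = \<mu> (\<Union>\<D>)"
  using D
proof (induction \<D> rule: finite_induct)
  case (insert A \<D>)
  have "A \<inter> \<Union>\<D> = {}" using insert.hyps insert.prems by (auto simp: disjoint_def)
  then have "\<mu> (A \<union> \<Union>\<D>) = \<mu> A + \<mu> (\<Union>\<D>)"
    using insert by (intro ca_Un[OF \<mu>] sets.finite_Union) auto
  then show ?case using insert by (simp add: disjoint_def)
qed (simp add: ca_empty[OF \<mu>])

text \<open>The two-piece partition along \<open>H\<close> attains the supremum: its value is
  additive in \<open>A\<close> and dominates \<open>|\<mu>|\<close>, so no finite partition yields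
  more.\<close>

lemma tv_Hahn:
  assumes \<mu>: "\<mu> \<in> ca M" and hahn: "hahn_set M \<mu> H" and A: "A \<in> sets M"
  shows "tv M \<mu> A = \<mu> (A \<inter> H) - \<mu> (A - H)"
proof -
  note H = hahn_setD[OF hahn]
  let ?\<nu> = "\<lambda>A. 2 * restr M \<mu> H A - \<mu> A"
  have \<nu>: "?\<nu> \<in> ca M" using \<mu> H by (intro ca_subtract ca_scale ca_restr)
  have \<nu>_eq: "?\<nu> B = \<mu> (B \<inter> H) - \<mu> (B - H)" if "B \<in> sets M" for B
    using ca_split[OF \<mu> that H(1)] that by (simp add: restr_def)
  let ?P = "{\<D>. finite \<D> \<and> \<D> \<subseteq> sets M \<and> disjoint \<D> \<and> \<Union>\<D> = A}"
  have "(SUP \<D>\<in>?P. \<Sum>D\<in>\<D>. \<bar>\<mu> D\<bar>) = ?\<nu> A"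
  proof (rule cSup_eq_maximum)
    let ?D = "{A \<inter> H, A - H}"
    have "(\<Sum>D\<in>?D. \<bar>\<mu> D\<bar>) = ?\<nu> A"
    proof (cases "A \<inter> H = A - H")
      case True
      then have "A \<inter> H = {}" "A - H = {}" by blast+
      then show ?thesis unfolding \<nu>_eq[OF A] by (simp only:) (simp add: ca_empty[OF \<mu>])
    next
      case False
      then show ?thesis using H(2,3)[OF A] A by (simp add: \<nu>_eq)
    qed
    moreover have "?D \<in> ?P" using A H(1) by (auto simp: disjoint_def)
    ultimately show "?\<nu> A \<in> (\<lambda>\<D>. \<Sum>D\<in>\<D>. \<bar>\<mu> D\<bar>) ` ?P" by (metis (no_types, lifting) image_eqI)
    fix x assume "x \<in> (\<lambda>\<D>. \<Sum>D\<in>\<D>. \<bar>\<mu> D\<bar>) ` ?P"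
    then obtain \<D> where D: "\<D> \<in> ?P" "x = (\<Sum>D\<in>\<D>. \<bar>\<mu> D\<bar>)" by blast
    have "x \<le> (\<Sum>D\<in>\<D>. ?\<nu> D)"
      unfolding D(2)
    proof (rule sum_mono)
      fix B assume "B \<in> \<D>"
      then have "B \<in> sets M" using D by auto
      then show "\<bar>\<mu> B\<bar> \<le> ?\<nu> B"
        using ca_split[OF \<mu> _ H(1), of B] H(2,3)[of B] unfolding \<nu>_eq[OF \<open>B \<in> sets M\<close>] by auto
    qed
    also have "\<dots> = ?\<nu> A" using D ca_Union_finite[OF \<nu>, of \<D>] by auto
    finally show "x \<le> ?\<nu> A" .
  qed
  then show ?thesis using A \<nu>_eq by (simp add: tv_def)
qed

lemma tv_outside: "A \<notin> sets M \<Longrightarrow> tv M \<mu> A = 0"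
  by (simp add: tv_def)

text \<open>By \<open>tv_Hahn\<close> the total variation is twice the restriction of
  \<open>\<mu>\<close> to a Hahn set minus \<open>\<mu>\<close>, a linear combination of signed
  measures.\<close>

lemma ca_tv:
  assumes \<mu>: "\<mu> \<in> ca M"
  shows "tv M \<mu> \<in> ca M"
proof -
  obtain H where "hahn_set M \<mu> H" using ca_Hahn_decomposition[OF \<mu>] by blast
  note H = hahn_setD[OF this]
  have "tv M \<mu> = (\<lambda>A. 2 * restr M \<mu> H A - \<mu> A)"
  proof
    fix A show "tv M \<mu> A = 2 * restr M \<mu> H A - \<mu> A"
      using tv_Hahn[OF \<mu> \<open>hahn_set M \<mu> H\<close>, of A] ca_split[OF \<mu> _ H(1), of A] ca_outside[OF \<mu>]
      by (cases "A \<in> sets M") (auto simp: restr_def tv_outside)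
  qed
  then show ?thesis using \<mu> H by (simp add: ca_subtract ca_scale ca_restr)
qed

lemma abs_le_tv:
  assumes \<mu>: "\<mu> \<in> ca M"
  shows "\<bar>\<mu> A\<bar> \<le> tv M \<mu> A"
proof (cases "A \<in> sets M")
  case True
  obtain H where "hahn_set M \<mu> H" using ca_Hahn_decomposition[OF \<mu>] by blast
  note H = hahn_setD[OF this]
  show ?thesis
    using tv_Hahn[OF \<mu> \<open>hahn_set M \<mu> H\<close> True] ca_split[OF \<mu> True H(1)] H(2,3)[OF True] by auto
qed (simp add: tv_outside ca_outside[OF \<mu>])

lemma tv_nonneg: "\<mu> \<in> ca M \<Longrightarrow> 0 \<le> tv M \<mu> A"
  using abs_le_tv[of \<mu> M A] by auto

lemma tv_least:
  assumes \<mu>: "\<mu> \<in> ca M" and \<nu>: "\<nu> \<in> ca M" and le: "\<And>A. A \<in> sets M \<Longrightarrow> \<bar>\<mu> A\<bar> \<le> \<nu> A"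
  shows "tv M \<mu> A \<le> \<nu> A"
proof (cases "A \<in> sets M")
  case True
  obtain H where "hahn_set M \<mu> H" using ca_Hahn_decomposition[OF \<mu>] by blast
  note H = hahn_setD[OF this]
  have "\<bar>\<mu> (A \<inter> H)\<bar> \<le> \<nu> (A \<inter> H)" "\<bar>\<mu> (A - H)\<bar> \<le> \<nu> (A - H)"
    using le[OF sets.Int[OF True H(1)]] le[OF sets.Diff[OF True H(1)]] .
  then show ?thesis using tv_Hahn[OF \<mu> \<open>hahn_set M \<mu> H\<close> True] ca_split[OF \<nu> True H(1)] by linarith
qed (simp add: tv_outside ca_outside[OF \<nu>])

lemma ca_mono:
  assumes "\<mu> \<in> ca M" "\<And>A. A \<in> sets M \<Longrightarrow> 0 \<le> \<mu> A" "A \<in> sets M" "B \<in> sets M" "A \<subseteq> B"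
  shows "\<mu> A \<le> \<mu> B"
  using ca_diff[OF assms(1,4,3,5)] assms(2)[of "B - A"] assms(3,4) by auto

lemma tv_mono: "\<mu> \<in> ca M \<Longrightarrow> A \<in> sets M \<Longrightarrow> B \<in> sets M \<Longrightarrow> A \<subseteq> B \<Longrightarrow> tv M \<mu> A \<le> tv M \<mu> B"
  by (rule ca_mono[OF ca_tv]) (auto intro: tv_nonneg)

lemma tv_of_nonneg:
  assumes \<mu>: "\<mu> \<in> ca M" and "\<And>A. A \<in> sets M \<Longrightarrow> 0 \<le> \<mu> A"
  shows "tv M \<mu> = \<mu>"
proof
  fix A show "tv M \<mu> A = \<mu> A"
    using tv_least[OF \<mu> \<mu>, of A] abs_le_tv[OF \<mu>, of A] assms(2) by force
qed

lemma tv_add: "\<mu> \<in> ca M \<Longrightarrow> \<nu> \<in> ca M \<Longrightarrow> tv M (\<lambda>A. \<mu> A + \<nu> A) A \<le> tv M \<mu> A + tv M \<nu> A"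
proof (rule tv_least)
  assume c: "\<mu> \<in> ca M" "\<nu> \<in> ca M"
  show "\<bar>\<mu> A + \<nu> A\<bar> \<le> tv M \<mu> A + tv M \<nu> A" for A
    using abs_le_tv[OF c(1), of A] abs_le_tv[OF c(2), of A] by linarith
qed (auto intro: ca_add ca_tv)

lemma tv_scale:
  assumes \<mu>: "\<mu> \<in> ca M"
  shows "tv M (\<lambda>A. a * \<mu> A) A = \<bar>a\<bar> * tv M \<mu> A"
proof (rule antisym)
  have le: "tv M (\<lambda>A. a * \<mu> A) A \<le> \<bar>a\<bar> * tv M \<mu> A" if \<mu>: "\<mu> \<in> ca M" for \<mu> a
    using \<mu> by (intro tv_least ca_scale ca_tv) (auto simp: abs_mult intro!: mult_left_mono
      abs_le_tv)
  show "tv M (\<lambda>A. a * \<mu> A) A \<le> \<bar>a\<bar> * tv M \<mu> A" using \<mu> by (rule le)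
  show "\<bar>a\<bar> * tv M \<mu> A \<le> tv M (\<lambda>A. a * \<mu> A) A"
  proof (cases "a = 0")
    case True
    then show ?thesis using tv_nonneg[OF ca_scale[OF \<mu>, of a]] by simp
  next
    case False
    have "tv M (\<lambda>A. inverse a * (a * \<mu> A)) A \<le> \<bar>inverse a\<bar> * tv M (\<lambda>A. a * \<mu> A) A"
      using \<mu> by (intro le ca_scale)
    moreover have "(\<lambda>A. inverse a * (a * \<mu> A)) = \<mu>" using False by (simp add: fun_eq_iff)
    ultimately show ?thesis using False by (simp add: field_simps)
  qed
qed


section \<open>Integration of bounded measurable functions\<close>

definition bmeas :: "'a measure \<Rightarrow> ('a \<Rightarrow> real) set" where
  "bmeas M = {f \<in> borel_measurable M. \<exists>C. \<forall>\<omega>\<in>space M. \<bar>f \<omega>\<bar> \<le> C}"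

lemma bmeasI: "f \<in> borel_measurable M \<Longrightarrow> (\<And>\<omega>. \<omega> \<in> space M \<Longrightarrow> \<bar>f \<omega>\<bar> \<le> C) \<Longrightarrow> f \<in> bmeas M"
  by (auto simp: bmeas_def)

lemma bmeas_measurable: "f \<in> bmeas M \<Longrightarrow> f \<in> borel_measurable M"
  by (simp add: bmeas_def)

lemma bmeas_bound:
  assumes "f \<in> bmeas M"
  obtains C where "0 \<le> C" "\<And>\<omega>. \<omega> \<in> space M \<Longrightarrow> \<bar>f \<omega>\<bar> \<le> C"
proof -
  obtain C where "\<forall>\<omega>\<in>space M. \<bar>f \<omega>\<bar> \<le> C" using assms by (auto simp: bmeas_def)
  then have "\<forall>\<omega>\<in>space M. \<bar>f \<omega>\<bar> \<le> \<bar>C\<bar>" by fastforce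
  then show ?thesis using that[of "\<bar>C\<bar>"] by auto
qed

lemma bmeas_const: "(\<lambda>\<omega>. c) \<in> bmeas M"
  by (auto simp: bmeas_def)

lemma bmeas_indicator: "A \<in> sets M \<Longrightarrow> (indicator A :: 'a \<Rightarrow> real) \<in> bmeas M"
  by (rule bmeasI[of _ _ 1]) (auto simp: indicator_def)

lemma bmeas_add: "f \<in> bmeas M \<Longrightarrow> g \<in> bmeas M \<Longrightarrow> (\<lambda>\<omega>. f \<omega> + g \<omega>) \<in> bmeas M"
  and bmeas_diff: "f \<in> bmeas M \<Longrightarrow> g \<in> bmeas M \<Longrightarrow> (\<lambda>\<omega>. f \<omega> - g \<omega>) \<in> bmeas M"
  and bmeas_mult: "f \<in> bmeas M \<Longrightarrow> g \<in> bmeas M \<Longrightarrow> (\<lambda>\<omega>. f \<omega> * g \<omega>) \<in> bmeas M"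
  and bmeas_max: "f \<in> bmeas M \<Longrightarrow> g \<in> bmeas M \<Longrightarrow> (\<lambda>\<omega>. max (f \<omega>) (g \<omega>)) \<in> bmeas M"
  and bmeas_min: "f \<in> bmeas M \<Longrightarrow> g \<in> bmeas M \<Longrightarrow> (\<lambda>\<omega>. min (f \<omega>) (g \<omega>)) \<in> bmeas M"
proof -
  assume fg: "f \<in> bmeas M" "g \<in> bmeas M"
  obtain C D where "0 \<le> C" "0 \<le> D"
    and b: "\<And>\<omega>. \<omega> \<in> space M \<Longrightarrow> \<bar>f \<omega>\<bar> \<le> C" "\<And>\<omega>. \<omega> \<in> space M \<Longrightarrow> \<bar>g \<omega>\<bar> \<le> D"
    using bmeas_bound[OF fg(1)] bmeas_bound[OF fg(2)] by metis
  note m[measurable] = fg[THEN bmeas_measurable]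
  show "(\<lambda>\<omega>. f \<omega> + g \<omega>) \<in> bmeas M" by (rule bmeasI[of _ _ "C + D"]) (use b in \<open>auto, fastforce\<close>)
  show "(\<lambda>\<omega>. f \<omega> - g \<omega>) \<in> bmeas M" by (rule bmeasI[of _ _ "C + D"]) (use b in \<open>auto, fastforce\<close>)
  show "(\<lambda>\<omega>. f \<omega> * g \<omega>) \<in> bmeas M"
    by (rule bmeasI[of _ _ "C * D"]) (use b in \<open>auto simp: abs_mult intro!: mult_mono' mult_mono
      \<open>0 \<le> C\<close>\<close>)
  show "(\<lambda>\<omega>. max (f \<omega>) (g \<omega>)) \<in> bmeas M"
    by (rule bmeasI[of _ _ "C + D"]) (use b in \<open>auto, fastforce\<close>)
  show "(\<lambda>\<omega>. min (f \<omega>) (g \<omega>)) \<in> bmeas M"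
    by (rule bmeasI[of _ _ "C + D"]) (use b in \<open>auto, fastforce\<close>)
qed

lemma bmeas_scale: "f \<in> bmeas M \<Longrightarrow> (\<lambda>\<omega>. a * f \<omega>) \<in> bmeas M"
  using bmeas_mult[OF bmeas_const] .

lemma bmeas_abs: "f \<in> bmeas M \<Longrightarrow> (\<lambda>\<omega>. \<bar>f \<omega>\<bar>) \<in> bmeas M"
  by (auto simp: bmeas_def)

lemma bmeas_sum:
  "finite K \<Longrightarrow> (\<And>k. k \<in> K \<Longrightarrow> f k \<in> bmeas M) \<Longrightarrow> (\<lambda>\<omega>. \<Sum>k\<in>K. f k \<omega>) \<in> bmeas M"
  by (induction K rule: finite_induct) (auto intro: bmeas_const bmeas_add)

text \<open>Sup-norm bounded linear functionals on the bounded measurable functions, with the norm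
  expressed through pointwise bounds. They are determined by indicators
  (\<open>bmeas_functional_eqI\<close>), so the integral identities below need to be checked on
  events only.\<close>

definition bmeas_functional :: "'a measure \<Rightarrow> (('a \<Rightarrow> real) \<Rightarrow> real) \<Rightarrow> bool" where
  "bmeas_functional M \<Lambda> \<longleftrightarrow>
     (\<forall>f\<in>bmeas M. \<forall>g\<in>bmeas M. \<Lambda> (\<lambda>\<omega>. f \<omega> + g \<omega>) = \<Lambda> f + \<Lambda> g) \<and>
     (\<forall>a. \<forall>f\<in>bmeas M. \<Lambda> (\<lambda>\<omega>. a * f \<omega>) = a * \<Lambda> f) \<and>
     (\<exists>K\<ge>0. \<forall>C. \<forall>f\<in>bmeas M. (\<forall>\<omega>\<in>space M. \<bar>f \<omega>\<bar> \<le> C) \<longrightarrow> \<bar>\<Lambda> f\<bar> \<le> K * C)"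

lemma bmeas_functionalI:
  assumes "\<And>f g. f \<in> bmeas M \<Longrightarrow> g \<in> bmeas M \<Longrightarrow> \<Lambda> (\<lambda>\<omega>. f \<omega> + g \<omega>) = \<Lambda> f + \<Lambda> g"
    "\<And>a f. f \<in> bmeas M \<Longrightarrow> \<Lambda> (\<lambda>\<omega>. a * f \<omega>) = a * \<Lambda> f" "0 \<le> K"
    "\<And>C f. f \<in> bmeas M \<Longrightarrow> (\<And>\<omega>. \<omega> \<in> space M \<Longrightarrow> \<bar>f \<omega>\<bar> \<le> C) \<Longrightarrow> \<bar>\<Lambda> f\<bar> \<le> K * C"
  shows "bmeas_functional M \<Lambda>"
  unfolding bmeas_functional_def using assms by blast

lemma bmeas_functional_add:
    "bmeas_functional M \<Lambda> \<Longrightarrow> f \<in> bmeas M \<Longrightarrow> g \<in> bmeas M \<Longrightarrow> \<Lambda> (\<lambda>\<omega>. f \<omega> + g \<omega>) = \<Lambda> f + \<Lambda> g"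
  and bmeas_functional_scale:
    "bmeas_functional M \<Lambda> \<Longrightarrow> f \<in> bmeas M \<Longrightarrow> \<Lambda> (\<lambda>\<omega>. a * f \<omega>) = a * \<Lambda> f"
  by (auto simp: bmeas_functional_def)

lemma bmeas_functional_bound:
  assumes "bmeas_functional M \<Lambda>"
  obtains K where "0 \<le> K"
    "\<And>C f. f \<in> bmeas M \<Longrightarrow> (\<And>\<omega>. \<omega> \<in> space M \<Longrightarrow> \<bar>f \<omega>\<bar> \<le> C) \<Longrightarrow> \<bar>\<Lambda> f\<bar> \<le> K * C"
  using assms unfolding bmeas_functional_def by blast

lemma bmeas_functional_diff:
  assumes "bmeas_functional M \<Lambda>" "f \<in> bmeas M" "g \<in> bmeas M"
  shows "\<Lambda> (\<lambda>\<omega>. f \<omega> - g \<omega>) = \<Lambda> f - \<Lambda> g"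
  using bmeas_functional_add[OF assms(1,2) bmeas_scale[OF assms(3), of "- 1"]]
    bmeas_functional_scale[OF assms(1,3), of "- 1"] by simp

lemma bmeas_functional_sum:
  assumes \<Lambda>: "bmeas_functional M \<Lambda>" and "finite K" "\<And>k. k \<in> K \<Longrightarrow> f k \<in> bmeas M"
  shows "\<Lambda> (\<lambda>\<omega>. \<Sum>k\<in>K. f k \<omega>) = (\<Sum>k\<in>K. \<Lambda> (f k))"
  using assms(2,3)
proof (induction K rule: finite_induct)
  case empty
  show ?case using bmeas_functional_scale[OF \<Lambda> bmeas_const, of 0 0] by simp
qed (simp add: bmeas_functional_add[OF \<Lambda>] bmeas_sum)

lemma bmeas_functional_combine:
  assumes 1: "bmeas_functional M \<Lambda>" and 2: "bmeas_functional M \<Lambda>'"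
  shows "bmeas_functional M (\<lambda>f. a * \<Lambda> f + b * \<Lambda>' f)"
proof -
  obtain K L where KL: "0 \<le> K" "0 \<le> L"
    "\<And>C f. f \<in> bmeas M \<Longrightarrow> (\<And>\<omega>. \<omega> \<in> space M \<Longrightarrow> \<bar>f \<omega>\<bar> \<le> C) \<Longrightarrow> \<bar>\<Lambda> f\<bar> \<le> K * C"
    "\<And>C f. f \<in> bmeas M \<Longrightarrow> (\<And>\<omega>. \<omega> \<in> space M \<Longrightarrow> \<bar>f \<omega>\<bar> \<le> C) \<Longrightarrow> \<bar>\<Lambda>' f\<bar> \<le> L * C"
    using bmeas_functional_bound[OF 1] bmeas_functional_bound[OF 2] by metis
  show ?thesis
  proof (rule bmeas_functionalI[where K = "\<bar>a\<bar> * K + \<bar>b\<bar> * L"])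
    fix C f assume f: "f \<in> bmeas M" "\<And>\<omega>. \<omega> \<in> space M \<Longrightarrow> \<bar>f \<omega>\<bar> \<le> C"
    have "\<bar>a * \<Lambda> f\<bar> \<le> \<bar>a\<bar> * (K * C)" "\<bar>b * \<Lambda>' f\<bar> \<le> \<bar>b\<bar> * (L * C)"
      using KL(3,4)[OF f] by (auto simp: abs_mult intro!: mult_left_mono)
    then show "\<bar>a * \<Lambda> f + b * \<Lambda>' f\<bar> \<le> (\<bar>a\<bar> * K + \<bar>b\<bar> * L) * C"
      by (simp add: algebra_simps)
  qed (use KL in \<open>simp_all add: bmeas_functional_add[OF 1] bmeas_functional_add[OF 2]
        bmeas_functional_scale[OF 1] bmeas_functional_scale[OF 2] algebra_simps\<close>)
qed

text \<open>Extends the reduction to indicators to identities that involve a density or a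
  restriction to an event.\<close>

lemma bmeas_functional_weight:
  assumes \<Lambda>: "bmeas_functional M \<Lambda>" and g: "g \<in> bmeas M"
  shows "bmeas_functional M (\<lambda>f. \<Lambda> (\<lambda>\<omega>. g \<omega> * f \<omega>))"
proof -
  obtain K where K: "0 \<le> K"
    "\<And>C f. f \<in> bmeas M \<Longrightarrow> (\<And>\<omega>. \<omega> \<in> space M \<Longrightarrow> \<bar>f \<omega>\<bar> \<le> C) \<Longrightarrow> \<bar>\<Lambda> f\<bar> \<le> K * C"
    using bmeas_functional_bound[OF \<Lambda>] by metis
  obtain D where D: "0 \<le> D" "\<And>\<omega>. \<omega> \<in> space M \<Longrightarrow> \<bar>g \<omega>\<bar> \<le> D" using bmeas_bound[OF g] by metis
  show ?thesis
  proof (rule bmeas_functionalI[where K = "K * D"])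
    fix C f assume f: "f \<in> bmeas M" "\<And>\<omega>. \<omega> \<in> space M \<Longrightarrow> \<bar>f \<omega>\<bar> \<le> C"
    have "\<bar>\<Lambda> (\<lambda>\<omega>. g \<omega> * f \<omega>)\<bar> \<le> K * (D * C)"
      using D f g by (intro K bmeas_mult) (auto simp: abs_mult intro!: mult_mono)
    then show "\<bar>\<Lambda> (\<lambda>\<omega>. g \<omega> * f \<omega>)\<bar> \<le> K * D * C" by (simp add: mult.assoc)
  next
    fix f h assume "f \<in> bmeas M" "h \<in> bmeas M"
    then show "\<Lambda> (\<lambda>\<omega>. g \<omega> * (f \<omega> + h \<omega>)) = \<Lambda> (\<lambda>\<omega>. g \<omega> * f \<omega>) + \<Lambda> (\<lambda>\<omega>. g \<omega> * h \<omega>)"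
      using bmeas_functional_add[OF \<Lambda>, of "\<lambda>\<omega>. g \<omega> * f \<omega>" "\<lambda>\<omega>. g \<omega> * h \<omega>"] g
      by (simp add: bmeas_mult distrib_left)
  next
    fix a f assume "f \<in> bmeas M"
    then show "\<Lambda> (\<lambda>\<omega>. g \<omega> * (a * f \<omega>)) = a * \<Lambda> (\<lambda>\<omega>. g \<omega> * f \<omega>)"
      using bmeas_functional_scale[OF \<Lambda>, of "\<lambda>\<omega>. g \<omega> * f \<omega>" a] g
      by (simp add: bmeas_mult mult.left_commute)
  qed (use K D in simp)
qed

text \<open>For \<open>f \<ge> 0\<close> the layers \<open>{f \<ge> k e}\<close> give a simple function with \<open>s \<le> f \<le> s + e\<close>.\<close>

lemma bmeas_functional_nonneg:
  assumes \<Lambda>: "bmeas_functional M \<Lambda>" and ind: "\<And>A. A \<in> sets M \<Longrightarrow> 0 \<le> \<Lambda> (indicator A)"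
    and f: "f \<in> bmeas M" "\<And>\<omega>. \<omega> \<in> space M \<Longrightarrow> 0 \<le> f \<omega>"
  shows "0 \<le> \<Lambda> f"
proof -
  obtain K where K: "0 \<le> K"
    "\<And>C f. f \<in> bmeas M \<Longrightarrow> (\<And>\<omega>. \<omega> \<in> space M \<Longrightarrow> \<bar>f \<omega>\<bar> \<le> C) \<Longrightarrow> \<bar>\<Lambda> f\<bar> \<le> K * C"
    using bmeas_functional_bound[OF \<Lambda>] by metis
  obtain C where C: "\<And>\<omega>. \<omega> \<in> space M \<Longrightarrow> \<bar>f \<omega>\<bar> \<le> C" using bmeas_bound[OF f(1)] by metis
  note [measurable] = bmeas_measurable[OF f(1)]
  have approx: "- (K * e) \<le> \<Lambda> f" if e: "0 < e" for e
  proof -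
    obtain N :: nat where "C / e < N" using reals_Archimedean2 by blast
    then have N: "C < N * e" using e by (simp add: field_simps)
    define L where "L k = {\<omega> \<in> space M. real k * e \<le> f \<omega>}" for k
    have L: "L k \<in> sets M" for k unfolding L_def by measurable
    define s where "s = (\<lambda>\<omega>. \<Sum>k\<in>{1..N}. e * indicator (L k) \<omega>)"
    have s_bm: "s \<in> bmeas M" unfolding s_def using L
      by (intro bmeas_sum bmeas_scale bmeas_indicator) auto
    have "\<Lambda> s = (\<Sum>k\<in>{1..N}. \<Lambda> (\<lambda>\<omega>. e * indicator (L k) \<omega>))"
      unfolding s_def using L by (intro bmeas_functional_sum[OF \<Lambda>] bmeas_scale bmeas_indicator) auto
    also have "\<dots> = (\<Sum>k\<in>{1..N}. e * \<Lambda> (indicator (L k)))"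
      using L by (intro sum.cong bmeas_functional_scale[OF \<Lambda>] bmeas_indicator) auto
    finally have s0: "0 \<le> \<Lambda> s" using ind L e by (auto intro!: sum_nonneg)
    have "\<bar>f \<omega> - s \<omega>\<bar> \<le> e" if w: "\<omega> \<in> space M" for \<omega>
    proof -
      \<comment> \<open>The number of layers that contain \<open>\<omega>\<close>. Hence
        \<open>s \<omega> = e * ?n\<close>, which misses \<open>f \<omega>\<close> by less than
        \<open>e\<close>.\<close>
      let ?n = "nat \<lfloor>f \<omega> / e\<rfloor>"
      have n: "real ?n \<le> f \<omega> / e" "f \<omega> / e < real ?n + 1"
        using f(2)[OF w] e by (auto simp: of_nat_nat floor_divide_lower intro!: floor_divide_upper)
      have "f \<omega> < N * e" using C[OF w] N by linarith
      moreover have "e * real ?n \<le> f \<omega>" using n(1) e by (simp add: field_simps)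
      ultimately have "e * real ?n < e * real N" by (simp add: mult.commute)
      then have "real ?n < real N" using e by simp
      have "{k \<in> {1..N}. \<omega> \<in> L k} = {1..?n}"
      proof (intro set_eqI iffI)
        fix k assume "k \<in> {k \<in> {1..N}. \<omega> \<in> L k}"
        then have "1 \<le> k" "real k \<le> f \<omega> / e" using e by (auto simp: L_def field_simps)
        then have "real k < real ?n + 1" using n by linarith
        then show "k \<in> {1..?n}" using \<open>1 \<le> k\<close> by simp
      next
        fix k assume k: "k \<in> {1..?n}"
        then have "real k \<le> real ?n" by simp
        then have "real k \<le> f \<omega> / e" using n by linarith
        then show "k \<in> {k \<in> {1..N}. \<omega> \<in> L k}"
          using k w e \<open>real ?n < real N\<close> by (auto simp: L_def field_simps)
      qed
      then have "s \<omega> = e * real ?n"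
        by (simp add: s_def indicator_def sum.If_cases sum_distrib_left[symmetric] Int_def)
      moreover have "e * real ?n \<le> f \<omega>" "f \<omega> < e * real ?n + e"
        using n e by (simp_all add: field_simps)
      ultimately show ?thesis by simp
    qed
    then have "\<bar>\<Lambda> (\<lambda>\<omega>. f \<omega> - s \<omega>)\<bar> \<le> K * e" using f s_bm by (intro K bmeas_diff) auto
    then show ?thesis using s0 bmeas_functional_diff[OF \<Lambda> f(1) s_bm] by linarith
  qed
  show ?thesis
  proof (rule ccontr)
    assume "\<not> ?thesis"
    then have neg: "\<Lambda> f < 0" by simp
    \<comment> \<open>Chosen such that \<open>K * e < - \<Lambda> f\<close>; the summand 1 keeps the
      quotient meaningful when \<open>K = 0\<close>.\<close>
    define e where "e = - \<Lambda> f / (2 * (K + 1))"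
    have "0 < e" using neg K by (auto simp: e_def divide_neg_pos)
    moreover have "K * e < - \<Lambda> f"
    proof -
      have "(K + 1) * e = - \<Lambda> f / 2" using K(1) by (simp add: e_def field_simps)
      then show ?thesis using neg \<open>0 < e\<close> by (simp add: algebra_simps)
    qed
    ultimately show False using approx[of e] by linarith
  qed
qed

text \<open>The difference of the two functionals vanishes on indicators, hence on constants, and is
  nonnegative at \<open>f + C\<close> by the layer approximation. So it is nonnegative at
  \<open>f\<close>, and exchanging the two functionals gives equality.\<close>

lemma bmeas_functional_eqI:
  assumes 1: "bmeas_functional M \<Lambda>" and 2: "bmeas_functional M \<Lambda>'"
    and ind: "\<And>A. A \<in> sets M \<Longrightarrow> \<Lambda> (indicator A) = \<Lambda>' (indicator A)" and f: "f \<in> bmeas M"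
  shows "\<Lambda> f = \<Lambda>' f"
proof -
  have le: "\<Lambda> f \<le> \<Lambda>' f"
    if 1: "bmeas_functional M \<Lambda>" and 2: "bmeas_functional M \<Lambda>'"
      and ind: "\<And>A. A \<in> sets M \<Longrightarrow> \<Lambda> (indicator A) = \<Lambda>' (indicator A)" for \<Lambda> \<Lambda>'
  proof -
    obtain C where C: "\<And>\<omega>. \<omega> \<in> space M \<Longrightarrow> \<bar>f \<omega>\<bar> \<le> C" using bmeas_bound[OF f] by metis
    let ?\<Xi> = "\<lambda>f. 1 * \<Lambda>' f + (- 1) * \<Lambda> f"
    have \<Xi>: "bmeas_functional M ?\<Xi>" by (rule bmeas_functional_combine[OF 2 1])
    have "0 \<le> ?\<Xi> (\<lambda>\<omega>. f \<omega> + C * indicator (space M) \<omega>)"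
    proof (rule bmeas_functional_nonneg[OF \<Xi>])
      show "0 \<le> ?\<Xi> (indicator A)" if "A \<in> sets M" for A using ind[OF that] by simp
      show "(\<lambda>\<omega>. f \<omega> + C * indicator (space M) \<omega>) \<in> bmeas M"
        by (intro bmeas_add bmeas_scale bmeas_indicator f sets.top)
      show "0 \<le> f \<omega> + C * indicator (space M) \<omega>" if "\<omega> \<in> space M" for \<omega>
        using C[OF that] that by (simp add: abs_le_iff)
    qed
    moreover have "?\<Xi> (\<lambda>\<omega>. C * indicator (space M) \<omega>) = 0"
      using bmeas_functional_scale[OF \<Xi> bmeas_indicator[OF sets.top], of C] ind[OF sets.top] by simp
    ultimately show ?thesis
      using bmeas_functional_add[OF \<Xi> f bmeas_scale[OF bmeas_indicator[OF sets.top], of C]] by simp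
  qed
  show ?thesis using le[OF 1 2 ind] le[OF 2 1 ind[symmetric]] by simp
qed

lemma bmeas_integrable:
  assumes "finite_measure N" "sets N = sets M" "f \<in> bmeas M"
  shows "integrable N f"
proof -
  interpret finite_measure N by fact
  obtain C where C: "\<And>\<omega>. \<omega> \<in> space M \<Longrightarrow> \<bar>f \<omega>\<bar> \<le> C" using bmeas_bound[OF assms(3)] by metis
  have "f \<in> borel_measurable N"
    using bmeas_measurable[OF assms(3)] by (simp add: measurable_cong_sets[OF assms(2) refl])
  then show ?thesis
    using C sets_eq_imp_space_eq[OF assms(2)] by (intro integrable_const_bound[of _ C]) auto
qed

lemma abs_integral_le:
  assumes "finite_measure N" "sets N = sets M" "f \<in> bmeas M"
    and C: "\<And>\<omega>. \<omega> \<in> space M \<Longrightarrow> \<bar>f \<omega>\<bar> \<le> C"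
  shows "\<bar>\<integral>\<omega>. f \<omega> \<partial>N\<bar> \<le> measure N (space M) * C"
proof -
  interpret finite_measure N by fact
  have "\<bar>\<integral>\<omega>. f \<omega> \<partial>N\<bar> \<le> (\<integral>\<omega>. \<bar>f \<omega>\<bar> \<partial>N)" by (rule integral_abs_bound)
  also have "\<dots> \<le> (\<integral>\<omega>. C \<partial>N)"
    using C sets_eq_imp_space_eq[OF assms(2)] bmeas_integrable[OF assms(1-3)]
    by (intro integral_mono) auto
  finally show ?thesis using sets_eq_imp_space_eq[OF assms(2)] by simp
qed

lemma bmeas_functional_integral:
  assumes "finite_measure N" "sets N = sets M"
  shows "bmeas_functional M (\<lambda>f. \<integral>\<omega>. f \<omega> \<partial>N)"
  using assms bmeas_integrable[OF assms] abs_integral_le[OF assms]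
  by (intro bmeas_functionalI[where K = "measure N (space M)"]) auto

section \<open>Integration against signed measures\<close>

definition pmeasure :: "'a measure \<Rightarrow> ('a set \<Rightarrow> real) \<Rightarrow> 'a measure" where
  "pmeasure M \<mu> = measure_of (space M) (sets M) (\<lambda>A. ennreal (\<mu> A))"

lemma sets_pmeasure [simp]: "sets (pmeasure M \<mu>) = sets M"
  and space_pmeasure [simp]: "space (pmeasure M \<mu>) = space M"
  by (simp_all add: pmeasure_def)

context
  fixes M :: "'a measure" and \<mu>
  assumes \<mu>: "\<mu> \<in> ca M" and nonneg: "\<And>A. A \<in> sets M \<Longrightarrow> 0 \<le> \<mu> A"
begin

lemma emeasure_pmeasure: "A \<in> sets M \<Longrightarrow> emeasure (pmeasure M \<mu>) A = ennreal (\<mu> A)"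
  unfolding pmeasure_def
proof (rule emeasure_measure_of_sigma)
  show "sigma_algebra (space M) (sets M)" ..
  show "positive (sets M) (\<lambda>A. ennreal (\<mu> A))" by (simp add: positive_def ca_empty[OF \<mu>])
  show "countably_additive (sets M) (\<lambda>A. ennreal (\<mu> A))"
    unfolding countably_additive_def
  proof (intro allI impI)
    fix A :: "nat \<Rightarrow> 'a set" assume A: "range A \<subseteq> sets M" "disjoint_family A"
    have "(\<lambda>n. ennreal (\<mu> (A n))) sums ennreal (\<mu> (\<Union>n. A n))"
      using ca_sums[OF \<mu> A] A nonneg by (subst sums_ennreal) auto
    then show "(\<Sum>n. ennreal (\<mu> (A n))) = ennreal (\<mu> (\<Union>n. A n))" by (rule sums_unique[symmetric])
  qed
qed

lemma finite_measure_pmeasure: "finite_measure (pmeasure M \<mu>)"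
  by (rule finite_measureI) (simp add: emeasure_pmeasure)

lemma measure_pmeasure: "measure (pmeasure M \<mu>) = \<mu>"
proof
  fix A show "measure (pmeasure M \<mu>) A = \<mu> A"
    by (cases "A \<in> sets M")
      (simp_all add: measure_def emeasure_pmeasure nonneg emeasure_notin_sets ca_outside[OF \<mu>])
qed

end

context
  fixes M :: "'a measure" and \<mu>
  assumes \<mu>: "\<mu> \<in> ca M"
begin

private lemma parts:
  shows "(\<lambda>A. (tv M \<mu> A + \<mu> A) / 2) \<in> ca M" "(\<lambda>A. (tv M \<mu> A - \<mu> A) / 2) \<in> ca M"
    "0 \<le> (tv M \<mu> A + \<mu> A) / 2" "0 \<le> (tv M \<mu> A - \<mu> A) / 2"
  using ca_scale[OF ca_add[OF ca_tv[OF \<mu>] \<mu>], of "1/2"]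
    ca_scale[OF ca_subtract[OF ca_tv[OF \<mu>] \<mu>], of "1/2"] abs_le_tv[OF \<mu>, of A]
  by (auto simp: abs_le_iff)

private lemma part_measures:
  "pos_part_measure M \<mu> = pmeasure M (\<lambda>A. (tv M \<mu> A + \<mu> A) / 2)"
  "neg_part_measure M \<mu> = pmeasure M (\<lambda>A. (tv M \<mu> A - \<mu> A) / 2)"
  by (simp_all add: pos_part_measure_def neg_part_measure_def pmeasure_def)

lemma signed_integral_functional: "bmeas_functional M (signed_integral M \<mu>)"
proof -
  have "bmeas_functional M (\<lambda>f. 1 * (\<integral>\<omega>. f \<omega> \<partial>pos_part_measure M \<mu>) +
      (- 1) * (\<integral>\<omega>. f \<omega> \<partial>neg_part_measure M \<mu>))"
    unfolding part_measures using parts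
    by (intro bmeas_functional_combine bmeas_functional_integral finite_measure_pmeasure) simp_all
  then show ?thesis by (simp add: signed_integral_def[abs_def])
qed

lemma abs_signed_integral_le:
  assumes "f \<in> bmeas M" "\<And>\<omega>. \<omega> \<in> space M \<Longrightarrow> \<bar>f \<omega>\<bar> \<le> C"
  shows "\<bar>signed_integral M \<mu> f\<bar> \<le> tv M \<mu> (space M) * C"
proof -
  have "\<bar>\<integral>\<omega>. f \<omega> \<partial>pos_part_measure M \<mu>\<bar> \<le> (tv M \<mu> (space M) + \<mu> (space M)) / 2 * C"
    using abs_integral_le[OF finite_measure_pmeasure[OF parts(1,3)] _ assms]
    unfolding part_measures measure_pmeasure[OF parts(1,3)] by simp
  moreover have "\<bar>\<integral>\<omega>. f \<omega> \<partial>neg_part_measure M \<mu>\<bar> \<le> (tv M \<mu> (space M) - \<mu> (space M)) / 2 * C"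
    using abs_integral_le[OF finite_measure_pmeasure[OF parts(2,4)] _ assms]
    unfolding part_measures measure_pmeasure[OF parts(2,4)] by simp
  ultimately show ?thesis by (simp add: signed_integral_def field_simps)
qed

lemma signed_integral_cong:
  assumes N: "N \<in> sets M" "tv M \<mu> N = 0" and f: "f \<in> borel_measurable M" "g \<in> borel_measurable M"
    and eq: "\<And>\<omega>. \<omega> \<in> space M - N \<Longrightarrow> f \<omega> = g \<omega>"
  shows "signed_integral M \<mu> f = signed_integral M \<mu> g"
proof -
  have "\<mu> N = 0" using abs_le_tv[OF \<mu>, of N] N by simp
  then have null: "N \<in> null_sets (pmeasure M (\<lambda>A. (tv M \<mu> A + \<mu> A) / 2))"
    "N \<in> null_sets (pmeasure M (\<lambda>A. (tv M \<mu> A - \<mu> A) / 2))"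
    using N by (simp_all add: null_sets_def emeasure_pmeasure[OF parts(1,3)] emeasure_pmeasure[OF
      parts(2,4)])
  have "(\<integral>\<omega>. f \<omega> \<partial>pmeasure M \<nu>) = (\<integral>\<omega>. g \<omega> \<partial>pmeasure M \<nu>)" if "N \<in> null_sets (pmeasure M \<nu>)" for \<nu>
  proof (rule integral_cong_AE)
    show "AE \<omega> in pmeasure M \<nu>. f \<omega> = g \<omega>" by (rule AE_I'[OF that]) (use eq in auto)
  qed (use f in \<open>simp_all add: measurable_cong_sets[OF sets_pmeasure refl]\<close>)
  then show ?thesis unfolding signed_integral_def part_measures using null by simp
qed

lemma signed_integral_indicator:
  assumes A: "A \<in> sets M"
  shows "signed_integral M \<mu> (indicator A) = \<mu> A"
proof -
  have "A \<inter> space M = A" using A sets.sets_into_space by blast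
  then show ?thesis
    using A unfolding signed_integral_def part_measures
    by (simp add: measure_pmeasure[OF parts(1,3)] measure_pmeasure[OF parts(2,4)]
        diff_divide_distrib[symmetric])
qed

end

lemma signed_integral_add:
  assumes "\<mu> \<in> ca M" "\<nu> \<in> ca M" "f \<in> bmeas M"
  shows "signed_integral M (\<lambda>A. \<mu> A + \<nu> A) f = signed_integral M \<mu> f + signed_integral M \<nu> f"
proof -
  have "signed_integral M (\<lambda>A. \<mu> A + \<nu> A) f = 1 * signed_integral M \<mu> f + 1 * signed_integral M \<nu> f"
    by (rule bmeas_functional_eqI[OF signed_integral_functional[OF ca_add[OF assms(1,2)]]
          bmeas_functional_combine[OF assms(1,2)[THEN signed_integral_functional]] _ assms(3)])
      (simp add: signed_integral_indicator assms ca_add)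
  then show ?thesis by simp
qed

lemma signed_integral_scale:
  assumes "\<mu> \<in> ca M" "f \<in> bmeas M"
  shows "signed_integral M (\<lambda>A. a * \<mu> A) f = a * signed_integral M \<mu> f"
proof -
  note \<Lambda> = signed_integral_functional[OF assms(1)]
  have "signed_integral M (\<lambda>A. a * \<mu> A) f = a * signed_integral M \<mu> f + 0 * signed_integral M \<mu> f"
    by (rule bmeas_functional_eqI[OF signed_integral_functional[OF ca_scale[OF assms(1)]]
          bmeas_functional_combine[OF \<Lambda> \<Lambda>] _ assms(2)])
      (simp add: signed_integral_indicator assms ca_scale)
  then show ?thesis by simp
qed

lemma signed_integral_restr:
  assumes "\<mu> \<in> ca M" "B \<in> sets M" "f \<in> bmeas M"
  shows "signed_integral M (restr M \<mu> B) f = signed_integral M \<mu> (\<lambda>\<omega>. indicator B \<omega> * f \<omega>)"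
proof -
  let ?\<Lambda> = "\<lambda>f. signed_integral M \<mu> (\<lambda>\<omega>. indicator B \<omega> * f \<omega>)"
  have 1: "bmeas_functional M (signed_integral M (restr M \<mu> B))"
    by (rule signed_integral_functional[OF ca_restr[OF assms(1,2)]])
  have 2: "bmeas_functional M ?\<Lambda>"
    by (rule bmeas_functional_weight[OF signed_integral_functional[OF assms(1)] bmeas_indicator[OF
      assms(2)]])
  have 3: "signed_integral M (restr M \<mu> B) (indicator A) = ?\<Lambda> (indicator A)" if A: "A \<in> sets M"
    for A
  proof -
    have eq: "(\<lambda>\<omega>. indicator B \<omega> * indicator A \<omega> :: real) = indicator (A \<inter> B)"
      by (rule ext) (simp split: split_indicator)
    show ?thesis
      unfolding eq using A assms
        by (simp only: signed_integral_indicator ca_restr restr_apply sets.Int)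
  qed
  show ?thesis by (rule bmeas_functional_eqI[OF 1 2 3 assms(3)])
qed

lemma signed_integral_nonneg:
  assumes "\<mu> \<in> ca M" "\<And>A. A \<in> sets M \<Longrightarrow> 0 \<le> \<mu> A" "f \<in> bmeas M" "\<And>\<omega>. \<omega> \<in> space M \<Longrightarrow> 0 \<le> f \<omega>"
  shows "0 \<le> signed_integral M \<mu> f"
  by (rule bmeas_functional_nonneg[OF signed_integral_functional[OF assms(1)] _ assms(3,4)])
    (simp_all add: signed_integral_indicator assms(1,2))

lemma signed_integral_eq_integral:
  assumes "\<mu> \<in> ca M" "\<And>A. A \<in> sets M \<Longrightarrow> 0 \<le> \<mu> A" "f \<in> bmeas M"
  shows "signed_integral M \<mu> f = (\<integral>\<omega>. f \<omega> \<partial>pmeasure M \<mu>)"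
proof (rule bmeas_functional_eqI[OF signed_integral_functional[OF assms(1)]
      bmeas_functional_integral[OF finite_measure_pmeasure[OF assms(1,2)] sets_pmeasure] _
        assms(3)])
  fix A assume A: "A \<in> sets M"
  then have "A \<inter> space M = A" using sets.sets_into_space by blast
  then show "signed_integral M \<mu> (indicator A) = (\<integral>\<omega>. indicator A \<omega> \<partial>pmeasure M \<mu>)"
    using A assms(1,2) by (simp add: signed_integral_indicator measure_pmeasure)
qed

section \<open>Densities\<close>

text \<open>The Radon-Nikodym theorem in terms of set functions. Applied to total variations it
  locates the support of an absolutely continuous measure; under a bound it is sharpened to a
  bounded density next.\<close>

lemma ca_density:
  assumes \<beta>: "\<beta> \<in> ca M" "\<And>A. A \<in> sets M \<Longrightarrow> 0 \<le> \<beta> A"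
    and \<alpha>: "\<alpha> \<in> ca M" "\<And>A. A \<in> sets M \<Longrightarrow> 0 \<le> \<alpha> A"
    and ac: "\<And>A. A \<in> sets M \<Longrightarrow> \<beta> A = 0 \<Longrightarrow> \<alpha> A = 0"
  shows "\<exists>g\<in>borel_measurable M. \<forall>A\<in>sets M.
    (\<integral>\<^sup>+\<omega>. g \<omega> * indicator A \<omega> \<partial>pmeasure M \<beta>) = ennreal (\<alpha> A)"
proof -
  interpret B: finite_measure "pmeasure M \<beta>" using \<beta> by (rule finite_measure_pmeasure)
  have "absolutely_continuous (pmeasure M \<beta>) (pmeasure M \<alpha>)"
    unfolding absolutely_continuous_def
  proof
    fix A assume "A \<in> null_sets (pmeasure M \<beta>)"
    then have A: "A \<in> sets M" "\<beta> A = 0"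
      using \<beta> by (auto simp: null_sets_def emeasure_pmeasure ennreal_eq_0_iff intro: antisym)
    then show "A \<in> null_sets (pmeasure M \<alpha>)"
      using ac[OF A] by (simp add: null_sets_def emeasure_pmeasure[OF \<alpha>])
  qed
  then obtain g where g: "g \<in> borel_measurable (pmeasure M \<beta>)"
    "density (pmeasure M \<beta>) g = pmeasure M \<alpha>"
    using B.Radon_Nikodym[of "pmeasure M \<alpha>"] by auto
  have "(\<integral>\<^sup>+\<omega>. g \<omega> * indicator A \<omega> \<partial>pmeasure M \<beta>) = ennreal (\<alpha> A)" if "A \<in> sets M" for A
    using emeasure_density[OF g(1), of A] that g(2) by (simp add: emeasure_pmeasure[OF \<alpha>])
  moreover have "g \<in> borel_measurable M"
    using g(1) by (simp add: measurable_cong_sets[OF sets_pmeasure refl])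
  ultimately show ?thesis by blast
qed

text \<open>The Radon-Nikodym density is almost everywhere finite and at most \<open>K\<close>.
  Truncation makes the bounds hold everywhere, which the pointwise estimates of the gluing argument
  use.\<close>

lemma ca_bounded_density:
  assumes \<beta>: "\<beta> \<in> ca M" "\<And>A. A \<in> sets M \<Longrightarrow> 0 \<le> \<beta> A"
    and \<alpha>: "\<alpha> \<in> ca M" "\<And>A. A \<in> sets M \<Longrightarrow> 0 \<le> \<alpha> A"
    and K: "0 \<le> K" and le: "\<And>A. A \<in> sets M \<Longrightarrow> \<alpha> A \<le> K * \<beta> A"
  shows "\<exists>h\<in>bmeas M. (\<forall>\<omega>. 0 \<le> h \<omega> \<and> h \<omega> \<le> K) \<and>
    (\<forall>A\<in>sets M. \<alpha> A = signed_integral M \<beta> (\<lambda>\<omega>. h \<omega> * indicator A \<omega>))"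
proof -
  have "\<alpha> A = 0" if "A \<in> sets M" "\<beta> A = 0" for A
    using le[OF that(1)] \<alpha>(2)[OF that(1)] that(2) by simp
  then obtain g where g: "g \<in> borel_measurable M" and gA: "\<And>A. A \<in> sets M \<Longrightarrow>
      (\<integral>\<^sup>+\<omega>. g \<omega> * indicator A \<omega> \<partial>pmeasure M \<beta>) = ennreal (\<alpha> A)"
    using ca_density[OF \<beta> \<alpha>] by blast
  let ?N = "pmeasure M \<beta>"
  interpret finite_measure ?N using \<beta> by (rule finite_measure_pmeasure)
  have mN: "borel_measurable ?N = (borel_measurable M :: ('a \<Rightarrow> 'c::topological_space) set)"
    by (rule measurable_cong_sets) simp_all
  have [measurable]: "g \<in> borel_measurable ?N"
    using g by (simp add: measurable_cong_sets[OF sets_pmeasure refl])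
  have "(\<integral>\<^sup>+\<omega>. g \<omega> \<partial>?N) = (\<integral>\<^sup>+\<omega>. g \<omega> * indicator (space M) \<omega> \<partial>?N)"
    by (rule nn_integral_cong) simp
  also have "\<dots> = ennreal (\<alpha> (space M))" by (rule gA) simp
  finally have "(\<integral>\<^sup>+\<omega>. g \<omega> \<partial>?N) \<noteq> \<infinity>" by simp
  then have fin: "AE \<omega> in ?N. g \<omega> \<noteq> \<infinity>" by (intro nn_integral_noteq_infinite) simp_all
  define k where "k = (\<lambda>\<omega>. enn2real (g \<omega>))"
  have [measurable]: "k \<in> borel_measurable ?N" unfolding k_def by simp
  have kA: "integrable ?N (\<lambda>\<omega>. k \<omega> * indicator A \<omega>)" "(\<integral>\<omega>. k \<omega> * indicator A \<omega> \<partial>?N) = \<alpha> A"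
    if A: "A \<in> sets M" for A
  proof -
    have [measurable]: "A \<in> sets ?N" using A by simp
    have eq: "(\<integral>\<^sup>+\<omega>. ennreal (k \<omega> * indicator A \<omega>) \<partial>?N) = ennreal (\<alpha> A)"
      unfolding gA[OF A, symmetric]
      by (rule nn_integral_cong_AE) (use fin in \<open>auto simp: k_def less_top split: split_indicator\<close>)
    show int: "integrable ?N (\<lambda>\<omega>. k \<omega> * indicator A \<omega>)"
      by (rule integrableI_nonneg) (use eq in \<open>auto simp: k_def\<close>)
    have "ennreal (\<integral>\<omega>. k \<omega> * indicator A \<omega> \<partial>?N) = ennreal (\<alpha> A)"
      using nn_integral_eq_integral[OF int] eq by (auto simp: k_def)
    moreover have "0 \<le> (\<integral>\<omega>. k \<omega> * indicator A \<omega> \<partial>?N)" by (auto simp: k_def)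
    ultimately show "(\<integral>\<omega>. k \<omega> * indicator A \<omega> \<partial>?N) = \<alpha> A" using \<alpha>(2)[OF A] by simp
  qed
  \<comment> \<open>On the event where the density exceeds \<open>K\<close>, the integral of its
    excess over \<open>K\<close> is \<open>\<alpha> - K * \<beta>\<close>, at most 0, although the
    integrand is nonnegative.\<close>
  have le_K: "AE \<omega> in ?N. k \<omega> \<le> K"
  proof -
    let ?A = "{\<omega> \<in> space ?N. K < k \<omega>}"
    have "?A \<in> sets ?N" by measurable
    then have A: "?A \<in> sets M" by simp
    have int: "integrable ?N (\<lambda>\<omega>. k \<omega> * indicator ?A \<omega> - K * indicator ?A \<omega>)"
      using kA(1)[OF A] A by (intro Bochner_Integration.integrable_diff integrable_mult_right)
        (auto simp: emeasure_pmeasure[OF \<beta>])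
    have "(\<integral>\<omega>. k \<omega> * indicator ?A \<omega> - K * indicator ?A \<omega> \<partial>?N) =
        (\<integral>\<omega>. k \<omega> * indicator ?A \<omega> \<partial>?N) - (\<integral>\<omega>. K * indicator ?A \<omega> \<partial>?N)"
      using kA(1)[OF A] A by (intro Bochner_Integration.integral_diff integrable_mult_right) (auto
        simp: emeasure_pmeasure[OF \<beta>])
    also have "\<dots> = \<alpha> ?A - K * \<beta> ?A"
    proof -
      have "?A \<inter> space M = ?A" by auto
      then show ?thesis unfolding kA(2)[OF A] by (simp add: measure_pmeasure[OF \<beta>])
    qed
    finally have "(\<integral>\<omega>. k \<omega> * indicator ?A \<omega> - K * indicator ?A \<omega> \<partial>?N) \<le> 0" using le[OF A] by simp
    moreover have nn: "0 \<le> k \<omega> * indicator ?A \<omega> - K * indicator ?A \<omega>" for \<omega>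
      by (simp split: split_indicator)
    ultimately have "(\<integral>\<omega>. k \<omega> * indicator ?A \<omega> - K * indicator ?A \<omega> \<partial>?N) = 0"
      by (intro antisym integral_nonneg) simp_all
    then have "AE \<omega> in ?N. k \<omega> * indicator ?A \<omega> - K * indicator ?A \<omega> = 0"
      using integral_nonneg_eq_0_iff_AE[OF int] nn by simp
    then show ?thesis
      using AE_space by eventually_elim (auto split: split_indicator_asm)
  qed
  \<comment> \<open>Agrees with \<open>k\<close> almost everywhere and is bounded at every
    point.\<close>
  define h where "h = (\<lambda>\<omega>. min K (k \<omega>))"
  have "h \<in> borel_measurable ?N" unfolding h_def by simp
  then have "h \<in> borel_measurable M" by (simp add: measurable_cong_sets[OF sets_pmeasure refl])
  moreover have h_le: "0 \<le> h \<omega> \<and> h \<omega> \<le> K" for \<omega> using K by (simp add: h_def k_def)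
  ultimately have hb: "h \<in> bmeas M" by (intro bmeasI[of _ _ K]) auto
  have "\<alpha> A = signed_integral M \<beta> (\<lambda>\<omega>. h \<omega> * indicator A \<omega>)" if A: "A \<in> sets M" for A
  proof -
    have [measurable]: "A \<in> sets ?N" using A by simp
    have [measurable]: "h \<in> borel_measurable ?N" unfolding h_def by simp
    have "\<alpha> A = (\<integral>\<omega>. k \<omega> * indicator A \<omega> \<partial>?N)" by (simp add: kA(2)[OF A])
    also have "\<dots> = (\<integral>\<omega>. h \<omega> * indicator A \<omega> \<partial>?N)"
      by (rule integral_cong_AE) (use le_K in \<open>auto simp: h_def\<close>)
    also have "\<dots> = signed_integral M \<beta> (\<lambda>\<omega>. h \<omega> * indicator A \<omega>)"
      using hb A by (intro signed_integral_eq_integral[symmetric] \<beta> bmeas_mult bmeas_indicator)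
    finally show ?thesis .
  qed
  then show ?thesis using hb h_le by blast
qed

text \<open>Uniformity over all events lets the limit in \<open>n\<close> be exchanged with the
  limit along an increasing sequence of sets.\<close>

lemma ca_uniform_limit:
  assumes \<mu>: "\<And>n. \<mu> n \<in> ca M" and out: "\<And>A. A \<notin> sets M \<Longrightarrow> \<nu> A = 0"
    and lim: "uniform_limit (sets M) \<mu> \<nu> sequentially"
  shows "\<nu> \<in> ca M"
proof (rule caI_incseq[OF out])
  have pt: "(\<lambda>n. \<mu> n A) \<longlonglongrightarrow> \<nu> A" if "A \<in> sets M" for A
    using tendsto_uniform_limitI[OF lim that] .
  fix A B assume AB: "A \<in> sets M" "B \<in> sets M" "A \<inter> B = {}"
  have "(\<lambda>n. \<mu> n A + \<mu> n B) \<longlonglongrightarrow> \<nu> A + \<nu> B" using AB by (intro tendsto_add pt)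
  then have "(\<lambda>n. \<mu> n (A \<union> B)) \<longlonglongrightarrow> \<nu> A + \<nu> B" using ca_Un[OF \<mu> AB] by simp
  then show "\<nu> (A \<union> B) = \<nu> A + \<nu> B" using pt[of "A \<union> B"] AB LIMSEQ_unique by blast
next
  fix A :: "nat \<Rightarrow> 'a set" assume A: "range A \<subseteq> sets M" "incseq A"
  have U: "(\<Union>k. A k) \<in> sets M" using A by auto
  show "(\<lambda>k. \<nu> (A k)) \<longlonglongrightarrow> \<nu> (\<Union>k. A k)"
  proof (rule LIMSEQ_I)
    fix e :: real assume "0 < e"
    then obtain n where n: "\<And>B. B \<in> sets M \<Longrightarrow> dist (\<mu> n B) (\<nu> B) < e / 3"
      using uniform_limitD[OF lim, of "e / 3"] by (auto simp: eventually_sequentially)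
    obtain K where K: "\<And>k. K \<le> k \<Longrightarrow> norm (\<mu> n (A k) - \<mu> n (\<Union>k. A k)) < e / 3"
      using LIMSEQ_D[OF ca_incseq[OF \<mu> A], of "e / 3" n] \<open>0 < e\<close> by auto
    have "norm (\<nu> (A k) - \<nu> (\<Union>k. A k)) < e" if "K \<le> k" for k
    proof -
      have "A k \<in> sets M" using A by auto
      then show ?thesis
        using K[OF that] n[of "A k"] n[OF U] unfolding dist_real_def real_norm_def by linarith
    qed
    then show "\<exists>K. \<forall>k\<ge>K. norm (\<nu> (A k) - \<nu> (\<Union>k. A k)) < e" by blast
  qed
qed

text \<open>Each of the two halves of a Hahn decomposition contributes at most
  \<open>e\<close>.\<close>

lemma tv_le_twice:
  assumes \<nu>: "\<nu> \<in> ca M" and e: "\<And>A. A \<in> sets M \<Longrightarrow> \<bar>\<nu> A\<bar> \<le> e"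
  shows "tv M \<nu> (space M) \<le> 2 * e"
proof -
  obtain H where H: "hahn_set M \<nu> H" using ca_Hahn_decomposition[OF \<nu>] by blast
  have "H \<in> sets M" using hahn_setD[OF H] by blast
  then have "\<bar>\<nu> (space M \<inter> H)\<bar> \<le> e" "\<bar>\<nu> (space M - H)\<bar> \<le> e" by (intro e; simp)+
  then show ?thesis using tv_Hahn[OF \<nu> H sets.top] by linarith
qed


section \<open>The metric of a normed vector lattice\<close>

context normed_vector_lattice
begin

lemma norm_zero: "vnorm N (vzero N) = 0"
  using norm_eq_zero[OF zero_closed] by simp

lemma norm_nonneg:
  assumes "x \<in> vcar N"
  shows "0 \<le> vnorm N x"
  using norm_triangle[OF assms scale_closed[OF assms, of "- 1"]] norm_scale[OF assms, of "- 1"]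
  by (simp add: add_inverse[OF assms] norm_zero)

lemma norm_diff_commute: "x \<in> vcar N \<Longrightarrow> y \<in> vcar N \<Longrightarrow> vnorm N (vdiff N x y) = vnorm N (vdiff N y x)"
  using norm_scale[of "vdiff N x y" "- 1"] by (simp add: diff_closed minus_diff)

lemma metric_space: "Metric_space (vcar N) (vdist N)"
proof
  show "0 \<le> vdist N x y" for x y by (simp add: vdist_def norm_nonneg diff_closed)
  show "vdist N x y = vdist N y x" for x y by (simp add: vdist_def norm_diff_commute)
  show "vdist N x y = 0 \<longleftrightarrow> x = y" if "x \<in> vcar N" "y \<in> vcar N" for x y
    using that by (simp add: vdist_def norm_eq_zero diff_closed diff_eq_zero)
  show "vdist N x z \<le> vdist N x y + vdist N y z"
    if "x \<in> vcar N" "y \<in> vcar N" "z \<in> vcar N" for x y z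
    using that norm_triangle[of "vdiff N x y" "vdiff N y z"]
    by (simp add: vdist_def diff_closed diff_add_diff)
qed

end

section \<open>Quasi-sure null sets and supported measures\<close>

locale priors =
  fixes M :: "'a measure" and \<PP> :: "'a measure set"
  assumes priors_nonempty: "\<PP> \<noteq> {}" and priors_Delta: "\<PP> \<subseteq> Delta M"
begin

definition negl :: "'a set \<Rightarrow> bool" where
  "negl A \<longleftrightarrow> A \<in> sets M \<and> (\<forall>P\<in>\<PP>. A \<in> null_sets P)"

lemma prior: "P \<in> \<PP> \<Longrightarrow> prob_space P" "P \<in> \<PP> \<Longrightarrow> sets P = sets M"
  using priors_Delta by (auto simp: Delta_def)

lemma upper_prob_eq_0: "A \<in> sets M \<Longrightarrow> upper_prob \<PP> A = 0 \<longleftrightarrow> negl A"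
  using prior unfolding upper_prob_def negl_def bot_ennreal[symmetric] SUP_bot_conv
  by (auto simp: null_sets_def bot_ennreal)

lemma negl_sets: "negl A \<Longrightarrow> A \<in> sets M"
  by (simp add: negl_def)

lemma negl_empty: "negl {}"
  by (simp add: negl_def)

lemma negl_UN: "(\<And>n :: nat. negl (A n)) \<Longrightarrow> negl (\<Union>n. A n)"
  unfolding negl_def by (auto intro!: null_sets_UN)

lemma negl_Un: "negl A \<Longrightarrow> negl B \<Longrightarrow> negl (A \<union> B)"
  unfolding negl_def by auto

lemma negl_subset: "negl B \<Longrightarrow> A \<in> sets M \<Longrightarrow> A \<subseteq> B \<Longrightarrow> negl A"
  unfolding negl_def using prior by (auto intro: null_sets_subset)

lemma dominated_iff:
  "dominated M \<SS> \<TT> \<longleftrightarrow> (\<forall>N\<in>sets M. (\<forall>\<nu>\<in>\<TT>. tv M \<nu> N \<le> 0) \<longrightarrow> (\<forall>\<mu>\<in>\<SS>. tv M \<mu> N \<le> 0))"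
  unfolding dominated_def bot_ennreal[symmetric] SUP_bot_conv
  by (simp add: bot_ennreal ennreal_eq_0_iff)

lemma tv_measure:
  assumes "prob_space Q" "sets Q = sets M"
  shows "measure Q \<in> ca M" "tv M (measure Q) = measure Q"
proof -
  interpret prob_space Q by fact
  show "measure Q \<in> ca M" by (rule ca_measure[OF _ assms(2)]) unfold_locales
  then show "tv M (measure Q) = measure Q" by (rule tv_of_nonneg) simp
qed

lemma priors_null_iff: "N \<in> sets M \<Longrightarrow> (\<forall>\<nu>\<in>measure ` \<PP>. tv M \<nu> N \<le> 0) \<longleftrightarrow> negl N"
proof -
  assume N: "N \<in> sets M"
  have "tv M (measure P) N \<le> 0 \<longleftrightarrow> N \<in> null_sets P" if "P \<in> \<PP>" for P
  proof -
    interpret prob_space P using that by (rule prior)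
    show ?thesis
      using N prior(2)[OF that] tv_measure(2)[OF prior[OF that]]
      by (simp add: null_sets_def emeasure_eq_measure measure_le_0_iff)
  qed
  then show ?thesis using N by (auto simp: negl_def)
qed

text \<open>A Hahn set cuts a negligible set into two negligible pieces. So \<open>\<mu>\<close>
  vanishes on all negligible sets exactly if its total variation does.\<close>

lemma ca_c_iff: "\<mu> \<in> ca_c M \<PP> \<longleftrightarrow> \<mu> \<in> ca M \<and> (\<forall>N. negl N \<longrightarrow> \<mu> N = 0)"
proof -
  have "(\<forall>N. negl N \<longrightarrow> tv M \<mu> N \<le> 0) \<longleftrightarrow> (\<forall>N. negl N \<longrightarrow> \<mu> N = 0)" if \<mu>: "\<mu> \<in> ca M"
  proof (intro iffI allI impI)
    fix N assume "\<forall>N. negl N \<longrightarrow> tv M \<mu> N \<le> 0" "negl N"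
    then show "\<mu> N = 0" using abs_le_tv[OF \<mu>, of N] by fastforce
  next
    fix N assume 0: "\<forall>N. negl N \<longrightarrow> \<mu> N = 0" and N: "negl N"
    obtain H where H: "hahn_set M \<mu> H" using ca_Hahn_decomposition[OF \<mu>] by blast
    have "negl (N \<inter> H)" "negl (N - H)"
      using negl_subset[OF N] negl_sets[OF N] hahn_setD(1)[OF H] by auto
    then show "tv M \<mu> N \<le> 0" using tv_Hahn[OF \<mu> H negl_sets[OF N]] 0 by simp
  qed
  then show ?thesis
    using priors_null_iff negl_sets by (auto simp: ca_c_def dominated_iff)
qed

section \<open>Supports and closure properties of supported measures\<close>

definition support :: "('a set \<Rightarrow> real) \<Rightarrow> 'a set \<Rightarrow> bool" where
  "support \<mu> S \<longleftrightarrow> S \<in> sets M \<and> \<mu> (space M - S) = 0 \<and> (\<forall>N\<in>sets M. \<mu> (N \<inter> S) = 0 \<longrightarrow> negl (N \<inter> S))"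

lemma supported_iff: "supported M \<PP> \<mu> \<longleftrightarrow> (\<exists>S. support \<mu> S)"
  unfolding supported_def support_def using upper_prob_eq_0 by (metis sets.Int)

abbreviation sca :: "('a set \<Rightarrow> real) set" where
  "sca \<equiv> vcar (sca_c M \<PP>)"

lemma sca_iff: "\<mu> \<in> sca \<longleftrightarrow> \<mu> \<in> ca M \<and> (\<forall>N. negl N \<longrightarrow> \<mu> N = 0) \<and> (\<exists>S. support (tv M \<mu>) S)"
  by (simp add: sca_c_def ca_c_iff supported_iff)

lemma sca_ca: "\<mu> \<in> sca \<Longrightarrow> \<mu> \<in> ca M"
  by (simp add: sca_iff)

lemma sca_negl: "\<mu> \<in> sca \<Longrightarrow> negl N \<Longrightarrow> \<mu> N = 0"
  by (simp add: sca_iff)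

lemma sca_tv_negl:
  assumes "\<mu> \<in> sca" "negl N"
  shows "tv M \<mu> N = 0"
proof -
  obtain H where H: "hahn_set M \<mu> H" using ca_Hahn_decomposition[OF sca_ca[OF assms(1)]] by blast
  have "negl (N \<inter> H)" "negl (N - H)"
    using negl_subset[OF assms(2)] negl_sets[OF assms(2)] hahn_setD(1)[OF H] by auto
  then show ?thesis
    using tv_Hahn[OF sca_ca[OF assms(1)] H negl_sets[OF assms(2)]] sca_negl[OF assms(1)] by simp
qed

lemma sca_support:
  assumes "\<mu> \<in> sca" "\<And>A. A \<in> sets M \<Longrightarrow> 0 \<le> \<mu> A"
  shows "\<exists>S. support \<mu> S"
  using assms tv_of_nonneg[OF sca_ca] by (metis sca_iff)

text \<open>Let \<open>g\<close> be the density of the variation of \<open>\<alpha>\<close> with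
  respect to that of \<open>\<beta>\<close>, and \<open>T\<close> a support of the latter. Then
  \<open>{g \<noteq> 0} \<inter> T\<close> is a support of \<open>\<alpha>\<close>: where
  \<open>g\<close> does not vanish, null sets of \<open>\<alpha>\<close> are null sets of
  \<open>\<beta>\<close>, hence negligible inside \<open>T\<close>. Scaling, restriction, total
  variation, sums and limits all reduce to this lemma.\<close>

lemma sca_absolutely_continuous:
  assumes \<beta>: "\<beta> \<in> sca" and \<alpha>: "\<alpha> \<in> ca M" and ac: "\<And>A. A \<in> sets M \<Longrightarrow> tv M \<beta> A = 0 \<Longrightarrow> \<alpha> A = 0"
  shows "\<alpha> \<in> sca"
proof -
  note \<beta>_ca = sca_ca[OF \<beta>]
  let ?a = "tv M \<alpha>" and ?b = "tv M \<beta>"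
  have b: "?b \<in> ca M" "\<And>A. 0 \<le> ?b A" using \<beta>_ca by (auto intro: ca_tv tv_nonneg)
  have a: "?a \<in> ca M" "\<And>A. 0 \<le> ?a A" using \<alpha> by (auto intro: ca_tv tv_nonneg)
  obtain H where H: "hahn_set M \<alpha> H" using ca_Hahn_decomposition[OF \<alpha>] by blast
  \<comment> \<open>Absolute continuity passes from \<open>\<alpha>\<close> to its total variation,
    since both halves of a null set along a Hahn set are null for \<open>\<beta>\<close>.\<close>
  have ac_tv: "?a A = 0" if A: "A \<in> sets M" "?b A = 0" for A
  proof -
    have Hs: "A \<inter> H \<in> sets M" "A - H \<in> sets M" using A hahn_setD(1)[OF H] by auto
    have "?b (A \<inter> H) \<le> ?b A" "?b (A - H) \<le> ?b A"
      by (intro tv_mono[OF \<beta>_ca] Hs A(1) Int_lower1 Diff_subset)+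
    then have "?b (A \<inter> H) = 0" "?b (A - H) = 0"
      using b(2)[of "A \<inter> H"] b(2)[of "A - H"] A(2) by simp_all
    then show ?thesis using ac Hs tv_Hahn[OF \<alpha> H A(1)] by simp
  qed
  obtain g where g[measurable]: "g \<in> borel_measurable M" and gA: "\<And>A. A \<in> sets M \<Longrightarrow>
      (\<integral>\<^sup>+\<omega>. g \<omega> * indicator A \<omega> \<partial>pmeasure M ?b) = ennreal (?a A)"
    using ca_density[OF b a ac_tv] by blast
  let ?N = "pmeasure M ?b"
  obtain T where T: "support ?b T" using \<beta> by (auto simp: sca_iff)
  then have Ts[measurable]: "T \<in> sets M" by (simp add: support_def)
  have gN[measurable]: "g \<in> borel_measurable ?N" using g
    by (simp add: measurable_cong_sets[OF sets_pmeasure refl])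
  define Z where "Z = {\<omega> \<in> space M. g \<omega> \<noteq> 0}"
  have Z[measurable]: "Z \<in> sets M" unfolding Z_def by simp
  have "support ?a (Z \<inter> T)"
    unfolding support_def
  proof (intro conjI ballI impI)
    show "Z \<inter> T \<in> sets M" by simp
    have "(\<integral>\<^sup>+\<omega>. g \<omega> * indicator (space M - Z) \<omega> \<partial>?N) = (\<integral>\<^sup>+\<omega>. 0 \<partial>?N)"
      by (rule nn_integral_cong) (auto simp: Z_def split: split_indicator)
    then have 1: "?a (space M - Z) = 0"
      using gA[of "space M - Z"] a(2)[of "space M - Z"] by (simp add: ennreal_eq_0_iff)
    have "?b (space M - T) = 0" using T by (simp add: support_def)
    then have 2: "?a (space M - T) = 0" by (intro ac_tv) simp_all
    have "?a (space M - Z \<inter> T) = ?a ((space M - Z) \<union> (Z - T))"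
      using sets.sets_into_space[OF Z] by (intro arg_cong[of _ _ ?a]) auto
    also have "\<dots> = ?a (space M - Z) + ?a (Z - T)" by (rule ca_Un[OF a(1)]) auto
    also have "?a (Z - T) \<le> ?a (space M - T)"
      using sets.sets_into_space[OF Z] by (intro tv_mono[OF \<alpha>]) auto
    finally show "?a (space M - Z \<inter> T) = 0"
      using 1 2 a(2)[of "space M - Z \<inter> T"] by simp
    fix N assume N[measurable]: "N \<in> sets M" and 0: "?a (N \<inter> (Z \<inter> T)) = 0"
    have "(\<integral>\<^sup>+\<omega>. g \<omega> * indicator (N \<inter> (Z \<inter> T)) \<omega> \<partial>?N) = 0" using gA[of "N \<inter> (Z \<inter> T)"] 0 by simp
    moreover have "(\<lambda>\<omega>. g \<omega> * indicator (N \<inter> (Z \<inter> T)) \<omega>) \<in> borel_measurable ?N"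
      by (rule borel_measurable_times_ennreal[OF gN borel_measurable_indicator]) simp
    ultimately have "AE \<omega> in ?N. g \<omega> * indicator (N \<inter> (Z \<inter> T)) \<omega> = 0"
      by (simp add: nn_integral_0_iff_AE)
    then have "AE \<omega> in ?N. \<omega> \<notin> N \<inter> (Z \<inter> T)"
      by eventually_elim (auto simp: Z_def split: split_indicator_asm)
    then have "emeasure ?N (N \<inter> (Z \<inter> T)) = 0"
      by (subst (asm) AE_iff_measurable[of "N \<inter> (Z \<inter> T)"]) (use sets.sets_into_space[OF N] in auto)
    then have "?b ((N \<inter> Z) \<inter> T) = 0"
      using b(2)[of "N \<inter> (Z \<inter> T)"] by (simp add: emeasure_pmeasure[OF b] ennreal_eq_0_iff Int_assoc)
    then have "negl ((N \<inter> Z) \<inter> T)" using T by (simp add: support_def)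
    then show "negl (N \<inter> (Z \<inter> T))" by (simp add: Int_assoc)
  qed
  moreover have "\<alpha> N = 0" if "negl N" for N
    using ac[OF negl_sets[OF that]] sca_tv_negl[OF \<beta> that] by simp
  ultimately show ?thesis using \<alpha> by (auto simp: sca_iff)
qed

lemma sca_zero: "(\<lambda>A. 0) \<in> sca"
proof -
  have "tv M (\<lambda>A. 0) = (\<lambda>A. 0)" by (rule tv_of_nonneg[OF ca_zero]) simp
  then have "support (tv M (\<lambda>A. 0)) {}" using negl_empty by (simp add: support_def)
  then show ?thesis by (auto simp: sca_iff ca_zero)
qed

lemma sca_scale:
  assumes \<mu>: "\<mu> \<in> sca"
  shows "(\<lambda>A. a * \<mu> A) \<in> sca"
proof (rule sca_absolutely_continuous[OF \<mu> ca_scale[OF sca_ca[OF \<mu>]]])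
  fix A assume "tv M \<mu> A = 0"
  then show "a * \<mu> A = 0" using abs_le_tv[OF sca_ca[OF \<mu>], of A] by simp
qed

lemma sca_tv: "\<mu> \<in> sca \<Longrightarrow> tv M \<mu> \<in> sca"
  by (rule sca_absolutely_continuous[of \<mu>]) (auto intro: ca_tv sca_ca)

lemma sca_restr:
  assumes \<mu>: "\<mu> \<in> sca" and B: "B \<in> sets M"
  shows "restr M \<mu> B \<in> sca"
proof (rule sca_absolutely_continuous[OF \<mu> ca_restr[OF sca_ca[OF \<mu>] B]])
  fix A assume A: "A \<in> sets M" "tv M \<mu> A = 0"
  have "\<bar>\<mu> (A \<inter> B)\<bar> \<le> tv M \<mu> (A \<inter> B)" by (rule abs_le_tv[OF sca_ca[OF \<mu>]])
  also have "\<dots> \<le> tv M \<mu> A" using A B by (intro tv_mono[OF sca_ca[OF \<mu>]]) auto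
  finally show "restr M \<mu> B A = 0" using A by (simp add: restr_apply)
qed

text \<open>A weighted sum of the total variations has the union of the supports as support.
  Countability enters twice, in the convergence of the sum and in the union of negligible
  sets.\<close>

lemma sca_sequence_dominated:
  fixes \<mu> :: "nat \<Rightarrow> 'a set \<Rightarrow> real"
  assumes \<mu>: "\<And>n. \<mu> n \<in> sca"
  shows "\<exists>\<beta>\<in>sca. \<forall>A\<in>sets M. tv M \<beta> A = 0 \<longrightarrow> (\<forall>n. \<mu> n A = 0)"
proof -
  note \<mu>c = sca_ca[OF \<mu>]
  \<comment> \<open>The denominator makes the terms at most \<open>(1/2) ^ n\<close> on every event;
    its summand 1 excludes division by 0.\<close>
  define c where "c n = (1/2) ^ n / (1 + tv M (\<mu> n) (space M))" for n
  have c: "0 < c n" for n using tv_nonneg[OF \<mu>c, of n "space M"] by (simp add: c_def)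
  let ?f = "\<lambda>n A. c n * tv M (\<mu> n) A"
  have f0: "0 \<le> ?f n A" for n A using c[of n] tv_nonneg[OF \<mu>c, of n A] by simp
  have f_le: "norm (?f n A) \<le> (1/2) ^ n" if "A \<in> sets M" for n A
  proof -
    have "tv M (\<mu> n) A \<le> 1 + tv M (\<mu> n) (space M)"
      using tv_mono[OF \<mu>c that sets.top sets.sets_into_space[OF that], of n] by simp
    then have "?f n A \<le> c n * (1 + tv M (\<mu> n) (space M))" using c[of n]
      by (intro mult_left_mono) auto
    also have "\<dots> = (1/2) ^ n" using tv_nonneg[OF \<mu>c, of n "space M"] by (simp add: c_def)
    finally show ?thesis using f0[of n A] by simp
  qed
  have geo: "summable (\<lambda>n. (1/2 :: real) ^ n)" by (rule summable_geometric) simp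
  define \<beta> where "\<beta> A = (\<Sum>n. ?f n A)" for A
  have sm: "summable (\<lambda>n. ?f n A)" if "A \<in> sets M" for A
    by (rule summable_comparison_test[OF _ geo]) (use f_le[OF that] in blast)
  have U: "uniform_limit (sets M) (\<lambda>n A. \<Sum>i<n. ?f i A) \<beta> sequentially"
    unfolding \<beta>_def using f_le geo by (rule Weierstrass_m_test)
  have P: "(\<lambda>A. \<Sum>i<n. ?f i A) \<in> ca M" for n
    by (induction n) (simp_all add: ca_zero ca_add ca_scale ca_tv[OF \<mu>c])
  have out: "\<beta> A = 0" if "A \<notin> sets M" for A using that by (simp add: \<beta>_def tv_outside)
  have \<beta>_ca: "\<beta> \<in> ca M" by (rule ca_uniform_limit[OF P out U])
  have \<beta>0: "0 \<le> \<beta> A" if "A \<in> sets M" for A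
    unfolding \<beta>_def using f0 by (intro suminf_nonneg sm that)
  have tv_\<beta>: "tv M \<beta> = \<beta>" using \<beta>_ca \<beta>0 by (rule tv_of_nonneg)
  have zero: "\<beta> A = 0 \<longleftrightarrow> (\<forall>n. tv M (\<mu> n) A = 0)" if "A \<in> sets M" for A
  proof -
    have "\<beta> A = 0 \<longleftrightarrow> (\<forall>n. ?f n A = 0)"
      unfolding \<beta>_def using f0 by (intro suminf_eq_zero_iff sm that)
    then show ?thesis using c by (auto simp: less_le)
  qed
  have "\<exists>S. support (tv M (\<mu> n)) S" for n using \<mu> by (simp add: sca_iff)
  then obtain S where S: "\<And>n. support (tv M (\<mu> n)) (S n)" by metis
  then have Ss: "S n \<in> sets M" for n by (simp add: support_def)
  have "support \<beta> (\<Union>n. S n)"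
    unfolding support_def
  proof (intro conjI ballI impI)
    show "(\<Union>n. S n) \<in> sets M" using Ss by auto
    have "tv M (\<mu> n) (space M - (\<Union>n. S n)) = 0" for n
    proof -
      have "tv M (\<mu> n) (space M - (\<Union>n. S n)) \<le> tv M (\<mu> n) (space M - S n)"
        using Ss by (intro tv_mono[OF \<mu>c]) auto
      then show ?thesis
        using S[of n] tv_nonneg[OF \<mu>c, of n "space M - (\<Union>n. S n)"] by (simp add: support_def)
    qed
    then show "\<beta> (space M - (\<Union>n. S n)) = 0" using Ss by (subst zero) auto
    fix N assume N: "N \<in> sets M" and 0: "\<beta> (N \<inter> (\<Union>n. S n)) = 0"
    have "negl (N \<inter> S n)" for n
    proof -
      have "tv M (\<mu> n) (N \<inter> S n) \<le> tv M (\<mu> n) (N \<inter> (\<Union>n. S n))"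
        using N Ss by (intro tv_mono[OF \<mu>c]) auto
      moreover have "tv M (\<mu> n) (N \<inter> (\<Union>n. S n)) = 0" using 0 N Ss by (subst (asm) zero) auto
      ultimately have "tv M (\<mu> n) (N \<inter> S n) = 0" using tv_nonneg[OF \<mu>c, of n "N \<inter> S n"] by simp
      then show ?thesis using S[of n] N by (simp add: support_def)
    qed
    then have "negl (\<Union>n. N \<inter> S n)" by (rule negl_UN)
    then show "negl (N \<inter> (\<Union>n. S n))" by (simp only: Int_UN_distrib)
  qed
  moreover have "\<beta> N = 0" if "negl N" for N
    using sca_tv_negl[OF \<mu> that] zero[OF negl_sets[OF that]] by simp
  ultimately have "\<beta> \<in> sca" using \<beta>_ca tv_\<beta> by (auto simp: sca_iff)
  moreover have "\<mu> n A = 0" if "A \<in> sets M" "tv M \<beta> A = 0" for n A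
    using zero[OF that(1)] that(2) tv_\<beta> abs_le_tv[OF \<mu>c, of n A] by simp
  ultimately show ?thesis by blast
qed

text \<open>The supports of the two summands say nothing directly about a sum with cancellation. A
  common dominating supported measure does, through absolute continuity; the sequence merely repeats
  \<open>\<nu>\<close>.\<close>

lemma sca_add:
  assumes "\<mu> \<in> sca" "\<nu> \<in> sca"
  shows "(\<lambda>A. \<mu> A + \<nu> A) \<in> sca"
proof -
  have "(if n = 0 then \<mu> else \<nu>) \<in> sca" for n :: nat using assms by simp
  then obtain \<beta> where \<beta>: "\<beta> \<in> sca"
      "\<forall>A\<in>sets M. tv M \<beta> A = 0 \<longrightarrow> (\<forall>n :: nat. (if n = 0 then \<mu> else \<nu>) A = 0)"
    using sca_sequence_dominated[of "\<lambda>n. if n = 0 then \<mu> else \<nu>"] by blast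
  show ?thesis
  proof (rule sca_absolutely_continuous[OF \<beta>(1) ca_add[OF assms[THEN sca_ca]]])
    fix A assume "A \<in> sets M" "tv M \<beta> A = 0"
    then have *: "(if n = 0 then \<mu> else \<nu>) A = 0" for n :: nat using \<beta>(2) by blast
    show "\<mu> A + \<nu> A = 0" using *[of 0] *[of 1] by simp
  qed
qed

section \<open>The Banach lattice of supported measures\<close>

lemma sca_simps [simp]:
  "vadd (sca_c M \<PP>) = (\<lambda>\<mu> \<nu> A. \<mu> A + \<nu> A)" "vscale (sca_c M \<PP>) = (\<lambda>a \<mu> A. a * \<mu> A)"
  "vzero (sca_c M \<PP>) = (\<lambda>A. 0)" "vle (sca_c M \<PP>) = (\<lambda>\<mu> \<nu>. \<forall>A\<in>sets M. \<mu> A \<le> \<nu> A)"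
  "vnorm (sca_c M \<PP>) = (\<lambda>\<mu>. tv M \<mu> (space M))"
  "vdiff (sca_c M \<PP>) \<mu> \<nu> = (\<lambda>A. \<mu> A - \<nu> A)"
  by (simp_all add: sca_c_def vdiff_def)

lemma sca_ordered_vector_space: "ordered_vector_space (sca_c M \<PP>)"
proof
  fix x y assume "x \<in> sca" "y \<in> sca" "vle (sca_c M \<PP>) x y" "vle (sca_c M \<PP>) y x"
  then show "x = y" by (intro ca_eqI[of _ M] sca_ca) (auto intro: antisym)
next
  fix x y z assume "vle (sca_c M \<PP>) x y" "vle (sca_c M \<PP>) y z"
  then show "vle (sca_c M \<PP>) x z" by (auto intro: order_trans)
qed (simp_all add: sca_zero sca_add sca_scale algebra_simps mult_left_mono)

lemma sca_vector_lattice: "vector_lattice (sca_c M \<PP>)"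
proof (rule ordered_vector_space.vector_lattice_if_pos_part[OF sca_ordered_vector_space])
  fix \<mu> assume \<mu>: "\<mu> \<in> sca"
  let ?s = "\<lambda>A. 1/2 * (\<mu> A + tv M \<mu> A)"
  have "is_sup (sca_c M \<PP>) {\<mu>, vzero (sca_c M \<PP>)} ?s"
    unfolding is_sup_def
  proof (intro conjI ballI impI)
    show "?s \<in> sca" using \<mu> by (intro sca_scale sca_add sca_tv)
    have "\<mu> A \<le> ?s A \<and> 0 \<le> ?s A" for A using abs_le_tv[OF sca_ca[OF \<mu>], of A] by auto
    then show "vle (sca_c M \<PP>) a ?s" if "a \<in> {\<mu>, vzero (sca_c M \<PP>)}" for a
      using that by auto
    fix u assume u: "u \<in> sca" "\<forall>a\<in>{\<mu>, vzero (sca_c M \<PP>)}. vle (sca_c M \<PP>) a u"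
    have "tv M \<mu> A \<le> 2 * u A - \<mu> A" if "A \<in> sets M" for A
      using \<mu> u by (intro tv_least ca_subtract ca_scale sca_ca) (auto simp: abs_le_iff)
    then show "vle (sca_c M \<PP>) ?s u" by (auto simp: field_simps)
  qed
  then show "\<exists>s. is_sup (sca_c M \<PP>) {\<mu>, vzero (sca_c M \<PP>)} s" by blast
qed

lemma sca_vabs:
  assumes \<mu>: "\<mu> \<in> sca"
  shows "vabs (sca_c M \<PP>) \<mu> = tv M \<mu>"
proof (rule vector_lattice.vabs_eqI[OF sca_vector_lattice])
  show "is_sup (sca_c M \<PP>) {\<mu>, vscale (sca_c M \<PP>) (- 1) \<mu>} (tv M \<mu>)"
    unfolding is_sup_def
  proof (intro conjI ballI impI)
    show "tv M \<mu> \<in> sca" using \<mu> by (rule sca_tv)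
    show "vle (sca_c M \<PP>) a (tv M \<mu>)" if "a \<in> {\<mu>, vscale (sca_c M \<PP>) (- 1) \<mu>}" for a
      using that abs_le_tv[OF sca_ca[OF \<mu>]] by (auto simp: abs_le_iff)
    fix u assume u: "u \<in> sca" "\<forall>a\<in>{\<mu>, vscale (sca_c M \<PP>) (- 1) \<mu>}. vle (sca_c M \<PP>) a u"
    have "tv M \<mu> A \<le> u A" if "A \<in> sets M" for A
      using \<mu> u by (intro tv_least sca_ca) (auto simp: abs_le_iff)
    then show "vle (sca_c M \<PP>) (tv M \<mu>) u" by simp
  qed
qed

lemma sca_normed_vector_lattice: "normed_vector_lattice (sca_c M \<PP>)"
proof (rule normed_vector_lattice.intro[OF sca_vector_lattice], unfold_locales)
  fix \<mu> assume \<mu>: "\<mu> \<in> sca"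
  show "vnorm (sca_c M \<PP>) \<mu> = 0 \<longleftrightarrow> \<mu> = vzero (sca_c M \<PP>)"
  proof
    assume "vnorm (sca_c M \<PP>) \<mu> = 0"
    then have "\<mu> A = 0" if "A \<in> sets M" for A
      using abs_le_tv[OF sca_ca[OF \<mu>], of A] that
        tv_mono[OF sca_ca[OF \<mu>] that sets.top sets.sets_into_space[OF that]] by simp
    then show "\<mu> = vzero (sca_c M \<PP>)" using \<mu> by (intro ca_eqI[of _ M]) (auto simp: sca_ca ca_zero)
  next
    assume "\<mu> = vzero (sca_c M \<PP>)"
    then have "tv M \<mu> = \<mu>" by (intro tv_of_nonneg) (simp_all add: ca_zero)
    then show "vnorm (sca_c M \<PP>) \<mu> = 0" using \<open>\<mu> = vzero (sca_c M \<PP>)\<close> by simp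
  qed
  show "vnorm (sca_c M \<PP>) (vscale (sca_c M \<PP>) a \<mu>) = \<bar>a\<bar> * vnorm (sca_c M \<PP>) \<mu>" for a
    using tv_scale[OF sca_ca[OF \<mu>]] by simp
  fix \<nu> assume \<nu>: "\<nu> \<in> sca"
  show "vnorm (sca_c M \<PP>) (vadd (sca_c M \<PP>) \<mu> \<nu>) \<le> vnorm (sca_c M \<PP>) \<mu> + vnorm (sca_c M \<PP>) \<nu>"
    using tv_add[OF sca_ca[OF \<mu>] sca_ca[OF \<nu>]] by simp
  assume "vle (sca_c M \<PP>) (vabs (sca_c M \<PP>) \<mu>) (vabs (sca_c M \<PP>) \<nu>)"
  then show "vnorm (sca_c M \<PP>) \<mu> \<le> vnorm (sca_c M \<PP>) \<nu>" using \<mu> \<nu> by (simp add: sca_vabs)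
qed

text \<open>Cauchy sequences in total variation are uniformly Cauchy over all events, so the limit
  is a signed measure. It is absolutely continuous with respect to one supported measure that
  dominates the whole sequence, hence supported. Uniform convergence gives back convergence in total
  variation at the cost of a factor 2.\<close>

lemma sca_Cauchy_limit:
  fixes \<sigma> :: "nat \<Rightarrow> 'a set \<Rightarrow> real"
  assumes \<sigma>: "\<And>n. \<sigma> n \<in> sca"
    and Cauchy: "\<And>e. 0 < e \<Longrightarrow> \<exists>N. \<forall>m\<ge>N. \<forall>n\<ge>N. tv M (\<lambda>A. \<sigma> m A - \<sigma> n A) (space M) < e"
  shows "\<exists>\<nu>\<in>sca. \<forall>e>0. \<exists>N. \<forall>n\<ge>N. tv M (\<lambda>A. \<sigma> n A - \<nu> A) (space M) < e"
proof -
  note \<sigma>c = sca_ca[OF \<sigma>]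
  have "uniformly_Cauchy_on (sets M) \<sigma>"
    unfolding uniformly_Cauchy_on_def
  proof (intro allI impI)
    fix e :: real assume "0 < e"
    then obtain N where N: "\<forall>m\<ge>N. \<forall>n\<ge>N. tv M (\<lambda>A. \<sigma> m A - \<sigma> n A) (space M) < e" using Cauchy
      by blast
    have "dist (\<sigma> m A) (\<sigma> n A) < e" if "A \<in> sets M" "m \<ge> N" "n \<ge> N" for A m n
    proof -
      have c: "(\<lambda>A. \<sigma> m A - \<sigma> n A) \<in> ca M" by (intro ca_subtract \<sigma>c)
      have "\<bar>\<sigma> m A - \<sigma> n A\<bar> \<le> tv M (\<lambda>A. \<sigma> m A - \<sigma> n A) A" using abs_le_tv[OF c, of A] .
      also have "\<dots> \<le> tv M (\<lambda>A. \<sigma> m A - \<sigma> n A) (space M)"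
        using tv_mono[OF c that(1) sets.top sets.sets_into_space[OF that(1)]] .
      also have "\<dots> < e" using N that by blast
      finally show ?thesis by (simp add: dist_real_def)
    qed
    then show "\<exists>N. \<forall>A\<in>sets M. \<forall>m\<ge>N. \<forall>n\<ge>N. dist (\<sigma> m A) (\<sigma> n A) < e" by blast
  qed
  then obtain l where l: "uniform_limit (sets M) \<sigma> l sequentially"
    using Cauchy_uniformly_convergent by (auto simp: uniformly_convergent_on_def)
  \<comment> \<open>Nothing is known about \<open>l\<close> outside the sigma-algebra, where members
    of \<open>ca\<close> must vanish.\<close>
  define \<nu> where "\<nu> A = (if A \<in> sets M then l A else 0)" for A
  have lim: "uniform_limit (sets M) \<sigma> \<nu> sequentially"
    using l by (simp add: \<nu>_def cong: uniform_limit_cong')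
  have \<nu>_ca: "\<nu> \<in> ca M" using \<sigma>c by (rule ca_uniform_limit[OF _ _ lim]) (simp add: \<nu>_def)
  obtain \<beta> where \<beta>: "\<beta> \<in> sca" "\<forall>A\<in>sets M. tv M \<beta> A = 0 \<longrightarrow> (\<forall>n. \<sigma> n A = 0)"
    using sca_sequence_dominated[of \<sigma>, OF \<sigma>] by blast
  have "\<nu> \<in> sca"
  proof (rule sca_absolutely_continuous[OF \<beta>(1) \<nu>_ca])
    fix A assume A: "A \<in> sets M" "tv M \<beta> A = 0"
    have "(\<lambda>n. \<sigma> n A) \<longlonglongrightarrow> \<nu> A" using tendsto_uniform_limitI[OF lim A(1)] .
    moreover have "\<sigma> n A = 0" for n using \<beta>(2) A by blast
    ultimately show "\<nu> A = 0" by (simp add: LIMSEQ_const_iff)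
  qed
  moreover have "\<exists>N. \<forall>n\<ge>N. tv M (\<lambda>A. \<sigma> n A - \<nu> A) (space M) < e" if e: "0 < e" for e
  proof -
    obtain N where N: "\<And>n A. N \<le> n \<Longrightarrow> A \<in> sets M \<Longrightarrow> dist (\<sigma> n A) (\<nu> A) < e / 3"
      using uniform_limitD[OF lim, of "e / 3"] e by (auto simp: eventually_sequentially)
    have "tv M (\<lambda>A. \<sigma> n A - \<nu> A) (space M) < e" if "N \<le> n" for n
    proof -
      have "tv M (\<lambda>A. \<sigma> n A - \<nu> A) (space M) \<le> 2 * (e / 3)"
        using N[OF that] by (intro tv_le_twice ca_subtract \<sigma>c \<nu>_ca) (simp add: dist_real_def
          less_imp_le)
      then show ?thesis using e by simp
    qed
    then show ?thesis by blast
  qed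
  ultimately show ?thesis by blast
qed

lemma sca_banach_lattice: "banach_lattice (sca_c M \<PP>)"
  unfolding banach_lattice_def
proof
  show nvl: "normed_vector_lattice (sca_c M \<PP>)" by (rule sca_normed_vector_lattice)
  interpret Metric_space sca "vdist (sca_c M \<PP>)"
    by (rule normed_vector_lattice.metric_space[OF nvl])
  show "Metric_space.mcomplete sca (vdist (sca_c M \<PP>))"
    unfolding mcomplete_def
  proof (intro allI impI)
    fix \<sigma> assume C: "MCauchy \<sigma>"
    then have \<sigma>: "\<sigma> n \<in> sca" for n by (auto simp: MCauchy_def)
    have "\<exists>N. \<forall>m\<ge>N. \<forall>n\<ge>N. tv M (\<lambda>A. \<sigma> m A - \<sigma> n A) (space M) < e" if "0 < e" for e
      using C that \<sigma> unfolding MCauchy_def vdist_def by simp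
    then obtain \<nu> where "\<nu> \<in> sca" "\<forall>e>0. \<exists>N. \<forall>n\<ge>N. tv M (\<lambda>A. \<sigma> n A - \<nu> A) (space M) < e"
      using sca_Cauchy_limit[of \<sigma>, OF \<sigma>] by blast
    then show "\<exists>x. limitin mtopology \<sigma> x sequentially"
      using \<sigma> by (intro exI[of _ \<nu>]) (simp add: limit_metric_sequentially vdist_def)
  qed
qed

end

section \<open>Bounded random variables modulo quasi-sure equality\<close>

lemma bmeas_uminus: "f \<in> bmeas M \<Longrightarrow> (\<lambda>\<omega>. - f \<omega>) \<in> bmeas M"
  using bmeas_scale[of f M "- 1"] by simp

context priors
begin

text \<open>Quasi sure validity as a filter, which makes the proof methods for eventual statements
  available.\<close>

definition qs :: "'a filter" where
  "qs = (INF A\<in>{A. negl A}. principal (space M - A))"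

lemma eventually_qs: "eventually p qs \<longleftrightarrow> (\<exists>A. negl A \<and> (\<forall>\<omega>\<in>space M - A. p \<omega>))"
proof -
  have "eventually p qs \<longleftrightarrow> (\<exists>A\<in>{A. negl A}. eventually p (principal (space M - A)))"
    unfolding qs_def
  proof (rule eventually_INF_base)
    show "{A. negl A} \<noteq> {}" using negl_empty by blast
    fix A B assume "A \<in> {A. negl A}" "B \<in> {A. negl A}"
    then show "\<exists>C\<in>{A. negl A}. principal (space M - C) \<le>
        inf (principal (space M - A)) (principal (space M - B))"
      by (intro bexI[of _ "A \<union> B"]) (auto simp: negl_Un)
  qed
  then show ?thesis by (auto simp: eventually_principal)
qed

lemma quasi_surely_iff: "quasi_surely M \<PP> p \<longleftrightarrow> eventually p qs"
  unfolding quasi_surely_def eventually_qs using upper_prob_eq_0 negl_sets by metis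

lemma qs_space: "\<forall>\<^sub>F \<omega> in qs. \<omega> \<in> space M"
  using negl_empty by (auto simp: eventually_qs)

text \<open>Only countably many exceptional sets can be joined to a negligible one. This is why the
  arguments about nets below have to extract sequences or appeal to supports.\<close>

lemma qs_countable:
  assumes "\<And>n :: nat. eventually (p n) qs"
  shows "\<forall>\<^sub>F \<omega> in qs. \<forall>n. p n \<omega>"
proof -
  have "\<exists>A. negl A \<and> (\<forall>\<omega>\<in>space M - A. p n \<omega>)" for n using assms by (simp add: eventually_qs)
  then obtain A where "\<And>n. negl (A n)" "\<And>n \<omega>. \<omega> \<in> space M - A n \<Longrightarrow> p n \<omega>" by metis
  then show ?thesis unfolding eventually_qs by (intro exI[of _ "\<Union>n. A n"]) (auto intro: negl_UN)
qed

lemma qs_iff_negl: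
  assumes "{\<omega> \<in> space M. \<not> p \<omega>} \<in> sets M"
  shows "eventually p qs \<longleftrightarrow> negl {\<omega> \<in> space M. \<not> p \<omega>}"
proof
  assume "eventually p qs"
  then obtain A where "negl A" "\<forall>\<omega>\<in>space M - A. p \<omega>" by (auto simp: eventually_qs)
  then show "negl {\<omega> \<in> space M. \<not> p \<omega>}" 
    using assms by (elim negl_subset) auto
qed (auto simp: eventually_qs)

text \<open>Some prior exists and gives the whole space mass 1. The resulting point of the space
  later rules out negative pointwise bounds of absolute values.\<close>

lemma space_not_negl: "\<not> negl (space M)"
proof
  assume n: "negl (space M)"
  obtain P where P: "P \<in> \<PP>" using priors_nonempty by blast
  interpret prob_space P using P by (rule prior)
  have "space P = space M" using prior(2)[OF P] by (rule sets_eq_imp_space_eq)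
  then show False using n P emeasure_space_1 by (simp add: negl_def null_sets_def)
qed

lemma space_nonempty: "space M \<noteq> {}"
  using space_not_negl negl_empty by auto

definition cl :: "('a \<Rightarrow> real) \<Rightarrow> ('a \<Rightarrow> real) set" where
  "cl f = qs_class M \<PP> f"

lemma mem_cl: "f \<in> borel_measurable M \<Longrightarrow>
    g \<in> cl f \<longleftrightarrow> g \<in> borel_measurable M \<and> (\<forall>\<^sub>F \<omega> in qs. f \<omega> = g \<omega>)"
  by (auto simp: cl_def qs_class_def qs_eq_def quasi_surely_iff)

lemma cl_eq_iff:
  assumes "f \<in> borel_measurable M" "g \<in> borel_measurable M"
  shows "cl f = cl g \<longleftrightarrow> (\<forall>\<^sub>F \<omega> in qs. f \<omega> = g \<omega>)"
proof
  assume "cl f = cl g"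
  then have "g \<in> cl f" using assms by (simp add: mem_cl)
  then show "\<forall>\<^sub>F \<omega> in qs. f \<omega> = g \<omega>" using assms by (simp add: mem_cl)
next
  assume eq: "\<forall>\<^sub>F \<omega> in qs. f \<omega> = g \<omega>"
  have "h \<in> cl f \<longleftrightarrow> h \<in> cl g" for h
    unfolding mem_cl[OF assms(1)] mem_cl[OF assms(2)]
  proof (intro conj_cong refl iffI)
    assume "\<forall>\<^sub>F \<omega> in qs. f \<omega> = h \<omega>"
    with eq show "\<forall>\<^sub>F \<omega> in qs. g \<omega> = h \<omega>" by eventually_elim simp
  next
    assume "\<forall>\<^sub>F \<omega> in qs. g \<omega> = h \<omega>"
    with eq show "\<forall>\<^sub>F \<omega> in qs. f \<omega> = h \<omega>" by eventually_elim simp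
  qed
  then show "cl f = cl g" by blast
qed

lemma representative_cl:
  assumes "f \<in> borel_measurable M"
  shows "representative (cl f) \<in> borel_measurable M" "\<forall>\<^sub>F \<omega> in qs. f \<omega> = representative (cl f) \<omega>"
proof -
  have "f \<in> cl f" using assms by (simp add: mem_cl)
  then have "representative (cl f) \<in> cl f"
    unfolding representative_def by (rule someI[of "\<lambda>g. g \<in> cl f"])
  then show "representative (cl f) \<in> borel_measurable M"
    "\<forall>\<^sub>F \<omega> in qs. f \<omega> = representative (cl f) \<omega>"
    using assms by (simp_all add: mem_cl)
qed

abbreviation L0 :: "('a \<Rightarrow> real) set vlat" where "L0 \<equiv> L0_c M \<PP>"
abbreviation Linf :: "('a \<Rightarrow> real) set nvlat" where "Linf \<equiv> Linf_c M \<PP>"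

lemma L0_car: "vcar L0 = cl ` borel_measurable M"
  by (auto simp: L0_c_def quotient_def cl_def qs_class_def)

lemma L0_add:
  assumes "f \<in> borel_measurable M" "g \<in> borel_measurable M"
  shows "vadd L0 (cl f) (cl g) = cl (\<lambda>\<omega>. f \<omega> + g \<omega>)"
proof -
  have "cl (\<lambda>\<omega>. representative (cl f) \<omega> + representative (cl g) \<omega>) = cl (\<lambda>\<omega>. f \<omega> + g \<omega>)"
    using assms representative_cl(1)[OF assms(1)] representative_cl(1)[OF assms(2)]
    by (subst cl_eq_iff)
      (auto intro!: borel_measurable_add eventually_elim2[OF representative_cl(2)[OF assms(1)]
        representative_cl(2)[OF assms(2)]])
  then show ?thesis by (simp add: L0_c_def cl_def)
qed

lemma L0_scale:
  assumes "f \<in> borel_measurable M"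
  shows "vscale L0 a (cl f) = cl (\<lambda>\<omega>. a * f \<omega>)"
proof -
  have "cl (\<lambda>\<omega>. a * representative (cl f) \<omega>) = cl (\<lambda>\<omega>. a * f \<omega>)"
    using assms representative_cl(1)[OF assms]
    by (subst cl_eq_iff)
      (auto intro!: borel_measurable_times eventually_mono[OF representative_cl(2)[OF assms]])
  then show ?thesis by (simp add: L0_c_def cl_def)
qed

lemma L0_zero: "vzero L0 = cl (\<lambda>\<omega>. 0)"
  by (simp add: L0_c_def cl_def)

lemma L0_le:
  assumes "f \<in> borel_measurable M" "g \<in> borel_measurable M"
  shows "vle L0 (cl f) (cl g) \<longleftrightarrow> (\<forall>\<^sub>F \<omega> in qs. f \<omega> \<le> g \<omega>)"
proof
  assume "vle L0 (cl f) (cl g)"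
  then obtain f' g' where "f' \<in> cl f" "g' \<in> cl g" "\<forall>\<^sub>F \<omega> in qs. f' \<omega> \<le> g' \<omega>"
    by (auto simp: L0_c_def quasi_surely_iff)
  then have "\<forall>\<^sub>F \<omega> in qs. f \<omega> = f' \<omega>" "\<forall>\<^sub>F \<omega> in qs. g \<omega> = g' \<omega>" "\<forall>\<^sub>F \<omega> in qs. f' \<omega> \<le> g' \<omega>"
    using assms by (auto simp: mem_cl)
  then show "\<forall>\<^sub>F \<omega> in qs. f \<omega> \<le> g \<omega>" by eventually_elim simp
next
  assume "\<forall>\<^sub>F \<omega> in qs. f \<omega> \<le> g \<omega>"
  moreover have "f \<in> cl f" "g \<in> cl g" using assms by (simp_all add: mem_cl)
  ultimately show "vle L0 (cl f) (cl g)" by (auto simp: L0_c_def quasi_surely_iff)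
qed

text \<open>\<open>L0\<close> is not established as a vector lattice here, so existence and
  uniqueness of the supremum in \<open>vabs\<close> are verified by hand.\<close>

lemma L0_abs:
  assumes f[measurable]: "f \<in> borel_measurable M"
  shows "vabs L0 (cl f) = cl (\<lambda>\<omega>. \<bar>f \<omega>\<bar>)"
proof -
  have m: "(\<lambda>\<omega>. \<bar>f \<omega>\<bar>) \<in> borel_measurable M" "(\<lambda>\<omega>. - 1 * f \<omega>) \<in> borel_measurable M" by measurable
  have sup: "is_sup L0 {cl f, vscale L0 (- 1) (cl f)} (cl (\<lambda>\<omega>. \<bar>f \<omega>\<bar>))"
    unfolding is_sup_def L0_scale[OF f]
  proof (intro conjI ballI impI)
    show "cl (\<lambda>\<omega>. \<bar>f \<omega>\<bar>) \<in> vcar L0" using m by (simp add: L0_car)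
    show "vle L0 a (cl (\<lambda>\<omega>. \<bar>f \<omega>\<bar>))" if "a \<in> {cl f, cl (\<lambda>\<omega>. - 1 * f \<omega>)}" for a
      using that L0_le[OF f m(1)] L0_le[OF m(2,1)] by (auto intro: always_eventually)
    fix u assume "u \<in> vcar L0" and u: "\<forall>a\<in>{cl f, cl (\<lambda>\<omega>. - 1 * f \<omega>)}. vle L0 a u"
    then obtain g where g: "g \<in> borel_measurable M" "u = cl g" by (auto simp: L0_car)
    then have "\<forall>\<^sub>F \<omega> in qs. f \<omega> \<le> g \<omega>" "\<forall>\<^sub>F \<omega> in qs. - 1 * f \<omega> \<le> g \<omega>"
      using u L0_le[OF f g(1)] L0_le[OF m(2) g(1)] by auto
    then have "\<forall>\<^sub>F \<omega> in qs. \<bar>f \<omega>\<bar> \<le> g \<omega>" by eventually_elim simp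
    then show "vle L0 (cl (\<lambda>\<omega>. \<bar>f \<omega>\<bar>)) u" using L0_le[OF m(1) g(1)] g by simp
  qed
  show ?thesis
    unfolding vabs_def
  proof (rule the_equality[where a = "cl (\<lambda>\<omega>. \<bar>f \<omega>\<bar>)"])
    fix s assume s: "is_sup L0 {cl f, vscale L0 (- 1) (cl f)} s"
    then obtain g where g: "g \<in> borel_measurable M" "s = cl g" by (auto simp: L0_car is_sup_def)
    have "vle L0 s (cl (\<lambda>\<omega>. \<bar>f \<omega>\<bar>))" "vle L0 (cl (\<lambda>\<omega>. \<bar>f \<omega>\<bar>)) s"
      using s sup unfolding is_sup_def by blast+
    then have "\<forall>\<^sub>F \<omega> in qs. g \<omega> \<le> \<bar>f \<omega>\<bar>" "\<forall>\<^sub>F \<omega> in qs. \<bar>f \<omega>\<bar> \<le> g \<omega>"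
      using L0_le[OF g(1) m(1)] L0_le[OF m(1) g(1)] g(2) by auto
    then have "\<forall>\<^sub>F \<omega> in qs. g \<omega> = \<bar>f \<omega>\<bar>" by eventually_elim simp
    then show "s = cl (\<lambda>\<omega>. \<bar>f \<omega>\<bar>)" using cl_eq_iff[OF g(1) m(1)] g(2) by simp
  qed (rule sup)
qed

lemma ess_bounded_by_iff:
  assumes f[measurable]: "f \<in> borel_measurable M"
  shows "ess_bounded_by M \<PP> (cl f) m \<longleftrightarrow> (\<forall>\<^sub>F \<omega> in qs. \<bar>f \<omega>\<bar> \<le> m)"
proof -
  have m: "(\<lambda>\<omega>. \<bar>f \<omega>\<bar>) \<in> borel_measurable M"
    "(indicator (space M) :: 'a \<Rightarrow> real) \<in> borel_measurable M"
    "(\<lambda>\<omega>. m * indicator (space M) \<omega>) \<in> borel_measurable M" by measurable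
  have "ess_bounded_by M \<PP> (cl f) m \<longleftrightarrow> (\<forall>\<^sub>F \<omega> in qs. \<bar>f \<omega>\<bar> \<le> m * indicator (space M) \<omega>)"
    unfolding ess_bounded_by_def L0_abs[OF f] cl_def[of "indicator (space M)", symmetric]
      L0_scale[OF m(2)] L0_le[OF m(1,3)] ..
  also have "\<dots> \<longleftrightarrow> (\<forall>\<^sub>F \<omega> in qs. \<bar>f \<omega>\<bar> \<le> m)"
    by (rule eventually_subst) (use qs_space in \<open>auto elim: eventually_mono\<close>)
  finally show ?thesis .
qed

lemma Linf_cl:
  assumes "f \<in> bmeas M"
  shows "cl f \<in> vcar Linf"
proof -
  obtain C where "0 \<le> C" and C: "\<And>\<omega>. \<omega> \<in> space M \<Longrightarrow> \<bar>f \<omega>\<bar> \<le> C" using bmeas_bound[OF assms] by metis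
  have "\<forall>\<^sub>F \<omega> in qs. \<bar>f \<omega>\<bar> \<le> C + 1" using qs_space by eventually_elim (use C in fastforce)
  then show ?thesis
    using \<open>0 \<le> C\<close> bmeas_measurable[OF assms]
    by (auto simp: Linf_c_def L0_car ess_bounded_by_iff intro!: exI[of _ "C + 1"])
qed

text \<open>Clipping a representative at an essential bound changes it only on a negligible set. All
  computations in \<open>Linf\<close> can therefore use representatives that are bounded
  everywhere.\<close>

lemma Linf_cases:
  assumes "X \<in> vcar Linf"
  obtains f where "f \<in> bmeas M" "X = cl f"
proof -
  obtain f m where f[measurable]: "f \<in> borel_measurable M" and X: "X = cl f"
    and m: "m > 0" "ess_bounded_by M \<PP> X m"
    using assms by (auto simp: Linf_c_def L0_car)
  have le: "\<forall>\<^sub>F \<omega> in qs. \<bar>f \<omega>\<bar> \<le> m" using m ess_bounded_by_iff[OF f] X by simp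
  let ?g = "\<lambda>\<omega>. max (- m) (min m (f \<omega>))"
  have g: "?g \<in> bmeas M" using m by (intro bmeasI[of _ _ m]) auto
  moreover have "X = cl ?g"
    unfolding X cl_eq_iff[OF f bmeas_measurable[OF g]]
    using le by eventually_elim auto
  ultimately show ?thesis using that by blast
qed

lemma Linf_add: "f \<in> bmeas M \<Longrightarrow> g \<in> bmeas M \<Longrightarrow> vadd Linf (cl f) (cl g) = cl (\<lambda>\<omega>. f \<omega> + g \<omega>)"
  using L0_add[of f g] by (simp add: Linf_c_def bmeas_measurable)

lemma Linf_scale: "f \<in> bmeas M \<Longrightarrow> vscale Linf a (cl f) = cl (\<lambda>\<omega>. a * f \<omega>)"
  using L0_scale[of f] by (simp add: Linf_c_def bmeas_measurable)

lemma Linf_zero: "vzero Linf = cl (\<lambda>\<omega>. 0)"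
  using L0_zero by (simp add: Linf_c_def)

lemma Linf_le: "f \<in> bmeas M \<Longrightarrow> g \<in> bmeas M \<Longrightarrow> vle Linf (cl f) (cl g) \<longleftrightarrow> (\<forall>\<^sub>F \<omega> in qs. f \<omega> \<le> g \<omega>)"
  using L0_le[of f g] by (simp add: Linf_c_def bmeas_measurable)

lemma Linf_eq: "f \<in> bmeas M \<Longrightarrow> g \<in> bmeas M \<Longrightarrow> cl f = cl g \<longleftrightarrow> (\<forall>\<^sub>F \<omega> in qs. f \<omega> = g \<omega>)"
  by (simp add: cl_eq_iff bmeas_measurable)

lemma Linf_ordered_vector_space: "ordered_vector_space Linf"
proof
  show "vzero Linf \<in> vcar Linf" by (simp add: Linf_zero Linf_cl bmeas_const)
  fix X assume X: "X \<in> vcar Linf"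
  then obtain f where f: "f \<in> bmeas M" "X = cl f" by (rule Linf_cases)
  note [simp] = Linf_add Linf_scale Linf_zero Linf_cl bmeas_add bmeas_scale bmeas_const Linf_le
  show "vscale Linf a X \<in> vcar Linf" for a using f by simp
  show "vadd Linf X (vzero Linf) = X" using f by simp
  show "vadd Linf X (vscale Linf (- 1) X) = vzero Linf" using f bmeas_scale[OF f(1), of "- 1"]
    by simp
  show "vscale Linf (a + b) X = vadd Linf (vscale Linf a X) (vscale Linf b X)" for a b
    using f by (simp add: distrib_right)
  show "vscale Linf a (vscale Linf b X) = vscale Linf (a * b) X" for a b
    using f by (simp add: mult.assoc)
  show "vscale Linf 1 X = X" using f by simp
  show "vle Linf X X" using f by simp
  fix Y assume Y: "Y \<in> vcar Linf"
  then obtain g where g: "g \<in> bmeas M" "Y = cl g" by (rule Linf_cases)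
  show "vadd Linf X Y \<in> vcar Linf" using f g by simp
  show "vadd Linf X Y = vadd Linf Y X" using f g by (simp add: add.commute)
  show "vscale Linf a (vadd Linf X Y) = vadd Linf (vscale Linf a X) (vscale Linf a Y)" for a
    using f g by (simp add: distrib_left)
  show "X = Y" if "vle Linf X Y" "vle Linf Y X"
  proof -
    have "\<forall>\<^sub>F \<omega> in qs. f \<omega> \<le> g \<omega>" "\<forall>\<^sub>F \<omega> in qs. g \<omega> \<le> f \<omega>" using that f g by simp_all
    then have "\<forall>\<^sub>F \<omega> in qs. f \<omega> = g \<omega>" by eventually_elim simp
    then show ?thesis using f g by (simp add: Linf_eq)
  qed
  show "vle Linf (vscale Linf a X) (vscale Linf a Y)" if "0 \<le> a" "vle Linf X Y" for a
    using that f g by (simp, elim eventually_mono) (simp add: mult_left_mono)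
  fix Z assume Z: "Z \<in> vcar Linf"
  then obtain h where h: "h \<in> bmeas M" "Z = cl h" by (rule Linf_cases)
  show "vadd Linf (vadd Linf X Y) Z = vadd Linf X (vadd Linf Y Z)" using f g h
    by (simp add: add.assoc)
  show "vle Linf X Z" if "vle Linf X Y" "vle Linf Y Z"
  proof -
    have "\<forall>\<^sub>F \<omega> in qs. f \<omega> \<le> g \<omega>" "\<forall>\<^sub>F \<omega> in qs. g \<omega> \<le> h \<omega>" using that f g h by simp_all
    then have "\<forall>\<^sub>F \<omega> in qs. f \<omega> \<le> h \<omega>" by eventually_elim simp
    then show ?thesis using f h by simp
  qed
  show "vle Linf (vadd Linf X Z) (vadd Linf Y Z)" if "vle Linf X Y"
    using that f g h by simp
qed

lemma Linf_vector_lattice: "vector_lattice Linf"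
proof (rule ordered_vector_space.vector_lattice_if_pos_part[OF Linf_ordered_vector_space])
  fix X assume "X \<in> vcar Linf"
  then obtain f where f: "f \<in> bmeas M" "X = cl f" by (rule Linf_cases)
  have m: "(\<lambda>\<omega>. max (f \<omega>) 0) \<in> bmeas M" using f by (intro bmeas_max bmeas_const)
  have "is_sup Linf {X, vzero Linf} (cl (\<lambda>\<omega>. max (f \<omega>) 0))"
    unfolding is_sup_def
  proof (intro conjI ballI impI)
    show "cl (\<lambda>\<omega>. max (f \<omega>) 0) \<in> vcar Linf" using m by (rule Linf_cl)
    show "vle Linf a (cl (\<lambda>\<omega>. max (f \<omega>) 0))" if "a \<in> {X, vzero Linf}" for a
      using that f m by (auto simp: Linf_zero Linf_le bmeas_const)
    fix u assume "u \<in> vcar Linf" and u: "\<forall>a\<in>{X, vzero Linf}. vle Linf a u"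
    then obtain g where g: "g \<in> bmeas M" "u = cl g" by (auto elim: Linf_cases)
    have "\<forall>\<^sub>F \<omega> in qs. f \<omega> \<le> g \<omega>" "\<forall>\<^sub>F \<omega> in qs. 0 \<le> g \<omega>"
      using u f g by (auto simp: Linf_zero Linf_le bmeas_const)
    then have "\<forall>\<^sub>F \<omega> in qs. max (f \<omega>) 0 \<le> g \<omega>" by eventually_elim simp
    then show "vle Linf (cl (\<lambda>\<omega>. max (f \<omega>) 0)) u" using m g by (simp add: Linf_le)
  qed
  then show "\<exists>s. is_sup Linf {X, vzero Linf} s" by blast
qed

end

sublocale priors \<subseteq> L: vector_lattice "Linf_c M \<PP>"
  by (rule Linf_vector_lattice)

sublocale priors \<subseteq> S: normed_vector_lattice "sca_c M \<PP>"
  by (rule sca_normed_vector_lattice)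

context priors
begin

text \<open>The supremum now ranges over upper bounds in \<open>Linf\<close> only, so
  \<open>L0_abs\<close> does not apply directly.\<close>

lemma Linf_abs:
  assumes f: "f \<in> bmeas M"
  shows "vabs Linf (cl f) = cl (\<lambda>\<omega>. \<bar>f \<omega>\<bar>)"
proof -
  have "vabs Linf (cl f) \<in> vcar Linf" using f by (intro L.vabs_closed Linf_cl)
  then obtain g where g: "g \<in> bmeas M" "vabs Linf (cl f) = cl g" by (rule Linf_cases)
  have sup: "is_sup Linf {cl f, cl (\<lambda>\<omega>. - 1 * f \<omega>)} (cl g)"
    using L.vabs_is_sup[OF Linf_cl[OF f]] by (simp only: g Linf_scale[OF f])
  have m: "(\<lambda>\<omega>. - 1 * f \<omega>) \<in> bmeas M" "(\<lambda>\<omega>. \<bar>f \<omega>\<bar>) \<in> bmeas M"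
    using f bmeas_uminus[OF f] by (auto intro: bmeas_abs)
  have "vle Linf (cl f) (cl g)" "vle Linf (cl (\<lambda>\<omega>. - 1 * f \<omega>)) (cl g)"
    by (rule L.is_sup_ge[OF sup]; simp)+
  then have 1: "\<forall>\<^sub>F \<omega> in qs. f \<omega> \<le> g \<omega>" "\<forall>\<^sub>F \<omega> in qs. - 1 * f \<omega> \<le> g \<omega>"
    using Linf_le[OF f g(1)] Linf_le[OF m(1) g(1)] by auto
  have "vle Linf (cl g) (cl (\<lambda>\<omega>. \<bar>f \<omega>\<bar>))"
    using Linf_le[OF f m(2)] Linf_le[OF m(1,2)]
    by (intro L.is_sup_least[OF sup Linf_cl[OF m(2)]]) (auto intro: always_eventually)
  then have "\<forall>\<^sub>F \<omega> in qs. g \<omega> \<le> \<bar>f \<omega>\<bar>" using Linf_le[OF g(1) m(2)] by simp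
  with 1 have "\<forall>\<^sub>F \<omega> in qs. g \<omega> = \<bar>f \<omega>\<bar>" by eventually_elim auto
  then show ?thesis using g m by (simp add: Linf_eq)
qed

lemma Linf_nonneg_cases:
  assumes "X \<in> L.nonneg"
  obtains f where "f \<in> bmeas M" "X = cl f" "\<forall>\<omega>. 0 \<le> f \<omega>"
proof -
  obtain f where f: "f \<in> bmeas M" "X = cl f" using assms by (auto elim: Linf_cases)
  then have "\<forall>\<^sub>F \<omega> in qs. 0 \<le> f \<omega>" using assms by (simp add: Linf_zero Linf_le bmeas_const)
  then have "\<forall>\<^sub>F \<omega> in qs. f \<omega> = max (f \<omega>) 0" by eventually_elim simp
  then have "X = cl (\<lambda>\<omega>. max (f \<omega>) 0)" using f by (simp add: Linf_eq bmeas_max bmeas_const)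
  then show ?thesis using f that[of "\<lambda>\<omega>. max (f \<omega>) 0"] by (simp add: bmeas_max bmeas_const)
qed

lemma Linf_nonneg_cl: "f \<in> bmeas M \<Longrightarrow> (\<And>\<omega>. \<omega> \<in> space M \<Longrightarrow> 0 \<le> f \<omega>) \<Longrightarrow> cl f \<in> L.nonneg"
  using qs_space by (auto simp: Linf_cl Linf_zero Linf_le bmeas_const elim: eventually_mono)

section \<open>The quasi sure supremum norm\<close>

lemma Linf_norm_set:
  assumes "f \<in> bmeas M"
  shows "vnorm Linf (cl f) = Inf {m. 0 < m \<and> (\<forall>\<^sub>F \<omega> in qs. \<bar>f \<omega>\<bar> \<le> m)}"
  by (simp add: Linf_c_def ess_bounded_by_iff[OF bmeas_measurable[OF assms]])

lemma Linf_norm_le: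
  assumes f: "f \<in> bmeas M" and m: "0 \<le> m" "\<forall>\<^sub>F \<omega> in qs. \<bar>f \<omega>\<bar> \<le> m"
  shows "vnorm Linf (cl f) \<le> m"
proof (rule field_le_epsilon)
  fix e :: real assume "0 < e"
  have "\<forall>\<^sub>F \<omega> in qs. \<bar>f \<omega>\<bar> \<le> m + e" using m(2) by eventually_elim (use \<open>0 < e\<close> in simp)
  then show "vnorm Linf (cl f) \<le> m + e"
    unfolding Linf_norm_set[OF f] using m \<open>0 < e\<close>
    by (intro cInf_lower) (auto intro!: bdd_belowI[of _ 0])
qed

text \<open>The norm is itself an essential bound: it is approached by the bounds
  \<open>norm + 1 / (n + 1)\<close>, and their countably many exceptional sets can be
  joined.\<close>

lemma Linf_norm_bound:
  assumes f: "f \<in> bmeas M"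
  shows "0 \<le> vnorm Linf (cl f)" "\<forall>\<^sub>F \<omega> in qs. \<bar>f \<omega>\<bar> \<le> vnorm Linf (cl f)"
proof -
  let ?A = "{m. 0 < m \<and> (\<forall>\<^sub>F \<omega> in qs. \<bar>f \<omega>\<bar> \<le> m)}"
  obtain C where "0 \<le> C" and C: "\<And>\<omega>. \<omega> \<in> space M \<Longrightarrow> \<bar>f \<omega>\<bar> \<le> C" using bmeas_bound[OF f] by metis
  have "\<forall>\<^sub>F \<omega> in qs. \<bar>f \<omega>\<bar> \<le> C + 1" using qs_space by eventually_elim (use C in fastforce)
  then have ne: "?A \<noteq> {}" using \<open>0 \<le> C\<close> by (auto intro!: exI[of _ "C + 1"])
  show "0 \<le> vnorm Linf (cl f)" unfolding Linf_norm_set[OF f] by (rule cInf_greatest[OF ne]) auto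
  have "\<forall>\<^sub>F \<omega> in qs. \<bar>f \<omega>\<bar> \<le> vnorm Linf (cl f) + 1 / real (Suc n)" for n
  proof -
    have "\<exists>m\<in>?A. m < Inf ?A + 1 / real (Suc n)"
      by (rule cInf_lessD[OF ne, unfolded Bex_def[symmetric]]) simp
    then obtain m where m: "\<forall>\<^sub>F \<omega> in qs. \<bar>f \<omega>\<bar> \<le> m" "m < vnorm Linf (cl f) + 1 / real (Suc n)"
      unfolding Linf_norm_set[OF f] by blast
    show ?thesis using m(1) by eventually_elim (use m(2) in linarith)
  qed
  then have "\<forall>\<^sub>F \<omega> in qs. \<forall>n. \<bar>f \<omega>\<bar> \<le> vnorm Linf (cl f) + 1 / real (Suc n)" by (rule qs_countable)
  then show "\<forall>\<^sub>F \<omega> in qs. \<bar>f \<omega>\<bar> \<le> vnorm Linf (cl f)"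
  proof eventually_elim
    fix \<omega> assume *: "\<forall>n. \<bar>f \<omega>\<bar> \<le> vnorm Linf (cl f) + 1 / real (Suc n)"
    have "(\<lambda>n. vnorm Linf (cl f) + 1 / real (Suc n)) \<longlonglongrightarrow> vnorm Linf (cl f) + 0"
      by (intro tendsto_add tendsto_const LIMSEQ_Suc[OF lim_1_over_n])
    then have "\<bar>f \<omega>\<bar> \<le> vnorm Linf (cl f) + 0" by (rule LIMSEQ_le_const) (use * in blast)
    then show "\<bar>f \<omega>\<bar> \<le> vnorm Linf (cl f)" by simp
  qed
qed

text \<open>Order boundedness on the interval from -1 to 1 is a sup-norm bound on the unit ball;
  scaling extends it to all bounded functions. This gives functionals on \<open>Linf\<close> access
  to the reduction to indicators.\<close>

lemma bmeas_functional_cl: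
  assumes lin: "linear_functional Linf \<phi>" and ob: "order_bounded Linf \<phi>"
  shows "bmeas_functional M (\<lambda>f. \<phi> (cl f))"
proof -
  have "bounded (\<phi> ` {X \<in> vcar Linf. vle Linf (cl (\<lambda>\<omega>. - 1)) X \<and> vle Linf X (cl (\<lambda>\<omega>. 1))})"
    using ob Linf_cl[OF bmeas_const] unfolding order_bounded_def by blast
  then obtain K where K: "\<And>X. X \<in> vcar Linf \<Longrightarrow> vle Linf (cl (\<lambda>\<omega>. - 1)) X \<Longrightarrow> vle Linf X (cl (\<lambda>\<omega>. 1)) \<Longrightarrow>
      \<bar>\<phi> X\<bar> \<le> K"
    by (auto simp: bounded_iff)
  have K1: "\<bar>\<phi> (cl f)\<bar> \<le> K" if f: "f \<in> bmeas M" "\<And>\<omega>. \<omega> \<in> space M \<Longrightarrow> \<bar>f \<omega>\<bar> \<le> 1" for f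
  proof (rule K[OF Linf_cl[OF f(1)]])
    have "\<forall>\<^sub>F \<omega> in qs. \<bar>f \<omega>\<bar> \<le> 1" using qs_space by eventually_elim (rule f(2))
    then have "\<forall>\<^sub>F \<omega> in qs. - 1 \<le> f \<omega>" "\<forall>\<^sub>F \<omega> in qs. f \<omega> \<le> 1" by (eventually_elim, simp)+
    then show "vle Linf (cl (\<lambda>\<omega>. - 1)) (cl f)" "vle Linf (cl f) (cl (\<lambda>\<omega>. 1))"
      using f by (simp_all add: Linf_le bmeas_const)
  qed
  have "0 \<le> K" using K1[OF bmeas_const, of 0] by simp
  have add: "\<phi> (cl (\<lambda>\<omega>. f \<omega> + g \<omega>)) = \<phi> (cl f) + \<phi> (cl g)" if "f \<in> bmeas M" "g \<in> bmeas M" for f g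
    using L.linear_functional_add[OF lin Linf_cl Linf_cl] that by (simp add: Linf_add)
  have scale: "\<phi> (cl (\<lambda>\<omega>. a * f \<omega>)) = a * \<phi> (cl f)" if "f \<in> bmeas M" for f a
    using L.linear_functional_scale[OF lin Linf_cl] that by (simp add: Linf_scale)
  show ?thesis
  proof (rule bmeas_functionalI[OF add scale \<open>0 \<le> K\<close>])
    fix C f assume f: "f \<in> bmeas M" and le: "\<And>\<omega>. \<omega> \<in> space M \<Longrightarrow> \<bar>f \<omega>\<bar> \<le> C"
    \<comment> \<open>A bound of absolute values at an actual point is nonnegative. The bound 0 is
      treated separately because it cannot be scaled to 1.\<close>
    obtain w where "w \<in> space M" using space_nonempty by blast
    then have "0 \<le> C" using le[of w] by linarith
    show "\<bar>\<phi> (cl f)\<bar> \<le> K * C"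
    proof (cases "C = 0")
      case True
      have "\<forall>\<^sub>F \<omega> in qs. f \<omega> = 0" using qs_space by eventually_elim (use le True in auto)
      then have "cl f = vzero Linf" using f by (simp add: Linf_zero Linf_eq bmeas_const)
      then show ?thesis using True L.linear_functional_zero[OF lin] by simp
    next
      case False
      then have "0 < C" using \<open>0 \<le> C\<close> by simp
      then have "\<bar>\<phi> (cl (\<lambda>\<omega>. inverse C * f \<omega>))\<bar> \<le> K"
        using le f by (intro K1 bmeas_scale) (auto simp: abs_mult field_simps)
      moreover have "\<phi> (cl f) = C * \<phi> (cl (\<lambda>\<omega>. inverse C * f \<omega>))"
        using scale[OF f, of "inverse C"] \<open>0 < C\<close> by simp
      ultimately show ?thesis
        using \<open>0 < C\<close> by (simp only: abs_mult mult.commute[of K]) (simp add: mult_left_mono)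
    qed
  qed
qed

section \<open>Order continuous functionals and supported measures\<close>

abbreviation W :: "(('a \<Rightarrow> real) set \<Rightarrow> real) vlat" where
  "W \<equiv> order_continuous_dual Linf"

lemma W_iff: "\<phi> \<in> vcar W \<longleftrightarrow> linear_functional Linf \<phi> \<and> order_bounded Linf \<phi> \<and>
    order_continuous Linf \<phi>"
  by (rule L.order_continuous_dual_car)

lemma W_bmeas_functional: "\<phi> \<in> vcar W \<Longrightarrow> bmeas_functional M (\<lambda>f. \<phi> (cl f))"
  by (simp add: W_iff bmeas_functional_cl)

definition fmeasure :: "(('a \<Rightarrow> real) set \<Rightarrow> real) \<Rightarrow> 'a set \<Rightarrow> real" where
  "fmeasure \<phi> A = (if A \<in> sets M then \<phi> (cl (indicator A)) else 0)"

text \<open>Along a sequence the pointwise supremum is also the supremum in \<open>Linf\<close>: for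
  an upper bound the exceptional sets of all \<open>n\<close> form one negligible set.\<close>

lemma incseq_indicator_sup:
  fixes A :: "nat \<Rightarrow> 'a set"
  assumes A: "range A \<subseteq> sets M" "incseq A"
  shows "up_directed Linf (range (\<lambda>n. cl (indicator (A n))))"
    "is_sup Linf (range (\<lambda>n. cl (indicator (A n)))) (cl (indicator (\<Union>n. A n)))"
    "m \<le> n \<Longrightarrow> vle Linf (cl (indicator (A m))) (cl (indicator (A n)))"
proof -
  have As: "A n \<in> sets M" for n using A by auto
  have U: "(\<Union>n. A n) \<in> sets M" using As by auto
  note b = bmeas_indicator[OF As] bmeas_indicator[OF U]
  have mono: "vle Linf (cl (indicator (A m))) (cl (indicator (A n)))" if "m \<le> n" for m n
    using incseqD[OF A(2) that]
      by (auto simp: Linf_le[OF b(1) b(1)] indicator_def intro!: always_eventually)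
  then show "m \<le> n \<Longrightarrow> vle Linf (cl (indicator (A m))) (cl (indicator (A n)))" .
  show "up_directed Linf (range (\<lambda>n. cl (indicator (A n))))"
    unfolding up_directed_def
  proof (intro conjI ballI)
    fix x y assume "x \<in> range (\<lambda>n. cl (indicator (A n)))" "y \<in> range (\<lambda>n. cl (indicator (A n)))"
    then obtain m n where "x = cl (indicator (A m))" "y = cl (indicator (A n))" by blast
    then show "\<exists>z\<in>range (\<lambda>n. cl (indicator (A n))). vle Linf x z \<and> vle Linf y z"
      using mono[of m "max m n"] mono[of n "max m n"] by auto
  qed (use Linf_cl[OF b(1)] in auto)
  show "is_sup Linf (range (\<lambda>n. cl (indicator (A n)))) (cl (indicator (\<Union>n. A n)))"
    unfolding is_sup_def
  proof (intro conjI ballI impI)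
    show "cl (indicator (\<Union>n. A n)) \<in> vcar Linf" by (rule Linf_cl[OF b(2)])
    show "vle Linf x (cl (indicator (\<Union>n. A n)))" if "x \<in> range (\<lambda>n. cl (indicator (A n)))" for x
      using that by (auto simp: Linf_le[OF b(1) b(2)] indicator_def intro!: always_eventually)
    fix u assume u: "u \<in> vcar Linf" "\<forall>x\<in>range (\<lambda>n. cl (indicator (A n))). vle Linf x u"
    obtain g where g: "g \<in> bmeas M" "u = cl g" using u by (auto elim: Linf_cases)
    have "\<forall>\<^sub>F \<omega> in qs. indicator (A n) \<omega> \<le> g \<omega>" for n
      using u g Linf_le[OF b(1) g(1)] by auto
    then have "\<forall>\<^sub>F \<omega> in qs. \<forall>n. indicator (A n) \<omega> \<le> g \<omega>" by (rule qs_countable)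
    then have "\<forall>\<^sub>F \<omega> in qs. indicator (\<Union>n. A n) \<omega> \<le> g \<omega>"
    proof eventually_elim
      fix \<omega> assume *: "\<forall>n. indicator (A n) \<omega> \<le> g \<omega>"
      have "0 \<le> (indicator (A 0) \<omega> :: real)" by simp
      also have "\<dots> \<le> g \<omega>" using * by blast
      finally have "0 \<le> g \<omega>" .
      moreover have "1 \<le> g \<omega>" if "\<omega> \<in> A n" for n using *[rule_format, of n] that by simp
      ultimately show "indicator (\<Union>n. A n) \<omega> \<le> g \<omega>"
        by (cases "\<omega> \<in> (\<Union>n. A n)") (simp_all, blast?)
    qed
    then show "vle Linf (cl (indicator (\<Union>n. A n))) u" using g Linf_le[OF b(2) g(1)] by simp
  qed
qed

lemma fmeasure_ca:
  assumes \<phi>: "\<phi> \<in> vcar W"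
  shows "fmeasure \<phi> \<in> ca M"
proof (rule caI_incseq)
  have lin: "linear_functional Linf \<phi>" and oc: "order_continuous Linf \<phi>" using \<phi>
    by (auto simp: W_iff)
  show "fmeasure \<phi> A = 0" if "A \<notin> sets M" for A using that by (simp add: fmeasure_def)
  show "fmeasure \<phi> (A \<union> B) = fmeasure \<phi> A + fmeasure \<phi> B"
    if AB: "A \<in> sets M" "B \<in> sets M" "A \<inter> B = {}" for A B
  proof -
    have "(indicator (A \<union> B) :: 'a \<Rightarrow> real) = (\<lambda>\<omega>. indicator A \<omega> + indicator B \<omega>)"
      using AB(3) by (auto simp: indicator_def fun_eq_iff)
    then show ?thesis
      using bmeas_functional_add[OF W_bmeas_functional[OF \<phi>] bmeas_indicator[OF AB(1)]
        bmeas_indicator[OF AB(2)]] AB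
      by (simp add: fmeasure_def)
  qed
  fix A :: "nat \<Rightarrow> 'a set" assume A: "range A \<subseteq> sets M" "incseq A"
  then have As: "A n \<in> sets M" for n by auto
  show "(\<lambda>n. fmeasure \<phi> (A n)) \<longlonglongrightarrow> fmeasure \<phi> (\<Union>n. A n)"
  proof (rule LIMSEQ_I)
    fix e :: real assume "0 < e"
    obtain m where m: "\<forall>d\<in>range (\<lambda>n. cl (indicator (A n))). vle Linf (cl (indicator (A m))) d \<longrightarrow>
        \<bar>\<phi> (cl (indicator (\<Union>n. A n))) - \<phi> d\<bar> < e"
      using L.order_continuous_up_directed[OF oc lin incseq_indicator_sup(1,2)[OF A] \<open>0 < e\<close>]
        by blast
    have "norm (fmeasure \<phi> (A n) - fmeasure \<phi> (\<Union>n. A n)) < e" if "m \<le> n" for n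
    proof -
      have "\<bar>\<phi> (cl (indicator (\<Union>n. A n))) - \<phi> (cl (indicator (A n)))\<bar> < e"
        using m incseq_indicator_sup(3)[OF A that] by blast
      then show ?thesis using As by (simp add: fmeasure_def abs_minus_commute sets.countable_UN)
    qed
    then show "\<exists>m. \<forall>n\<ge>m. norm (fmeasure \<phi> (A n) - fmeasure \<phi> (\<Union>n. A n)) < e" by blast
  qed
qed

lemma indicator_mult_cong:
  assumes "f \<in> bmeas M" "g \<in> bmeas M" "B \<in> sets M" "cl f = cl g"
  shows "cl (\<lambda>\<omega>. indicator B \<omega> * f \<omega>) = cl (\<lambda>\<omega>. indicator B \<omega> * g \<omega>)"
  using assms by (auto simp: Linf_eq bmeas_mult bmeas_indicator elim: eventually_mono)

text \<open>The band projection onto the classes that vanish outside \<open>B\<close>. The choice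
  picks some bounded representative; \<open>band_cl\<close> shows that any other gives the same
  class.\<close>

definition band :: "'a set \<Rightarrow> ('a \<Rightarrow> real) set \<Rightarrow> ('a \<Rightarrow> real) set" where
  "band B X = cl (\<lambda>\<omega>. indicator B \<omega> * (SOME f. f \<in> bmeas M \<and> X = cl f) \<omega>)"

lemma band_cl:
  assumes "f \<in> bmeas M" "B \<in> sets M"
  shows "band B (cl f) = cl (\<lambda>\<omega>. indicator B \<omega> * f \<omega>)"
proof -
  let ?g = "SOME g. g \<in> bmeas M \<and> cl f = cl g"
  have "?g \<in> bmeas M \<and> cl f = cl ?g" by (rule someI[of _ f]) (use assms in simp)
  then show ?thesis unfolding band_def using assms by (intro indicator_mult_cong) auto
qed

text \<open>The projection commutes with the operations and with absolute values, and it maps nets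
  decreasing to 0 to such nets. So composing with it keeps linearity, order boundedness and order
  continuity.\<close>

lemma band_W:
  assumes \<phi>: "\<phi> \<in> vcar W" and B: "B \<in> sets M"
  shows "(\<lambda>X\<in>vcar Linf. \<phi> (band B X)) \<in> vcar W"
proof -
  note bB = bmeas_mult[OF bmeas_indicator[OF B]]
  have lin: "linear_functional Linf \<phi>" and ob: "order_bounded Linf \<phi>"
    and oc: "order_continuous Linf \<phi>"
    using \<phi> by (auto simp: W_iff)
  have closed: "band B X \<in> vcar Linf" if "X \<in> vcar Linf" for X
    using that by (elim Linf_cases) (simp add: band_cl B Linf_cl bB)
  have add: "band B (vadd Linf X Y) = vadd Linf (band B X) (band B Y)"
    if "X \<in> vcar Linf" "Y \<in> vcar Linf" for X Y
    using that by (elim Linf_cases) (simp add: band_cl B Linf_add bB bmeas_add distrib_left)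
  have scale: "band B (vscale Linf a X) = vscale Linf a (band B X)" if "X \<in> vcar Linf" for X a
    using that by (elim Linf_cases) (simp add: band_cl B Linf_scale bB bmeas_scale
      mult.left_commute)
  have diff: "band B (vdiff Linf X Y) = vdiff Linf (band B X) (band B Y)"
    if "X \<in> vcar Linf" "Y \<in> vcar Linf" for X Y
    using that by (simp add: vdiff_def add scale L.scale_closed)
  have mono: "vle Linf (band B X) (band B Y)"
    if XY: "X \<in> vcar Linf" "Y \<in> vcar Linf" "vle Linf X Y" for X Y
  proof -
    obtain f where f: "f \<in> bmeas M" "X = cl f" by (rule Linf_cases[OF XY(1)])
    obtain g where g: "g \<in> bmeas M" "Y = cl g" by (rule Linf_cases[OF XY(2)])
    note fg = f g
    have "\<forall>\<^sub>F \<omega> in qs. f \<omega> \<le> g \<omega>" using XY(3) fg by (simp add: Linf_le)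
    then have "\<forall>\<^sub>F \<omega> in qs. indicator B \<omega> * f \<omega> \<le> indicator B \<omega> * g \<omega>"
      by eventually_elim (simp split: split_indicator)
    then show ?thesis using fg by (simp add: band_cl B Linf_le bB)
  qed
  have abs: "vabs Linf (band B X) = band B (vabs Linf X)" if "X \<in> vcar Linf" for X
    using that by (elim Linf_cases) (simp add: band_cl B Linf_abs bB bmeas_abs abs_mult)
  have le: "vle Linf (band B X) X" if X: "X \<in> L.nonneg" for X
  proof -
    obtain f where f: "f \<in> bmeas M" "X = cl f" "\<forall>\<omega>. 0 \<le> f \<omega>" using X by (elim Linf_nonneg_cases)
    have "indicator B \<omega> * f \<omega> \<le> f \<omega>" for \<omega> using f(3) by (simp split: split_indicator)
    then show ?thesis using f by (simp add: band_cl B Linf_le bB)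
  qed
  show ?thesis
    unfolding W_iff
  proof (intro conjI)
    show "linear_functional Linf (\<lambda>X\<in>vcar Linf. \<phi> (band B X))"
      using L.linear_functional_add[OF lin closed closed] L.linear_functional_scale[OF lin closed]
      by (simp add: linear_functional_def add scale L.add_closed L.scale_closed)
    show "order_bounded Linf (\<lambda>X\<in>vcar Linf. \<phi> (band B X))"
      unfolding order_bounded_def
    proof (intro ballI)
      fix a b assume ab: "a \<in> vcar Linf" "b \<in> vcar Linf"
      have "bounded (\<phi> ` {X \<in> vcar Linf. vle Linf (band B a) X \<and> vle Linf X (band B b)})"
        using ob closed ab unfolding order_bounded_def by blast
      then show "bounded ((\<lambda>X\<in>vcar Linf. \<phi> (band B X)) ` {X \<in> vcar Linf. vle Linf a X \<and>
          vle Linf X b})"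
        by (rule bounded_subset) (use closed mono ab in \<open>auto intro!: imageI\<close>)
    qed
    show "order_continuous Linf (\<lambda>X\<in>vcar Linf. \<phi> (band B X))"
      unfolding order_continuous_def
    proof (intro allI impI)
      fix I :: "(('a \<Rightarrow> real) set \<times> ('a \<Rightarrow> real) set) set" and r x x0
      assume "order_converges Linf I r x x0"
      then obtain y where dir: "directed I r" and x: "x \<in> I \<rightarrow> vcar Linf" and x0: "x0 \<in> vcar Linf"
        and y: "y \<in> I \<rightarrow> vcar Linf"
          and dec: "\<And>i j. i \<in> I \<Longrightarrow> j \<in> I \<Longrightarrow> (i, j) \<in> r \<Longrightarrow> vle Linf (y j) (y i)"
        and inf0: "is_inf Linf (y ` I) (vzero Linf)"
        and dom: "\<And>i. i \<in> I \<Longrightarrow> vle Linf (vabs Linf (vdiff Linf (x i) x0)) (y i)"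
        unfolding order_converges_def by blast
      have ypos: "y i \<in> L.nonneg" if "i \<in> I" for i using inf0 y that by (auto simp: is_inf_def)
      have band0: "band B (vzero Linf) = vzero Linf" by (simp add: Linf_zero band_cl B bmeas_const)
      have "order_converges Linf I r (\<lambda>i. band B (x i)) (band B x0)"
        unfolding order_converges_def
      proof (intro conjI bexI[of _ "\<lambda>i. band B (y i)"] ballI impI)
        show "(\<lambda>i. band B (x i)) \<in> I \<rightarrow> vcar Linf" "(\<lambda>i. band B (y i)) \<in> I \<rightarrow> vcar Linf"
          "band B x0 \<in> vcar Linf"
          using x y x0 closed by auto
        show "vle Linf (band B (y j)) (band B (y i))" if "i \<in> I" "j \<in> I" "(i, j) \<in> r" for i j
          using dec[OF that] y that by (intro mono) auto
        show "vle Linf (vabs Linf (vdiff Linf (band B (x i)) (band B x0))) (band B (y i))"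
          if "i \<in> I" for i
        proof -
          have c: "x i \<in> vcar Linf" "y i \<in> vcar Linf" using x y that by auto
          show ?thesis
            using mono[OF L.vabs_closed[OF L.diff_closed[OF c(1) x0]] c(2) dom[OF that]]
            by (simp add: abs diff c x0 L.diff_closed flip: diff)
        qed
        show "is_inf Linf ((\<lambda>i. band B (y i)) ` I) (vzero Linf)"
          unfolding is_inf_def
        proof (intro conjI ballI impI)
          show "vle Linf (vzero Linf) a" if "a \<in> (\<lambda>i. band B (y i)) ` I" for a
            using that ypos mono[OF L.zero_closed] by (auto simp: band0)
          fix u assume u: "u \<in> vcar Linf" "\<forall>a\<in>(\<lambda>i. band B (y i)) ` I. vle Linf u a"
          \<comment> \<open>The projection of a positive element lies below that element, so lower
            bounds of the projected net are lower bounds of the net.\<close>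
          have "vle Linf u (y i)" if "i \<in> I" for i
            using u that ypos[OF that] le[OF ypos[OF that]] L.le_trans[of u "band B (y i)"
              "y i"] closed by auto
          then show "vle Linf u (vzero Linf)" using inf0 u by (auto simp: is_inf_def)
        qed (rule L.zero_closed)
      qed (rule dir)
      then have "((\<lambda>i. \<phi> (band B (x i))) \<longlongrightarrow> \<phi> (band B x0)) (net_filter I r)"
        using oc by (simp add: order_continuous_def)
      moreover have "\<forall>\<^sub>F i in net_filter I r. \<phi> (band B (x i)) = (\<lambda>X\<in>vcar Linf. \<phi> (band B X)) (x i)"
        using dir x by (auto simp: eventually_net_filter directed_def)
      ultimately show "((\<lambda>i. (\<lambda>X\<in>vcar Linf. \<phi> (band B X)) (x i)) \<longlongrightarrow> (\<lambda>X\<in>vcar Linf. \<phi> (band B X))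
          x0) (net_filter I r)"
        using Lim_transform_eventually x0 by simp
    qed
  qed
qed

text \<open>The positive part is \<open>\<phi>\<close> composed with the projection onto a Hahn set
  \<open>H\<close> of its measure. Positivity and domination of \<open>\<phi>\<close> are
  inequalities on indicators, where they are the Hahn property. It is least because an upper bound
  exceeds \<open>\<phi>\<close> on the part in \<open>H\<close> and 0 on the complementary
  part.\<close>

lemma W_pos_part:
  assumes \<phi>: "\<phi> \<in> vcar W"
  shows "\<exists>\<psi>\<in>vcar W. L.positive_functional \<psi> \<and> (\<forall>X\<in>L.nonneg. \<phi> X \<le> \<psi> X) \<and>
    is_sup W {\<phi>, vzero W} \<psi>"
proof -
  obtain H where hahn: "hahn_set M (fmeasure \<phi>) H"
    using ca_Hahn_decomposition[OF fmeasure_ca[OF \<phi>]] by blast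
  note H = hahn_setD(1)[OF hahn]
  let ?\<psi> = "\<lambda>X\<in>vcar Linf. \<phi> (band H X)"
  have \<psi>W: "?\<psi> \<in> vcar W" by (rule band_W[OF \<phi> H])
  note \<Lambda> = W_bmeas_functional[OF \<phi>]
  have bH: "bmeas_functional M (\<lambda>f. \<phi> (cl (\<lambda>\<omega>. indicator H \<omega> * f \<omega>)))"
    by (rule bmeas_functional_weight[OF \<Lambda> bmeas_indicator[OF H]])
  have ind: "(\<lambda>\<omega>. indicator H \<omega> * indicator A \<omega> :: real) = indicator (A \<inter> H)" for A
    by (rule ext) (simp split: split_indicator)
  have pos: "0 \<le> \<phi> (cl (\<lambda>\<omega>. indicator H \<omega> * f \<omega>))" if "f \<in> bmeas M" "\<And>\<omega>. \<omega> \<in> space M \<Longrightarrow> 0 \<le> f \<omega>"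
    for f
  proof (rule bmeas_functional_nonneg[OF bH _ that])
    show "0 \<le> \<phi> (cl (\<lambda>\<omega>. indicator H \<omega> * indicator A \<omega>))" if "A \<in> sets M" for A
      unfolding ind using hahn_setD(2)[OF hahn that] that H by (simp add: fmeasure_def)
  qed
  have ge: "0 \<le> 1 * \<phi> (cl (\<lambda>\<omega>. indicator H \<omega> * f \<omega>)) + - 1 * \<phi> (cl f)"
    if "f \<in> bmeas M" "\<And>\<omega>. \<omega> \<in> space M \<Longrightarrow> 0 \<le> f \<omega>" for f
  proof (rule bmeas_functional_nonneg[OF bmeas_functional_combine[OF bH \<Lambda>] _ that])
    fix A assume A: "A \<in> sets M"
    show "0 \<le> 1 * \<phi> (cl (\<lambda>\<omega>. indicator H \<omega> * indicator A \<omega>)) + - 1 * \<phi> (cl (indicator A))"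
      unfolding ind using hahn_setD(3)[OF hahn A] ca_split[OF fmeasure_ca[OF \<phi>] A H] A H
      by (simp add: fmeasure_def)
  qed
  have \<psi>pos: "L.positive_functional ?\<psi>"
    unfolding L.positive_functional_def
  proof (intro conjI ballI)
    show "linear_functional Linf ?\<psi>" using \<psi>W by (simp add: W_iff)
    fix X assume X: "X \<in> L.nonneg"
    then obtain f where f: "f \<in> bmeas M" "X = cl f" "\<forall>\<omega>. 0 \<le> f \<omega>" by (rule Linf_nonneg_cases)
    show "0 \<le> ?\<psi> X" using pos[OF f(1) f(3)[rule_format]] f(1,2) H by (simp add: Linf_cl band_cl)
  qed
  have \<psi>ge: "\<phi> X \<le> ?\<psi> X" if X: "X \<in> L.nonneg" for X
  proof -
    obtain f where f: "f \<in> bmeas M" "X = cl f" "\<forall>\<omega>. 0 \<le> f \<omega>" using X by (rule Linf_nonneg_cases)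
    show ?thesis using ge[OF f(1) f(3)[rule_format]] f(1,2) H by (simp add: Linf_cl band_cl)
  qed
  have "is_sup W {\<phi>, vzero W} ?\<psi>"
    unfolding is_sup_def
  proof (intro conjI ballI impI)
    show "vle W a ?\<psi>" if "a \<in> {\<phi>, vzero W}" for a
      using that \<psi>ge \<psi>pos
      by (auto simp: L.order_continuous_dual_vle L.order_continuous_dual_vzero
        L.positive_functional_def)
    fix u assume u: "u \<in> vcar W" "\<forall>a\<in>{\<phi>, vzero W}. vle W a u"
    have le: "\<phi> X \<le> u X" "0 \<le> u X" if "X \<in> L.nonneg" for X
      using u(2) that by (auto simp: L.order_continuous_dual_vle L.order_continuous_dual_vzero)
    show "vle W ?\<psi> u"
      unfolding L.order_continuous_dual_vle
    proof
      fix X assume "X \<in> L.nonneg"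
      then obtain f where f: "f \<in> bmeas M" "X = cl f" "\<forall>\<omega>. 0 \<le> f \<omega>" by (rule Linf_nonneg_cases)
      let ?f = "\<lambda>\<omega>. indicator H \<omega> * f \<omega>" and ?g = "\<lambda>\<omega>. indicator (space M - H) \<omega> * f \<omega>"
      have b: "?f \<in> bmeas M" "?g \<in> bmeas M" using f H by (auto intro!: bmeas_mult bmeas_indicator)
      have "\<forall>\<^sub>F \<omega> in qs. f \<omega> = ?f \<omega> + ?g \<omega>"
        using qs_space by eventually_elim (simp split: split_indicator)
      then have "cl f = cl (\<lambda>\<omega>. ?f \<omega> + ?g \<omega>)" using f b by (subst Linf_eq) (auto intro: bmeas_add)
      then have "u X = u (cl ?f) + u (cl ?g)"
        using bmeas_functional_add[OF W_bmeas_functional[OF u(1)] b] f(2) by simp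
      moreover have "0 \<le> u (cl ?g)" using b f(3) by (intro le(2) Linf_nonneg_cl) auto
      moreover have "\<phi> (cl ?f) \<le> u (cl ?f)" using b f(3) by (intro le(1) Linf_nonneg_cl) auto
      ultimately show "?\<psi> X \<le> u X" using f(1,2) H by (simp add: Linf_cl band_cl)
    qed
  qed (rule \<psi>W)
  then show ?thesis using \<psi>W \<psi>pos \<psi>ge by blast
qed

lemma W_vector_lattice: "vector_lattice W"
proof (rule ordered_vector_space.vector_lattice_if_pos_part[OF
  L.ordered_vector_space_order_continuous_dual])
  fix \<phi> assume "\<phi> \<in> vcar W"
  then show "\<exists>s. is_sup W {\<phi>, vzero W} s" using W_pos_part by blast
qed

end

section \<open>Integration as an order continuous functional\<close>

context priors
begin

lemma sca_nonnegD: "\<mu> \<in> S.nonneg \<Longrightarrow> \<mu> \<in> sca" "\<mu> \<in> S.nonneg \<Longrightarrow> A \<in> sets M \<Longrightarrow> 0 \<le> \<mu> A"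
  by auto

lemma sca_nonnegI: "\<mu> \<in> sca \<Longrightarrow> (\<And>A. A \<in> sets M \<Longrightarrow> 0 \<le> \<mu> A) \<Longrightarrow> \<mu> \<in> S.nonneg"
  by simp

definition ifun :: "('a set \<Rightarrow> real) \<Rightarrow> ('a \<Rightarrow> real) set \<Rightarrow> real" where
  "ifun \<mu> = (\<lambda>X\<in>vcar Linf. signed_integral M \<mu> (representative X))"

lemma signed_integral_qs_cong:
  assumes \<mu>: "\<mu> \<in> sca" and f: "f \<in> borel_measurable M" "g \<in> borel_measurable M"
    and eq: "\<forall>\<^sub>F \<omega> in qs. f \<omega> = g \<omega>"
  shows "signed_integral M \<mu> f = signed_integral M \<mu> g"
proof -
  obtain N where "negl N" "\<forall>\<omega>\<in>space M - N. f \<omega> = g \<omega>" using eq by (auto simp: eventually_qs)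
  then show ?thesis
    using signed_integral_cong[OF sca_ca[OF \<mu>] negl_sets sca_tv_negl[OF \<mu>] f, of N] by blast
qed

lemma signed_integral_representative:
  assumes "\<mu> \<in> sca" "f \<in> bmeas M"
  shows "signed_integral M \<mu> (representative (cl f)) = signed_integral M \<mu> f"
  using representative_cl[OF bmeas_measurable[OF assms(2)]] assms
  by (intro signed_integral_qs_cong[symmetric]) (auto intro: bmeas_measurable)

lemma ifun_cl: "\<mu> \<in> sca \<Longrightarrow> f \<in> bmeas M \<Longrightarrow> ifun \<mu> (cl f) = signed_integral M \<mu> f"
  by (simp add: ifun_def Linf_cl signed_integral_representative)

lemma ifun_linear:
  assumes \<mu>: "\<mu> \<in> sca"
  shows "linear_functional Linf (ifun \<mu>)"
  unfolding linear_functional_def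
proof (intro conjI ballI allI)
  note \<Lambda> = signed_integral_functional[OF sca_ca[OF \<mu>]]
  show "ifun \<mu> \<in> extensional (vcar Linf)" by (simp add: ifun_def)
  fix X assume "X \<in> vcar Linf"
  then obtain f where f: "f \<in> bmeas M" "X = cl f" by (rule Linf_cases)
  show "ifun \<mu> (vscale Linf a X) = a * ifun \<mu> X" for a
    using f \<mu> by (simp add: Linf_scale ifun_cl bmeas_scale bmeas_functional_scale[OF \<Lambda>])
  fix Y assume "Y \<in> vcar Linf"
  then obtain g where g: "g \<in> bmeas M" "Y = cl g" by (rule Linf_cases)
  show "ifun \<mu> (vadd Linf X Y) = ifun \<mu> X + ifun \<mu> Y"
    using f g \<mu> by (simp add: Linf_add ifun_cl bmeas_add bmeas_functional_add[OF \<Lambda>])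
qed

lemma ifun_positive:
  assumes \<mu>: "\<mu> \<in> S.nonneg"
  shows "L.positive_functional (ifun \<mu>)"
  unfolding L.positive_functional_def
proof (intro conjI ballI)
  show "linear_functional Linf (ifun \<mu>)" using sca_nonnegD(1)[OF \<mu>] by (rule ifun_linear)
  fix X assume "X \<in> L.nonneg"
  then obtain f where f: "f \<in> bmeas M" "X = cl f" "\<forall>\<omega>. 0 \<le> f \<omega>" by (rule Linf_nonneg_cases)
  have "0 \<le> signed_integral M \<mu> f"
    by (rule signed_integral_nonneg[OF sca_ca[OF sca_nonnegD(1)[OF \<mu>]] sca_nonnegD(2)[OF \<mu>] f(1)])
      (use f in auto)
  then show "0 \<le> ifun \<mu> X" using f sca_nonnegD(1)[OF \<mu>] by (simp add: ifun_cl)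
qed

lemma qs_AE:
  assumes \<mu>: "\<mu> \<in> S.nonneg" and p: "eventually p qs"
  shows "AE \<omega> in pmeasure M \<mu>. p \<omega>"
proof -
  note c = sca_nonnegD[OF \<mu>]
  obtain N where N: "negl N" "\<forall>\<omega>\<in>space M - N. p \<omega>" using p by (auto simp: eventually_qs)
  have "N \<in> null_sets (pmeasure M \<mu>)"
    using negl_sets[OF N(1)] sca_negl[OF c(1) N(1)]
    by (simp add: null_sets_def emeasure_pmeasure[OF sca_ca[OF c(1)] c(2)])
  then show ?thesis by (rule AE_I') (use N in auto)
qed

text \<open>
  A decreasing net with infimum 0 has a sequence along which the integrals approach their infimum.
  Its pointwise infimum \<open>g\<close> lies \<open>\<mu>\<close>-almost everywhere, hence quasi surely on the support of \<open>\<mu>\<close>,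
  below every member of the net, so \<open>g = 0\<close> there.
\<close>

lemma ifun_order_continuous:
  assumes \<mu>: "\<mu> \<in> S.nonneg"
  shows "order_continuous Linf (ifun \<mu>)"
proof (rule L.order_continuousI[OF ifun_positive[OF \<mu>]], rule ccontr)
  fix I :: "(('a \<Rightarrow> real) set \<times> ('a \<Rightarrow> real) set) set" and r y and e :: real
  assume dir: "directed I r" and y: "y \<in> I \<rightarrow> vcar Linf"
    and dec: "\<And>i j. i \<in> I \<Longrightarrow> j \<in> I \<Longrightarrow> (i, j) \<in> r \<Longrightarrow> vle Linf (y j) (y i)"
    and inf0: "is_inf Linf (y ` I) (vzero Linf)" and e: "0 < e"
    and no: "\<not> (\<exists>i\<in>I. ifun \<mu> (y i) < e)"
  note \<mu>s = sca_nonnegD(1)[OF \<mu>]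
  note \<mu>c = sca_ca[OF \<mu>s]
  note \<mu>0 = sca_nonnegD(2)[OF \<mu>]
  let ?N = "pmeasure M \<mu>"
  interpret finite_measure ?N by (rule finite_measure_pmeasure[OF \<mu>c \<mu>0])
  have int: "integrable ?N f" if "f \<in> bmeas M" for f
    using bmeas_integrable[OF finite_measure_axioms sets_pmeasure that] .
  have mN: "f \<in> borel_measurable ?N" if "f \<in> borel_measurable M" for f :: "'a \<Rightarrow> real"
    using that by (simp add: measurable_cong_sets[OF sets_pmeasure refl])
  have "\<exists>f. f \<in> bmeas M \<and> y i = cl f \<and> (\<forall>\<omega>. 0 \<le> f \<omega>)" if "i \<in> I" for i
  proof -
    have "y i \<in> L.nonneg" using y inf0 that by (auto simp: is_inf_def)
    then show ?thesis by (rule Linf_nonneg_cases) blast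
  qed
  then obtain f where f: "\<And>i. i \<in> I \<Longrightarrow> f i \<in> bmeas M" "\<And>i. i \<in> I \<Longrightarrow> y i = cl (f i)"
      "\<And>i \<omega>. i \<in> I \<Longrightarrow> 0 \<le> f i \<omega>" by metis
  have ifun_y: "ifun \<mu> (y i) = (\<integral>\<omega>. f i \<omega> \<partial>?N)" if "i \<in> I" for i
    using that f by (simp add: ifun_cl[OF \<mu>s] signed_integral_eq_integral[OF \<mu>c \<mu>0])
  have f_dec: "\<forall>\<^sub>F \<omega> in qs. f j \<omega> \<le> f i \<omega>" if "i \<in> I" "j \<in> I" "(i, j) \<in> r" for i j
    using dec[OF that] f that by (simp add: Linf_le)
  have ne: "I \<noteq> {}" using dir by (simp add: directed_def)
  define m where "m = (INF i\<in>I. ifun \<mu> (y i))"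
  have bdd: "bdd_below ((\<lambda>i. ifun \<mu> (y i)) ` I)" using no
    by (intro bdd_belowI2[of _ e]) (auto simp: not_less)
  have m_le: "m \<le> ifun \<mu> (y i)" if "i \<in> I" for i unfolding m_def using bdd that by (rule cINF_lower)
  have e_m: "e \<le> m" unfolding m_def using no by (intro cINF_greatest[OF ne]) (auto simp: not_less)
  have near: "\<exists>k\<in>I. ifun \<mu> (y k) < m + 1 / real (Suc n)" for n
    using cINF_less_iff[OF ne bdd, of "m + 1 / real (Suc n)"] by (simp add: m_def)
  \<comment> \<open>The sequence also runs upwards in the index order, so its representatives
    decrease quasi surely and converge to \<open>g\<close>.\<close>
  have "\<exists>s. \<forall>n :: nat. (s n \<in> I \<and> ifun \<mu> (y (s n)) < m + 1 / real (Suc n)) \<and> (s n, s (Suc n)) \<in> r"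
  proof (rule dependent_nat_choice)
    show "\<exists>k. k \<in> I \<and> ifun \<mu> (y k) < m + 1 / real (Suc 0)" using near[of 0] by blast
    fix i and n :: nat assume i: "i \<in> I \<and> ifun \<mu> (y i) < m + 1 / real (Suc n)"
    obtain k where k: "k \<in> I" "ifun \<mu> (y k) < m + 1 / real (Suc (Suc n))" using near by blast
    obtain j where j: "j \<in> I" "(i, j) \<in> r" "(k, j) \<in> r" using dir i k unfolding directed_def
      by blast
    have "ifun \<mu> (y j) \<le> ifun \<mu> (y k)"
      using dec[OF k(1) j(1) j(3)] y j k
      by (intro L.positive_functional_mono[OF ifun_positive[OF \<mu>]]) auto
    then show "\<exists>j. (j \<in> I \<and> ifun \<mu> (y j) < m + 1 / real (Suc (Suc n))) \<and> (i, j) \<in> r"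
      using j k by (intro exI[of _ j]) auto
  qed
  then obtain s :: "nat \<Rightarrow> _" where s: "\<And>n. s n \<in> I" "\<And>n. ifun \<mu> (y (s n)) < m + 1 / real (Suc n)"
    "\<And>n. (s n, s (Suc n)) \<in> r" by blast
  define g where "g = (\<lambda>\<omega>. INF n. f (s n) \<omega>)"
  have bddg: "bdd_below (range (\<lambda>n. f (s n) \<omega>))" for \<omega> using f(3)[OF s(1)] by (intro bdd_belowI2)
  have g_le: "g \<omega> \<le> f (s n) \<omega>" for n \<omega> unfolding g_def using bddg by (rule cINF_lower) simp
  have g_ge: "0 \<le> g \<omega>" for \<omega> unfolding g_def using f(3)[OF s(1)] by (intro cINF_greatest) auto
  have g_m: "g \<in> borel_measurable M"
    unfolding g_def using f(1)[OF s(1)] bddg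
      by (intro borel_measurable_cINF) (auto intro: bmeas_measurable)
  have gb: "g \<in> bmeas M"
  proof -
    obtain C where C: "\<And>\<omega>. \<omega> \<in> space M \<Longrightarrow> \<bar>f (s 0) \<omega>\<bar> \<le> C"
      using bmeas_bound[OF f(1)[OF s(1)[of 0]]] by metis
    have "\<bar>g \<omega>\<bar> \<le> C" if "\<omega> \<in> space M" for \<omega>
      using g_le[where n = 0 and \<omega> = \<omega>] g_ge[of \<omega>] C[OF that] by linarith
    then show ?thesis using g_m by (intro bmeasI)
  qed
  have "\<forall>\<^sub>F \<omega> in qs. \<forall>n. f (s (Suc n)) \<omega> \<le> f (s n) \<omega>"
    by (rule qs_countable) (use f_dec s in blast)
  then have "\<forall>\<^sub>F \<omega> in qs. (\<lambda>n. f (s n) \<omega>) \<longlonglongrightarrow> g \<omega>"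
  proof eventually_elim
    fix \<omega> assume "\<forall>n. f (s (Suc n)) \<omega> \<le> f (s n) \<omega>"
    then have "decseq (\<lambda>n. f (s n) \<omega>)" by (intro decseq_SucI) blast
    then show "(\<lambda>n. f (s n) \<omega>) \<longlonglongrightarrow> g \<omega>" unfolding g_def using bddg by (intro LIMSEQ_decseq_INF)
  qed
  then have lim: "AE \<omega> in ?N. (\<lambda>n. f (s n) \<omega>) \<longlonglongrightarrow> g \<omega>" by (rule qs_AE[OF \<mu>])
  \<comment> \<open>Some member \<open>f j\<close> of the net lies below both \<open>f (s n)\<close>
    and \<open>f i\<close>, so their minimum has integral at least \<open>m\<close>; dominated
    convergence passes to \<open>g\<close>. As \<open>g\<close> has integral at most
    \<open>m\<close>, its excess over \<open>f i\<close> is a null function.\<close>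
  have min_ge: "m \<le> (\<integral>\<omega>. min (g \<omega>) (f i \<omega>) \<partial>?N)" if i: "i \<in> I" for i
  proof -
    have "(\<lambda>n. \<integral>\<omega>. min (f (s n) \<omega>) (f i \<omega>) \<partial>?N) \<longlonglongrightarrow> (\<integral>\<omega>. min (g \<omega>) (f i \<omega>) \<partial>?N)"
    proof (rule integral_dominated_convergence[where w = "f i"])
      show "AE \<omega> in ?N. (\<lambda>n. min (f (s n) \<omega>) (f i \<omega>)) \<longlonglongrightarrow> min (g \<omega>) (f i \<omega>)"
        using lim by eventually_elim (intro tendsto_min tendsto_const)
      show "AE \<omega> in ?N. norm (min (f (s n) \<omega>) (f i \<omega>)) \<le> f i \<omega>" for n
        using f(3)[OF s(1)] f(3)[OF i] by (intro AE_I2) (simp add: min_def)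
      show "(\<lambda>\<omega>. min (g \<omega>) (f i \<omega>)) \<in> borel_measurable ?N"
        using g_m bmeas_measurable[OF f(1)[OF i]] by (intro mN borel_measurable_min)
      show "(\<lambda>\<omega>. min (f (s n) \<omega>) (f i \<omega>)) \<in> borel_measurable ?N" for n
        using bmeas_measurable[OF f(1)[OF s(1)]] bmeas_measurable[OF f(1)[OF i]]
          by (intro mN borel_measurable_min)
    qed (rule int[OF f(1)[OF i]])
    moreover have "m \<le> (\<integral>\<omega>. min (f (s n) \<omega>) (f i \<omega>) \<partial>?N)" for n
    proof -
      obtain j where j: "j \<in> I" "(s n, j) \<in> r" "(i, j) \<in> r" using dir s(1) i
        unfolding directed_def by blast
      have "AE \<omega> in ?N. f j \<omega> \<le> f (s n) \<omega>" "AE \<omega> in ?N. f j \<omega> \<le> f i \<omega>"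
        using f_dec[OF s(1) j(1,2)] f_dec[OF i j(1,3)] by (auto intro: qs_AE[OF \<mu>])
      then have "AE \<omega> in ?N. f j \<omega> \<le> min (f (s n) \<omega>) (f i \<omega>)" by eventually_elim simp
      then have "(\<integral>\<omega>. f j \<omega> \<partial>?N) \<le> (\<integral>\<omega>. min (f (s n) \<omega>) (f i \<omega>) \<partial>?N)"
        using f(1) s(1) i j by (intro integral_mono_AE int bmeas_min) auto
      then show ?thesis using m_le[OF j(1)] ifun_y[OF j(1)] by simp
    qed
    ultimately show ?thesis by (intro LIMSEQ_le_const) auto
  qed
  have g_int_le: "(\<integral>\<omega>. g \<omega> \<partial>?N) \<le> m"
  proof -
    have "(\<integral>\<omega>. g \<omega> \<partial>?N) \<le> m + 1 / real (Suc n)" for n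
    proof -
      have "(\<integral>\<omega>. g \<omega> \<partial>?N) \<le> (\<integral>\<omega>. f (s n) \<omega> \<partial>?N)"
        using g_le f(1) s(1) gb by (intro integral_mono int) auto
      then show ?thesis using s(2)[of n] ifun_y[OF s(1)[of n]] by linarith
    qed
    moreover have "(\<lambda>n. m + 1 / real (Suc n)) \<longlonglongrightarrow> m + 0"
      by (intro tendsto_add tendsto_const LIMSEQ_Suc[OF lim_1_over_n])
    ultimately show ?thesis using LIMSEQ_le_const[of _ "m + 0" "\<integral>\<omega>. g \<omega> \<partial>?N"] by auto
  qed
  obtain T where T: "support \<mu> T" using sca_support[OF \<mu>s \<mu>0] by blast
  then have Ts: "T \<in> sets M" by (simp add: support_def)
  \<comment> \<open>Cut down to the support, the relation between \<open>g\<close> and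
    \<open>f i\<close> holds quasi surely instead of only almost everywhere. This makes
    \<open>cl ?h\<close> a lower bound of the net, although the exceptional set varies with
    \<open>i\<close>.\<close>
  let ?h = "\<lambda>\<omega>. indicator T \<omega> * g \<omega>"
  have hb: "?h \<in> bmeas M" using Ts gb by (intro bmeas_mult bmeas_indicator)
  have "vle Linf (cl ?h) (y i)" if i: "i \<in> I" for i
  proof -
    have mb: "(\<lambda>\<omega>. min (g \<omega>) (f i \<omega>)) \<in> bmeas M" using gb f(1)[OF i] by (rule bmeas_min)
    have db: "(\<lambda>\<omega>. g \<omega> - min (g \<omega>) (f i \<omega>)) \<in> bmeas M" using gb mb by (rule bmeas_diff)
    have "(\<integral>\<omega>. g \<omega> - min (g \<omega>) (f i \<omega>) \<partial>?N) \<le> 0"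
      using int[OF gb] int[OF mb] min_ge[OF i] g_int_le by simp
    moreover have "0 \<le> (\<integral>\<omega>. g \<omega> - min (g \<omega>) (f i \<omega>) \<partial>?N)"
      by (rule Bochner_Integration.integral_nonneg) simp
    ultimately have "AE \<omega> in ?N. g \<omega> - min (g \<omega>) (f i \<omega>) = 0"
      using integral_nonneg_eq_0_iff_AE[OF int[OF db]] by simp
    moreover define A where "A = {\<omega> \<in> space M. f i \<omega> < g \<omega>}"
    have A: "A \<in> sets M"
      unfolding A_def using g_m bmeas_measurable[OF f(1)[OF i]] by measurable
    ultimately have "AE \<omega> in ?N. \<omega> \<notin> A"
      by (auto elim!: eventually_mono simp: A_def min_def split: if_splits)
    then have "emeasure ?N A = 0"
      using A by (subst (asm) AE_iff_measurable[of A]) (auto simp: A_def)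
    then have "\<mu> A = 0" using \<mu>0[OF A] A by (simp add: emeasure_pmeasure[OF \<mu>c \<mu>0] ennreal_eq_0_iff)
    then have "\<mu> (A \<inter> T) = 0" using ca_mono[OF \<mu>c \<mu>0, of "A \<inter> T" A] \<mu>0[of "A \<inter> T"] A Ts by auto
    then have "negl (A \<inter> T)" using T A by (simp add: support_def)
    then have "\<forall>\<^sub>F \<omega> in qs. \<omega> \<notin> A \<inter> T" by (auto simp: eventually_qs)
    then have "\<forall>\<^sub>F \<omega> in qs. ?h \<omega> \<le> f i \<omega>"
      using qs_space by eventually_elim (use f(3)[OF i] in \<open>auto simp: A_def split:
        split_indicator\<close>)
    then show ?thesis using f i hb by (simp add: Linf_le)
  qed
  then have "vle Linf (cl ?h) (vzero Linf)" using inf0 Linf_cl[OF hb] by (auto simp: is_inf_def)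
  then have "\<forall>\<^sub>F \<omega> in qs. ?h \<omega> \<le> 0" using hb by (simp add: Linf_zero Linf_le bmeas_const)
  then have "AE \<omega> in ?N. ?h \<omega> \<le> 0" by (rule qs_AE[OF \<mu>])
  moreover have "AE \<omega> in ?N. \<omega> \<notin> space M - T"
  proof (rule AE_not_in)
    show "space M - T \<in> null_sets ?N"
      using T Ts by (simp add: null_sets_def support_def emeasure_pmeasure[OF \<mu>c \<mu>0])
  qed
  moreover have "AE \<omega> in ?N. \<omega> \<in> space M" using AE_space[of ?N] by simp
  ultimately have "AE \<omega> in ?N. g \<omega> \<le> 0" by eventually_elim auto
  then have "(\<integral>\<omega>. min (g \<omega>) (f (s 0) \<omega>) \<partial>?N) \<le> (\<integral>\<omega>. 0 \<partial>?N)"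
    using gb f(1)[OF s(1)]
    by (intro integral_mono_AE int bmeas_min bmeas_const) (auto elim!: eventually_mono simp:
      min_def)
  then show False using min_ge[OF s(1)[of 0]] e e_m by simp
qed

lemma ifun_W:
  assumes "\<mu> \<in> sca"
  shows "ifun \<mu> \<in> vcar W"
proof -
  have pos: "ifun \<mu> \<in> vcar W" if "\<mu> \<in> S.nonneg" for \<mu>
    using ifun_positive[OF that] ifun_order_continuous[OF that] L.positive_functional_order_bounded
    by (simp add: W_iff L.positive_functional_def)
  obtain u v where uv: "u \<in> S.nonneg" "v \<in> S.nonneg" "\<mu> = vdiff (sca_c M \<PP>) u v"
    by (rule S.nonneg_decompose[OF assms])
  note c = sca_nonnegD(1)[OF uv(1)] sca_nonnegD(1)[OF uv(2)]
  have eq: "ifun \<mu> = (\<lambda>X\<in>vcar Linf. 1 * ifun u X + (- 1) * ifun v X)"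
  proof (rule L.linear_functional_ext[OF ifun_linear[OF assms]])
    show "linear_functional Linf (\<lambda>X\<in>vcar Linf. 1 * ifun u X + (- 1) * ifun v X)"
      using c by (intro L.linear_functional_combine ifun_linear)
    fix X assume X: "X \<in> vcar Linf"
    then obtain f where f: "f \<in> bmeas M" "X = cl f" by (rule Linf_cases)
    have \<mu>: "\<mu> = (\<lambda>A. u A + (- 1) * v A)" using uv(3) by simp
    have "signed_integral M \<mu> f = signed_integral M u f + (- 1) * signed_integral M v f"
      unfolding \<mu> using f c
      by (simp only: signed_integral_add signed_integral_scale ca_scale sca_ca)
    then show "ifun \<mu> X = (\<lambda>X\<in>vcar Linf. 1 * ifun u X + (- 1) * ifun v X) X"
      using X f assms c by (simp add: ifun_cl)
  qed
  show ?thesis unfolding eq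
    by (rule L.order_continuous_dual_combine[OF pos[OF uv(1)] pos[OF uv(2)]])
qed

section \<open>Supports of order continuous functionals\<close>

lemma fmeasure_negl:
  assumes \<phi>: "\<phi> \<in> vcar W" and N: "negl N"
  shows "fmeasure \<phi> N = 0"
proof -
  have "\<forall>\<^sub>F \<omega> in qs. (indicator N \<omega> :: real) = 0"
    unfolding eventually_qs using N by (intro exI[of _ N]) auto
  then have "cl (indicator N) = vzero Linf"
    using negl_sets[OF N] by (simp add: Linf_zero Linf_eq bmeas_indicator bmeas_const)
  then show ?thesis
    using negl_sets[OF N] \<phi> L.linear_functional_zero[of \<phi>] by (simp add: fmeasure_def W_iff)
qed

text \<open>The null sets of \<open>\<psi>\<close> have a supremum \<open>f\<close> with \<open>\<psi> f = 0\<close>, and \<open>{f \<le> 0}\<close> is a support.\<close>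

lemma fmeasure_positive_supported:
  assumes DC: "dedekind_complete Linf" and \<psi>W: "\<psi> \<in> vcar W" and \<psi>: "L.positive_functional \<psi>"
  shows "fmeasure \<psi> \<in> sca"
proof -
  let ?\<mu> = "fmeasure \<psi>"
  have \<mu>c: "?\<mu> \<in> ca M" using \<psi>W by (rule fmeasure_ca)
  have \<mu>0: "0 \<le> ?\<mu> A" for A
    using \<psi> Linf_nonneg_cl[OF bmeas_indicator, of A]
      unfolding fmeasure_def L.positive_functional_def by auto
  have tv: "tv M ?\<mu> = ?\<mu>" using \<mu>c \<mu>0 by (rule tv_of_nonneg)
  \<comment> \<open>Null sets are closed under finite unions, so their indicators form a directed
    family, bounded by 1.\<close>
  define \<B> where "\<B> = {B \<in> sets M. ?\<mu> B = 0}"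
  define D where "D = (\<lambda>B. cl (indicator B)) ` \<B>"
  have \<B>s: "B \<in> sets M" if "B \<in> \<B>" for B using that by (simp add: \<B>_def)
  have D: "up_directed Linf D"
    unfolding up_directed_def
  proof (intro conjI ballI)
    show "D \<noteq> {}" using ca_empty[OF \<mu>c] by (auto simp: D_def \<B>_def)
    show "D \<subseteq> vcar Linf" using \<B>s by (auto simp: D_def intro!: Linf_cl bmeas_indicator)
    fix x y assume "x \<in> D" "y \<in> D"
    then obtain A B where AB: "A \<in> \<B>" "B \<in> \<B>" "x = cl (indicator A)" "y = cl (indicator B)"
      by (auto simp: D_def)
    have "?\<mu> (A \<union> B) = ?\<mu> A + ?\<mu> (B - A)"
      using ca_Un[OF \<mu>c, of A "B - A"] \<B>s[OF AB(1)] \<B>s[OF AB(2)] by simp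
    moreover have "?\<mu> (B - A) \<le> ?\<mu> B"
      using \<B>s[OF AB(1)] \<B>s[OF AB(2)] by (intro ca_mono[OF \<mu>c \<mu>0]) auto
    ultimately have "A \<union> B \<in> \<B>" using AB \<mu>0[of "A \<union> B"] by (auto simp: \<B>_def)
    moreover have "vle Linf x (cl (indicator (A \<union> B)))" "vle Linf y (cl (indicator (A \<union> B)))"
      using AB \<B>s[OF AB(1)] \<B>s[OF AB(2)]
      by (auto simp: Linf_le bmeas_indicator indicator_def intro!: always_eventually)
    ultimately show "\<exists>z\<in>D. vle Linf x z \<and> vle Linf y z" by (auto simp: D_def)
  qed
  have "vle Linf d (cl (\<lambda>\<omega>. 1))" if "d \<in> D" for d
    using that \<B>s by (auto simp: D_def Linf_le bmeas_indicator bmeas_const indicator_def intro!: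
      always_eventually)
  then have "\<exists>u\<in>vcar Linf. \<forall>d\<in>D. vle Linf d u" using Linf_cl[OF bmeas_const[of 1 M]] by blast
  moreover have "D \<subseteq> vcar Linf" "D \<noteq> {}" using D by (simp_all add: up_directed_def)
  ultimately obtain s where s: "is_sup Linf D s"
    using DC[unfolded dedekind_complete_def, rule_format, of D] by blast
  have D0: "\<psi> d = 0" if "d \<in> D" for d using that by (auto simp: D_def \<B>_def fmeasure_def)
  \<comment> \<open>Members of \<open>D\<close> have value 0 and, by order continuity, come
    arbitrarily close to the value of the supremum.\<close>
  have "\<psi> s = 0"
  proof (rule ccontr)
    assume "\<psi> s \<noteq> 0"
    then have "\<exists>d\<in>D. \<forall>d'\<in>D. vle Linf d d' \<longrightarrow> \<bar>\<psi> s - \<psi> d'\<bar> < \<bar>\<psi> s\<bar>"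
      using \<psi>W by (intro L.order_continuous_up_directed[OF _ _ D s]) (auto simp: W_iff)
    then obtain d where "d \<in> D" "vle Linf d d \<longrightarrow> \<bar>\<psi> s - \<psi> d\<bar> < \<bar>\<psi> s\<bar>" by blast
    then show False using D0 L.le_refl D by (auto simp: up_directed_def)
  qed
  have "vle Linf (cl (indicator {})) s" using L.is_sup_ge[OF s] ca_empty[OF \<mu>c]
    by (auto simp: D_def \<B>_def)
  then have "s \<in> L.nonneg" using L.is_sup_closed[OF s]
    by (simp add: Linf_zero indicator_def[abs_def])
  then obtain f where f: "f \<in> bmeas M" "s = cl f" "\<forall>\<omega>. 0 \<le> f \<omega>" by (rule Linf_nonneg_cases)
  note [measurable] = bmeas_measurable[OF f(1)]
  let ?S = "{\<omega> \<in> space M. f \<omega> \<le> 0}"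
  have "support ?\<mu> ?S"
    unfolding support_def
  proof (intro conjI ballI impI)
    show "?S \<in> sets M" by measurable
    \<comment> \<open>On these sets the indicator is at most \<open>(n + 1) f\<close>, so
      \<open>\<psi> s = 0\<close> makes them null. They increase to the complement of
      \<open>?S\<close>.\<close>
    define A where "A n = {\<omega> \<in> space M. 1 / real (Suc n) < f \<omega>}" for n
    have A: "A n \<in> sets M" for n unfolding A_def by measurable
    have A0: "?\<mu> (A n) = 0" for n
    proof -
      have "indicator (A n) \<omega> \<le> real (Suc n) * f \<omega>" for \<omega>
        using f(3) by (auto simp: A_def field_simps split: split_indicator)
      then have "vle Linf (cl (indicator (A n))) (cl (\<lambda>\<omega>. real (Suc n) * f \<omega>))"
        using f A by (simp add: Linf_le bmeas_indicator bmeas_scale)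
      then have "\<psi> (cl (indicator (A n))) \<le> \<psi> (cl (\<lambda>\<omega>. real (Suc n) * f \<omega>))"
        using f A by (intro L.positive_functional_mono[OF \<psi>] Linf_cl bmeas_indicator bmeas_scale)
      also have "\<dots> = real (Suc n) * \<psi> s"
        using bmeas_functional_scale[OF W_bmeas_functional[OF \<psi>W] f(1)] f(2) by simp
      finally show ?thesis using \<open>\<psi> s = 0\<close> \<mu>0[of "A n"] A by (simp add: fmeasure_def)
    qed
    have "incseq A"
    proof (rule incseq_SucI)
      fix n
      have "1 / real (Suc (Suc n)) \<le> 1 / real (Suc n)" by (simp add: frac_le)
      then show "A n \<le> A (Suc n)" unfolding A_def by (auto intro: le_less_trans)
    qed
    then have "(\<lambda>n. ?\<mu> (A n)) \<longlonglongrightarrow> ?\<mu> (\<Union>n. A n)" using A by (intro ca_incseq[OF \<mu>c]) auto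
    moreover have "(\<Union>n. A n) = space M - ?S"
    proof -
      have iff: "(\<exists>n. 1 / real (Suc n) < f \<omega>) \<longleftrightarrow> 0 < f \<omega>" for \<omega>
      proof
        assume "\<exists>n. 1 / real (Suc n) < f \<omega>"
        then obtain n where "1 / real (Suc n) < f \<omega>" by blast
        moreover have "0 < 1 / real (Suc n)" by simp
        ultimately show "0 < f \<omega>" by linarith
      next
        show "\<exists>n. 1 / real (Suc n) < f \<omega>" if "0 < f \<omega>"
          using reals_Archimedean[OF that] by (simp only: inverse_eq_divide)
      qed
      have "(\<Union>n. A n) = {\<omega> \<in> space M. \<exists>n. 1 / real (Suc n) < f \<omega>}"
        by (auto simp: A_def simp del: of_nat_Suc)
      also have "\<dots> = space M - ?S" unfolding iff by auto
      finally show ?thesis .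
    qed
    ultimately show "?\<mu> (space M - ?S) = 0" using A0 by (simp add: LIMSEQ_const_iff)
    fix N assume N: "N \<in> sets M" "?\<mu> (N \<inter> ?S) = 0"
    have NS: "N \<inter> ?S \<in> sets M" using N by measurable
    \<comment> \<open>A null subset of \<open>?S\<close> is a member of the family, so its indicator
      lies below \<open>f\<close>; but \<open>f \<le> 0\<close> on \<open>?S\<close>.\<close>
    then have "cl (indicator (N \<inter> ?S)) \<in> D" using N by (auto simp: D_def \<B>_def)
    then have "vle Linf (cl (indicator (N \<inter> ?S))) (cl f)" using L.is_sup_ge[OF s] f by simp
    then have "\<forall>\<^sub>F \<omega> in qs. indicator (N \<inter> ?S) \<omega> \<le> f \<omega>"
      using Linf_le[OF bmeas_indicator[OF NS] f(1)] by simp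
    then have "\<forall>\<^sub>F \<omega> in qs. \<omega> \<notin> N \<inter> ?S" by eventually_elim auto
    moreover have eq: "{\<omega> \<in> space M. \<not> \<omega> \<notin> N \<inter> ?S} = N \<inter> ?S" by auto
    ultimately show "negl (N \<inter> ?S)" using qs_iff_negl[of "\<lambda>\<omega>. \<omega> \<notin> N \<inter> ?S"] NS unfolding eq by blast
  qed
  then show ?thesis using \<mu>c tv fmeasure_negl[OF \<psi>W] by (auto simp: sca_iff)
qed

text \<open>Writes \<open>\<phi>\<close> as the positive functional \<open>\<psi>\<close> minus the
  positive functional \<open>\<psi> - \<phi>\<close>.\<close>

lemma fmeasure_sca:
  assumes DC: "dedekind_complete Linf" and \<phi>: "\<phi> \<in> vcar W"
  shows "fmeasure \<phi> \<in> sca"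
proof -
  obtain \<psi> where \<psi>: "\<psi> \<in> vcar W" "L.positive_functional \<psi>" "\<forall>X\<in>L.nonneg. \<phi> X \<le> \<psi> X"
    using W_pos_part[OF \<phi>] by blast
  let ?\<chi> = "\<lambda>X\<in>vcar Linf. 1 * \<psi> X + (- 1) * \<phi> X"
  have \<chi>W: "?\<chi> \<in> vcar W" using \<psi>(1) \<phi> by (rule L.order_continuous_dual_combine)
  have "L.positive_functional ?\<chi>"
    using \<chi>W \<psi>(3) by (auto simp: L.positive_functional_def W_iff)
  then have "(\<lambda>A. fmeasure \<psi> A + (- 1) * fmeasure ?\<chi> A) \<in> sca"
    using \<psi> \<chi>W by (intro sca_add sca_scale fmeasure_positive_supported[OF DC])
  moreover have "(\<lambda>A. fmeasure \<psi> A + (- 1) * fmeasure ?\<chi> A) = fmeasure \<phi>"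
    by (auto simp: fmeasure_def fun_eq_iff Linf_cl bmeas_indicator)
  ultimately show ?thesis by simp
qed

text \<open>Both sides agree on indicators. So under Dedekind completeness every order continuous
  functional is integration against a supported measure.\<close>

lemma ifun_fmeasure:
  assumes DC: "dedekind_complete Linf" and \<phi>: "\<phi> \<in> vcar W"
  shows "ifun (fmeasure \<phi>) = \<phi>"
proof (rule L.linear_functional_ext)
  have \<mu>: "fmeasure \<phi> \<in> sca" by (rule fmeasure_sca[OF DC \<phi>])
  then show "linear_functional Linf (ifun (fmeasure \<phi>))" by (rule ifun_linear)
  show "linear_functional Linf \<phi>" using \<phi> by (simp add: W_iff)
  fix X assume "X \<in> vcar Linf"
  then obtain f where f: "f \<in> bmeas M" "X = cl f" by (rule Linf_cases)
  have "signed_integral M (fmeasure \<phi>) f = \<phi> (cl f)"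
    by (rule bmeas_functional_eqI[OF signed_integral_functional[OF sca_ca[OF \<mu>]]
      W_bmeas_functional[OF \<phi>] _ f(1)])
      (simp add: signed_integral_indicator[OF sca_ca[OF \<mu>]] fmeasure_def)
  then show "ifun (fmeasure \<phi>) X = \<phi> X" using f \<mu> by (simp add: ifun_cl)
qed

section \<open>Class (S)\<close>

text \<open>The working form of class (S): supported measures charge every event that is not
  negligible. Normalising such a measure turns it into a probability, which gives the converse
  direction.\<close>

lemma class_S_iff:
  "class_S M \<PP> \<longleftrightarrow> (\<forall>A\<in>sets M. \<not> negl A \<longrightarrow> (\<exists>\<mu>\<in>S.nonneg. 0 < \<mu> A))"
proof
  assume "class_S M \<PP>"
  then obtain \<QQ> where Q: "\<QQ> \<subseteq> Delta M" "dominated M (measure ` \<PP>) (measure ` \<QQ>)" "measure ` \<QQ> \<subseteq> sca"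
    by (auto simp: class_S_def)
  show "\<forall>A\<in>sets M. \<not> negl A \<longrightarrow> (\<exists>\<mu>\<in>S.nonneg. 0 < \<mu> A)"
  proof (intro ballI impI)
    fix A assume A: "A \<in> sets M" "\<not> negl A"
    then obtain R where R: "R \<in> \<QQ>" "0 < tv M (measure R) A"
      using Q(2) priors_null_iff[OF A(1)] unfolding dominated_iff by force
    moreover have "tv M (measure R) = measure R"
      using Q(1) R(1) by (intro tv_measure) (auto simp: Delta_def)
    moreover have "measure R \<in> S.nonneg" using Q(3) R(1) by auto
    ultimately show "\<exists>\<mu>\<in>S.nonneg. 0 < \<mu> A" by auto
  qed
next
  assume pos: "\<forall>A\<in>sets M. \<not> negl A \<longrightarrow> (\<exists>\<mu>\<in>S.nonneg. 0 < \<mu> A)"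
  \<comment> \<open>The largest possible choice: all supported probabilities.\<close>
  define \<QQ> where "\<QQ> = {R \<in> Delta M. measure R \<in> sca}"
  have "dominated M (measure ` \<QQ>) (measure ` \<PP>)"
    using priors_null_iff sca_tv_negl by (auto simp: dominated_iff \<QQ>_def)
  moreover have "dominated M (measure ` \<PP>) (measure ` \<QQ>)"
    unfolding dominated_iff
  proof (intro ballI impI)
    fix N assume N: "N \<in> sets M" "\<forall>\<nu>\<in>measure ` \<QQ>. tv M \<nu> N \<le> 0"
    have "negl N"
    proof (rule ccontr)
      assume "\<not> negl N"
      then obtain \<mu> where \<mu>: "\<mu> \<in> S.nonneg" "0 < \<mu> N" using pos N(1) by blast
      note c = sca_nonnegD(1)[OF \<mu>(1)]
      have "\<mu> N \<le> \<mu> (space M)"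
        using ca_mono[OF sca_ca[OF c] sca_nonnegD(2)[OF \<mu>(1)] N(1) sets.top
          sets.sets_into_space[OF N(1)]] .
      then have m: "0 < \<mu> (space M)" using \<mu>(2) by simp
      let ?\<nu> = "\<lambda>A. inverse (\<mu> (space M)) * \<mu> A"
      have \<nu>: "?\<nu> \<in> sca" "0 \<le> ?\<nu> A" if "A \<in> sets M" for A
        using c sca_nonnegD(2)[OF \<mu>(1) that] m by (auto intro: sca_scale)
      then have \<nu>s: "?\<nu> \<in> sca" "\<And>A. A \<in> sets M \<Longrightarrow> 0 \<le> ?\<nu> A" by blast+
      have "prob_space (pmeasure M ?\<nu>)"
        by (rule prob_spaceI) (use m in \<open>simp add: emeasure_pmeasure[OF sca_ca[OF \<nu>s(1)] \<nu>s(2)]\<close>)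
      then have "pmeasure M ?\<nu> \<in> \<QQ>"
        using \<nu>s by (simp add: \<QQ>_def Delta_def measure_pmeasure[OF sca_ca[OF \<nu>s(1)] \<nu>s(2)])
      then have "tv M ?\<nu> N \<le> 0"
        using N(2) measure_pmeasure[OF sca_ca[OF \<nu>s(1)] \<nu>s(2)] by force
      then have "?\<nu> N \<le> 0" using abs_le_tv[OF sca_ca[OF \<nu>s(1)], of N] by simp
      then show False using m \<mu>(2) by (simp add: mult_le_0_iff)
    qed
    then have "\<forall>\<mu>\<in>measure ` \<PP>. tv M \<mu> N \<le> 0" using priors_null_iff[OF N(1)] by blast
    then show "tv M \<mu> N \<le> 0" if "\<mu> \<in> measure ` \<PP>" for \<mu> using that by blast
  qed
  ultimately show "class_S M \<PP>" unfolding class_S_def by (intro exI[of _ \<QQ>]) (auto simp: \<QQ>_def)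
qed

lemma class_S_if_W_separates:
  assumes DC: "dedekind_complete Linf"
    and sep: "\<And>A. A \<in> sets M \<Longrightarrow> \<not> negl A \<Longrightarrow> \<exists>\<phi>\<in>vcar W. \<phi> (cl (indicator A)) \<noteq> 0"
  shows "class_S M \<PP>"
  unfolding class_S_iff
proof (intro ballI impI)
  fix A assume A: "A \<in> sets M" "\<not> negl A"
  then obtain \<phi> where \<phi>: "\<phi> \<in> vcar W" "\<phi> (cl (indicator A)) \<noteq> 0" using sep by blast
  have s: "fmeasure \<phi> \<in> sca" using DC \<phi>(1) by (rule fmeasure_sca)
  have "0 < \<bar>fmeasure \<phi> A\<bar>" using \<phi>(2) A(1) by (simp add: fmeasure_def)
  then have "0 < tv M (fmeasure \<phi>) A" using abs_le_tv[OF sca_ca[OF s], of A] by linarith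
  moreover have "tv M (fmeasure \<phi>) \<in> S.nonneg"
    using s tv_nonneg[OF sca_ca[OF s]] by (intro sca_nonnegI sca_tv)
  ultimately show "\<exists>\<mu>\<in>S.nonneg. 0 < \<mu> A" by blast
qed

text \<open>If \<open>f\<close> exceeds \<open>a\<close> on an event that is not negligible, it
  exceeds \<open>a + 1 / (n + 1)\<close> on such an event for some \<open>n\<close>. A positive
  supported measure charging that event, restricted to it and normalised, integrates
  \<open>f\<close> to at least this larger value. The strict inequality serves order, norm and the
  Hausdorff property alike.\<close>

lemma class_S_witness:
  assumes cS: "class_S M \<PP>" and f: "f \<in> bmeas M" and not_le: "\<not> (\<forall>\<^sub>F \<omega> in qs. f \<omega> \<le> a)"
  shows "\<exists>\<nu>\<in>S.nonneg. \<nu> (space M) = 1 \<and> a < signed_integral M \<nu> f"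
proof -
  note [measurable] = bmeas_measurable[OF f]
  have "\<exists>n. \<not> (\<forall>\<^sub>F \<omega> in qs. f \<omega> \<le> a + 1 / real (Suc n))"
  proof (rule ccontr)
    assume "\<not> ?thesis"
    then have "\<forall>\<^sub>F \<omega> in qs. \<forall>n. f \<omega> \<le> a + 1 / real (Suc n)" by (intro qs_countable) blast
    then have "\<forall>\<^sub>F \<omega> in qs. f \<omega> \<le> a"
    proof eventually_elim
      fix \<omega> assume *: "\<forall>n. f \<omega> \<le> a + 1 / real (Suc n)"
      have "(\<lambda>n. a + 1 / real (Suc n)) \<longlonglongrightarrow> a + 0"
        by (intro tendsto_add tendsto_const LIMSEQ_Suc[OF lim_1_over_n])
      then have "f \<omega> \<le> a + 0" by (rule LIMSEQ_le_const) (use * in blast)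
      then show "f \<omega> \<le> a" by simp
    qed
    then show False using not_le by blast
  qed
  then obtain n where n: "\<not> (\<forall>\<^sub>F \<omega> in qs. f \<omega> \<le> a + 1 / real (Suc n))" by blast
  define b where "b = a + 1 / real (Suc n)"
  define A where "A = {\<omega> \<in> space M. \<not> f \<omega> \<le> b}"
  have A: "A \<in> sets M" unfolding A_def by measurable
  have "\<not> negl A" using n qs_iff_negl[of "\<lambda>\<omega>. f \<omega> \<le> b"] A unfolding A_def b_def by blast
  then obtain \<mu> where \<mu>: "\<mu> \<in> S.nonneg" "0 < \<mu> A" using cS A unfolding class_S_iff by blast
  note \<mu>s = sca_nonnegD(1)[OF \<mu>(1)]
  note \<mu>c = sca_ca[OF \<mu>s]
  note \<Lambda> = signed_integral_functional[OF \<mu>c]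
  \<comment> \<open>Conditioning \<open>\<mu>\<close> on the event \<open>A\<close>.\<close>
  let ?\<nu> = "\<lambda>B. inverse (\<mu> A) * restr M \<mu> A B"
  have 1: "?\<nu> \<in> S.nonneg"
  proof (rule sca_nonnegI)
    show "?\<nu> \<in> sca" using \<mu>s A by (intro sca_scale sca_restr)
    show "0 \<le> ?\<nu> B" if "B \<in> sets M" for B
      using \<mu>(2) sca_nonnegD(2)[OF \<mu>(1), of "B \<inter> A"] that A by (simp add: restr_apply)
  qed
  have 2: "?\<nu> (space M) = 1"
  proof -
    have "space M \<inter> A = A" by (auto simp: A_def)
    then show ?thesis using \<mu>(2) by (simp add: restr_apply)
  qed
  have 3: "a < signed_integral M ?\<nu> f"
  proof -
    have fb: "(\<lambda>\<omega>. indicator A \<omega> * f \<omega>) \<in> bmeas M" using f A by (intro bmeas_mult bmeas_indicator)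
    have bb: "(\<lambda>\<omega>. b * indicator A \<omega>) \<in> bmeas M" using A by (intro bmeas_scale bmeas_indicator)
    have "0 \<le> signed_integral M \<mu> (\<lambda>\<omega>. indicator A \<omega> * f \<omega> - b * indicator A \<omega>)"
      by (rule signed_integral_nonneg[OF \<mu>c sca_nonnegD(2)[OF \<mu>(1)] bmeas_diff[OF fb bb]])
        (auto simp: A_def split: split_indicator)
    then have "b * \<mu> A \<le> signed_integral M \<mu> (\<lambda>\<omega>. indicator A \<omega> * f \<omega>)"
      using A by (simp add: bmeas_functional_diff[OF \<Lambda> fb bb]
          bmeas_functional_scale[OF \<Lambda> bmeas_indicator] signed_integral_indicator[OF \<mu>c])
    then have "b \<le> inverse (\<mu> A) * signed_integral M \<mu> (\<lambda>\<omega>. indicator A \<omega> * f \<omega>)"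
      using \<mu>(2) by (simp add: field_simps)
    also have "\<dots> = signed_integral M ?\<nu> f"
      using \<mu>c A f by (simp only: signed_integral_scale ca_restr signed_integral_restr)
    finally have "b \<le> signed_integral M ?\<nu> f" .
    moreover have "0 < 1 / real (Suc n)" by simp
    ultimately show ?thesis unfolding b_def by linarith
  qed
  show ?thesis using 2 3 by (intro bexI[OF _ 1]) simp
qed

lemma class_S_le_iff:
  assumes cS: "class_S M \<PP>" and X: "X \<in> vcar Linf" and Y: "Y \<in> vcar Linf"
  shows "vle Linf X Y \<longleftrightarrow> (\<forall>\<mu>\<in>S.nonneg. ifun \<mu> X \<le> ifun \<mu> Y)"
proof
  show "\<forall>\<mu>\<in>S.nonneg. ifun \<mu> X \<le> ifun \<mu> Y" if "vle Linf X Y"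
    using L.positive_functional_mono[OF ifun_positive X Y that] by blast
  assume le: "\<forall>\<mu>\<in>S.nonneg. ifun \<mu> X \<le> ifun \<mu> Y"
  obtain f where f: "f \<in> bmeas M" "X = cl f" using X by (rule Linf_cases)
  obtain g where g: "g \<in> bmeas M" "Y = cl g" using Y by (rule Linf_cases)
  have "\<forall>\<^sub>F \<omega> in qs. f \<omega> - g \<omega> \<le> 0"
  proof (rule ccontr)
    assume "\<not> ?thesis"
    then obtain \<nu> where \<nu>: "\<nu> \<in> S.nonneg" "0 < signed_integral M \<nu> (\<lambda>\<omega>. f \<omega> - g \<omega>)"
      using class_S_witness[OF cS bmeas_diff[OF f(1) g(1)]] by blast
    note s = sca_nonnegD(1)[OF \<nu>(1)]
    have "ifun \<nu> X \<le> ifun \<nu> Y" using le \<nu>(1) by (rule bspec)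
    then have "signed_integral M \<nu> f \<le> signed_integral M \<nu> g" using f g s by (simp add: ifun_cl)
    then show False
      using \<nu>(2) bmeas_functional_diff[OF signed_integral_functional[OF sca_ca[OF s]] f(1) g(1)]
        by simp
  qed
  then show "vle Linf X Y" using f g by (simp add: Linf_le)
qed

end

section \<open>Representation of functionals on supported measures\<close>

context priors
begin

definition weight :: "('a set \<Rightarrow> real) \<Rightarrow> ('a \<Rightarrow> real) \<Rightarrow> 'a set \<Rightarrow> real" where
  "weight \<mu> g = (\<lambda>A. if A \<in> sets M then signed_integral M \<mu> (\<lambda>\<omega>. g \<omega> * indicator A \<omega>) else 0)"

context
  fixes \<mu> assumes \<mu>: "\<mu> \<in> S.nonneg"
begin

lemma abs_signed_integral_indicator_le:
  assumes g: "g \<in> bmeas M" "\<And>\<omega>. \<omega> \<in> space M \<Longrightarrow> \<bar>g \<omega>\<bar> \<le> C" and A: "A \<in> sets M"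
  shows "\<bar>signed_integral M \<mu> (\<lambda>\<omega>. g \<omega> * indicator A \<omega>)\<bar> \<le> C * \<mu> A"
proof -
  note \<mu>c = sca_ca[OF sca_nonnegD(1)[OF \<mu>]]
  have r: "restr M \<mu> A \<in> ca M" using \<mu>c A by (rule ca_restr)
  have "signed_integral M \<mu> (\<lambda>\<omega>. g \<omega> * indicator A \<omega>) = signed_integral M (restr M \<mu> A) g"
    unfolding signed_integral_restr[OF \<mu>c A g(1)] by (simp add: mult.commute)
  moreover have "tv M (restr M \<mu> A) = restr M \<mu> A"
  proof (rule tv_of_nonneg[OF r])
    show "0 \<le> restr M \<mu> A B" if "B \<in> sets M" for B
      using sca_nonnegD(2)[OF \<mu>, of "B \<inter> A"] that A by (simp add: restr_apply)
  qed
  moreover have "space M \<inter> A = A" using sets.sets_into_space[OF A] by blast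
  ultimately show ?thesis
    using abs_signed_integral_le[OF r g] by (simp add: restr_apply mult.commute)
qed

lemma weight_ca:
  assumes g: "g \<in> bmeas M"
  shows "weight \<mu> g \<in> ca M"
proof -
  note \<mu>c = sca_ca[OF sca_nonnegD(1)[OF \<mu>]]
  obtain C where C: "\<And>\<omega>. \<omega> \<in> space M \<Longrightarrow> \<bar>g \<omega>\<bar> \<le> C" using bmeas_bound[OF g] by metis
  show ?thesis
  proof (rule ca_dominatedI[OF _ _ ca_scale[OF \<mu>c, of C]])
    show "weight \<mu> g A = 0" if "A \<notin> sets M" for A using that by (simp add: weight_def)
    show "\<bar>weight \<mu> g A\<bar> \<le> C * \<mu> A" if "A \<in> sets M" for A
      using abs_signed_integral_indicator_le[OF g C that] that by (simp add: weight_def)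
    fix A B assume AB: "A \<in> sets M" "B \<in> sets M" "A \<inter> B = {}"
    have eq: "(\<lambda>\<omega>. g \<omega> * indicator (A \<union> B) \<omega>) = (\<lambda>\<omega>. g \<omega> * indicator A \<omega> + g \<omega> * indicator B \<omega>)"
      using AB(3) by (auto simp: indicator_def fun_eq_iff)
    have "signed_integral M \<mu> (\<lambda>\<omega>. g \<omega> * indicator A \<omega> + g \<omega> * indicator B \<omega>) =
        signed_integral M \<mu> (\<lambda>\<omega>. g \<omega> * indicator A \<omega>) +
          signed_integral M \<mu> (\<lambda>\<omega>. g \<omega> * indicator B \<omega>)"
      using g AB by (intro bmeas_functional_add[OF signed_integral_functional[OF \<mu>c]] bmeas_mult
        bmeas_indicator)
    then show "weight \<mu> g (A \<union> B) = weight \<mu> g A + weight \<mu> g B"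
      using AB by (simp add: weight_def eq)
  qed
qed

lemma tv_weight_le:
  assumes g: "g \<in> bmeas M" "\<And>\<omega>. \<omega> \<in> space M \<Longrightarrow> \<bar>g \<omega>\<bar> \<le> C"
  shows "tv M (weight \<mu> g) (space M) \<le> C * \<mu> (space M)"
  using abs_signed_integral_indicator_le[OF g] sca_ca[OF sca_nonnegD(1)[OF \<mu>]] g
  by (intro tv_least weight_ca ca_scale) (auto simp: weight_def)

lemma weight_sca:
  assumes g: "g \<in> bmeas M"
  shows "weight \<mu> g \<in> sca"
proof (rule sca_absolutely_continuous[OF sca_nonnegD(1)[OF \<mu>] weight_ca[OF g]])
  obtain C where C: "\<And>\<omega>. \<omega> \<in> space M \<Longrightarrow> \<bar>g \<omega>\<bar> \<le> C" using bmeas_bound[OF g] by metis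
  fix A assume A: "A \<in> sets M" "tv M \<mu> A = 0"
  then have "\<mu> A = 0" using abs_le_tv[OF sca_ca[OF sca_nonnegD(1)[OF \<mu>]], of A] by simp
  then show "weight \<mu> g A = 0"
    using abs_signed_integral_indicator_le[OF g C A(1)] A(1) by (simp add: weight_def)
qed

lemma weight_indicator: "A \<in> sets M \<Longrightarrow> weight \<mu> (indicator A) = restr M \<mu> A"
proof
  fix B assume A: "A \<in> sets M"
  have "(\<lambda>\<omega>. indicator A \<omega> * indicator B \<omega> :: real) = indicator (B \<inter> A)"
    by (rule ext) (simp split: split_indicator)
  then show "weight \<mu> (indicator A) B = restr M \<mu> A B"
    using A signed_integral_indicator[OF sca_ca[OF sca_nonnegD(1)[OF \<mu>]], of "B \<inter> A"]
    by (simp add: weight_def restr_def)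
qed

text \<open>The passage from almost everywhere to quasi surely: the event where \<open>k\<close>
  does not vanish is null, and null events inside a support are negligible.\<close>

lemma positive_set_negl:
  assumes T: "support \<mu> T" and k: "k \<in> bmeas M" "\<And>\<omega>. 0 \<le> k \<omega>" and 0: "signed_integral M \<mu> k = 0"
  shows "\<forall>\<^sub>F \<omega> in qs. \<omega> \<in> T \<longrightarrow> k \<omega> = 0"
proof -
  note \<mu>c = sca_ca[OF sca_nonnegD(1)[OF \<mu>]]
  note \<mu>0 = sca_nonnegD(2)[OF \<mu>]
  note [measurable] = bmeas_measurable[OF k(1)]
  have Ts: "T \<in> sets M" using T by (simp add: support_def)
  have int: "integrable (pmeasure M \<mu>) k"
    by (rule bmeas_integrable[OF finite_measure_pmeasure[OF \<mu>c \<mu>0] sets_pmeasure k(1)])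
  have "(\<integral>\<omega>. k \<omega> \<partial>pmeasure M \<mu>) = 0" using 0 signed_integral_eq_integral[OF \<mu>c \<mu>0 k(1)] by simp
  then have AE: "AE \<omega> in pmeasure M \<mu>. k \<omega> = 0"
    using integral_nonneg_eq_0_iff_AE[OF int] k(2) by simp
  define A where "A = {\<omega> \<in> space M. k \<omega> \<noteq> 0}"
  have A: "A \<in> sets M" unfolding A_def by measurable
  have "AE \<omega> in pmeasure M \<mu>. \<omega> \<notin> A" using AE by eventually_elim (simp add: A_def)
  then have "emeasure (pmeasure M \<mu>) A = 0"
    using A by (subst (asm) AE_iff_measurable[of A]) (auto simp: A_def)
  then have "\<mu> A = 0" using \<mu>0[OF A] A by (simp add: emeasure_pmeasure[OF \<mu>c \<mu>0] ennreal_eq_0_iff)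
  then have "\<mu> (A \<inter> T) = 0" using ca_mono[OF \<mu>c \<mu>0, of "A \<inter> T" A] \<mu>0[of "A \<inter> T"] A Ts by auto
  then have "negl (A \<inter> T)" using T A by (simp add: support_def)
  then have "\<forall>\<^sub>F \<omega> in qs. \<omega> \<notin> A \<inter> T" by (auto simp: eventually_qs)
  then show ?thesis using qs_space by eventually_elim (auto simp: A_def)
qed

end

text \<open>Testing on the event \<open>{g < f}\<close> makes the integral of the positive part of
  \<open>f - g\<close> vanish.\<close>

lemma support_eq:
  assumes \<mu>: "\<mu> \<in> S.nonneg" and T: "support \<mu> T" and fg: "f \<in> bmeas M" "g \<in> bmeas M"
    and eq: "\<And>A. A \<in> sets M \<Longrightarrow> signed_integral M \<mu> (\<lambda>\<omega>. f \<omega> * indicator A \<omega>) =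
      signed_integral M \<mu> (\<lambda>\<omega>. g \<omega> * indicator A \<omega>)"
  shows "\<forall>\<^sub>F \<omega> in qs. \<omega> \<in> T \<longrightarrow> f \<omega> = g \<omega>"
proof -
  have le: "\<forall>\<^sub>F \<omega> in qs. \<omega> \<in> T \<longrightarrow> f \<omega> \<le> g \<omega>"
    if fg: "f \<in> bmeas M" "g \<in> bmeas M" and eq: "\<And>A. A \<in> sets M \<Longrightarrow>
      signed_integral M \<mu> (\<lambda>\<omega>. f \<omega> * indicator A \<omega>) =
        signed_integral M \<mu> (\<lambda>\<omega>. g \<omega> * indicator A \<omega>)" for f g
  proof -
    note [measurable] = fg[THEN bmeas_measurable]
    define A where "A = {\<omega> \<in> space M. g \<omega> < f \<omega>}"
    have A: "A \<in> sets M" unfolding A_def by measurable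
    have b: "(\<lambda>\<omega>. f \<omega> * indicator A \<omega>) \<in> bmeas M" "(\<lambda>\<omega>. g \<omega> * indicator A \<omega>) \<in> bmeas M"
      using fg A by (auto intro: bmeas_mult bmeas_indicator)
    have "signed_integral M \<mu> (\<lambda>\<omega>. f \<omega> * indicator A \<omega> - g \<omega> * indicator A \<omega>) = 0"
      using bmeas_functional_diff[OF signed_integral_functional[OF sca_ca[OF sca_nonnegD(1)[OF
        \<mu>]]] b] eq[OF A] by simp
    then have "\<forall>\<^sub>F \<omega> in qs. \<omega> \<in> T \<longrightarrow> f \<omega> * indicator A \<omega> - g \<omega> * indicator A \<omega> = 0"
      using b by (intro positive_set_negl[OF \<mu> T] bmeas_diff) (auto simp: A_def split:
        split_indicator)
    then show ?thesis
      using qs_space by eventually_elim (auto simp: A_def split: split_indicator_asm)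
  qed
  have "\<forall>\<^sub>F \<omega> in qs. \<omega> \<in> T \<longrightarrow> f \<omega> \<le> g \<omega>" by (rule le[OF fg]) (rule eq)
  moreover have "\<forall>\<^sub>F \<omega> in qs. \<omega> \<in> T \<longrightarrow> g \<omega> \<le> f \<omega>" by (rule le[OF fg(2,1)]) (rule eq[symmetric])
  ultimately show ?thesis by eventually_elim auto
qed

text \<open>
  For positive \<open>\<mu>\<close> the set function \<open>A \<mapsto> \<Phi> (\<mu>|A) + C \<mu> A\<close> has a density \<open>d\<close> with respect to \<open>\<mu>\<close>.
  On the support of \<open>\<mu>\<close> it does not change when \<open>\<mu>\<close> grows, so Dedekind completeness glues these
  densities together.
\<close>

lemma sca_functional_density:
  assumes \<Phi>: "linear_functional (sca_c M \<PP>) \<Phi>"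
    and C: "0 \<le> C" "\<And>\<mu>. \<mu> \<in> sca \<Longrightarrow> \<bar>\<Phi> \<mu>\<bar> \<le> C * tv M \<mu> (space M)"
    and \<mu>: "\<mu> \<in> S.nonneg"
  shows "\<exists>d\<in>bmeas M. (\<forall>\<omega>. 0 \<le> d \<omega> \<and> d \<omega> \<le> 2 * C) \<and>
    (\<forall>g\<in>bmeas M. \<Phi> (weight \<mu> g) + C * signed_integral M \<mu> g = signed_integral M \<mu> (\<lambda>\<omega>. d \<omega> * g \<omega>))"
proof -
  note \<mu>s = sca_nonnegD(1)[OF \<mu>]
  note \<mu>c = sca_ca[OF \<mu>s]
  note \<mu>0 = sca_nonnegD(2)[OF \<mu>]
  note \<Lambda> = signed_integral_functional[OF \<mu>c]
  let ?\<Xi> = "\<lambda>g. \<Phi> (weight \<mu> g) + C * signed_integral M \<mu> g"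
  have \<Phi>_add: "\<Phi> (\<lambda>A. \<mu> A + \<nu> A) = \<Phi> \<mu> + \<Phi> \<nu>" if "\<mu> \<in> sca" "\<nu> \<in> sca" for \<mu> \<nu>
    using S.linear_functional_add[OF \<Phi> that] by simp
  have \<Phi>_scale: "\<Phi> (\<lambda>A. a * \<mu> A) = a * \<Phi> \<mu>" if "\<mu> \<in> sca" for \<mu> a
    using S.linear_functional_scale[OF \<Phi> that] by simp
  \<comment> \<open>As a bounded functional of the weight, \<open>\<Phi>\<close> is determined by
    indicators, so the density found for events works for every bounded weight
    \<open>g\<close>.\<close>
  have \<Phi>w: "bmeas_functional M (\<lambda>g. \<Phi> (weight \<mu> g))"
  proof (rule bmeas_functionalI[where K = "C * \<mu> (space M)"])
    fix f g assume fg: "f \<in> bmeas M" "g \<in> bmeas M"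
    have "weight \<mu> (\<lambda>\<omega>. f \<omega> + g \<omega>) = (\<lambda>A. weight \<mu> f A + weight \<mu> g A)"
    proof
      fix A
      have "signed_integral M \<mu> (\<lambda>\<omega>. f \<omega> * indicator A \<omega> + g \<omega> * indicator A \<omega>) =
        signed_integral M \<mu> (\<lambda>\<omega>. f \<omega> * indicator A \<omega>) +
          signed_integral M \<mu> (\<lambda>\<omega>. g \<omega> * indicator A \<omega>)" if "A \<in> sets M"
        using fg that by (intro bmeas_functional_add[OF \<Lambda>] bmeas_mult bmeas_indicator)
      then show "weight \<mu> (\<lambda>\<omega>. f \<omega> + g \<omega>) A = weight \<mu> f A + weight \<mu> g A"
        by (simp add: weight_def distrib_right)
    qed
    then show "\<Phi> (weight \<mu> (\<lambda>\<omega>. f \<omega> + g \<omega>)) = \<Phi> (weight \<mu> f) + \<Phi> (weight \<mu> g)"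
      using \<Phi>_add weight_sca[OF \<mu>] fg by simp
  next
    fix a f assume f: "f \<in> bmeas M"
    have "weight \<mu> (\<lambda>\<omega>. a * f \<omega>) = (\<lambda>A. a * weight \<mu> f A)"
    proof
      fix A
      have "signed_integral M \<mu> (\<lambda>\<omega>. a * (f \<omega> * indicator A \<omega>)) =
        a * signed_integral M \<mu> (\<lambda>\<omega>. f \<omega> * indicator A \<omega>)" if "A \<in> sets M"
        using f that by (intro bmeas_functional_scale[OF \<Lambda>] bmeas_mult bmeas_indicator)
      then show "weight \<mu> (\<lambda>\<omega>. a * f \<omega>) A = a * weight \<mu> f A"
        by (simp add: weight_def mult.assoc)
    qed
    then show "\<Phi> (weight \<mu> (\<lambda>\<omega>. a * f \<omega>)) = a * \<Phi> (weight \<mu> f)"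
      using \<Phi>_scale weight_sca[OF \<mu> f] by simp
  next
    show "0 \<le> C * \<mu> (space M)" using C(1) \<mu>0 by simp
    fix B f assume f: "f \<in> bmeas M" "\<And>\<omega>. \<omega> \<in> space M \<Longrightarrow> \<bar>f \<omega>\<bar> \<le> B"
    have "\<bar>\<Phi> (weight \<mu> f)\<bar> \<le> C * tv M (weight \<mu> f) (space M)"
      by (rule C(2)[OF weight_sca[OF \<mu> f(1)]])
    also have "\<dots> \<le> C * (B * \<mu> (space M))" using tv_weight_le[OF \<mu> f] C(1) by (rule mult_left_mono)
    finally show "\<bar>\<Phi> (weight \<mu> f)\<bar> \<le> C * \<mu> (space M) * B" by (simp add: mult_ac)
  qed
  have \<Xi>: "bmeas_functional M ?\<Xi>" using bmeas_functional_combine[OF \<Phi>w \<Lambda>, of 1 C] by simp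
  define \<nu> where "\<nu> A = (if A \<in> sets M then ?\<Xi> (indicator A) else 0)" for A
  have \<nu>_eq: "\<nu> A = \<Phi> (restr M \<mu> A) + C * \<mu> A" if "A \<in> sets M" for A
    using that weight_indicator[OF \<mu> that] signed_integral_indicator[OF \<mu>c that]
      by (simp add: \<nu>_def)
  have bound: "\<bar>\<Phi> (restr M \<mu> A)\<bar> \<le> C * \<mu> A" if A: "A \<in> sets M" for A
  proof -
    have "tv M (restr M \<mu> A) = restr M \<mu> A"
      using \<mu>0 A by (intro tv_of_nonneg ca_restr[OF \<mu>c]) (auto simp: restr_apply)
    moreover have "space M \<inter> A = A" using sets.sets_into_space[OF A] by blast
    ultimately show ?thesis using C(2)[OF sca_restr[OF \<mu>s A]] by (simp add: restr_apply)
  qed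
  \<comment> \<open>The summand \<open>C * \<mu> A\<close> compensates the bound
    \<open>|\<Phi> (restr M \<mu> A)| \<le> C * \<mu> A\<close>. It makes the set function
    nonnegative and at most \<open>2 * C * \<mu> A\<close>, so that
    \<open>ca_bounded_density\<close> applies.\<close>
  have \<nu>0: "0 \<le> \<nu> A" and \<nu>_le: "\<nu> A \<le> 2 * C * \<mu> A" if A: "A \<in> sets M" for A
    using bound[OF A] unfolding \<nu>_eq[OF A] by (simp_all add: abs_le_iff)
  have \<nu>c: "\<nu> \<in> ca M"
  proof (rule ca_dominatedI[OF _ _ ca_scale[OF \<mu>c, of "2 * C"]])
    show "\<nu> A = 0" if "A \<notin> sets M" for A using that by (simp add: \<nu>_def)
    show "\<bar>\<nu> A\<bar> \<le> 2 * C * \<mu> A" if "A \<in> sets M" for A using \<nu>0[OF that] \<nu>_le[OF that] by simp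
    fix A B assume AB: "A \<in> sets M" "B \<in> sets M" "A \<inter> B = {}"
    have eq: "(indicator (A \<union> B) :: 'a \<Rightarrow> real) = (\<lambda>\<omega>. indicator A \<omega> + indicator B \<omega>)"
      using AB(3) by (auto simp: indicator_def fun_eq_iff)
    show "\<nu> (A \<union> B) = \<nu> A + \<nu> B"
      using AB bmeas_functional_add[OF \<Xi> bmeas_indicator[OF AB(1)] bmeas_indicator[OF AB(2)]]
      by (simp add: \<nu>_def eq)
  qed
  obtain d where d: "d \<in> bmeas M" "\<forall>\<omega>. 0 \<le> d \<omega> \<and> d \<omega> \<le> 2 * C"
      "\<forall>A\<in>sets M. \<nu> A = signed_integral M \<mu> (\<lambda>\<omega>. d \<omega> * indicator A \<omega>)"
    using ca_bounded_density[OF \<mu>c \<mu>0 \<nu>c \<nu>0 mult_nonneg_nonneg[OF zero_le_numeral C(1)] \<nu>_le]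
    by blast
  have "?\<Xi> g = signed_integral M \<mu> (\<lambda>\<omega>. d \<omega> * g \<omega>)" if g: "g \<in> bmeas M" for g
  proof (rule bmeas_functional_eqI[OF \<Xi> bmeas_functional_weight[OF \<Lambda> d(1)] _ g])
    show "?\<Xi> (indicator A) = signed_integral M \<mu> (\<lambda>\<omega>. d \<omega> * indicator A \<omega>)" if "A \<in> sets M" for A
      using d(3) that by (simp add: \<nu>_def)
  qed
  then show ?thesis using d(1,2) by blast
qed

text \<open>Let \<open>h\<close> be the density of \<open>\<mu>\<close> with respect to the larger
  \<open>\<kappa>\<close>. The weight \<open>h 1_A\<close> on \<open>\<kappa>\<close> gives the same
  measure as the weight \<open>1_A\<close> on \<open>\<mu>\<close>, so both densities have equal
  integrals over every event with respect to \<open>\<mu>\<close>, and \<open>support_eq\<close>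
  applies.\<close>

lemma sca_functional_density_mono:
  assumes \<mu>: "\<mu> \<in> S.nonneg" and \<kappa>: "\<kappa> \<in> S.nonneg" and le: "\<And>A. A \<in> sets M \<Longrightarrow> \<mu> A \<le> \<kappa> A"
    and T: "support \<mu> T" and d: "d \<in> bmeas M" "d' \<in> bmeas M"
    and dens: "\<And>g. g \<in> bmeas M \<Longrightarrow> \<Phi> (weight \<mu> g) + C * signed_integral M \<mu> g =
        signed_integral M \<mu> (\<lambda>\<omega>. d \<omega> * g \<omega>)"
    and dens': "\<And>g. g \<in> bmeas M \<Longrightarrow> \<Phi> (weight \<kappa> g) + C * signed_integral M \<kappa> g =
        signed_integral M \<kappa> (\<lambda>\<omega>. d' \<omega> * g \<omega>)"
  shows "\<forall>\<^sub>F \<omega> in qs. \<omega> \<in> T \<longrightarrow> d \<omega> = d' \<omega>"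
proof (rule support_eq[OF \<mu> T d])
  note \<mu>c = sca_ca[OF sca_nonnegD(1)[OF \<mu>]] and \<kappa>c = sca_ca[OF sca_nonnegD(1)[OF \<kappa>]]
  note \<mu>0 = sca_nonnegD(2)[OF \<mu>] and \<kappa>0 = sca_nonnegD(2)[OF \<kappa>]
  note \<Lambda>\<mu> = signed_integral_functional[OF \<mu>c] and \<Lambda>\<kappa> = signed_integral_functional[OF \<kappa>c]
  have le1: "\<mu> A \<le> 1 * \<kappa> A" if "A \<in> sets M" for A using le[OF that] by simp
  obtain h where h: "h \<in> bmeas M" "\<forall>A\<in>sets M. \<mu> A = signed_integral M \<kappa> (\<lambda>\<omega>. h \<omega> * indicator A \<omega>)"
    using ca_bounded_density[OF \<kappa>c \<kappa>0 \<mu>c \<mu>0 zero_le_one le1] by blast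
  have hk: "signed_integral M \<mu> k = signed_integral M \<kappa> (\<lambda>\<omega>. h \<omega> * k \<omega>)" if k: "k \<in> bmeas M" for k
    by (rule bmeas_functional_eqI[OF \<Lambda>\<mu> bmeas_functional_weight[OF \<Lambda>\<kappa> h(1)] _ k])
      (use h(2) in \<open>simp add: signed_integral_indicator[OF \<mu>c]\<close>)
  fix A assume A: "A \<in> sets M"
  have iA: "(indicator A :: 'a \<Rightarrow> real) \<in> bmeas M" using A by (rule bmeas_indicator)
  have hA: "(\<lambda>\<omega>. h \<omega> * indicator A \<omega>) \<in> bmeas M" using h(1) iA by (rule bmeas_mult)
  \<comment> \<open>Changing the base measure from \<open>\<mu>\<close> to \<open>\<kappa>\<close>
    costs only the factor \<open>h\<close>.\<close>
  have w: "weight \<kappa> (\<lambda>\<omega>. h \<omega> * indicator A \<omega>) = weight \<mu> (indicator A)"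
  proof
    fix B
    have "signed_integral M \<mu> (\<lambda>\<omega>. indicator A \<omega> * indicator B \<omega>) =
        signed_integral M \<kappa> (\<lambda>\<omega>. h \<omega> * (indicator A \<omega> * indicator B \<omega>))" if "B \<in> sets M"
      using A that by (intro hk bmeas_mult bmeas_indicator)
    then show "weight \<kappa> (\<lambda>\<omega>. h \<omega> * indicator A \<omega>) B = weight \<mu> (indicator A) B"
      by (simp add: weight_def mult.assoc)
  qed
  have "signed_integral M \<mu> (\<lambda>\<omega>. d \<omega> * indicator A \<omega>) = \<Phi> (weight \<mu> (indicator A)) +
      C * signed_integral M \<mu> (indicator A)"
    by (rule dens[OF iA, symmetric])
  also have "\<dots> = \<Phi> (weight \<kappa> (\<lambda>\<omega>. h \<omega> * indicator A \<omega>)) +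
      C * signed_integral M \<kappa> (\<lambda>\<omega>. h \<omega> * indicator A \<omega>)"
    unfolding w hk[OF iA] ..
  also have "\<dots> = signed_integral M \<kappa> (\<lambda>\<omega>. d' \<omega> * (h \<omega> * indicator A \<omega>))" by (rule dens'[OF hA])
  also have "\<dots> = signed_integral M \<kappa> (\<lambda>\<omega>. h \<omega> * (d' \<omega> * indicator A \<omega>))"
    by (simp only: mult.left_commute)
  also have "\<dots> = signed_integral M \<mu> (\<lambda>\<omega>. d' \<omega> * indicator A \<omega>)"
    by (rule hk[OF bmeas_mult[OF d(2) iA], symmetric])
  finally show "signed_integral M \<mu> (\<lambda>\<omega>. d \<omega> * indicator A \<omega>) =
      signed_integral M \<mu> (\<lambda>\<omega>. d' \<omega> * indicator A \<omega>)" .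
qed

text \<open>The representing function is the supremum in \<open>Linf\<close> of all local densities,
  minus the shift \<open>C\<close>. The main step is that on each support this supremum does not
  exceed the local density there, although uncountably many densities take part.\<close>

lemma sca_functional_representation:
  assumes DC: "dedekind_complete Linf"
    and \<Phi>: "linear_functional (sca_c M \<PP>) \<Phi>"
      and C: "0 \<le> C" "\<And>\<mu>. \<mu> \<in> sca \<Longrightarrow> \<bar>\<Phi> \<mu>\<bar> \<le> C * tv M \<mu> (space M)"
  shows "\<exists>f\<in>bmeas M. \<forall>\<mu>\<in>sca. \<Phi> \<mu> = signed_integral M \<mu> f"
proof -
  have "\<forall>\<mu>\<in>S.nonneg. \<exists>d. d \<in> bmeas M \<and> (\<forall>\<omega>. 0 \<le> d \<omega> \<and> d \<omega> \<le> 2 * C) \<and>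
    (\<forall>g\<in>bmeas M. \<Phi> (weight \<mu> g) + C * signed_integral M \<mu> g = signed_integral M \<mu> (\<lambda>\<omega>. d \<omega> * g \<omega>))"
    using sca_functional_density[OF \<Phi> C] by blast
  then obtain d where d: "\<forall>\<mu>\<in>S.nonneg. d \<mu> \<in> bmeas M \<and> (\<forall>\<omega>. 0 \<le> d \<mu> \<omega> \<and> d \<mu> \<omega> \<le> 2 * C) \<and>
    (\<forall>g\<in>bmeas M. \<Phi> (weight \<mu> g) + C * signed_integral M \<mu> g =
      signed_integral M \<mu> (\<lambda>\<omega>. d \<mu> \<omega> * g \<omega>))"
    by (rule bchoice[THEN exE])
  then have db: "d \<mu> \<in> bmeas M" and d0: "0 \<le> d \<mu> \<omega>" and d2: "d \<mu> \<omega> \<le> 2 * C"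
    and dens: "g \<in> bmeas M \<Longrightarrow> \<Phi> (weight \<mu> g) + C * signed_integral M \<mu> g =
        signed_integral M \<mu> (\<lambda>\<omega>. d \<mu> \<omega> * g \<omega>)"
    if "\<mu> \<in> S.nonneg" for \<mu> \<omega> g using that by blast+
  have "\<forall>\<mu>\<in>S.nonneg. \<exists>T. support \<mu> T" using sca_support by simp
  then obtain T where "\<forall>\<mu>\<in>S.nonneg. support \<mu> (T \<mu>)" by (rule bchoice[THEN exE])
  then have T: "support \<mu> (T \<mu>)" if "\<mu> \<in> S.nonneg" for \<mu> using that by blast
  then have Ts: "T \<mu> \<in> sets M" if "\<mu> \<in> S.nonneg" for \<mu> using that by (simp add: support_def)
  \<comment> \<open>Neither measure need dominate the other; both densities are compared with that
    of the sum.\<close>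
  have consistent: "\<forall>\<^sub>F \<omega> in qs. \<omega> \<in> T \<mu> \<inter> T \<nu> \<longrightarrow> d \<mu> \<omega> = d \<nu> \<omega>"
    if \<mu>: "\<mu> \<in> S.nonneg" and \<nu>: "\<nu> \<in> S.nonneg" for \<mu> \<nu>
  proof -
    have \<kappa>: "(\<lambda>A. \<mu> A + \<nu> A) \<in> S.nonneg"
      using sca_add[OF sca_nonnegD(1)[OF \<mu>] sca_nonnegD(1)[OF \<nu>]] sca_nonnegD(2)[OF \<mu>]
        sca_nonnegD(2)[OF \<nu>]
      by simp
    have "\<forall>\<^sub>F \<omega> in qs. \<omega> \<in> T \<mu> \<longrightarrow> d \<mu> \<omega> = d (\<lambda>A. \<mu> A + \<nu> A) \<omega>"
      by (rule sca_functional_density_mono[OF \<mu> \<kappa> _ T[OF \<mu>] db[OF \<mu>] db[OF \<kappa>] dens[OF \<mu>] dens[OF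
        \<kappa>]])
        (use sca_nonnegD(2)[OF \<nu>] in simp)
    moreover have "\<forall>\<^sub>F \<omega> in qs. \<omega> \<in> T \<nu> \<longrightarrow> d \<nu> \<omega> = d (\<lambda>A. \<mu> A + \<nu> A) \<omega>"
      by (rule sca_functional_density_mono[OF \<nu> \<kappa> _ T[OF \<nu>] db[OF \<nu>] db[OF \<kappa>] dens[OF \<nu>] dens[OF
        \<kappa>]])
        (use sca_nonnegD(2)[OF \<mu>] in simp)
    ultimately show ?thesis by eventually_elim simp
  qed
  \<comment> \<open>Extension by 0 off the support. Since the shifted densities are nonnegative,
    these zeros do not push the supremum above the density of another measure.\<close>
  let ?k = "\<lambda>\<mu> \<omega>. indicator (T \<mu>) \<omega> * d \<mu> \<omega>"
  have kb: "?k \<mu> \<in> bmeas M" if "\<mu> \<in> S.nonneg" for \<mu>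
    using Ts[OF that] db[OF that] by (intro bmeas_mult bmeas_indicator)
  let ?D = "(\<lambda>\<mu>. cl (?k \<mu>)) ` S.nonneg"
  have "vle Linf x (cl (\<lambda>\<omega>. 2 * C))" if "x \<in> ?D" for x
  proof -
    obtain \<mu> where \<mu>: "\<mu> \<in> S.nonneg" "x = cl (?k \<mu>)" using \<open>x \<in> ?D\<close> by blast
    have "?k \<mu> \<omega> \<le> 2 * C" for \<omega> using d2[OF \<mu>(1)] C(1) by (simp split: split_indicator)
    then show ?thesis
      unfolding \<mu>(2) Linf_le[OF kb[OF \<mu>(1)] bmeas_const] by (intro always_eventually allI)
  qed
  then have "\<exists>u\<in>vcar Linf. \<forall>x\<in>?D. vle Linf x u" using Linf_cl[OF bmeas_const[of "2 * C" M]] by blast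
  moreover have "?D \<subseteq> vcar Linf" using Linf_cl[OF kb] by blast
  moreover have "?D \<noteq> {}" using sca_zero by (auto intro!: exI[of _ "\<lambda>A. 0"])
  ultimately obtain G where G: "is_sup Linf ?D G"
    using DC[unfolded dedekind_complete_def, rule_format, of ?D] by blast
  obtain g where g: "g \<in> bmeas M" "G = cl g" using L.is_sup_closed[OF G] by (rule Linf_cases)
  have ge: "\<forall>\<^sub>F \<omega> in qs. ?k \<mu> \<omega> \<le> g \<omega>" if \<mu>: "\<mu> \<in> S.nonneg" for \<mu>
    using L.is_sup_ge[OF G imageI[OF \<mu>]] Linf_le[OF kb[OF \<mu>] g(1)] g(2) by simp
  have eq: "\<forall>\<^sub>F \<omega> in qs. \<omega> \<in> T \<mu> \<longrightarrow> g \<omega> = d \<mu> \<omega>" if \<mu>: "\<mu> \<in> S.nonneg" for \<mu>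
  proof -
    \<comment> \<open>A competing upper bound: the local density on \<open>T \<mu>\<close> and
      \<open>g\<close> elsewhere. That it bounds the family forces \<open>g \<le> d \<mu>\<close> on
      \<open>T \<mu>\<close>.\<close>
    let ?h = "\<lambda>\<omega>. ?k \<mu> \<omega> + indicator (space M - T \<mu>) \<omega> * g \<omega>"
    have hb: "?h \<in> bmeas M"
      using db[OF \<mu>] g(1) Ts[OF \<mu>] by (intro bmeas_add bmeas_mult bmeas_indicator) auto
    have "vle Linf G (cl ?h)"
    proof (rule L.is_sup_least[OF G Linf_cl[OF hb]])
      fix x assume "x \<in> ?D"
      then obtain \<nu> where \<nu>: "\<nu> \<in> S.nonneg" "x = cl (?k \<nu>)" by blast
      have "\<forall>\<^sub>F \<omega> in qs. ?k \<nu> \<omega> \<le> ?h \<omega>"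
        using ge[OF \<nu>(1)] consistent[OF \<mu> \<nu>(1)] qs_space
      proof eventually_elim
        fix \<omega> assume "?k \<nu> \<omega> \<le> g \<omega>" "\<omega> \<in> T \<mu> \<inter> T \<nu> \<longrightarrow> d \<mu> \<omega> = d \<nu> \<omega>" "\<omega> \<in> space M"
        then show "?k \<nu> \<omega> \<le> ?h \<omega>" using d0[OF \<mu>] by (cases "\<omega> \<in> T \<mu>"; cases "\<omega> \<in> T \<nu>") simp_all
      qed
      then show "vle Linf x (cl ?h)" unfolding \<nu>(2) by (simp only: Linf_le[OF kb[OF \<nu>(1)] hb])
    qed
    then have "\<forall>\<^sub>F \<omega> in qs. g \<omega> \<le> ?h \<omega>" using Linf_le[OF g(1) hb] g(2) by simp
    then show ?thesis
      using ge[OF \<mu>]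
    proof eventually_elim
      fix \<omega> assume "g \<omega> \<le> ?h \<omega>" "?k \<mu> \<omega> \<le> g \<omega>"
      then show "\<omega> \<in> T \<mu> \<longrightarrow> g \<omega> = d \<mu> \<omega>" by (cases "\<omega> \<in> T \<mu>") simp_all
    qed
  qed
  have c1: "(\<lambda>\<omega>. 1) \<in> bmeas M" "(\<lambda>\<omega>. C) \<in> bmeas M" by (rule bmeas_const)+
  \<comment> \<open>Removes the shift \<open>C\<close> that was added to make the densities
    nonnegative.\<close>
  let ?f = "\<lambda>\<omega>. g \<omega> - C"
  have fb: "?f \<in> bmeas M" using g(1) c1(2) by (rule bmeas_diff)
  have rep: "\<Phi> \<mu> = signed_integral M \<mu> ?f" if \<mu>: "\<mu> \<in> S.nonneg" for \<mu>
  proof -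
    note \<mu>s = sca_nonnegD(1)[OF \<mu>]
    note \<mu>c = sca_ca[OF \<mu>s]
    note \<Lambda> = signed_integral_functional[OF \<mu>c]
    have "signed_integral M \<mu> g = signed_integral M \<mu> (d \<mu>)"
    proof -
      obtain N where N: "negl N" "\<forall>\<omega>\<in>space M - N. \<omega> \<in> T \<mu> \<longrightarrow> g \<omega> = d \<mu> \<omega>"
        using eq[OF \<mu>] by (auto simp: eventually_qs)
      have tv: "tv M \<mu> = \<mu>" using \<mu>c sca_nonnegD(2)[OF \<mu>] by (rule tv_of_nonneg)
      have Ns: "N \<in> sets M" "space M - T \<mu> \<in> sets M" using negl_sets[OF N(1)] Ts[OF \<mu>] by auto
      have "\<mu> (N \<union> (space M - T \<mu>)) = \<mu> N + \<mu> ((space M - T \<mu>) - N)"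
        using ca_Un[OF \<mu>c, of N "(space M - T \<mu>) - N"] Ns by (simp add: Un_Diff_cancel)
      moreover have "\<mu> ((space M - T \<mu>) - N) \<le> \<mu> (space M - T \<mu>)"
        using Ns by (intro ca_mono[OF \<mu>c sca_nonnegD(2)[OF \<mu>]]) auto
      moreover have "\<mu> (space M - T \<mu>) = 0" using T[OF \<mu>] by (simp add: support_def)
      moreover have "\<mu> N = 0" using \<mu>s N(1) by (rule sca_negl)
      moreover have "0 \<le> \<mu> (N \<union> (space M - T \<mu>))" using Ns by (intro sca_nonnegD(2)[OF \<mu>]) auto
      ultimately have "tv M \<mu> (N \<union> (space M - T \<mu>)) = 0" unfolding tv by linarith
      then show ?thesis
        using N(2) Ns bmeas_measurable[OF g(1)] bmeas_measurable[OF db[OF \<mu>]]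
        by (intro signed_integral_cong[OF \<mu>c, of "N \<union> (space M - T \<mu>)"]) auto
    qed
    also have "\<dots> = \<Phi> (weight \<mu> (\<lambda>\<omega>. 1)) + C * signed_integral M \<mu> (\<lambda>\<omega>. 1)"
      using dens[OF \<mu> c1(1)] by simp
    also have "weight \<mu> (\<lambda>\<omega>. 1) = \<mu>"
    proof
      fix A show "weight \<mu> (\<lambda>\<omega>. 1) A = \<mu> A"
        using signed_integral_indicator[OF \<mu>c, of A] ca_outside[OF \<mu>c, of A]
          by (simp add: weight_def)
    qed
    also have "C * signed_integral M \<mu> (\<lambda>\<omega>. 1) = signed_integral M \<mu> (\<lambda>\<omega>. C)"
      using bmeas_functional_scale[OF \<Lambda> c1(1), of C] by simp
    finally show ?thesis using bmeas_functional_diff[OF \<Lambda> g(1) c1(2)] by simp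
  qed
  have "\<Phi> = (\<lambda>\<mu>\<in>sca. signed_integral M \<mu> ?f)"
  proof (rule S.linear_functional_eq_if_eq_on_nonneg[OF \<Phi>])
    show "linear_functional (sca_c M \<PP>) (\<lambda>\<mu>\<in>sca. signed_integral M \<mu> ?f)"
      using fb sca_add sca_scale
      by (auto simp: linear_functional_def signed_integral_add signed_integral_scale sca_ca)
  qed (use rep in simp)
  then have "\<forall>\<mu>\<in>sca. \<Phi> \<mu> = signed_integral M \<mu> ?f" by (simp add: fun_eq_iff)
  then show ?thesis using fb by blast
qed

end

section \<open>The equivalences\<close>

lemma norm_dual_vcar: "\<phi> \<in> vcar (norm_dual N) \<longleftrightarrow>
    linear_functional N \<phi> \<and> (\<exists>C. \<forall>x\<in>vcar N. \<bar>\<phi> x\<bar> \<le> C * vnorm N x)"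
  and norm_dual_vadd: "vadd (norm_dual N) \<phi> \<psi> = (\<lambda>x\<in>vcar N. \<phi> x + \<psi> x)"
  and norm_dual_vscale: "vscale (norm_dual N) a \<phi> = (\<lambda>x\<in>vcar N. a * \<phi> x)"
  and norm_dual_vle: "vle (norm_dual N) \<phi> \<psi> \<longleftrightarrow>
    (\<forall>x\<in>{x \<in> vcar N. vle N (vzero N) x}. \<phi> x \<le> \<psi> x)"
  and norm_dual_vnorm: "vnorm (norm_dual N) \<phi> = (SUP x\<in>{x \<in> vcar N. vnorm N x \<le> 1}. \<bar>\<phi> x\<bar>)"
  by (auto simp: norm_dual_def)

lemma (in normed_vector_lattice) norm_dual_bound:
  assumes \<phi>: "\<phi> \<in> vcar (norm_dual N)" and x: "x \<in> vcar N"
  shows "\<bar>\<phi> x\<bar> \<le> vnorm (norm_dual N) \<phi> * vnorm N x"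
proof (cases "vnorm N x = 0")
  case True
  then have "x = vzero N" using norm_eq_zero[OF x] by simp
  then show ?thesis using \<phi> linear_functional_zero[of \<phi>] by (simp add: norm_dual_vcar norm_zero)
next
  case False
  then have pos: "0 < vnorm N x" using norm_nonneg[OF x] by simp
  let ?B = "{x \<in> vcar N. vnorm N x \<le> 1}"
  obtain C where C: "\<forall>x\<in>vcar N. \<bar>\<phi> x\<bar> \<le> C * vnorm N x" using \<phi> by (auto simp: norm_dual_vcar)
  have "\<bar>\<phi> y\<bar> \<le> \<bar>C\<bar>" if y: "y \<in> ?B" for y
  proof -
    have "\<bar>\<phi> y\<bar> \<le> C * vnorm N y" using C y by blast
    also have "\<dots> \<le> \<bar>C\<bar> * vnorm N y" using norm_nonneg y by (intro mult_right_mono) auto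
    also have "\<dots> \<le> \<bar>C\<bar> * 1" using y by (intro mult_left_mono) auto
    finally show ?thesis by simp
  qed
  then have bdd: "bdd_above ((\<lambda>x. \<bar>\<phi> x\<bar>) ` ?B)" by (intro bdd_aboveI2)
  let ?y = "vscale N (inverse (vnorm N x)) x"
  have "?y \<in> ?B" using x pos norm_scale[OF x, of "inverse (vnorm N x)"] by (simp add: scale_closed)
  then have "\<bar>\<phi> ?y\<bar> \<le> vnorm (norm_dual N) \<phi>"
    unfolding norm_dual_vnorm using bdd by (rule cSUP_upper)
  moreover have "\<phi> ?y = inverse (vnorm N x) * \<phi> x"
    using \<phi> x by (intro linear_functional_scale) (auto simp: norm_dual_vcar)
  then have "\<phi> x = vnorm N x * \<phi> ?y" using pos by simp
  ultimately show ?thesis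
    using pos by (simp only: abs_mult mult.commute[of _ "vnorm N x"]) (simp add: mult_left_mono)
qed

section \<open>The dual of the supported measures and arbitrary preduals\<close>

context priors
begin

lemma integral_functional_eq:
  assumes "f \<in> bmeas M"
  shows "integral_functional M \<PP> (cl f) = (\<lambda>\<mu>\<in>sca. signed_integral M \<mu> f)"
  unfolding integral_functional_def
  by (rule restrict_ext) (simp add: signed_integral_representative assms)

lemma integral_functional_eq_ifun:
  "X \<in> vcar Linf \<Longrightarrow> integral_functional M \<PP> X = (\<lambda>\<mu>\<in>sca. ifun \<mu> X)"
  unfolding integral_functional_def by (rule restrict_ext) (simp add: ifun_def)

lemma integral_functional_in_dual:
  assumes f: "f \<in> bmeas M"
  shows "(\<lambda>\<mu>\<in>sca. signed_integral M \<mu> f) \<in> vcar (norm_dual (sca_c M \<PP>))"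
proof -
  obtain C where C: "\<And>\<omega>. \<omega> \<in> space M \<Longrightarrow> \<bar>f \<omega>\<bar> \<le> C" using bmeas_bound[OF f] by metis
  have "\<bar>signed_integral M \<mu> f\<bar> \<le> C * tv M \<mu> (space M)" if "\<mu> \<in> sca" for \<mu>
    using abs_signed_integral_le[OF sca_ca[OF that] f C] by (simp add: mult.commute)
  moreover have "linear_functional (sca_c M \<PP>) (\<lambda>\<mu>\<in>sca. signed_integral M \<mu> f)"
    using f sca_add sca_scale
    by (simp add: linear_functional_def signed_integral_add signed_integral_scale sca_ca)
  ultimately show ?thesis by (auto simp: norm_dual_vcar)
qed

text \<open>The dual norm is at most the norm of \<open>f\<close> because \<open>f\<close> may be
  clipped at its norm. Conversely, if \<open>f\<close> or \<open>- f\<close> exceeded the dual norm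
  on an event that is not negligible, \<open>class_S_witness\<close> would give a measure of norm 1
  with too large an integral.\<close>

lemma dual_norm_integral_functional:
  assumes cS: "class_S M \<PP>" and f: "f \<in> bmeas M"
  shows "vnorm (norm_dual (sca_c M \<PP>)) (\<lambda>\<mu>\<in>sca. signed_integral M \<mu> f) = vnorm Linf (cl f)"
proof (rule antisym)
  let ?T = "\<lambda>\<mu>\<in>sca. signed_integral M \<mu> f" and ?m = "vnorm Linf (cl f)"
  let ?B = "{\<mu> \<in> sca. vnorm (sca_c M \<PP>) \<mu> \<le> 1}"
  have zB: "(\<lambda>A. 0) \<in> ?B"
    using sca_zero tv_of_nonneg[OF ca_zero[of M]] by simp
  \<comment> \<open>Equal to \<open>f\<close> quasi surely, but bounded by the norm at every point,
    as the estimate of the integral requires.\<close>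
  define g where "g = (\<lambda>\<omega>. max (- ?m) (min ?m (f \<omega>)))"
  have m0: "0 \<le> ?m" using f by (rule Linf_norm_bound)
  have g: "g \<in> bmeas M" unfolding g_def using f bmeas_const by (intro bmeas_max bmeas_min)
  have "\<forall>\<^sub>F \<omega> in qs. f \<omega> = g \<omega>"
    using Linf_norm_bound(2)[OF f] by eventually_elim (auto simp: g_def)
  then have fg: "signed_integral M \<mu> f = signed_integral M \<mu> g" if "\<mu> \<in> sca" for \<mu>
    using that f g by (intro signed_integral_qs_cong bmeas_measurable)
  have le: "\<bar>?T \<mu>\<bar> \<le> ?m" if \<mu>: "\<mu> \<in> ?B" for \<mu>
  proof -
    have s: "\<mu> \<in> sca" using \<mu> by simp
    have "\<bar>signed_integral M \<mu> g\<bar> \<le> tv M \<mu> (space M) * ?m"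
      using m0 by (intro abs_signed_integral_le[OF sca_ca[OF s] g]) (auto simp: g_def)
    also have "\<dots> \<le> 1 * ?m" using \<mu> m0 by (intro mult_right_mono) auto
    finally show ?thesis using s fg by simp
  qed
  show "vnorm (norm_dual (sca_c M \<PP>)) ?T \<le> ?m"
    unfolding norm_dual_vnorm by (rule cSUP_least[OF _ le]) (use zB in blast)
  let ?s = "vnorm (norm_dual (sca_c M \<PP>)) ?T"
  have bdd: "bdd_above ((\<lambda>\<mu>. \<bar>?T \<mu>\<bar>) ` ?B)" using le by (rule bdd_aboveI2)
  have upper: "\<bar>?T \<mu>\<bar> \<le> ?s" if "\<mu> \<in> ?B" for \<mu>
    unfolding norm_dual_vnorm using that bdd by (rule cSUP_upper)
  have s0: "0 \<le> ?s" using upper[OF zB] by (rule order_trans[OF abs_ge_zero])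
  have in_B: "\<nu> \<in> ?B" "\<nu> \<in> sca" if "\<nu> \<in> S.nonneg" "\<nu> (space M) = 1" for \<nu>
    using that tv_of_nonneg[OF sca_ca[OF sca_nonnegD(1)[OF that(1)]] sca_nonnegD(2)[OF that(1)]]
      by auto
  have 1: "\<forall>\<^sub>F \<omega> in qs. f \<omega> \<le> ?s"
  proof (rule ccontr)
    assume "\<not> ?thesis"
    then obtain \<nu> where \<nu>: "\<nu> \<in> S.nonneg" "\<nu> (space M) = 1" "?s < signed_integral M \<nu> f"
      using class_S_witness[OF cS f] by blast
    then show False using upper[OF in_B(1)[OF \<nu>(1,2)]] in_B(2)[OF \<nu>(1,2)] by simp
  qed
  have 2: "\<forall>\<^sub>F \<omega> in qs. - f \<omega> \<le> ?s"
  proof (rule ccontr)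
    assume "\<not> ?thesis"
    then obtain \<nu> where \<nu>: "\<nu> \<in> S.nonneg" "\<nu> (space M) = 1" "?s < signed_integral M \<nu> (\<lambda>\<omega>. - f \<omega>)"
      using class_S_witness[OF cS bmeas_uminus[OF f]] by blast
    moreover have "signed_integral M \<nu> (\<lambda>\<omega>. - f \<omega>) = - signed_integral M \<nu> f"
      using bmeas_functional_scale[OF signed_integral_functional[OF sca_ca[OF in_B(2)[OF \<nu>(1,2)]]]
        f, of "- 1"] by simp
    ultimately show False using upper[OF in_B(1)[OF \<nu>(1,2)]] in_B(2)[OF \<nu>(1,2)] by simp
  qed
  from 1 2 have "\<forall>\<^sub>F \<omega> in qs. \<bar>f \<omega>\<bar> \<le> ?s" by eventually_elim simp
  then show "?m \<le> ?s" by (rule Linf_norm_le[OF f s0])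
qed

text \<open>Surjectivity is the representation of bounded functionals. Supported measures detect the
  order, which also gives injectivity through antisymmetry.\<close>

theorem Linf_dual_of_sca:
  assumes cS: "class_S M \<PP>" and DC: "dedekind_complete Linf"
  shows "isometric_lattice_iso Linf (norm_dual (sca_c M \<PP>)) (integral_functional M \<PP>)"
proof -
  let ?T = "integral_functional M \<PP>" and ?D = "norm_dual (sca_c M \<PP>)"
  have le: "vle Linf X Y \<longleftrightarrow> vle ?D (?T X) (?T Y)" if "X \<in> vcar Linf" "Y \<in> vcar Linf" for X Y
    unfolding class_S_le_iff[OF cS that] norm_dual_vle integral_functional_eq_ifun[OF that(1)]
      integral_functional_eq_ifun[OF that(2)] by simp
  have refl: "vle ?D \<phi> \<phi>" for \<phi> by (simp add: norm_dual_vle)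
  have "inj_on ?T (vcar Linf)"
  proof (rule inj_onI)
    fix X Y assume XY: "X \<in> vcar Linf" "Y \<in> vcar Linf" "?T X = ?T Y"
    then have "vle Linf X Y" "vle Linf Y X" using le refl by auto
    then show "X = Y" using XY by (intro L.le_antisym)
  qed
  moreover have "?T ` vcar Linf = vcar ?D"
  proof (intro subset_antisym subsetI)
    fix \<phi> assume "\<phi> \<in> ?T ` vcar Linf"
    then obtain f where "f \<in> bmeas M" "\<phi> = ?T (cl f)" by (auto elim: Linf_cases)
    then show "\<phi> \<in> vcar ?D" by (simp only: integral_functional_eq integral_functional_in_dual)
  next
    fix \<Phi> assume \<Phi>: "\<Phi> \<in> vcar ?D"
    then obtain C where C: "\<And>\<mu>. \<mu> \<in> sca \<Longrightarrow> \<bar>\<Phi> \<mu>\<bar> \<le> C * tv M \<mu> (space M)"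
      and lin: "linear_functional (sca_c M \<PP>) \<Phi>"
      by (auto simp: norm_dual_vcar)
    have "\<bar>\<Phi> \<mu>\<bar> \<le> \<bar>C\<bar> * tv M \<mu> (space M)" if "\<mu> \<in> sca" for \<mu>
      using C[OF that] mult_right_mono[OF abs_ge_self[of C] tv_nonneg[OF sca_ca[OF that]], of
        "space M"] by linarith
    then obtain f where f: "f \<in> bmeas M" "\<forall>\<mu>\<in>sca. \<Phi> \<mu> = signed_integral M \<mu> f"
      using sca_functional_representation[OF DC lin abs_ge_zero] by blast
    have "\<Phi> = (\<lambda>\<mu>\<in>sca. signed_integral M \<mu> f)"
      using lin f(2) by (intro extensionalityI[of _ sca]) (auto simp: linear_functional_def)
    then have "\<Phi> = ?T (cl f)" using integral_functional_eq[OF f(1)] by simp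
    then show "\<Phi> \<in> ?T ` vcar Linf" using Linf_cl[OF f(1)] by blast
  qed
  ultimately have bij: "bij_betw ?T (vcar Linf) (vcar ?D)" by (simp add: bij_betw_def)
  have add: "?T (vadd Linf X Y) = vadd ?D (?T X) (?T Y)" if "X \<in> vcar Linf" "Y \<in> vcar Linf" for X Y
    unfolding integral_functional_eq_ifun[OF L.add_closed[OF that]] integral_functional_eq_ifun[OF
      that(1)]
      integral_functional_eq_ifun[OF that(2)] norm_dual_vadd
    by (rule restrict_ext) (use that in \<open>simp add: L.linear_functional_add ifun_linear\<close>)
  have scale: "?T (vscale Linf a X) = vscale ?D a (?T X)" if "X \<in> vcar Linf" for X a
    unfolding integral_functional_eq_ifun[OF L.scale_closed[OF that]]
      integral_functional_eq_ifun[OF that]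
      norm_dual_vscale
    by (rule restrict_ext) (use that in \<open>simp add: L.linear_functional_scale ifun_linear\<close>)
  have norm: "vnorm ?D (?T X) = vnorm Linf X" if X: "X \<in> vcar Linf" for X
  proof -
    obtain f where f: "f \<in> bmeas M" "X = cl f" using X by (rule Linf_cases)
    show ?thesis using dual_norm_integral_functional[OF cS f(1)]
      by (simp only: f integral_functional_eq)
  qed
  show ?thesis
    unfolding isometric_lattice_iso_def lattice_iso_def using bij add scale le norm by blast
qed

lemma not_negl_indicator:
  assumes A: "A \<in> sets M" "\<not> negl A"
  shows "\<not> vle Linf (cl (indicator A)) (vzero Linf)"
proof
  assume "vle Linf (cl (indicator A)) (vzero Linf)"
  then have "\<forall>\<^sub>F \<omega> in qs. indicator A \<omega> \<le> (0 :: real)"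
    using A by (simp add: Linf_zero Linf_le bmeas_indicator bmeas_const)
  then have "\<forall>\<^sub>F \<omega> in qs. \<omega> \<notin> A" by eventually_elim (auto split: split_indicator_asm)
  moreover have "{\<omega> \<in> space M. \<not> \<omega> \<notin> A} = A" using sets.sets_into_space[OF A(1)] by auto
  ultimately show False using A qs_iff_negl[of "\<lambda>\<omega>. \<omega> \<notin> A"] by simp
qed

text \<open>
  Pointwise limits of directed nets in a dual are again bounded functionals, so suprema in
  \<open>L\<^sup>\<infinity>\<close> are computed pointwise on the predual and its elements act order continuously.
\<close>

theorem predual_imp_class_S:
  fixes N :: "'b nvlat"
  assumes N: "normed_vector_lattice N" and iso: "isometric_lattice_iso Linf (norm_dual N) T"
  shows "class_S M \<PP> \<and> dedekind_complete Linf"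
proof -
  interpret N: normed_vector_lattice N by (rule N)
  let ?D = "norm_dual N"
  have bij: "bij_betw T (vcar Linf) (vcar ?D)"
    and T_add: "\<And>X Y. X \<in> vcar Linf \<Longrightarrow> Y \<in> vcar Linf \<Longrightarrow> T (vadd Linf X Y) = vadd ?D (T X) (T Y)"
    and T_scale: "\<And>a X. X \<in> vcar Linf \<Longrightarrow> T (vscale Linf a X) = vscale ?D a (T X)"
    and T_le: "\<And>X Y. X \<in> vcar Linf \<Longrightarrow> Y \<in> vcar Linf \<Longrightarrow> vle Linf X Y \<longleftrightarrow> vle ?D (T X) (T Y)"
    and T_norm: "\<And>X. X \<in> vcar Linf \<Longrightarrow> vnorm ?D (T X) = vnorm Linf X"
    using iso unfolding isometric_lattice_iso_def lattice_iso_def by blast+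
  have T_in: "T X \<in> vcar ?D" if "X \<in> vcar Linf" for X using bij that by (auto simp: bij_betw_def)
  have lin: "linear_functional N (T X)" if "X \<in> vcar Linf" for X using T_in[OF that]
    by (simp add: norm_dual_vcar)
  have le: "vle Linf X Y \<longleftrightarrow> (\<forall>x\<in>N.nonneg. T X x \<le> T Y x)" if "X \<in> vcar Linf" "Y \<in> vcar Linf" for X Y
    unfolding T_le[OF that] norm_dual_vle ..
  \<comment> \<open>The norm bound that survives the pointwise limit places the limit in the dual,
    hence in the range of \<open>T\<close>.\<close>
  have limit: "\<exists>s\<in>vcar Linf. T s = F"
    if D: "up_directed Linf D" and U: "U \<in> vcar Linf" "\<And>d. d \<in> D \<Longrightarrow> vle Linf d U"
      and F: "linear_functional N F"
      "\<And>x. x \<in> vcar N \<Longrightarrow> ((\<lambda>d. T d x) \<longlongrightarrow> F x) (net_filter D (up_rel Linf D))" for D U F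
  proof -
    have dir: "directed D (up_rel Linf D)" using D by (rule L.directed_up_rel)
    have Dc: "D \<subseteq> vcar Linf" using D by (simp add: up_directed_def)
    obtain d0 where d0: "d0 \<in> D" using D by (auto simp: up_directed_def)
    obtain f0 where f0: "f0 \<in> bmeas M" "d0 = cl f0" using d0 Dc by (auto elim: Linf_cases)
    obtain u where u: "u \<in> bmeas M" "U = cl u" using U(1) by (rule Linf_cases)
    \<comment> \<open>Members of \<open>D\<close> need not be bounded below. From \<open>d0\<close>
      on they lie between \<open>d0\<close> and \<open>U\<close>, which bounds their norms, and a
      tail suffices for the limit.\<close>
    define K where "K = max (vnorm Linf d0) (vnorm Linf U)"
    have "0 \<le> K" using Linf_norm_bound(1)[OF f0(1)] f0(2) by (simp add: K_def)
    have norm: "vnorm Linf d \<le> K" if d: "d \<in> D" "(d0, d) \<in> up_rel Linf D" for d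
    proof -
      obtain f where f: "f \<in> bmeas M" "d = cl f" using d Dc by (auto elim: Linf_cases)
      have "\<forall>\<^sub>F \<omega> in qs. f0 \<omega> \<le> f \<omega>"
        using d(2) f f0 by (simp add: up_rel_def Linf_le)
      moreover have "\<forall>\<^sub>F \<omega> in qs. f \<omega> \<le> u \<omega>" using U(2)[OF d(1)] f u by (simp add: Linf_le)
      ultimately have "\<forall>\<^sub>F \<omega> in qs. \<bar>f \<omega>\<bar> \<le> K"
        using Linf_norm_bound(2)[OF f0(1)] Linf_norm_bound(2)[OF u(1)]
        by eventually_elim (auto simp: K_def f0(2) u(2))
      then show ?thesis unfolding f(2) by (rule Linf_norm_le[OF f(1) \<open>0 \<le> K\<close>])
    qed
    have "\<bar>F x\<bar> \<le> K * vnorm N x" if x: "x \<in> vcar N" for x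
    proof (rule tendsto_upperbound[OF tendsto_rabs[OF F(2)[OF x]] _ net_filter_not_bot[OF dir]])
      show "\<forall>\<^sub>F d in net_filter D (up_rel Linf D). \<bar>T d x\<bar> \<le> K * vnorm N x"
      proof (rule eventually_net_filterI[OF dir d0])
        fix d assume d: "d \<in> D" "(d0, d) \<in> up_rel Linf D"
        have dc: "d \<in> vcar Linf" using d Dc by blast
        have "\<bar>T d x\<bar> \<le> vnorm ?D (T d) * vnorm N x" by (rule N.norm_dual_bound[OF T_in[OF dc] x])
        also have "\<dots> \<le> K * vnorm N x"
          using norm[OF d] N.norm_nonneg[OF x] by (simp add: T_norm[OF dc] mult_right_mono)
        finally show "\<bar>T d x\<bar> \<le> K * vnorm N x" .
      qed
    qed
    then have "F \<in> vcar ?D" using F(1) by (auto simp: norm_dual_vcar)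
    then show ?thesis using bij by (force simp: bij_betw_def)
  qed
  have sup: "\<exists>s. is_sup Linf D s \<and> (\<forall>x\<in>vcar N. ((\<lambda>d. T d x) \<longlongrightarrow> T s x) (net_filter D (up_rel Linf
      D)))"
    if D: "up_directed Linf D" and U: "U \<in> vcar Linf" "\<And>d. d \<in> D \<Longrightarrow> vle Linf d U" for D U
    by (rule N.functional_representation_sup[OF L.ordered_vector_space_axioms lin le D U limit[OF
      D U]]) blast+
  have DC: "dedekind_complete Linf"
  proof (rule L.dedekind_completeI)
    fix D u assume "up_directed Linf D" "u \<in> vcar Linf" "\<And>d. d \<in> D \<Longrightarrow> vle Linf d u"
    then show "\<exists>s. is_sup Linf D s" using sup[of D u] by blast
  qed
  have T_minus: "T (vscale Linf (- 1) X) x = - T X x" if "X \<in> vcar Linf" "x \<in> vcar N" for X x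
    using T_scale[OF that(1), of "- 1"] that(2) by (simp add: norm_dual_vscale)
  have evW: "(\<lambda>X\<in>vcar Linf. T X x) \<in> vcar W" if x: "x \<in> N.nonneg" for x
  proof -
    let ?ev = "\<lambda>X\<in>vcar Linf. T X x"
    have ev_lin: "linear_functional Linf ?ev"
      using x T_add T_scale
      by (simp add: linear_functional_def L.add_closed L.scale_closed norm_dual_vadd
        norm_dual_vscale)
    have T0: "T (vzero Linf) x = 0" using L.linear_functional_zero[OF ev_lin] L.zero_closed by simp
    have pos: "L.positive_functional ?ev"
      unfolding L.positive_functional_def
    proof (intro conjI ballI)
      fix X assume X: "X \<in> L.nonneg"
      then have "T (vzero Linf) x \<le> T X x" using le[OF L.zero_closed, of X] x by blast
      then show "0 \<le> ?ev X" using T0 X by simp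
    qed (rule ev_lin)
    have "order_continuous Linf ?ev"
    proof (rule L.order_continuousI[OF pos])
      fix I :: "(('a \<Rightarrow> real) set \<times> ('a \<Rightarrow> real) set) set" and r y and e :: real
      assume dir: "directed I r" and y: "y \<in> I \<rightarrow> vcar Linf"
        and dec: "\<And>i j. i \<in> I \<Longrightarrow> j \<in> I \<Longrightarrow> (i, j) \<in> r \<Longrightarrow> vle Linf (y j) (y i)"
        and inf0: "is_inf Linf (y ` I) (vzero Linf)" and e: "0 < e"
      \<comment> \<open>A net decreasing to 0 becomes, after negation, an upward directed set with
        supremum 0, to which \<open>sup\<close> applies.\<close>
      let ?n = "vscale Linf (- 1)"
      define D where "D = (\<lambda>i. ?n (y i)) ` I"
      have yc: "y i \<in> vcar Linf" if "i \<in> I" for i using y that by auto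
      have D: "up_directed Linf D"
        unfolding up_directed_def
      proof (intro conjI ballI)
        show "D \<noteq> {}" using dir by (auto simp: D_def directed_def)
        show "D \<subseteq> vcar Linf" using yc by (auto simp: D_def intro: L.scale_closed)
        fix a b assume "a \<in> D" "b \<in> D"
        then obtain i j where ij: "i \<in> I" "j \<in> I" "a = ?n (y i)" "b = ?n (y j)"
          by (auto simp: D_def)
        obtain k where k: "k \<in> I" "(i, k) \<in> r" "(j, k) \<in> r" using dir ij(1,2)
          unfolding directed_def by blast
        have "vle Linf a (?n (y k))" "vle Linf b (?n (y k))"
          unfolding ij(3,4) using L.le_minus[OF yc[OF k(1)] yc[OF ij(1)] dec[OF ij(1) k(1,2)]]
            L.le_minus[OF yc[OF k(1)] yc[OF ij(2)] dec[OF ij(2) k(1,3)]] .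
        then show "\<exists>c\<in>D. vle Linf a c \<and> vle Linf b c" using k(1) unfolding D_def by blast
      qed
      have le0: "vle Linf d (vzero Linf)" if dD: "d \<in> D" for d
      proof -
        obtain i where i: "i \<in> I" "d = ?n (y i)" using dD unfolding D_def by blast
        have "vle Linf (vzero Linf) (y i)" using inf0 i(1) by (auto simp: is_inf_def)
        from L.le_minus[OF L.zero_closed yc[OF i(1)] this] show ?thesis
          unfolding i(2) by (simp add: L.scale_zero_right)
      qed
      have zero_sup: "is_sup Linf D (vzero Linf)"
        unfolding is_sup_def
      proof (intro conjI ballI impI)
        fix u assume u: "u \<in> vcar Linf" "\<forall>a\<in>D. vle Linf a u"
        have "vle Linf (?n u) (y i)" if "i \<in> I" for i
        proof -
          have "vle Linf (?n (y i)) u" using u(2) that unfolding D_def by blast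
          then show ?thesis by (rule L.le_minus_swap[OF yc[OF that] u(1)])
        qed
        then have "vle Linf (?n u) (vzero Linf)"
          using inf0 L.scale_closed[OF u(1)] unfolding is_inf_def by blast
        from L.le_minus_swap[OF u(1) L.zero_closed this] show "vle Linf (vzero Linf) u"
          by (simp add: L.scale_zero_right)
      qed (use le0 L.zero_closed in auto)
      obtain s where s: "is_sup Linf D s" "\<forall>x\<in>vcar N. ((\<lambda>d. T d x) \<longlongrightarrow> T s x) (net_filter D (up_rel
          Linf D))"
        using sup[OF D L.zero_closed le0] by blast
      have "s = vzero Linf" using s(1) zero_sup by (rule L.is_sup_unique)
      then have "((\<lambda>d. T d x) \<longlongrightarrow> 0) (net_filter D (up_rel Linf D))" using s(2) x T0 by auto
      from order_tendstoD(1)[OF this, of "- e"]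
      have "\<forall>\<^sub>F d in net_filter D (up_rel Linf D). - e < T d x" using e by simp
      then obtain d where "d \<in> D" "\<forall>c\<in>D. (d, c) \<in> up_rel Linf D \<longrightarrow> - e < T c x"
        unfolding eventually_net_filter[OF L.directed_up_rel[OF D]] by blast
      moreover have "(d, d) \<in> up_rel Linf D"
        using \<open>d \<in> D\<close> D by (auto simp: up_rel_def up_directed_def intro: L.le_refl)
      ultimately obtain i where i: "i \<in> I" "- e < T (?n (y i)) x" by (auto simp: D_def)
      then show "\<exists>i\<in>I. ?ev (y i) < e"
        using T_minus[OF yc[OF i(1)], of x] x yc[OF i(1)] by (intro bexI[OF _ i(1)]) simp
    qed
    then show ?thesis
      using ev_lin L.positive_functional_order_bounded[OF pos] by (simp add: W_iff)
  qed
  have "class_S M \<PP>"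
  proof (rule class_S_if_W_separates[OF DC])
    fix A assume A: "A \<in> sets M" "\<not> negl A"
    have c: "cl (indicator A) \<in> vcar Linf" using A by (intro Linf_cl bmeas_indicator)
    obtain x where x: "x \<in> N.nonneg" "\<not> T (cl (indicator A)) x \<le> T (vzero Linf) x"
      using not_negl_indicator[OF A] le[OF c L.zero_closed] by blast
    have "T (vscale Linf 0 (vzero Linf)) x = 0"
      unfolding T_scale[OF L.zero_closed] norm_dual_vscale using x by simp
    then have "T (vzero Linf) x = 0" by (simp only: L.scale_zero_right)
    then show "\<exists>\<phi>\<in>vcar W. \<phi> (cl (indicator A)) \<noteq> 0"
      using x c by (intro bexI[OF _ evW[OF x(1)]]) simp
  qed
  then show ?thesis using DC by blast
qed

end

section \<open>Perfectness\<close>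

context priors
begin

abbreviation ev :: "('a \<Rightarrow> real) set \<Rightarrow> (('a \<Rightarrow> real) set \<Rightarrow> real) \<Rightarrow> real" where
  "ev X \<equiv> \<lambda>\<phi>\<in>vcar W. \<phi> X"

lemma W_nonneg_iff: "\<phi> \<in> {\<phi> \<in> vcar W. vle W (vzero W) \<phi>} \<longleftrightarrow> \<phi> \<in> vcar W \<and> L.positive_functional \<phi>"
  by (auto simp: L.order_continuous_dual_vle L.order_continuous_dual_vzero
    L.positive_functional_def W_iff)

lemma ev_vadd: "X \<in> vcar Linf \<Longrightarrow> Y \<in> vcar Linf \<Longrightarrow>
    ev (vadd Linf X Y) = vadd (order_continuous_dual W) (ev X) (ev Y)"
  and ev_vscale: "X \<in> vcar Linf \<Longrightarrow> ev (vscale Linf a X) = vscale (order_continuous_dual W) a (ev X)"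
  unfolding vector_lattice.order_continuous_dual_vadd[OF W_vector_lattice]
    vector_lattice.order_continuous_dual_vscale[OF W_vector_lattice]
  by (rule restrict_ext, simp add: W_iff L.linear_functional_add L.linear_functional_scale)+

text \<open>Suprema are formed pointwise on the order continuous dual. The limit of a bounded
  directed set lies between two evaluations, so domination makes it a member of the bidual, that is,
  an evaluation. Since evaluations detect the order, order continuous functionals separate
  indicators from 0.\<close>

theorem perfect_imp_class_S:
  assumes "perfect Linf"
  shows "class_S M \<PP> \<and> dedekind_complete Linf"
proof -
  interpret W: vector_lattice W by (rule W_vector_lattice)
  let ?D = "order_continuous_dual W"
  have bij: "bij_betw ev (vcar Linf) (vcar ?D)"
    and le: "\<And>X Y. X \<in> vcar Linf \<Longrightarrow> Y \<in> vcar Linf \<Longrightarrow> vle Linf X Y \<longleftrightarrow> vle ?D (ev X) (ev Y)"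
    using assms unfolding perfect_def lattice_iso_def by blast+
  have ev_in: "ev X \<in> vcar ?D" if "X \<in> vcar Linf" for X using bij that by (auto simp: bij_betw_def)
  have ev_lin: "linear_functional W (ev X)" if "X \<in> vcar Linf" for X
    using ev_in[OF that] by (simp add: W.order_continuous_dual_car)
  have ev_le: "vle Linf X Y \<longleftrightarrow> (\<forall>\<phi>\<in>W.nonneg. ev X \<phi> \<le> ev Y \<phi>)" if "X \<in> vcar Linf" "Y \<in> vcar Linf"
    for X Y
    unfolding le[OF that] W.order_continuous_dual_vle ..
  have DC: "dedekind_complete Linf"
  proof (rule L.dedekind_completeI)
    fix D U assume D: "up_directed Linf D" and U: "U \<in> vcar Linf" "\<And>d. d \<in> D \<Longrightarrow> vle Linf d U"
    have "\<exists>s\<in>vcar Linf. ev s = F"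
      if F: "linear_functional W F" and ge: "\<And>d \<phi>. d \<in> D \<Longrightarrow> \<phi> \<in> W.nonneg \<Longrightarrow> ev d \<phi> \<le> F \<phi>"
        and least: "\<And>u \<phi>. u \<in> vcar Linf \<Longrightarrow> (\<And>d. d \<in> D \<Longrightarrow> vle Linf d u) \<Longrightarrow> \<phi> \<in> W.nonneg \<Longrightarrow> F \<phi> \<le> ev u \<phi>"
      for F
    proof -
      obtain d where d: "d \<in> D" using D by (auto simp: up_directed_def)
      have dc: "d \<in> vcar Linf" using d D by (auto simp: up_directed_def)
      \<comment> \<open>Domination is available for positive functionals only, so a member
        \<open>ev d\<close> of the directed set is subtracted first and added back at the
        end.\<close>
      let ?G = "\<lambda>\<phi>\<in>vcar W. 1 * ev U \<phi> + (- 1) * ev d \<phi>"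
      let ?F = "\<lambda>\<phi>\<in>vcar W. 1 * F \<phi> + (- 1) * ev d \<phi>"
      have FU: "F \<phi> \<le> ev U \<phi>" if "\<phi> \<in> W.nonneg" for \<phi> using least[OF U that] .
      have G: "?G \<in> vcar ?D" using ev_in[OF U(1)] ev_in[OF dc]
        by (rule W.order_continuous_dual_combine)
      have "0 \<le> ?G \<phi>" if "\<phi> \<in> W.nonneg" for \<phi> using ge[OF d that] FU[OF that] that by simp
      then have Gpos: "W.positive_functional ?G"
        using G unfolding W.positive_functional_def by (simp add: W.order_continuous_dual_car)
      have "0 \<le> ?F \<phi>" if "\<phi> \<in> W.nonneg" for \<phi> using ge[OF d that] that by simp
      then have Fpos: "W.positive_functional ?F"
        using W.linear_functional_combine[OF F ev_lin[OF dc], of 1 "- 1"]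
        unfolding W.positive_functional_def by blast
      have "?F \<phi> \<le> ?G \<phi>" if "\<phi> \<in> W.nonneg" for \<phi> using FU[OF that] that by simp
      then have "?F \<in> vcar ?D" by (rule W.order_continuous_dual_dominated[OF Gpos G Fpos])
      then have "(\<lambda>\<phi>\<in>vcar W. 1 * ?F \<phi> + 1 * ev d \<phi>) \<in> vcar ?D"
        using ev_in[OF dc] by (rule W.order_continuous_dual_combine)
      moreover have "(\<lambda>\<phi>\<in>vcar W. 1 * ?F \<phi> + 1 * ev d \<phi>) = F"
        using F by (intro extensionalityI[of _ "vcar W"]) (auto simp: linear_functional_def)
      ultimately have "F \<in> vcar ?D" by simp
      then show ?thesis using bij by (force simp: bij_betw_def)
    qed
    note lim = this
    show "\<exists>s. is_sup Linf D s"
      by (rule W.functional_representation_sup[OF L.ordered_vector_space_axioms ev_lin ev_le D U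
        lim]) blast+
  qed
  have "class_S M \<PP>"
  proof (rule class_S_if_W_separates[OF DC])
    fix A assume A: "A \<in> sets M" "\<not> negl A"
    have c: "cl (indicator A) \<in> vcar Linf" using A by (intro Linf_cl bmeas_indicator)
    obtain \<phi> where \<phi>: "\<phi> \<in> W.nonneg" "\<not> ev (cl (indicator A)) \<phi> \<le> ev (vzero Linf) \<phi>"
      using not_negl_indicator[OF A] ev_le[OF c L.zero_closed] by blast
    then have "\<phi> (cl (indicator A)) \<noteq> \<phi> (vzero Linf)" by auto
    then show "\<exists>\<phi>\<in>vcar W. \<phi> (cl (indicator A)) \<noteq> 0"
      using \<phi>(1) L.linear_functional_zero[of \<phi>] by (intro bexI[of _ \<phi>]) (auto simp: W_iff)
  qed
  then show ?thesis using DC by blast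
qed

lemma ifun_vadd: "\<mu> \<in> sca \<Longrightarrow> \<nu> \<in> sca \<Longrightarrow> ifun (\<lambda>A. \<mu> A + \<nu> A) = vadd W (ifun \<mu>) (ifun \<nu>)"
  and ifun_vscale: "\<mu> \<in> sca \<Longrightarrow> ifun (\<lambda>A. a * \<mu> A) = vscale W a (ifun \<mu>)"
proof -
  assume \<mu>: "\<mu> \<in> sca"
  show "ifun (\<lambda>A. a * \<mu> A) = vscale W a (ifun \<mu>)"
  proof (rule extensionalityI[of _ "vcar Linf"])
    fix X assume X: "X \<in> vcar Linf"
    then obtain f where "f \<in> bmeas M" "X = cl f" by (rule Linf_cases)
    then show "ifun (\<lambda>A. a * \<mu> A) X = vscale W a (ifun \<mu>) X"
      using X \<mu> by (simp add: L.order_continuous_dual_vscale ifun_cl sca_scale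
        signed_integral_scale sca_ca)
  qed (simp_all add: ifun_def L.order_continuous_dual_vscale)
  assume \<nu>: "\<nu> \<in> sca"
  show "ifun (\<lambda>A. \<mu> A + \<nu> A) = vadd W (ifun \<mu>) (ifun \<nu>)"
  proof (rule extensionalityI[of _ "vcar Linf"])
    fix X assume X: "X \<in> vcar Linf"
    then obtain f where "f \<in> bmeas M" "X = cl f" by (rule Linf_cases)
    then show "ifun (\<lambda>A. \<mu> A + \<nu> A) X = vadd W (ifun \<mu>) (ifun \<nu>) X"
      using X \<mu> \<nu> by (simp add: L.order_continuous_dual_vadd ifun_cl sca_add signed_integral_add
        sca_ca)
  qed (simp_all add: ifun_def L.order_continuous_dual_vadd)
qed

lemma ifun_mono:
  assumes "\<mu> \<in> sca" "\<nu> \<in> sca" "\<And>A. A \<in> sets M \<Longrightarrow> \<mu> A \<le> \<nu> A"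
  shows "vle W (ifun \<mu>) (ifun \<nu>)"
  unfolding L.order_continuous_dual_vle
proof
  fix X assume X: "X \<in> L.nonneg"
  have \<kappa>: "(\<lambda>A. \<nu> A + (- 1) * \<mu> A) \<in> S.nonneg"
    using sca_add[OF assms(2) sca_scale[OF assms(1), of "- 1"]] assms(3) by simp
  have "0 \<le> ifun (\<lambda>A. \<nu> A + (- 1) * \<mu> A) X"
    using ifun_positive[OF \<kappa>] X unfolding L.positive_functional_def by blast
  also have "\<dots> = ifun \<nu> X - ifun \<mu> X"
    unfolding ifun_vadd[OF assms(2) sca_scale[OF assms(1)]] ifun_vscale[OF assms(1)]
    using X by (simp add: L.order_continuous_dual_vadd L.order_continuous_dual_vscale)
  finally show "ifun \<mu> X \<le> ifun \<nu> X" by simp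
qed

text \<open>The series of total variations converges in the complete space \<open>sca\<close>.
  Unlike \<open>sca_sequence_dominated\<close>, the result is a bound in the order and not merely
  absolute continuity.\<close>

lemma sca_series_dominated:
  fixes \<nu> :: "nat \<Rightarrow> 'a set \<Rightarrow> real"
  assumes \<nu>: "\<And>n. \<nu> n \<in> sca" and norm: "\<And>n. tv M (\<nu> n) (space M) \<le> (1/2) ^ n"
  shows "\<exists>\<beta>\<in>sca. \<forall>n. \<forall>A\<in>sets M. \<bar>\<nu> n A\<bar> \<le> \<beta> A"
proof -
  note \<nu>c = sca_ca[OF \<nu>]
  define \<sigma> where "\<sigma> n = (\<lambda>A. \<Sum>i<n. tv M (\<nu> i) A)" for n
  have \<sigma>: "\<sigma> n \<in> sca" for n
    by (induction n) (simp_all add: \<sigma>_def sca_zero sca_add sca_tv \<nu>)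
  have mono: "\<sigma> n A \<le> \<sigma> m A" if "n \<le> m" for n m A
    unfolding \<sigma>_def using that tv_nonneg[OF \<nu>c] by (intro sum_mono2) auto
  have tv_eq: "tv M (\<lambda>A. \<sigma> m A - \<sigma> n A) (space M) = \<bar>\<sigma> m (space M) - \<sigma> n (space M)\<bar>" for m n
  proof -
    have le: "tv M (\<lambda>A. \<sigma> m A - \<sigma> n A) (space M) = \<sigma> m (space M) - \<sigma> n (space M)" if "n \<le> m" for m n
      using tv_of_nonneg[OF ca_subtract[OF sca_ca[OF \<sigma>] sca_ca[OF \<sigma>]], of m n] mono[OF that] by simp
    have swap: "tv M (\<lambda>A. \<sigma> m A - \<sigma> n A) (space M) = tv M (\<lambda>A. \<sigma> n A - \<sigma> m A) (space M)" for m n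
      using tv_scale[OF ca_subtract[OF sca_ca[OF \<sigma>[of n]] sca_ca[OF \<sigma>[of m]]], of "- 1" "space M"]
        by simp
    show ?thesis
    proof (cases "n \<le> m")
      case True
      then show ?thesis using le[OF True] mono[OF True, of "space M"] by simp
    next
      case False
      then have "m \<le> n" by simp
      then show ?thesis using le[of m n] swap[of m n] mono[of m n "space M"] by simp
    qed
  qed
  have "summable (\<lambda>i. tv M (\<nu> i) (space M))"
    by (rule summable_comparison_test[of _ "\<lambda>n. (1/2 :: real) ^ n"])
      (use norm tv_nonneg[OF \<nu>c] in \<open>auto intro: summable_geometric\<close>)
  then have "Cauchy (\<lambda>n. \<sigma> n (space M))"
    unfolding \<sigma>_def summable_iff_convergent by (rule convergent_Cauchy)
  then have "\<exists>N. \<forall>m\<ge>N. \<forall>n\<ge>N. tv M (\<lambda>A. \<sigma> m A - \<sigma> n A) (space M) < e" if "0 < e" for e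
    using that unfolding tv_eq Cauchy_def dist_real_def by blast
  then obtain \<beta> where \<beta>: "\<beta> \<in> sca" "\<forall>e>0. \<exists>N. \<forall>n\<ge>N. tv M (\<lambda>A. \<sigma> n A - \<beta> A) (space M) < e"
    using sca_Cauchy_limit[of \<sigma>, OF \<sigma>] by blast
  have "\<bar>\<nu> n A\<bar> \<le> \<beta> A" if A: "A \<in> sets M" for n A
  proof (rule field_le_epsilon)
    fix e :: real assume "0 < e"
    then obtain N where N: "\<forall>n\<ge>N. tv M (\<lambda>A. \<sigma> n A - \<beta> A) (space M) < e" using \<beta>(2) by blast
    define m where "m = max N (Suc n)"
    have c: "(\<lambda>A. \<sigma> m A - \<beta> A) \<in> ca M" using \<sigma> \<beta>(1) by (intro ca_subtract sca_ca)
    have "\<bar>\<sigma> m A - \<beta> A\<bar> \<le> tv M (\<lambda>A. \<sigma> m A - \<beta> A) A" using abs_le_tv[OF c] .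
    also have "\<dots> \<le> tv M (\<lambda>A. \<sigma> m A - \<beta> A) (space M)"
      using tv_mono[OF c A sets.top sets.sets_into_space[OF A]] .
    also have "\<dots> < e" using N by (simp add: m_def)
    finally have "\<sigma> m A < \<beta> A + e" by linarith
    moreover have "\<sigma> (Suc n) A \<le> \<sigma> m A" by (rule mono) (simp add: m_def)
    moreover have "tv M (\<nu> n) A \<le> \<sigma> (Suc n) A"
      unfolding \<sigma>_def using tv_nonneg[OF \<nu>c] by (simp add: sum_nonneg)
    ultimately show "\<bar>\<nu> n A\<bar> \<le> \<beta> A + e" using abs_le_tv[OF \<nu>c, of n A] by linarith
  qed
  then show ?thesis using \<beta>(1) by blast
qed

text \<open>An unbounded functional admits measures \<open>\<nu>\<close> of norm at most
  \<open>(1/2) ^ n\<close> with values beyond \<open>n\<close>. Such a sequence lies in one order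
  interval, on which \<open>F\<close> is bounded.\<close>

lemma bidual_functional_bounded:
  assumes F: "linear_functional W F" "order_bounded W F"
  shows "\<exists>C\<ge>0. \<forall>\<mu>\<in>sca. \<bar>F (ifun \<mu>)\<bar> \<le> C * tv M \<mu> (space M)"
proof (rule ccontr)
  interpret W: vector_lattice W by (rule W_vector_lattice)
  assume no: "\<not> ?thesis"
  \<comment> \<open>The factor \<open>2 ^ n\<close> pays for the normalisation to norm
    \<open>(1/2) ^ n\<close>, the factor \<open>n\<close> makes the values unbounded.\<close>
  have "\<exists>\<mu>. \<mu> \<in> sca \<and> real n * 2 ^ n * tv M \<mu> (space M) < \<bar>F (ifun \<mu>)\<bar>" for n
  proof -
    have "0 \<le> real n * 2 ^ n" by simp
    then show ?thesis using no by (meson not_less)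
  qed
  then obtain \<mu> where \<mu>: "\<And>n. \<mu> n \<in> sca"
    "\<And>n. real n * 2 ^ n * tv M (\<mu> n) (space M) < \<bar>F (ifun (\<mu> n))\<bar>" by metis
  have F_scale: "F (ifun (\<lambda>A. a * \<mu> A)) = a * F (ifun \<mu>)" if "\<mu> \<in> sca" for a \<mu>
    unfolding ifun_vscale[OF that] by (rule W.linear_functional_scale[OF F(1) ifun_W[OF that]])
  have tv_pos: "0 < tv M (\<mu> n) (space M)" for n
  proof (rule ccontr)
    assume "\<not> ?thesis"
    then have "tv M (\<mu> n) (space M) = 0" using tv_nonneg[OF sca_ca[OF \<mu>(1)], of n "space M"] by simp
    then have "\<mu> n = (\<lambda>A. 0)" using S.norm_eq_zero[OF \<mu>(1)] by simp
    then have "F (ifun (\<mu> n)) = 0" using F_scale[OF sca_zero, of 0] by simp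
    then show False using \<mu>(2)[of n] \<open>tv M (\<mu> n) (space M) = 0\<close> by simp
  qed
  \<comment> \<open>Scales the measure to norm \<open>(1/2) ^ n\<close>; the strict inequality in
    its choice excludes norm 0.\<close>
  define c where "c n = inverse (2 ^ n * tv M (\<mu> n) (space M))" for n
  have c_pos: "0 < c n" for n using tv_pos[of n] by (simp add: c_def)
  let ?\<nu> = "\<lambda>n A. c n * \<mu> n A"
  have \<nu>: "?\<nu> n \<in> sca" for n using \<mu>(1) by (rule sca_scale)
  have "tv M (?\<nu> n) (space M) \<le> (1/2) ^ n" for n
    using c_pos[of n] tv_pos[of n] unfolding tv_scale[OF sca_ca[OF \<mu>(1)]]
    by (simp add: c_def field_simps power_one_over)
  then obtain \<beta> where \<beta>: "\<beta> \<in> sca" "\<forall>n. \<forall>A\<in>sets M. \<bar>?\<nu> n A\<bar> \<le> \<beta> A"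
    using sca_series_dominated[of ?\<nu>, OF \<nu>] by blast
  have m\<beta>: "(\<lambda>A. - 1 * \<beta> A) \<in> sca" using \<beta>(1) by (rule sca_scale)
  have "bounded (F ` {\<phi> \<in> vcar W. vle W (ifun (\<lambda>A. - 1 * \<beta> A)) \<phi> \<and> vle W \<phi> (ifun \<beta>)})"
    using F(2) ifun_W[OF m\<beta>] ifun_W[OF \<beta>(1)] unfolding order_bounded_def by blast
  then obtain K where K: "\<And>\<phi>. \<phi> \<in> vcar W \<Longrightarrow> vle W (ifun (\<lambda>A. - 1 * \<beta> A)) \<phi> \<Longrightarrow> vle W \<phi> (ifun \<beta>) \<Longrightarrow>
      \<bar>F \<phi>\<bar> \<le> K"
    by (auto simp: bounded_iff)
  have "\<bar>F (ifun (?\<nu> n))\<bar> \<le> K" for n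
  proof (rule K[OF ifun_W[OF \<nu>]])
    have b: "\<bar>?\<nu> n A\<bar> \<le> \<beta> A" if "A \<in> sets M" for A using \<beta>(2) that by blast
    show "vle W (ifun (\<lambda>A. - 1 * \<beta> A)) (ifun (?\<nu> n))"
      by (rule ifun_mono[OF m\<beta> \<nu>]) (use b in \<open>fastforce simp: abs_le_iff\<close>)
    show "vle W (ifun (?\<nu> n)) (ifun \<beta>)"
      by (rule ifun_mono[OF \<nu> \<beta>(1)]) (use b in \<open>fastforce simp: abs_le_iff\<close>)
  qed
  moreover have "real n < \<bar>F (ifun (?\<nu> n))\<bar>" for n
  proof -
    have "real n = c n * (real n * 2 ^ n * tv M (\<mu> n) (space M))" using tv_pos[of n]
      by (simp add: c_def field_simps)
    also have "\<dots> < c n * \<bar>F (ifun (\<mu> n))\<bar>" using \<mu>(2) c_pos by (intro mult_strict_left_mono)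
    also have "\<dots> = \<bar>F (ifun (?\<nu> n))\<bar>" using c_pos[of n] by (simp add: F_scale[OF \<mu>(1)] abs_mult)
    finally show ?thesis .
  qed
  ultimately have "real n < K" for n using less_le_trans by blast
  then show False using reals_Archimedean2[of K] less_asym by blast
qed

text \<open>Only surjectivity has content beyond the detection of the order by supported measures. A
  member \<open>F\<close> of the bidual, pulled back along \<open>ifun\<close>, is a norm bounded
  functional on \<open>sca\<close> and thus integration of some \<open>f\<close>. As
  \<open>ifun\<close> reaches every order continuous functional, \<open>F\<close> is evaluation at
  the class of \<open>f\<close>.\<close>

theorem class_S_imp_perfect:
  assumes cS: "class_S M \<PP>" and DC: "dedekind_complete Linf"
  shows "perfect Linf"
proof -
  interpret W: vector_lattice W by (rule W_vector_lattice)
  let ?D = "order_continuous_dual W"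
  have le: "vle Linf X Y \<longleftrightarrow> vle ?D (ev X) (ev Y)" if XY: "X \<in> vcar Linf" "Y \<in> vcar Linf" for X Y
  proof
    assume "vle Linf X Y"
    then show "vle ?D (ev X) (ev Y)"
      unfolding W.order_continuous_dual_vle W_nonneg_iff
      using L.positive_functional_mono XY by (auto simp: W_nonneg_iff[simplified])
  next
    assume ev_le: "vle ?D (ev X) (ev Y)"
    have "ifun \<mu> X \<le> ifun \<mu> Y" if \<mu>: "\<mu> \<in> S.nonneg" for \<mu>
    proof -
      have w: "ifun \<mu> \<in> vcar W" using sca_nonnegD(1)[OF \<mu>] by (rule ifun_W)
      then have "ifun \<mu> \<in> W.nonneg" using ifun_positive[OF \<mu>] W_nonneg_iff by blast
      then have "ev X (ifun \<mu>) \<le> ev Y (ifun \<mu>)" using ev_le unfolding W.order_continuous_dual_vle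
        by blast
      then show ?thesis using w by simp
    qed
    then show "vle Linf X Y" using class_S_le_iff[OF cS XY] by blast
  qed
  have "inj_on ev (vcar Linf)"
  proof (rule inj_onI)
    fix X Y assume XY: "X \<in> vcar Linf" "Y \<in> vcar Linf" "ev X = ev Y"
    have "vle ?D (ev X) (ev Y)" "vle ?D (ev Y) (ev X)" unfolding XY(3) W.order_continuous_dual_vle
      by simp_all
    then have "vle Linf X Y" "vle Linf Y X" using le XY by blast+
    then show "X = Y" using XY by (intro L.le_antisym)
  qed
  moreover have "ev ` vcar Linf = vcar ?D"
  proof (intro subset_antisym subsetI)
    fix F assume "F \<in> ev ` vcar Linf"
    then show "F \<in> vcar ?D" using L.evaluation_in_bidual[OF W_vector_lattice] by blast
  next
    fix F assume "F \<in> vcar ?D"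
    then have F: "linear_functional W F" "order_bounded W F"
      by (simp_all add: W.order_continuous_dual_car)
    \<comment> \<open>The pullback of \<open>F\<close> to supported measures.\<close>
    let ?\<Phi> = "\<lambda>\<mu>\<in>sca. F (ifun \<mu>)"
    obtain C where C: "0 \<le> C" "\<forall>\<mu>\<in>sca. \<bar>F (ifun \<mu>)\<bar> \<le> C * tv M \<mu> (space M)"
      using bidual_functional_bounded[OF F] by blast
    have \<Phi>: "linear_functional (sca_c M \<PP>) ?\<Phi>"
      unfolding linear_functional_def
      using F(1) by (auto simp: sca_add sca_scale ifun_vadd ifun_vscale ifun_W
          W.linear_functional_add W.linear_functional_scale)
    have "\<bar>?\<Phi> \<mu>\<bar> \<le> C * tv M \<mu> (space M)" if "\<mu> \<in> sca" for \<mu> using C(2) that by simp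
    then obtain f where f: "f \<in> bmeas M" "\<forall>\<mu>\<in>sca. ?\<Phi> \<mu> = signed_integral M \<mu> f"
      using sca_functional_representation[OF DC \<Phi> C(1)] by blast
    have "F = ev (cl f)"
    proof (rule extensionalityI[of _ "vcar W"])
      show "F \<in> extensional (vcar W)" using F(1) by (simp add: linear_functional_def)
      fix \<phi> assume \<phi>: "\<phi> \<in> vcar W"
      have s: "fmeasure \<phi> \<in> sca" by (rule fmeasure_sca[OF DC \<phi>])
      have "F \<phi> = F (ifun (fmeasure \<phi>))" by (simp only: ifun_fmeasure[OF DC \<phi>])
      also have "\<dots> = signed_integral M (fmeasure \<phi>) f" using f(2) s by auto
      also have "\<dots> = ifun (fmeasure \<phi>) (cl f)" using s f(1) by (simp only: ifun_cl)
      also have "\<dots> = ev (cl f) \<phi>" using \<phi> by (simp add: ifun_fmeasure[OF DC \<phi>])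
      finally show "F \<phi> = ev (cl f) \<phi>" .
    qed simp
    then show "F \<in> ev ` vcar Linf" using Linf_cl[OF f(1)] by blast
  qed
  ultimately have "bij_betw ev (vcar Linf) (vcar ?D)" by (simp add: bij_betw_def)
  then show ?thesis
    unfolding perfect_def lattice_iso_def using ev_vadd ev_vscale le by blast
qed

section \<open>Order continuous locally convex-solid topologies\<close>

lemma seminorm_topology_openin:
  "p \<in> \<S> \<Longrightarrow> x \<in> vcar V \<Longrightarrow> 0 < e \<Longrightarrow> openin (seminorm_topology V \<S>) {y \<in> vcar V. p (vdiff V y x) < e}"
  unfolding seminorm_topology_def by (rule topology_generated_by_Basis) blast

lemma seminorm_topology_topspace: "topspace (seminorm_topology V \<S>) = vcar V"
  unfolding seminorm_topology_def by auto

text \<open>The Hausdorff property yields a seminorm \<open>p\<close> that does not vanish at the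
  indicator. A functional below \<open>X \<mapsto> p (X^+)\<close> that attains this bound at the
  indicator is positive, since negative elements have positive part 0. On positive elements it is at
  most \<open>p\<close>, so it inherits order continuity from the topology.\<close>

theorem order_continuous_topology_imp_class_S:
  assumes lcs: "locally_convex_solid Linf \<T>" and H: "Hausdorff_space \<T>"
    and oc: "order_continuous_topology Linf \<T>" and DC: "dedekind_complete Linf"
  shows "class_S M \<PP>"
proof (rule class_S_if_W_separates[OF DC])
  fix A assume A: "A \<in> sets M" "\<not> negl A"
  let ?a = "cl (indicator A)"
  have iA: "(indicator A :: 'a \<Rightarrow> real) \<in> bmeas M" using A(1) by (rule bmeas_indicator)
  have a: "?a \<in> vcar Linf" using iA by (rule Linf_cl)
  obtain \<S> where S: "\<And>p. p \<in> \<S> \<Longrightarrow> lattice_seminorm Linf p" and T: "\<T> = seminorm_topology Linf \<S>"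
    using lcs unfolding locally_convex_solid_def by blast
  have p_add: "p (vadd Linf x y) \<le> p x + p y" if "p \<in> \<S>" "x \<in> vcar Linf" "y \<in> vcar Linf" for p x y
    using S[OF that(1)] that by (auto simp: lattice_seminorm_def)
  have p_scale: "p (vscale Linf c x) = \<bar>c\<bar> * p x" if "p \<in> \<S>" "x \<in> vcar Linf" for p c x
    using S[OF that(1)] that by (auto simp: lattice_seminorm_def)
  have p_mono: "p x \<le> p y"
    if "p \<in> \<S>" "x \<in> vcar Linf" "y \<in> vcar Linf" "vle Linf (vabs Linf x) (vabs Linf y)" for p x y
    using S[OF that(1)] that by (auto simp: lattice_seminorm_def)
  have "\<exists>p\<in>\<S>. p ?a \<noteq> 0"
  proof (rule ccontr)
    assume "\<not> ?thesis"
    then have 0: "p ?a = 0" if "p \<in> \<S>" for p using that by blast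
    \<comment> \<open>If all seminorms vanish at the indicator, no basic set distinguishes it from
      0; induction over the generated topology extends this to all open sets.\<close>
    have mem: "?a \<in> U" if "openin \<T> U" "vzero Linf \<in> U" for U
    proof -
      have "generate_topology_on (insert (vcar Linf)
         {B. \<exists>p\<in>\<S>. \<exists>x\<in>vcar Linf. \<exists>e>0. B = {y \<in> vcar Linf. p (vdiff Linf y x) < e}}) U"
        using that(1) unfolding T seminorm_topology_def openin_topology_generated_by_iff .
      then have "vzero Linf \<in> U \<longrightarrow> ?a \<in> U"
      proof induction
        case (Basis s)
        show ?case
        proof (cases "s = vcar Linf")
          case False
          then obtain p x e where p: "p \<in> \<S>" "x \<in> vcar Linf"
            "s = {y \<in> vcar Linf. p (vdiff Linf y x) < e}"
            using Basis by blast
          have z: "vdiff Linf (vzero Linf) x \<in> vcar Linf" using p(2)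
            by (intro L.diff_closed L.zero_closed)
          have "vdiff Linf ?a x = vadd Linf ?a (vdiff Linf (vzero Linf) x)"
            using L.zero_diff[OF p(2)] by (simp add: vdiff_def[of Linf ?a])
          then have "p (vdiff Linf ?a x) \<le> p (vdiff Linf (vzero Linf) x)"
            using p_add[OF p(1) a z] 0[OF p(1)] by simp
          then show ?thesis using p(3) a by auto
        qed (use a in simp)
      qed auto
      then show ?thesis using that(2) by blast
    qed
    have "?a \<noteq> vzero Linf" using not_negl_indicator[OF A] L.le_refl[OF L.zero_closed] by auto
    then obtain U U' where "openin \<T> U" "openin \<T> U'" "vzero Linf \<in> U" "?a \<in> U'" "disjnt U U'"
      using H a L.zero_closed unfolding Hausdorff_space_def T seminorm_topology_topspace by metis
    then show False using mem by (auto simp: disjnt_iff)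
  qed
  then obtain p where p: "p \<in> \<S>" "p ?a \<noteq> 0" by blast
  \<comment> \<open>The positive part, written with the operations of \<open>Linf\<close>.\<close>
  define pp where "pp X = vscale Linf (1/2) (vadd Linf X (vabs Linf X))" for X
  have pp_cl: "pp (cl f) = cl (\<lambda>\<omega>. max (f \<omega>) 0)" if f: "f \<in> bmeas M" for f
  proof -
    have "pp (cl f) = cl (\<lambda>\<omega>. 1/2 * (f \<omega> + \<bar>f \<omega>\<bar>))"
      unfolding pp_def using f by (simp only: Linf_abs Linf_add Linf_scale bmeas_abs bmeas_add)
    moreover have "(\<lambda>\<omega>. 1/2 * (f \<omega> + \<bar>f \<omega>\<bar>)) = (\<lambda>\<omega>. max (f \<omega>) 0)" by (auto simp: fun_eq_iff max_def)
    ultimately show ?thesis by simp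
  qed
  note m0 = bmeas_max[OF _ bmeas_const[of 0]]
  have p0: "p (vzero Linf) = 0" using p_scale[OF p(1) L.zero_closed, of 0]
    by (simp add: L.scale_zero_right)
  define q where "q = (\<lambda>X\<in>vcar Linf. p (pp X))"
  have q_cl: "q (cl f) = p (cl (\<lambda>\<omega>. max (f \<omega>) 0))" if "f \<in> bmeas M" for f
    using that by (simp add: q_def Linf_cl pp_cl)
  have "L.sublinear q"
    unfolding L.sublinear_def
  proof (intro conjI ballI allI impI)
    show "q \<in> extensional (vcar Linf)" by (simp add: q_def)
    fix X assume "X \<in> vcar Linf"
    then obtain f where f: "f \<in> bmeas M" "X = cl f" by (rule Linf_cases)
    show "q (vscale Linf c X) = c * q X" if "0 \<le> c" for c
    proof -
      have "(\<lambda>\<omega>. max (c * f \<omega>) 0) = (\<lambda>\<omega>. c * max (f \<omega>) 0)"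
        using that by (auto simp: fun_eq_iff max_def mult_le_0_iff zero_le_mult_iff)
      then have "q (vscale Linf c X) = p (vscale Linf c (cl (\<lambda>\<omega>. max (f \<omega>) 0)))"
        using f by (simp add: Linf_scale q_cl bmeas_scale m0)
      also have "\<dots> = c * q X" using f that p(1) by (simp add: p_scale q_cl Linf_cl m0)
      finally show ?thesis .
    qed
    fix Y assume "Y \<in> vcar Linf"
    then obtain g where g: "g \<in> bmeas M" "Y = cl g" by (rule Linf_cases)
    let ?F = "cl (\<lambda>\<omega>. max (f \<omega>) 0)" and ?G = "cl (\<lambda>\<omega>. max (g \<omega>) 0)"
    have c: "?F \<in> vcar Linf" "?G \<in> vcar Linf" using f g by (auto intro: Linf_cl m0)
    have "q (vadd Linf X Y) = p (cl (\<lambda>\<omega>. max (f \<omega> + g \<omega>) 0))"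
      using f g by (simp add: Linf_add q_cl bmeas_add)
    also have "\<dots> \<le> p (vadd Linf ?F ?G)"
    proof (rule p_mono[OF p(1)])
      have "\<bar>max (f \<omega> + g \<omega>) 0\<bar> \<le> \<bar>max (f \<omega>) 0 + max (g \<omega>) 0\<bar>" for \<omega> by (auto simp: max_def)
      then show "vle Linf (vabs Linf (cl (\<lambda>\<omega>. max (f \<omega> + g \<omega>) 0))) (vabs Linf (vadd Linf ?F ?G))"
        using f g by (simp only: Linf_add Linf_abs Linf_le bmeas_abs bmeas_add m0) simp
    qed (use f g c in \<open>auto intro!: Linf_cl m0 bmeas_add L.add_closed\<close>)
    also have "\<dots> \<le> q X + q Y" using p_add[OF p(1) c] f g by (simp add: q_cl)
    finally show "q (vadd Linf X Y) \<le> q X + q Y" .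
  qed
  then obtain \<phi> where \<phi>: "linear_functional Linf \<phi>" "\<And>X. X \<in> vcar Linf \<Longrightarrow> \<phi> X \<le> q X" "\<phi> ?a = q ?a"
    using L.hahn_banach[OF _ a] by blast
  have q_nonneg: "q X = p X" if X: "X \<in> L.nonneg" for X
  proof -
    obtain f where f: "f \<in> bmeas M" "X = cl f" "\<forall>\<omega>. 0 \<le> f \<omega>" using X by (rule Linf_nonneg_cases)
    have "(\<lambda>\<omega>. max (f \<omega>) 0) = f" using f(3) by (auto simp: fun_eq_iff max_def intro: antisym)
    then show ?thesis using f by (simp add: q_cl)
  qed
  have pos: "L.positive_functional \<phi>"
    unfolding L.positive_functional_def
  proof (intro conjI ballI)
    fix X assume X: "X \<in> L.nonneg"
    obtain f where f: "f \<in> bmeas M" "X = cl f" "\<forall>\<omega>. 0 \<le> f \<omega>" using X by (rule Linf_nonneg_cases)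
    \<comment> \<open>For positive \<open>X\<close> the positive part of \<open>- X\<close> is 0, so
      \<open>\<phi> (- X) \<le> p 0 = 0\<close>.\<close>
    have "(\<lambda>\<omega>. max (- f \<omega>) 0) = (\<lambda>\<omega>. 0)" using f(3)
      by (auto simp: fun_eq_iff max_def intro: antisym)
    then have "q (vscale Linf (- 1) X) = p (vzero Linf)"
      using f by (simp add: Linf_scale q_cl bmeas_uminus Linf_zero)
    then have "\<phi> (vscale Linf (- 1) X) \<le> 0" using \<phi>(2)[of "vscale Linf (- 1) X"] X p0
      by (simp add: L.scale_closed)
    then show "0 \<le> \<phi> X" using X \<phi>(1) by (simp add: L.linear_functional_scale)
  qed (rule \<phi>(1))
  have "order_continuous Linf \<phi>"
  proof (rule L.order_continuousI[OF pos])
    fix I :: "(('a \<Rightarrow> real) set \<times> ('a \<Rightarrow> real) set) set" and r y and e :: real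
    assume dir: "directed I r" and y: "y \<in> I \<rightarrow> vcar Linf"
      and dec: "\<And>i j. i \<in> I \<Longrightarrow> j \<in> I \<Longrightarrow> (i, j) \<in> r \<Longrightarrow> vle Linf (y j) (y i)"
      and inf0: "is_inf Linf (y ` I) (vzero Linf)" and e: "0 < e"
    have "order_converges Linf I r y (vzero Linf)"
      by (rule L.order_converges_decreasing[OF dir y dec inf0])
    then have lim: "limitin \<T> y (vzero Linf) (net_filter I r)" using oc
      by (simp add: order_continuous_topology_def)
    let ?U = "{Y \<in> vcar Linf. p (vdiff Linf Y (vzero Linf)) < e}"
    have "openin \<T> ?U" unfolding T by (rule seminorm_topology_openin[OF p(1) L.zero_closed e])
    moreover have "vzero Linf \<in> ?U" using p0 e by (simp add: L.zero_closed L.diff_zero)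
    ultimately have "\<forall>\<^sub>F i in net_filter I r. y i \<in> ?U" using lim by (simp only: limitin_def)
    then obtain i where "i \<in> I" "\<forall>j\<in>I. (i, j) \<in> r \<longrightarrow> y j \<in> ?U"
      unfolding eventually_net_filter[OF dir] by blast
    then have i: "i \<in> I" "y i \<in> ?U" using dir
      by (auto simp: directed_def preorder_on_def refl_on_def)
    have "y i \<in> L.nonneg" using inf0 i y by (auto simp: is_inf_def)
    then have "\<phi> (y i) \<le> p (y i)" using \<phi>(2)[of "y i"] q_nonneg[of "y i"] by simp
    moreover have "p (y i) < e" using i(2) y i(1) by (auto simp: L.diff_zero)
    ultimately show "\<exists>i\<in>I. \<phi> (y i) < e" using i(1) by (intro bexI[of _ i]) auto
  qed
  then have "\<phi> \<in> vcar W" using \<phi>(1) L.positive_functional_order_bounded[OF pos] by (simp add: W_iff)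
  moreover have "\<phi> ?a \<noteq> 0"
    using \<phi>(3) q_nonneg[OF Linf_nonneg_cl[OF iA]] p(2) by simp
  ultimately show "\<exists>\<phi>\<in>vcar W. \<phi> ?a \<noteq> 0" by blast
qed

text \<open>Each seminorm is the integral of the absolute value, so its order continuity is that of
  \<open>ifun\<close>. By class (S) the integrals of \<open>|X - Y|\<close> do not all vanish for
  distinct \<open>X\<close> and \<open>Y\<close>, which separates points.\<close>

theorem class_S_imp_order_continuous_topology:
  assumes cS: "class_S M \<PP>"
  shows "\<exists>\<T>. locally_convex_solid Linf \<T> \<and> Hausdorff_space \<T> \<and> order_continuous_topology Linf \<T>"
proof -
  define p where "p \<mu> X = ifun \<mu> (vabs Linf X)" for \<mu> X
  have p_cl: "p \<mu> (cl f) = signed_integral M \<mu> (\<lambda>\<omega>. \<bar>f \<omega>\<bar>)" if "\<mu> \<in> sca" "f \<in> bmeas M" for \<mu> f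
    using that by (simp add: p_def Linf_abs ifun_cl bmeas_abs)
  have p_mono: "p \<mu> X \<le> p \<mu> Y"
    if "\<mu> \<in> S.nonneg" "X \<in> vcar Linf" "Y \<in> vcar Linf" "vle Linf (vabs Linf X) (vabs Linf Y)"
      for \<mu> X Y
    unfolding p_def using that by (intro L.positive_functional_mono[OF ifun_positive] L.vabs_closed)
  have p_nonneg: "0 \<le> p \<mu> X" if "\<mu> \<in> S.nonneg" "X \<in> vcar Linf" for \<mu> X
    using ifun_positive[OF that(1)] L.vabs_closed[OF that(2)] L.vabs_nonneg[OF that(2)]
    unfolding p_def L.positive_functional_def by blast
  have p_add: "p \<mu> (vadd Linf X Y) \<le> p \<mu> X + p \<mu> Y"
    if \<mu>: "\<mu> \<in> S.nonneg" and XY: "X \<in> vcar Linf" "Y \<in> vcar Linf" for \<mu> X Y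
  proof -
    obtain f where f: "f \<in> bmeas M" "X = cl f" using XY(1) by (rule Linf_cases)
    obtain g where g: "g \<in> bmeas M" "Y = cl g" using XY(2) by (rule Linf_cases)
    note s = sca_nonnegD(1)[OF \<mu>]
    note \<Lambda> = signed_integral_functional[OF sca_ca[OF s]]
    have ab: "(\<lambda>\<omega>. \<bar>f \<omega>\<bar>) \<in> bmeas M" "(\<lambda>\<omega>. \<bar>g \<omega>\<bar>) \<in> bmeas M" "(\<lambda>\<omega>. \<bar>f \<omega> + g \<omega>\<bar>) \<in> bmeas M"
      using f g by (auto intro: bmeas_abs bmeas_add)
    have "0 \<le> signed_integral M \<mu> (\<lambda>\<omega>. (\<bar>f \<omega>\<bar> + \<bar>g \<omega>\<bar>) - \<bar>f \<omega> + g \<omega>\<bar>)"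
      by (rule signed_integral_nonneg[OF sca_ca[OF s] sca_nonnegD(2)[OF \<mu>] bmeas_diff[OF
        bmeas_add[OF ab(1,2)] ab(3)]])
        (use abs_triangle_ineq in \<open>simp_all only: diff_ge_0_iff_ge\<close>)
    then show ?thesis
      using f g s by (simp add: Linf_add p_cl bmeas_add bmeas_functional_diff[OF \<Lambda> bmeas_add[OF
        ab(1,2)] ab(3)]
          bmeas_functional_add[OF \<Lambda> ab(1,2)])
  qed
  have p_scale: "p \<mu> (vscale Linf a X) = \<bar>a\<bar> * p \<mu> X" if \<mu>: "\<mu> \<in> S.nonneg" and X: "X \<in> vcar Linf"
    for \<mu> a X
  proof -
    obtain f where f: "f \<in> bmeas M" "X = cl f" using X by (rule Linf_cases)
    note s = sca_nonnegD(1)[OF \<mu>]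
    show ?thesis
      using f s bmeas_functional_scale[OF signed_integral_functional[OF sca_ca[OF s]] bmeas_abs[OF
        f(1)], of "\<bar>a\<bar>"]
      by (simp add: Linf_scale p_cl bmeas_scale abs_mult)
  qed
  have semi: "lattice_seminorm Linf (p \<mu>)" if "\<mu> \<in> S.nonneg" for \<mu>
    unfolding lattice_seminorm_def using p_nonneg p_add p_scale p_mono that by blast
  have p_diff: "p \<mu> (vdiff Linf X Z) \<le> p \<mu> (vdiff Linf X Y) + p \<mu> (vdiff Linf Y Z)"
    if "\<mu> \<in> S.nonneg" "X \<in> vcar Linf" "Y \<in> vcar Linf" "Z \<in> vcar Linf" for \<mu> X Y Z
    using p_add[OF that(1) L.diff_closed[OF that(2,3)] L.diff_closed[OF that(3,4)]]
    by (simp only: L.diff_add_diff[OF that(2-4)])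
  have p_sym: "p \<mu> (vdiff Linf X Y) = p \<mu> (vdiff Linf Y X)"
    if "\<mu> \<in> S.nonneg" "X \<in> vcar Linf" "Y \<in> vcar Linf" for \<mu> X Y
    using p_scale[OF that(1) L.diff_closed[OF that(2,3)], of "- 1"]
      by (simp add: L.minus_diff[OF that(2,3)])
  let ?T = "seminorm_topology Linf (p ` S.nonneg)"
  have "locally_convex_solid Linf ?T"
    unfolding locally_convex_solid_def using semi by blast
  moreover have "Hausdorff_space ?T"
    unfolding Hausdorff_space_def seminorm_topology_topspace
  proof (intro allI impI)
    fix X Y assume "X \<in> vcar Linf \<and> Y \<in> vcar Linf \<and> X \<noteq> Y"
    then have XY: "X \<in> vcar Linf" "Y \<in> vcar Linf" "X \<noteq> Y" by auto
    have dc: "vdiff Linf X Y \<in> vcar Linf" using XY by (intro L.diff_closed)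
    obtain f where f: "f \<in> bmeas M" "vdiff Linf X Y = cl f" using dc by (rule Linf_cases)
    have "\<not> (\<forall>\<^sub>F \<omega> in qs. \<bar>f \<omega>\<bar> \<le> 0)"
    proof
      assume "\<forall>\<^sub>F \<omega> in qs. \<bar>f \<omega>\<bar> \<le> 0"
      then have "\<forall>\<^sub>F \<omega> in qs. f \<omega> = 0" by eventually_elim simp
      then have "vdiff Linf X Y = vzero Linf" using f by (simp add: Linf_zero Linf_eq bmeas_const)
      then show False using XY by (simp add: L.diff_eq_zero)
    qed
    then obtain \<nu> where \<nu>: "\<nu> \<in> S.nonneg" "0 < signed_integral M \<nu> (\<lambda>\<omega>. \<bar>f \<omega>\<bar>)"
      using class_S_witness[OF cS bmeas_abs[OF f(1)]] by blast
    \<comment> \<open>Half the distance of \<open>X\<close> and \<open>Y\<close>, so that the two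
      balls are disjoint by the triangle inequality.\<close>
    define e where "e = p \<nu> (vdiff Linf X Y) / 2"
    have e: "0 < e" using \<nu> f by (simp add: e_def p_cl)
    let ?B = "\<lambda>x. {y \<in> vcar Linf. p \<nu> (vdiff Linf y x) < e}"
    have z: "p \<nu> (vdiff Linf x x) = 0" if "x \<in> vcar Linf" for x
      using p_scale[OF \<nu>(1) L.zero_closed, of 0] that by (simp add: L.diff_self L.scale_zero_right)
    have open_B: "openin ?T (?B x)" if "x \<in> vcar Linf" for x
      by (rule seminorm_topology_openin[OF imageI[OF \<nu>(1)] that e])
    have "openin ?T (?B X)" "openin ?T (?B Y)" using open_B XY by blast+
    moreover have "X \<in> ?B X" "Y \<in> ?B Y" using z e XY by auto
    moreover have "disjnt (?B X) (?B Y)"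
      unfolding disjnt_iff
    proof (intro allI notI)
      fix y assume y: "y \<in> ?B X \<and> y \<in> ?B Y"
      then have yc: "y \<in> vcar Linf" by blast
      have "p \<nu> (vdiff Linf X Y) \<le> p \<nu> (vdiff Linf y X) + p \<nu> (vdiff Linf y Y)"
        using p_diff[OF \<nu>(1) XY(1) yc XY(2)] p_sym[OF \<nu>(1) XY(1) yc] by simp
      then show False using y by (simp add: e_def)
    qed
    ultimately show "\<exists>U V. openin ?T U \<and> openin ?T V \<and> X \<in> U \<and> Y \<in> V \<and> disjnt U V" by blast
  qed
  moreover have "order_continuous_topology Linf ?T"
    unfolding order_continuous_topology_def
  proof (intro allI impI)
    fix I :: "(('a \<Rightarrow> real) set \<times> ('a \<Rightarrow> real) set) set" and r x
    assume "order_converges Linf I r x (vzero Linf)"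
    then obtain y where dir: "directed I r" and x: "x \<in> I \<rightarrow> vcar Linf" and y: "y \<in> I \<rightarrow> vcar Linf"
      and dec: "\<And>i j. i \<in> I \<Longrightarrow> j \<in> I \<Longrightarrow> (i, j) \<in> r \<Longrightarrow> vle Linf (y j) (y i)"
      and inf0: "is_inf Linf (y ` I) (vzero Linf)"
      and dom: "\<And>i. i \<in> I \<Longrightarrow> vle Linf (vabs Linf (vdiff Linf (x i) (vzero Linf))) (y i)"
      unfolding order_converges_def by blast
    have xc: "x i \<in> vcar Linf" and yc: "y i \<in> vcar Linf" if "i \<in> I" for i using x y that by auto
    have small: "\<forall>\<^sub>F i in net_filter I r. i \<in> I \<and> p \<mu> (x i) < e" if \<mu>: "\<mu> \<in> S.nonneg"
      and e: "0 < e" for \<mu> e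
    proof -
      have "\<exists>i\<in>I. \<forall>j\<in>I. (i, j) \<in> r \<longrightarrow> \<bar>ifun \<mu> (y j)\<bar> < e"
        by (rule L.order_continuous_eventually[OF ifun_order_continuous[OF \<mu>] ifun_linear[OF
          sca_nonnegD(1)[OF \<mu>]] dir y dec inf0 e])
      then obtain i where i: "i \<in> I" "\<And>j. j \<in> I \<Longrightarrow> (i, j) \<in> r \<Longrightarrow> \<bar>ifun \<mu> (y j)\<bar> < e" by blast
      show ?thesis
      proof (rule eventually_net_filterI[OF dir i(1)])
        fix j assume j: "j \<in> I" "(i, j) \<in> r"
        have "vle Linf (vabs Linf (x j)) (y j)" using dom[OF j(1)] xc[OF j(1)]
          by (simp add: L.diff_zero)
        then have "p \<mu> (x j) \<le> ifun \<mu> (y j)"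
          unfolding p_def by (intro L.positive_functional_mono[OF ifun_positive[OF \<mu>]]
            L.vabs_closed xc yc j(1))
        then show "j \<in> I \<and> p \<mu> (x j) < e" using i(2)[OF j] j(1) by simp
      qed
    qed
    have "\<forall>\<^sub>F i in net_filter I r. x i \<in> U" if "openin ?T U" "vzero Linf \<in> U" for U
    proof -
      have "generate_topology_on (insert (vcar Linf)
         {B. \<exists>q\<in>p ` S.nonneg. \<exists>x\<in>vcar Linf. \<exists>e>0. B = {y \<in> vcar Linf. q (vdiff Linf y x) < e}}) U"
        using that(1) unfolding seminorm_topology_def openin_topology_generated_by_iff .
      then have "vzero Linf \<in> U \<longrightarrow> (\<forall>\<^sub>F i in net_filter I r. x i \<in> U)"
      proof induction
        case (Int a b)
        then show ?case by (auto elim: eventually_elim2)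
      next
        case (UN K)
        show ?case
        proof
          assume "vzero Linf \<in> \<Union>K"
          then obtain k where k: "k \<in> K" "vzero Linf \<in> k" by blast
          then have "\<forall>\<^sub>F i in net_filter I r. x i \<in> k" using UN.IH by blast
          then show "\<forall>\<^sub>F i in net_filter I r. x i \<in> \<Union>K" by eventually_elim (use k(1) in blast)
        qed
      next
        case (Basis s)
        show ?case
        proof (cases "s = vcar Linf")
          case True
          then show ?thesis using xc dir by (auto simp: eventually_net_filter directed_def)
        next
          case False
          then obtain \<mu> z e where \<mu>: "\<mu> \<in> S.nonneg" and z: "z \<in> vcar Linf"
            and s: "s = {y \<in> vcar Linf. p \<mu> (vdiff Linf y z) < e}"
            using Basis by blast
          show ?thesis
          proof
            assume "vzero Linf \<in> s"
            \<comment> \<open>Basic balls need not be centred at 0. The distance from 0 to the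
              centre leaves this much room for the net.\<close>
            then have d: "0 < e - p \<mu> (vdiff Linf (vzero Linf) z)" by (simp add: s)
            show "\<forall>\<^sub>F i in net_filter I r. x i \<in> s"
              using small[OF \<mu> d]
            proof eventually_elim
              fix i assume i: "i \<in> I \<and> p \<mu> (x i) < e - p \<mu> (vdiff Linf (vzero Linf) z)"
              then have "p \<mu> (vdiff Linf (x i) z) \<le> p \<mu> (x i) + p \<mu> (vdiff Linf (vzero Linf) z)"
                using p_diff[OF \<mu> xc L.zero_closed z, of i] xc by (simp add: L.diff_zero)
              then show "x i \<in> s" using i xc by (auto simp: s)
            qed
          qed
        qed
      qed auto
      then show ?thesis using that(2) by blast
    qed
    then show "limitin ?T x (vzero Linf) (net_filter I r)"
      unfolding limitin_def seminorm_topology_topspace using L.zero_closed by blast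
  qed
  ultimately show ?thesis by blast
qed

end

text \<open>Every condition is compared with the first one. The space \<open>sca_c\<close> is the
  witness for both existential conditions and lives on the type fixed there; the last conjunct
  transfers the converse to preduals on any type.\<close>

theorem theorem5p3:
  fixes M :: "'a measure" and \<PP> :: "'a measure set"
  assumes "\<PP> \<noteq> {}" and "\<PP> \<subseteq> Delta M"
  shows
    "((class_S M \<PP> \<and> dedekind_complete (Linf_c M \<PP>))
        \<longleftrightarrow> isometric_lattice_iso (Linf_c M \<PP>) (norm_dual (sca_c M \<PP>)) (integral_functional M \<PP>))
   \<and> ((class_S M \<PP> \<and> dedekind_complete (Linf_c M \<PP>))
        \<longleftrightarrow> (\<exists>(N :: ('a set \<Rightarrow> real) nvlat) T. normed_vector_lattice N \<and>
              isometric_lattice_iso (Linf_c M \<PP>) (norm_dual N) T))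
   \<and> ((class_S M \<PP> \<and> dedekind_complete (Linf_c M \<PP>))
        \<longleftrightarrow> (\<exists>(N :: ('a set \<Rightarrow> real) nvlat) T. banach_lattice N \<and>
              isometric_lattice_iso (Linf_c M \<PP>) (norm_dual N) T))
   \<and> ((class_S M \<PP> \<and> dedekind_complete (Linf_c M \<PP>))
        \<longleftrightarrow> perfect (Linf_c M \<PP>))
   \<and> ((class_S M \<PP> \<and> dedekind_complete (Linf_c M \<PP>))
        \<longleftrightarrow> ((\<exists>\<T>. locally_convex_solid (Linf_c M \<PP>) \<T> \<and> Hausdorff_space \<T> \<and>
               order_continuous_topology (Linf_c M \<PP>) \<T>) \<and> dedekind_complete (Linf_c M \<PP>)))
   \<and> (\<forall>(N :: 'b nvlat) T. normed_vector_lattice N \<and>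
          isometric_lattice_iso (Linf_c M \<PP>) (norm_dual N) T
        \<longrightarrow> class_S M \<PP> \<and> dedekind_complete (Linf_c M \<PP>))"
proof -
  interpret priors M \<PP> using assms by unfold_locales
  let ?one = "class_S M \<PP> \<and> dedekind_complete Linf"
  have dual: "isometric_lattice_iso Linf (norm_dual (sca_c M \<PP>)) (integral_functional M \<PP>)" if ?one
    using that Linf_dual_of_sca by blast
  have banach: "banach_lattice (sca_c M \<PP>)" by (rule sca_banach_lattice)
  have predual: ?one
    if "normed_vector_lattice N" "isometric_lattice_iso Linf (norm_dual N) T"
    for N :: "('a set \<Rightarrow> real) nvlat" and T
    using predual_imp_class_S[OF that] .
  \<comment> \<open>That the dual of \<open>sca_c\<close> gives the first condition back is the
    general predual argument, applied to \<open>sca_c\<close> itself.\<close>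
  have "?one \<longleftrightarrow> isometric_lattice_iso Linf (norm_dual (sca_c M \<PP>)) (integral_functional M \<PP>)"
    using dual predual[OF sca_normed_vector_lattice] by blast
  moreover have "?one \<longleftrightarrow> (\<exists>(N :: ('a set \<Rightarrow> real) nvlat) T. normed_vector_lattice N \<and>
      isometric_lattice_iso Linf (norm_dual N) T)"
    using dual predual sca_normed_vector_lattice by blast
  moreover have "?one \<longleftrightarrow> (\<exists>(N :: ('a set \<Rightarrow> real) nvlat) T. banach_lattice N \<and>
      isometric_lattice_iso Linf (norm_dual N) T)"
    using dual predual banach unfolding banach_lattice_def by blast
  moreover have "?one \<longleftrightarrow> perfect Linf"
    using perfect_imp_class_S class_S_imp_perfect by blast
  moreover have "?one \<longleftrightarrow> (\<exists>\<T>. locally_convex_solid Linf \<T> \<and> Hausdorff_space \<T> \<and>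
      order_continuous_topology Linf \<T>) \<and> dedekind_complete Linf"
    using order_continuous_topology_imp_class_S class_S_imp_order_continuous_topology by blast
  moreover have "\<forall>(N :: 'b nvlat) T. normed_vector_lattice N \<and>
      isometric_lattice_iso Linf (norm_dual N) T
      \<longrightarrow> ?one"
    using predual_imp_class_S by blast
  ultimately show ?thesis by blast
qed

end
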